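(* Let $V$ be one of the surfaces $\mathbb{P}^1\times\mathbb{P}^1\setminus\Delta$ or $\mathbb{P}^2\setminus Q$ over $\mathbb{C}$, where $\Delta$ is the diagonal in $\mathbb{P}^1\times\mathbb{P}^1$ and $Q$ is a nonsingular quadric in $\mathbb{P}^2$. Then any two effective $\mathbb{C}^*$-actions on $V$ are conjugate in $\operatorname{Aut}(V)$.
   Context: $\mathbb{C}^*$-actions are algebraic; $\operatorname{Aut}(V)$ is the group of automorphisms of the algebraic variety $V$. *)

theory Defs
  imports "HOL-Analysis.Analysis" "HOL-Algebra.Group_Action"
begin

section \<open>Complex varieties as spaces with functions\<close>

text \<open>
  A variety over the complex numbers is given by its closed points, its Zariski topology and,
  for every open set \<open>U\<close>, the complex-valued functions that are regular on \<open>U\<close>.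
  HOL functions are total; whether \<open>f\<close> is regular on \<open>U\<close> depends only on the values of \<open>f\<close>
  on \<open>U\<close>, and \<open>regfuns X U\<close> is meaningful only for open \<open>U\<close>.
\<close>

record 'a fun_space =
  zariski :: "'a topology"
  regfuns :: "'a set \<Rightarrow> ('a \<Rightarrow> complex) set"

abbreviation points :: "'a fun_space \<Rightarrow> 'a set"
  where "points X \<equiv> topspace (zariski X)"

definition morphism :: "'a fun_space \<Rightarrow> 'b fun_space \<Rightarrow> ('a \<Rightarrow> 'b) \<Rightarrow> bool"
  where "morphism X Y f \<longleftrightarrow>
    continuous_map (zariski X) (zariski Y) f \<and>
    (\<forall>U g. openin (zariski Y) U \<and> g \<in> regfuns Y U \<longrightarrow>
       g \<circ> f \<in> regfuns X {x \<in> points X. f x \<in> U})"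

definition open_subspace :: "'a fun_space \<Rightarrow> 'a set \<Rightarrow> 'a fun_space"
  where "open_subspace X U = \<lparr>zariski = subtopology (zariski X) U, regfuns = regfuns X\<rparr>"

text \<open>
  Products of (pre)varieties: the functions \<open>\<Sum>i. a i x * b i y\<close> with \<open>a i\<close> regular on \<open>U\<close>
  and \<open>b i\<close> regular on \<open>U'\<close> form the image of the tensor product of the two rings in the
  functions on \<open>U \<times> U'\<close>. Their nonvanishing loci are a base of the Zariski topology of the
  product (which is finer than the product topology), and the regular functions are locally
  quotients of two of them.
\<close>

definition tensor_funs ::
    "'a fun_space \<Rightarrow> 'b fun_space \<Rightarrow> 'a set \<Rightarrow> 'b set \<Rightarrow> ('a \<times> 'b \<Rightarrow> complex) set"
  where "tensor_funs X Y U U' =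
    {f. \<exists>(n::nat) a b. (\<forall>i<n. a i \<in> regfuns X U \<and> b i \<in> regfuns Y U') \<and>
          (\<forall>x\<in>U. \<forall>y\<in>U'. f (x, y) = (\<Sum>i<n. a i x * b i y))}"

definition product_zariski :: "'a fun_space \<Rightarrow> 'b fun_space \<Rightarrow> ('a \<times> 'b) topology"
  where "product_zariski X Y = topology_generated_by
    {{p \<in> U \<times> U'. f p \<noteq> 0} | U U' f.
       openin (zariski X) U \<and> openin (zariski Y) U' \<and> f \<in> tensor_funs X Y U U'}"

definition product_space :: "'a fun_space \<Rightarrow> 'b fun_space \<Rightarrow> ('a \<times> 'b) fun_space"
  where "product_space X Y =
    \<lparr>zariski = product_zariski X Y,
     regfuns = (\<lambda>W. {f. \<forall>p\<in>W. \<exists>N U U' g h.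
        openin (product_zariski X Y) N \<and> p \<in> N \<and> N \<subseteq> W \<and>
        openin (zariski X) U \<and> openin (zariski Y) U' \<and> N \<subseteq> U \<times> U' \<and>
        g \<in> tensor_funs X Y U U' \<and> h \<in> tensor_funs X Y U U' \<and>
        (\<forall>q\<in>N. h q \<noteq> 0 \<and> f q = g q / h q)})\<rparr>"


section \<open>The affine line and the multiplicative group\<close>

definition affine_line_zariski :: "complex topology"
  where "affine_line_zariski = topology_generated_by {{z. poly p z \<noteq> 0} | p. True}"

definition affine_line :: "complex fun_space"
  where "affine_line =
    \<lparr>zariski = affine_line_zariski,
     regfuns = (\<lambda>W. {f. \<forall>z\<in>W. \<exists>N (g :: complex poly) h.
        openin affine_line_zariski N \<and> z \<in> N \<and> N \<subseteq> W \<and>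
        (\<forall>w\<in>N. poly h w \<noteq> 0 \<and> f w = poly g w / poly h w)})\<rparr>"

definition Cstar :: "complex fun_space"
  where "Cstar = open_subspace affine_line (- {0})"

definition Cstar_group :: "complex monoid"
  where "Cstar_group = \<lparr>carrier = - {0}, mult = (*), one = 1\<rparr>"


section \<open>Projective space\<close>

text \<open>
  The points of the projective space with homogeneous coordinates indexed by \<open>'n\<close>, of dimension
  \<open>CARD('n) - 1\<close>, are the classes of nonzero vectors modulo scaling; a class does not contain
  the zero vector. Over the complex numbers a form is determined by the function it defines.
\<close>

definition scaling_rel :: "((complex ^ 'n) \<times> (complex ^ 'n)) set"
  where "scaling_rel = {(x, y). x \<noteq> 0 \<and> y \<noteq> 0 \<and> (\<exists>c. y = c *s x)}"

definition proj_points :: "(complex ^ 'n) set set"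
  where "proj_points = (- {0}) // scaling_rel"

definition homogeneous_form :: "nat \<Rightarrow> (complex ^ 'n \<Rightarrow> complex) \<Rightarrow> bool"
  where "homogeneous_form d f \<longleftrightarrow>
    (\<exists>c. f = (\<lambda>x. \<Sum>m | (\<Sum>i\<in>UNIV. m i) = d. c m * (\<Prod>i\<in>UNIV. (x $ i) ^ m i)))"

definition proj_zariski :: "(complex ^ 'n) set topology"
  where "proj_zariski = topology_generated_by
    {{p \<in> proj_points. \<forall>x\<in>p. f x \<noteq> 0} | f. \<exists>d. homogeneous_form d f}"

definition proj_space :: "(complex ^ 'n) set fun_space"
  where "proj_space =
    \<lparr>zariski = proj_zariski,
     regfuns = (\<lambda>W. {f. \<forall>p\<in>W. \<exists>N d g h.
        openin proj_zariski N \<and> p \<in> N \<and> N \<subseteq> W \<and>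
        homogeneous_form d g \<and> homogeneous_form d h \<and>
        (\<forall>q\<in>N. \<forall>x\<in>q. h x \<noteq> 0 \<and> f q = g x / h x)})\<rparr>"

definition partial_deriv :: "'n \<Rightarrow> (complex ^ 'n \<Rightarrow> complex) \<Rightarrow> complex ^ 'n \<Rightarrow> complex"
  where "partial_deriv i f x = deriv (\<lambda>z. f (x + z *s axis i 1)) 0"

text \<open>The Jacobian criterion; it excludes the zero form.\<close>

definition nonsingular_quadratic_form :: "(complex ^ 'n \<Rightarrow> complex) \<Rightarrow> bool"
  where "nonsingular_quadratic_form q \<longleftrightarrow> homogeneous_form 2 q \<and>
    (\<forall>x. x \<noteq> 0 \<and> q x = 0 \<longrightarrow> (\<exists>i. partial_deriv i q x \<noteq> 0))"

definition nonsingular_quadric :: "(complex ^ 'n) set set \<Rightarrow> bool"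
  where "nonsingular_quadric Q \<longleftrightarrow>
    (\<exists>q. nonsingular_quadratic_form q \<and> Q = {p \<in> proj_points. \<forall>x\<in>p. q x = 0})"


section \<open>The two surfaces\<close>

definition P1P1_minus_diagonal :: "((complex ^ 2) set \<times> (complex ^ 2) set) fun_space"
  where "P1P1_minus_diagonal =
    open_subspace (product_space proj_space proj_space) {(p, p'). p \<noteq> p'}"

definition P2_minus :: "(complex ^ 3) set set \<Rightarrow> (complex ^ 3) set fun_space"
  where "P2_minus Q = open_subspace proj_space (- Q)"


section \<open>Automorphism groups and algebraic actions\<close>

text \<open>As in \<^const>\<open>BijGroup\<close>, automorphisms are represented by extensional functions.\<close>

definition automorphisms :: "'a fun_space \<Rightarrow> ('a \<Rightarrow> 'a) set"
  where "automorphisms X =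
    {f \<in> Bij (points X). morphism X X f \<and> morphism X X (inv_into (points X) f)}"

definition Aut :: "'a fun_space \<Rightarrow> ('a \<Rightarrow> 'a) monoid"
  where "Aut X = BijGroup (points X) \<lparr>carrier := automorphisms X\<rparr>"

definition Cstar_action :: "'a fun_space \<Rightarrow> (complex \<Rightarrow> 'a \<Rightarrow> 'a) \<Rightarrow> bool"
  where "Cstar_action X \<alpha> \<longleftrightarrow>
    group_action Cstar_group (points X) \<alpha> \<and>
    morphism (product_space Cstar X) X (\<lambda>(t, x). \<alpha> t x)"

definition effective_Cstar_action :: "'a fun_space \<Rightarrow> (complex \<Rightarrow> 'a \<Rightarrow> 'a) \<Rightarrow> bool"
  where "effective_Cstar_action X \<alpha> \<longleftrightarrow>
    Cstar_action X \<alpha> \<and> faithful_action Cstar_group (points X) \<alpha>"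

definition conjugate_in_Aut ::
    "'a fun_space \<Rightarrow> (complex \<Rightarrow> 'a \<Rightarrow> 'a) \<Rightarrow> (complex \<Rightarrow> 'a \<Rightarrow> 'a) \<Rightarrow> bool"
  where "conjugate_in_Aut X \<alpha> \<beta> \<longleftrightarrow>
    (\<exists>\<phi> \<in> carrier (Aut X). \<forall>t \<in> carrier Cstar_group.
       \<beta> t = \<phi> \<otimes>\<^bsub>Aut X\<^esub> \<alpha> t \<otimes>\<^bsub>Aut X\<^esub> inv\<^bsub>Aut X\<^esub> \<phi>)"


section \<open>Basic facts\<close>

lemma group_Cstar_group: "group Cstar_group"
  by (rule groupI) (auto simp: Cstar_group_def intro!: bexI[of _ "inverse _"])

lemma homogeneous_form_1: "homogeneous_form 0 (\<lambda>x :: complex ^ 'n. 1)"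
proof -
  have "{m :: 'n \<Rightarrow> nat. (\<Sum>i\<in>UNIV. m i) = 0} = {\<lambda>_. 0}"
    by auto
  then show ?thesis
    unfolding homogeneous_form_def by (intro exI[of _ "\<lambda>_. 1"]) simp
qed

lemma points_proj_space: "points proj_space = proj_points"
proof -
  have "proj_points \<subseteq> \<Union> {{p \<in> proj_points. \<forall>x\<in>p. f x \<noteq> 0} | f :: complex ^ 'n \<Rightarrow> complex. \<exists>d. homogeneous_form d f}"
    using homogeneous_form_1 by (intro Union_upper CollectI exI[of _ "\<lambda>_. 1"]) auto
  then show ?thesis
    by (auto simp: proj_space_def proj_zariski_def)
qed

lemma points_affine_line: "points affine_line = UNIV"
proof -
  have "UNIV \<subseteq> \<Union> {{z. poly p z \<noteq> 0} | p :: complex poly. True}"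
    by (intro Union_upper CollectI exI[of _ "1"]) auto
  then show ?thesis
    by (auto simp: affine_line_def affine_line_zariski_def)
qed

lemma points_Cstar: "points Cstar = carrier Cstar_group"
  using points_affine_line by (simp add: Cstar_def open_subspace_def Cstar_group_def)

lemma one_regular_proj_space: "(\<lambda>_. 1) \<in> regfuns proj_space (points proj_space)"
proof -
  have "homogeneous_form 0 (\<lambda>x :: complex ^ 'n. 1)" by (rule homogeneous_form_1)
  then show ?thesis
    unfolding proj_space_def
    by (auto intro!: exI[of _ "topspace proj_zariski"] exI[of _ "\<lambda>_. 1"])
qed

lemma points_product_space:
  assumes "(\<lambda>_. 1) \<in> regfuns X (points X)" "(\<lambda>_. 1) \<in> regfuns Y (points Y)"
  shows "points (product_space X Y) = points X \<times> points Y"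
proof -
  have *: "(\<lambda>_. 1) \<in> tensor_funs X Y (points X) (points Y)"
    unfolding tensor_funs_def using assms
    by (intro CollectI exI[of _ 1] exI[of _ "\<lambda>_ _. 1"]) auto
  have "points X \<times> points Y \<subseteq> points (product_space X Y)"
    unfolding product_space_def product_zariski_def using *
    by (simp, intro Union_upper CollectI exI[of _ "points X"] exI[of _ "points Y"]
          exI[of _ "\<lambda>_. 1"]) auto
  moreover have "points (product_space X Y) \<subseteq> points X \<times> points Y"
    unfolding product_space_def product_zariski_def
    by (auto dest: openin_subset)
  ultimately show ?thesis by blast
qed

lemma points_P1P1_minus_diagonal:
  "points P1P1_minus_diagonal = {(p, p'). p \<in> proj_points \<and> p' \<in> proj_points \<and> p \<noteq> p'}"
  using points_product_space[OF one_regular_proj_space one_regular_proj_space]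
  by (auto simp: P1P1_minus_diagonal_def open_subspace_def points_proj_space)

lemma points_P2_minus: "points (P2_minus Q) = proj_points - Q"
  using points_proj_space by (auto simp: P2_minus_def open_subspace_def)

lemma morphism_compose:
  assumes "morphism X Y f" "morphism Y Z g"
  shows "morphism X Z (g \<circ> f)"
  unfolding morphism_def
proof (intro conjI allI impI)
  show "continuous_map (zariski X) (zariski Z) (g \<circ> f)"
    using assms by (auto simp: morphism_def intro: continuous_map_compose)
  fix U h assume U: "openin (zariski Z) U \<and> h \<in> regfuns Z U"
  let ?V = "{y \<in> points Y. g y \<in> U}"
  have "openin (zariski Y) ?V" "h \<circ> g \<in> regfuns Y ?V"
    using U assms(2) by (auto simp: morphism_def intro: openin_continuous_map_preimage)
  then have "(h \<circ> g) \<circ> f \<in> regfuns X {x \<in> points X. f x \<in> ?V}"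
    using assms(1) unfolding morphism_def by blast
  moreover have "{x \<in> points X. f x \<in> ?V} = {x \<in> points X. (g \<circ> f) x \<in> U}"
    using assms(1) by (auto simp: morphism_def continuous_map_def)
  ultimately show "h \<circ> (g \<circ> f) \<in> regfuns X {x \<in> points X. (g \<circ> f) x \<in> U}"
    by (simp add: comp_assoc)
qed

lemma morphism_cong:
  assumes loc: "\<And>U f g. f \<in> regfuns X U \<Longrightarrow> (\<And>x. x \<in> U \<Longrightarrow> f x = g x) \<Longrightarrow> g \<in> regfuns X U"
    and f: "morphism X Y f" and eq: "\<And>x. x \<in> points X \<Longrightarrow> f x = g x"
  shows "morphism X Y g"
  unfolding morphism_def
proof (intro conjI allI impI)
  show "continuous_map (zariski X) (zariski Y) g"
    using f eq by (auto simp: morphism_def intro: continuous_map_eq)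
  fix U h assume "openin (zariski Y) U \<and> h \<in> regfuns Y U"
  then have "h \<circ> f \<in> regfuns X {x \<in> points X. f x \<in> U}"
    using f unfolding morphism_def by blast
  moreover have "{x \<in> points X. f x \<in> U} = {x \<in> points X. g x \<in> U}"
    using eq by auto
  ultimately have "h \<circ> f \<in> regfuns X {x \<in> points X. g x \<in> U}"
    by simp
  then show "h \<circ> g \<in> regfuns X {x \<in> points X. g x \<in> U}"
    by (rule loc) (simp add: eq)
qed

lemma morphism_id: "morphism X X (\<lambda>x. x)"
proof -
  have "{x \<in> points X. x \<in> U} = U" if "openin (zariski X) U" for U
    using openin_subset[OF that] by auto
  then show ?thesis
    by (auto simp: morphism_def comp_def)
qed

lemma group_Aut:
  assumes loc: "\<And>U f g. f \<in> regfuns X U \<Longrightarrow> (\<And>x. x \<in> U \<Longrightarrow> f x = g x) \<Longrightarrow> g \<in> regfuns X U"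
  shows "group (Aut X)"
proof -
  let ?S = "points X"
  have cong: "morphism X Y g" if "morphism X Y f" "\<And>x. x \<in> ?S \<Longrightarrow> f x = g x" for Y :: "'a fun_space" and f g
    using loc that by (rule morphism_cong)
  interpret B: group "BijGroup ?S" by (rule group_BijGroup)
  have inv_mem: "inv_into ?S f x \<in> ?S" if "f \<in> Bij ?S" "x \<in> ?S" for f x
    using that by (rule Bij_inv_into_mem)
  have inv_eq: "inv\<^bsub>BijGroup ?S\<^esub> f = restrict (inv_into ?S f) ?S" if "f \<in> Bij ?S" for f
    using inv_BijGroup[OF that] by simp
  have "subgroup (automorphisms X) (BijGroup ?S)"
  proof (rule B.subgroupI)
    show "automorphisms X \<subseteq> carrier (BijGroup ?S)"
      by (auto simp: automorphisms_def BijGroup_def)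
    have "morphism X X (\<lambda>x\<in>?S. x)"
      by (rule cong[OF morphism_id]) auto
    moreover have "morphism X X (inv_into ?S (\<lambda>x\<in>?S. x))"
      by (rule cong[OF morphism_id]) (auto intro!: inv_into_f_eq[symmetric] inj_onI)
    ultimately show "automorphisms X \<noteq> {}"
      using id_Bij[of ?S] by (auto simp: automorphisms_def)
  next
    fix f assume f: "f \<in> automorphisms X"
    then have bij: "f \<in> Bij ?S" and m: "morphism X X f" "morphism X X (inv_into ?S f)"
      by (auto simp: automorphisms_def)
    let ?g = "restrict (inv_into ?S f) ?S"
    have g: "?g \<in> Bij ?S" using bij by (rule restrict_inv_into_Bij)
    have "morphism X X ?g" by (rule cong[OF m(2)]) auto
    moreover have "morphism X X (inv_into ?S ?g)"
    proof (rule cong[OF m(1)])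
      fix x assume x: "x \<in> ?S"
      have fx: "f x \<in> ?S" "inj_on f ?S" using bij x by (auto simp: Bij_def bij_betw_def)
      have "inv_into ?S ?g (?g (f x)) = f x"
        using g fx by (intro inv_into_f_f) (auto simp: Bij_def bij_betw_def)
      then show "f x = inv_into ?S ?g x" using fx x by simp
    qed
    ultimately show "inv\<^bsub>BijGroup ?S\<^esub> f \<in> automorphisms X"
      using g inv_eq[OF bij] by (simp add: automorphisms_def)
  next
    fix f g assume "f \<in> automorphisms X" "g \<in> automorphisms X"
    then have bij: "f \<in> Bij ?S" "g \<in> Bij ?S"
      and m: "morphism X X f" "morphism X X (inv_into ?S f)"
        "morphism X X g" "morphism X X (inv_into ?S g)"
      by (auto simp: automorphisms_def)
    have b: "compose ?S f g \<in> Bij ?S" using bij by (rule compose_Bij)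
    have "morphism X X (compose ?S f g)"
      by (rule cong[OF morphism_compose[OF m(3) m(1)]]) (auto simp: compose_def)
    moreover have "morphism X X (inv_into ?S (compose ?S f g))"
    proof (rule cong[OF morphism_compose[OF m(2) m(4)]])
      fix x assume x: "x \<in> ?S"
      let ?y = "inv_into ?S g (inv_into ?S f x)"
      have y: "?y \<in> ?S" using inv_mem bij x by simp
      have "f (g ?y) = x"
        using bij x inv_mem[OF bij(1) x] by (simp add: Bij_def bij_betw_def f_inv_into_f)
      then have "inv_into ?S (compose ?S f g) x = ?y"
        using b y by (intro inv_into_f_eq) (auto simp: Bij_def bij_betw_def compose_def)
      then show "(inv_into ?S g \<circ> inv_into ?S f) x = inv_into ?S (compose ?S f g) x" by simp
    qed
    ultimately show "f \<otimes>\<^bsub>BijGroup ?S\<^esub> g \<in> automorphisms X"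
      using b bij by (simp add: automorphisms_def BijGroup_def)
  qed
  then show ?thesis
    unfolding Aut_def by (rule B.subgroup_imp_group)
qed

lemma group_Aut_P1P1_minus_diagonal: "group (Aut P1P1_minus_diagonal)"
proof (rule group_Aut)
  fix U and f g :: "(complex ^ 2) set \<times> (complex ^ 2) set \<Rightarrow> complex"
  assume f: "f \<in> regfuns P1P1_minus_diagonal U" and eq: "\<And>x. x \<in> U \<Longrightarrow> f x = g x"
  have "(\<forall>q\<in>N. h q \<noteq> 0 \<and> f q = a q / h q) \<longleftrightarrow> (\<forall>q\<in>N. h q \<noteq> 0 \<and> g q = a q / h q)"
    if "N \<subseteq> U" for N h a
    by (intro ball_cong refl) (use eq that in auto)
  with f show "g \<in> regfuns P1P1_minus_diagonal U"
    by (simp add: P1P1_minus_diagonal_def open_subspace_def product_space_def cong: conj_cong)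
qed

lemma group_Aut_P2_minus: "group (Aut (P2_minus Q))"
proof (rule group_Aut)
  fix U and f g :: "(complex ^ 3) set \<Rightarrow> complex"
  assume f: "f \<in> regfuns (P2_minus Q) U" and eq: "\<And>x. x \<in> U \<Longrightarrow> f x = g x"
  have "(\<forall>q\<in>N. \<forall>x\<in>q. h x \<noteq> 0 \<and> f q = a x / h x) \<longleftrightarrow>
        (\<forall>q\<in>N. \<forall>x\<in>q. h x \<noteq> 0 \<and> g q = a x / h x)"
    if "N \<subseteq> U" for N and h a :: "complex ^ 3 \<Rightarrow> complex"
    by (intro ball_cong refl) (use eq that in auto)
  with f show "g \<in> regfuns (P2_minus Q) U"
    by (simp add: P2_minus_def open_subspace_def proj_space_def cong: conj_cong)
qed

end

theory Submission
  imports Defs "HOL-Library.Poly_Mapping" "HOL-Computational_Algebra.Fundamental_Theorem_Algebra"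
begin

text \<open>
  Both surfaces come from the affine quadric \<open>x y = z^2 - 1\<close>. A pair of distinct points \<open>[a:b]\<close>,
  \<open>[c:d]\<close> of the projective line has the invariants \<open>2 b d\<close>, \<open>2 a c\<close> and \<open>a d + b c\<close>, divided by
  \<open>a d - b c\<close>, and they identify the complement of the diagonal with the quadric. After a linear
  change of coordinates the complement of a nonsingular conic is the set of lines on which
  \<open>z^2 - x y\<close> does not vanish; such a line meets the quadric in two opposite points, so this surface is
  the quotient of the quadric by \<open>s \<mapsto> - s\<close>. The locale \<open>surface\<close> describes both cases at once, with
  a flag \<open>anti\<close> for the second one, and the claim becomes a statement about the ring of functions on
  the quadric, or about its subring of even functions (\<open>inv_ring\<close>).

  An action of the torus on an affine surface makes every regular function \<open>f\<close> a finite sum of weight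
  vectors: \<open>f (\<alpha> t p)\<close> is regular in \<open>p\<close> and a Laurent polynomial in \<open>t\<close>, uniformly in \<open>p\<close> because
  the complex numbers are uncountable (\<open>separately_laurent\<close>), and the group law turns its
  coefficients into weight vectors. Differentiating at \<open>t = 1\<close> gives a derivation \<open>D\<close> of the ring
  which is diagonalisable with integer eigenvalues.

  The quadric carries an invariant area form and hence a Poisson bracket. The divergence of \<open>D\<close> is a
  function on the surface; since \<open>D\<close> is diagonalisable, this function is constant, and then zero, so
  that \<open>D\<close> is the bracket with a Hamiltonian \<open>h\<close> (\<open>good_hamiltonian\<close>). In the coordinates \<open>x, z\<close> of
  the chart \<open>x \<noteq> 0\<close> the function \<open>h\<close> is a Laurent polynomial in \<open>x\<close> with coefficients polynomial in
  \<open>z\<close>, and iterated brackets of \<open>h\<close> with a fixed function stay in a finite-dimensional space. If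
  the Newton polygon of \<open>h\<close> were too large, the leading forms of these iterates would not vanish and
  their weights would grow without bound. This restricts the polygon so much that one of the
  triangular automorphisms \<open>z \<mapsto> z + x p(x)\<close> (\<open>shear\<close>), up to exchanging \<open>x\<close> and \<open>y\<close>, lowers its size,
  as long as \<open>h\<close> is not linear in \<open>z\<close> alone (\<open>good_reducible\<close>).

  For \<open>h = b z + c\<close> the coordinates themselves are eigenfunctions, so in suitable coordinates the
  action is \<open>(x, y, z) \<mapsto> (t^n x, t^-n y, z)\<close> with \<open>n = b\<close>. It is effective only for \<open>n = 1\<close> or
  \<open>n = -1\<close>, and the exchange of \<open>x\<close> and \<open>y\<close> relates these two. Hence all effective actions are conjugate
  to a single one (\<open>effective_actions_conjugate\<close>). All automorphisms involved commute with the
  antipodal map when \<open>anti\<close> is set, so they descend to the quotient.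
\<close>

section \<open>Laurent polynomials in one variable over polynomials in another\<close>

type_synonym laur = "int \<Rightarrow>\<^sub>0 complex poly"

abbreviation lrow :: "laur => int => complex poly" where "lrow \<equiv> Poly_Mapping.lookup"
abbreviation lkeys :: "laur => int set" where "lkeys \<equiv> Poly_Mapping.keys"
abbreviation lmon :: "int => complex poly => laur" where "lmon \<equiv> Poly_Mapping.single"

lemma laur_expand: "f = (\<Sum>k\<in>lkeys f. lmon k (lrow f k))" for f :: laur
  by (rule poly_mapping_eqI) (auto simp: lookup_sum lookup_single when_def in_keys_iff sum.delta)

lemma laur_induct [case_names mon add]:
  fixes f :: laur
  assumes "\<And>k p. P (lmon k p)" "\<And>f g. P f ==> P g ==> P (f + g)"
  shows "P f"
proof -
  have "P (\<Sum>k\<in>K. lmon k (lrow f k))" if "finite K" for K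
    using that
  proof (induction K)
    case empty
    show ?case using assms(1)[of 0 0] by simp
  next
    case (insert k K)
    then show ?case using assms by simp
  qed
  from this[of "lkeys f"] show ?thesis using laur_expand[of f] by simp
qed

lemma laurent_coeffs_zero:
  fixes a :: "int => complex"
  assumes K: "finite K" and inf: "infinite X"
    and eq: "\<And>x. x \<in> X ==> x ~= 0 ==> (\<Sum>k\<in>K. a k * x powi k) = 0" and k: "k \<in> K"
  shows "a k = 0"
proof -
  obtain N :: nat where N: "\<And>k. k \<in> K ==> \<bar>k\<bar> \<le> int N"
  proof -
    have "\<And>k. k \<in> K ==> \<bar>k\<bar> \<le> int (nat (\<Sum>k\<in>K. \<bar>k\<bar>))"
      using K by (auto simp: sum_nonneg intro!: member_le_sum)
    then show ?thesis using that by blast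
  qed
  define p where "p = (\<Sum>k\<in>K. monom (a k) (nat (k + int N)))"
  have "poly p x = x ^ N * (\<Sum>k\<in>K. a k * x powi k)" if "x ~= 0" for x
    unfolding p_def poly_sum sum_distrib_left poly_monom
  proof (rule sum.cong[OF refl])
    fix k assume "k \<in> K"
    then have "0 \<le> k + int N" using N[of k] by auto
    then have "x ^ nat (k + int N) = x powi (k + int N)"
      by (simp add: power_int_def)
    also have "\<dots> = x powi k * x ^ N" using that by (simp add: power_int_add)
    finally show "a k * x ^ nat (k + int N) = x ^ N * (a k * x powi k)" by simp
  qed
  then have "X - {0} \<subseteq> {x. poly p x = 0}" using eq by auto
  moreover have "infinite (X - {0})" using inf by simp
  ultimately have "p = 0" using poly_roots_finite infinite_super by blast
  then have "0 = coeff p (nat (k + int N))" by simp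
  also have "\<dots> = (\<Sum>l\<in>K. if nat (l + int N) = nat (k + int N) then a l else 0)"
    by (simp add: p_def coeff_sum)
  also have "\<dots> = (\<Sum>l\<in>K. if l = k then a l else 0)"
  proof (rule sum.cong[OF refl])
    fix l assume "l \<in> K"
    then have "0 \<le> l + int N" "0 \<le> k + int N" using N[of l] N[OF k] by auto
    then have "nat (l + int N) = nat (k + int N) \<longleftrightarrow> l = k" by (simp add: eq_nat_nat_iff)
    then show "(if nat (l + int N) = nat (k + int N) then a l else 0) = (if l = k then a l else 0)"
      by simp
  qed
  also have "\<dots> = a k" using K k by simp
  finally show ?thesis by simp
qed

definition evl :: "laur => complex => complex poly"
  where "evl f x = (\<Sum>k\<in>lkeys f. smult (x powi k) (lrow f k))"

lemma evl_superset:
  "finite K ==> lkeys f \<subseteq> K ==> evl f x = (\<Sum>k\<in>K. smult (x powi k) (lrow f k))"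
  unfolding evl_def by (rule sum.mono_neutral_left) (auto simp: in_keys_iff)

lemma evl_mon [simp]: "evl (lmon k p) x = smult (x powi k) p"
  by (simp add: evl_superset[of "{k}"])

lemma evl_0 [simp]: "evl 0 x = 0"
  by (simp add: evl_def)

lemma evl_add [simp]: "evl (f + g) x = evl f x + evl g x"
proof -
  have "lkeys (f + g) \<subseteq> lkeys f \<union> lkeys g" by (rule keys_add)
  then show ?thesis
    by (simp add: evl_superset[of "lkeys f \<union> lkeys g"] lookup_add smult_add_right sum.distrib)
qed

lemma evl_uminus [simp]: "evl (- f) x = - evl f x"
  by (metis add_eq_0_iff evl_0 evl_add)

lemma evl_diff [simp]: "evl (f - g) x = evl f x - evl g x"
  using evl_add[of f "- g" x] by simp

lemma evl_sum: "evl (sum f A) x = (\<Sum>a\<in>A. evl (f a) x)"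
  by (induction A rule: infinite_finite_induct) auto

lemma evl_mult [simp]:
  assumes x: "x ~= 0"
  shows "evl (f * g) x = evl f x * evl g x"
proof (induction f rule: laur_induct)
  case (mon k p)
  show ?case
  proof (induction g rule: laur_induct)
    case (mon l q)
    have "x powi (k + l) = x powi k * x powi l" using x by (simp add: power_int_add)
    then show ?case by (simp add: mult_single mult.commute)
  qed (simp add: distrib_left)
qed (simp add: distrib_right)

lemma evl_1 [simp]: "evl 1 x = 1"
  using evl_mon[of 0 1 x] by simp

lemma laur_eqI_evl:
  assumes inf: "infinite X" and eq: "\<And>x. x \<in> X ==> x ~= 0 ==> evl f x = evl g x"
  shows "f = g"
proof -
  define h where "h = f - g"
  have h: "x \<in> X ==> x ~= 0 ==> evl h x = 0" for x
    using eq by (simp add: h_def)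
  have "lrow h k = 0" for k
  proof (cases "k \<in> lkeys h")
    case True
    show ?thesis
    proof (rule poly_eqI, simp)
      fix n
      have *: "(\<Sum>k\<in>lkeys h. coeff (lrow h k) n * x powi k) = 0" if "x \<in> X" "x ~= 0" for x
      proof -
        have "coeff (evl h x) n = 0" using h that by simp
        then show ?thesis by (simp add: evl_def coeff_sum mult.commute)
      qed
      show "coeff (lrow h k) n = 0"
        by (rule laurent_coeffs_zero[where X = X and K = "lkeys h", OF finite_keys inf * True])
    qed
  qed (simp add: in_keys_iff)
  then have "h = 0" by (intro poly_mapping_eqI) simp
  then show ?thesis by (simp add: h_def)
qed

lemma infinite_Compl_complex: "finite F ==> infinite (- F :: complex set)"
  by (metis Diff_infinite_finite infinite_UNIV_char_0 Compl_eq_Diff_UNIV)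

lemma infinite_nonzero: "infinite (- {0} :: complex set)"
  by (rule infinite_Compl_complex) simp

lemma poly_eqI_cofinite:
  fixes p q :: "complex poly"
  assumes "finite F" "\<And>x. x \<notin> F ==> poly p x = poly q x"
  shows "p = q"
proof (rule ccontr)
  assume "p ~= q"
  then have "finite {x. poly (p - q) x = 0}" by (intro poly_roots_finite) auto
  moreover have "- F \<subseteq> {x. poly (p - q) x = 0}" using assms by auto
  moreover have "infinite (- F)" using assms(1) by (rule infinite_Compl_complex)
  ultimately show False using finite_subset by blast
qed

lift_definition dlx :: "laur => laur" is "\<lambda>f k. smult (of_int k) (f k)"
  by (rule finite_subset[rotated]) auto

lift_definition dz :: "laur => laur" is "\<lambda>f k. pderiv (f k)"
  by (rule finite_subset[rotated]) auto

lemma lookup_dlx: "lrow (dlx f) k = smult (of_int k) (lrow f k)"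
  by transfer simp

lemma lookup_dz: "lrow (dz f) k = pderiv (lrow f k)"
  by transfer simp

lemma dlx_add [simp]: "dlx (f + g) = dlx f + dlx g"
  by (rule poly_mapping_eqI) (simp add: lookup_dlx lookup_add smult_add_right)

lemma dz_add [simp]: "dz (f + g) = dz f + dz g"
  by (rule poly_mapping_eqI) (simp add: lookup_dz lookup_add pderiv_add)

lemma dlx_mon [simp]: "dlx (lmon k p) = lmon k (smult (of_int k) p)"
  by (rule poly_mapping_eqI) (simp add: lookup_dlx lookup_single when_def)

lemma dz_mon [simp]: "dz (lmon k p) = lmon k (pderiv p)"
  by (rule poly_mapping_eqI) (simp add: lookup_dz lookup_single when_def)

lemma dlx_mult: "dlx (f * g) = dlx f * g + f * dlx g"
proof (induction f rule: laur_induct)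
  case (mon k p)
  show ?case
  proof (induction g rule: laur_induct)
    case (mon l q)
    show ?case by (simp add: mult_single smult_add_left flip: single_add)
  next
    case (add f g)
    then show ?case by (simp only: distrib_left dlx_add) (simp add: add_ac)
  qed
next
  case (add f1 f2)
  then show ?case by (simp only: distrib_right dlx_add) (simp add: add_ac)
qed

lemma dz_mult: "dz (f * g) = dz f * g + f * dz g"
proof (induction f rule: laur_induct)
  case (mon k p)
  show ?case
  proof (induction g rule: laur_induct)
    case (mon l q)
    have "pderiv (p * q) = pderiv p * q + p * pderiv q" by (simp add: pderiv_mult)
    then show ?case by (simp add: mult_single flip: single_add)
  next
    case (add f g)
    then show ?case by (simp only: distrib_left dz_add) (simp add: add_ac)
  qed
next
  case (add f1 f2)
  then show ?case by (simp only: distrib_right dz_add) (simp add: add_ac)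
qed

lemma dlx_dz: "dlx (dz f) = dz (dlx f)"
  by (rule poly_mapping_eqI) (simp add: lookup_dlx lookup_dz pderiv_smult)

lemma dlx_uminus [simp]: "dlx (- f) = - dlx f"
  by (rule poly_mapping_eqI) (simp add: lookup_dlx)

lemma dz_uminus [simp]: "dz (- f) = - dz f"
  by (rule poly_mapping_eqI) (simp add: lookup_dz pderiv_minus)

lemma dlx_diff [simp]: "dlx (f - g) = dlx f - dlx g"
  by (rule poly_mapping_eqI) (simp add: lookup_dlx lookup_minus smult_diff_right)

lemma dz_diff [simp]: "dz (f - g) = dz f - dz g"
  by (rule poly_mapping_eqI) (simp add: lookup_dz lookup_minus pderiv_diff)

text \<open>
  The bracket \<open>{h, f} = x (\<partial>\<^sub>z h \<partial>\<^sub>x f - \<partial>\<^sub>x h \<partial>\<^sub>z f)\<close> is the Poisson bracket of the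
  area form that is invariant under the linear symmetries of the quadric.
\<close>

definition br :: "laur => laur => laur"
  where "br h f = dz h * dlx f - dlx h * dz f"

lemma br_add_left: "br (f + g) h = br f h + br g h"
  by (simp add: br_def algebra_simps)

lemma br_add_right: "br h (f + g) = br h f + br h g"
  by (simp add: br_def algebra_simps)

lemma br_mult_left: "br (f * g) h = f * br g h + g * br f h"
  by (simp add: br_def dlx_mult dz_mult algebra_simps)

lemma br_mult_right: "br h (f * g) = f * br h g + g * br h f"
  by (simp add: br_def dlx_mult dz_mult algebra_simps)

lemma br_swap: "br f h = - br h f"
  by (simp add: br_def)

lemma br_const_left [simp]: "br (lmon 0 [:c:]) f = 0"
  by (simp add: br_def pderiv_pCons)

lemma br_const_right [simp]: "br f (lmon 0 [:c:]) = 0"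
  by (simp add: br_def pderiv_pCons)

lemma br_sum_right: "br h (sum f A) = (\<Sum>a\<in>A. br h (f a))"
proof (induction A rule: infinite_finite_induct)
  case (insert a A) then show ?case by (simp add: br_add_right)
qed (use br_const_right[of h 0] in simp_all)

lemma br_sum_left: "br (sum f A) h = (\<Sum>a\<in>A. br (f a) h)"
  by (subst br_swap, subst br_sum_right, simp add: sum_negf[symmetric], subst br_swap, simp)

section \<open>The ring of the affine quadric\<close>

type_synonym pt = "complex \<times> complex \<times> complex"

definition quadric :: "pt set"
  where "quadric = {(x, y, z). x * y = z^2 - 1}"

definition chart :: "complex => complex => pt"
  where "chart x z = (x, (z^2 - 1) / x, z)"

definition cx :: "pt => complex" where "cx s = fst s"
definition cy :: "pt => complex" where "cy s = fst (snd s)"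
definition cz :: "pt => complex" where "cz s = snd (snd s)"

lemma coords [simp]: "cx (a, b, c) = a" "cy (a, b, c) = b" "cz (a, b, c) = c"
  by (simp_all add: cx_def cy_def cz_def)

lemma coords_uminus [simp]: "cx (- s) = - cx s" "cy (- s) = - cy s" "cz (- s) = - cz s"
  by (simp_all add: cx_def cy_def cz_def)

lemma coords_chart [simp]: "cx (chart x z) = x" "cy (chart x z) = (z^2 - 1) / x" "cz (chart x z) = z"
  by (simp_all add: chart_def)

lemma pt_eqI: "cx s = cx t ==> cy s = cy t ==> cz s = cz t ==> s = t"
  by (simp add: cx_def cy_def cz_def prod_eq_iff)

lemma quadric_iff: "s \<in> quadric \<longleftrightarrow> cx s * cy s = cz s ^ 2 - 1"
  by (cases s) (auto simp: quadric_def)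

lemma quadric_uminus [simp]: "- s \<in> quadric \<longleftrightarrow> s \<in> quadric"
  by (simp add: quadric_iff)

lemma chart_in [simp]: "x ~= 0 ==> chart x z \<in> quadric"
  by (simp add: quadric_iff)

lemma chart_cover: "s \<in> quadric ==> cx s ~= 0 ==> s = chart (cx s) (cz s)"
  by (rule pt_eqI) (auto simp: quadric_iff field_simps)

inductive_set polyfun :: "(pt => complex) set" where
  const: "(\<lambda>_. c) \<in> polyfun"
| cx: "cx \<in> polyfun"
| cy: "cy \<in> polyfun"
| cz: "cz \<in> polyfun"
| add: "f \<in> polyfun ==> g \<in> polyfun ==> (\<lambda>s. f s + g s) \<in> polyfun"
| mult: "f \<in> polyfun ==> g \<in> polyfun ==> (\<lambda>s. f s * g s) \<in> polyfun"

definition qring :: "(pt => complex) set"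
  where "qring = {f. \<exists>P\<in>polyfun. \<forall>s\<in>quadric. f s = P s}"

lemma qringE:
  assumes "f \<in> qring" obtains P where "P \<in> polyfun" "\<And>s. s \<in> quadric ==> f s = P s"
  using assms by (auto simp: qring_def)

lemma polyfun_qring: "P \<in> polyfun ==> P \<in> qring"
  by (auto simp: qring_def)

lemma qring_cong: "f \<in> qring ==> (\<And>s. s \<in> quadric ==> f s = g s) ==> g \<in> qring"
  by (force simp: qring_def)

lemma qring_const [simp]: "(\<lambda>_. c) \<in> qring"
  and qring_cx [simp]: "cx \<in> qring" and qring_cy [simp]: "cy \<in> qring" and qring_cz [simp]: "cz \<in> qring"
  by (auto intro: polyfun_qring polyfun.intros)

lemma qring_add [simp]: "f \<in> qring ==> g \<in> qring ==> (\<lambda>s. f s + g s) \<in> qring"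
  and qring_mult [simp]: "f \<in> qring ==> g \<in> qring ==> (\<lambda>s. f s * g s) \<in> qring"
   by (force simp: qring_def intro: polyfun.add, force simp: qring_def intro: polyfun.mult)

lemma qring_eta [simp]: "f \<in> qring ==> (\<lambda>s. f s) \<in> qring"
  by simp

lemma qring_cmult [simp]: "f \<in> qring ==> (\<lambda>s. c * f s) \<in> qring"
  using qring_mult[OF qring_const] .

lemma qring_uminus [simp]: "f \<in> qring ==> (\<lambda>s. - f s) \<in> qring"
  using qring_cmult[of f "-1"] by simp

lemma qring_diff [simp]: "f \<in> qring ==> g \<in> qring ==> (\<lambda>s. f s - g s) \<in> qring"
  using qring_add[of f "\<lambda>s. - g s"] by simp

lemma qring_power [simp]: "f \<in> qring ==> (\<lambda>s. f s ^ n) \<in> qring"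
  by (induction n) auto

lemma qring_sum [simp]: "(\<And>a. a \<in> A ==> f a \<in> qring) ==> (\<lambda>s. \<Sum>a\<in>A. f a s) \<in> qring"
  by (induction A rule: infinite_finite_induct) auto

lemma qring_poly [simp]: "f \<in> qring ==> (\<lambda>s. poly p (f s)) \<in> qring"
  by (induction p) auto

lemma polyfun_poly: "f \<in> polyfun ==> (\<lambda>s. poly p (f s)) \<in> polyfun"
  by (induction p) (auto intro: polyfun.intros)

lemma polyfun_curve:
  assumes "P \<in> polyfun"
  obtains r where "\<And>c. P (poly p1 c, poly p2 c, poly p3 c) = poly r c"
proof -
  from assms have "\<exists>r. \<forall>c. P (poly p1 c, poly p2 c, poly p3 c) = poly r c"
  proof induction
    case (const a) show ?case by (intro exI[of _ "[:a:]"]) simp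
  next
    case (add f g)
    then obtain r r' where "\<forall>c. f (poly p1 c, poly p2 c, poly p3 c) = poly r c"
      "\<forall>c. g (poly p1 c, poly p2 c, poly p3 c) = poly r' c" by blast
    then show ?case by (intro exI[of _ "r + r'"]) simp
  next
    case (mult f g)
    then obtain r r' where "\<forall>c. f (poly p1 c, poly p2 c, poly p3 c) = poly r c"
      "\<forall>c. g (poly p1 c, poly p2 c, poly p3 c) = poly r' c" by blast
    then show ?case by (intro exI[of _ "r * r'"]) simp
  qed auto
  then show ?thesis using that by blast
qed

text \<open>
  The chart \<open>x \<noteq> 0\<close> is dense: every other point of the quadric lies on a polynomial curve
  that runs inside the chart except for finitely many parameters.
\<close>

lemma qring_zero_on_chart:
  assumes f: "f \<in> qring" and zero: "\<And>x z. x ~= 0 ==> f (chart x z) = 0" and s: "s \<in> quadric"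
  shows "f s = 0"
proof -
  obtain P where P: "P \<in> polyfun" and fP: "\<And>s. s \<in> quadric ==> f s = P s" using f unfolding qring_def by blast
  have zero': "P t = 0" if "t \<in> quadric" "cx t ~= 0" for t
    using zero[OF that(2), of "cz t"] chart_cover[OF that] fP[OF that(1)] by simp
  obtain x y z where xyz: "s = (x, y, z)" by (cases s)
  have q: "x * y = z^2 - 1" using s by (simp add: quadric_iff xyz)
  consider "x ~= 0" | "x = 0" "y ~= 0" | "x = 0" "y = 0" by blast
  then have "P s = 0"
  proof cases
    case 1 then show ?thesis using zero'[OF s] by (simp add: xyz)
  next
    case 2
    let ?p = "smult (1 / y) [:-1, 0, 1:]"
    obtain r where r: "\<And>c. P (poly ?p c, poly [:y:] c, poly [:0, 1:] c) = poly r c"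
      using polyfun_curve[OF P] by blast
    have "r = 0"
    proof (rule poly_eqI_cofinite[of "{1, -1}"])
      fix c :: complex assume "c \<notin> {1, -1}"
      then have "c^2 - 1 ~= 0" by (simp add: power2_eq_1_iff)
      then have "P (poly ?p c, poly [:y:] c, poly [:0, 1:] c) = 0"
        using 2 by (intro zero') (auto simp: quadric_iff field_simps power2_eq_square)
      then show "poly r c = poly 0 c" using r by simp
    qed simp
    moreover have "z * z = 1" using q 2 by (simp add: power2_eq_square)
    ultimately show ?thesis using r[of z] 2 by (simp add: xyz)
  next
    case 3
    obtain r where r: "\<And>c. P (poly [:0, 1:] c, poly 0 c, poly [:z:] c) = poly r c"
      using polyfun_curve[OF P] by blast
    have "r = 0"
    proof (rule poly_eqI_cofinite[of "{0}"])
      fix c :: complex assume "c \<notin> {0}"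
      then have "P (poly [:0, 1:] c, poly 0 c, poly [:z:] c) = 0"
        using 3 q by (intro zero') (auto simp: quadric_iff)
      then show "poly r c = poly 0 c" using r by simp
    qed simp
    then show ?thesis using r[of 0] 3 by (simp add: xyz)
  qed
  then show ?thesis using fP[OF s] by simp
qed

subsection \<open>Laurent expansions\<close>

definition expands :: "(pt => complex) => laur => bool"
  where "expands f t \<longleftrightarrow> (\<forall>x z. x ~= 0 --> f (chart x z) = poly (evl t x) z)"

definition lexp :: "(pt => complex) => laur"
  where "lexp f = (THE t. expands f t)"

lemma expands_unique: "expands f t ==> expands f u ==> t = u"
proof (rule laur_eqI_evl[OF infinite_nonzero])
  fix x :: complex assume e: "expands f t" "expands f u" and x: "x ~= 0"
  have "poly (evl t x) z = poly (evl u x) z" for z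
    using e x unfolding expands_def by metis
  then show "evl t x = evl u x" by (simp add: poly_eq_poly_eq_iff[symmetric] fun_eq_iff)
qed

lemma lexp_eqI: "expands f t ==> lexp f = t"
  unfolding lexp_def using expands_unique by blast

lemma expands_cong: "(\<And>s. s \<in> quadric ==> f s = g s) ==> expands f t \<longleftrightarrow> expands g t"
  by (auto simp: expands_def)

lemma lexp_cong: "(\<And>s. s \<in> quadric ==> f s = g s) ==> lexp f = lexp g"
proof -
  assume "\<And>s. s \<in> quadric ==> f s = g s"
  then have "expands f = expands g" using expands_cong[of f g] by blast
  then show ?thesis by (simp add: lexp_def)
qed

lemma expands_const: "expands (\<lambda>_. c) (lmon 0 [:c:])"
  and expands_cx: "expands cx (lmon 1 1)"
  and expands_cy: "expands cy (lmon (-1) [:-1, 0, 1:])"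
  and expands_cz: "expands cz (lmon 0 [:0, 1:])"
  by (auto simp: expands_def field_simps power2_eq_square power_int_minus)

lemma expands_add: "expands f t ==> expands g u ==> expands (\<lambda>s. f s + g s) (t + u)"
  and expands_mult: "expands f t ==> expands g u ==> expands (\<lambda>s. f s * g s) (t * u)"
  by (auto simp: expands_def)

lemma expands_lexp: "f \<in> qring ==> expands f (lexp f)"
proof -
  assume "f \<in> qring"
  then obtain P where P: "P \<in> polyfun" and fP: "\<And>s. s \<in> quadric ==> f s = P s"
    unfolding qring_def by blast
  from P have "\<exists>t. expands P t"
    by induction (blast intro: expands_const expands_cx expands_cy expands_cz expands_add expands_mult)+
  then obtain t where "expands P t" by blast
  then have "expands f t" using expands_cong[of f P t] fP by simp
  then show ?thesis using lexp_eqI by simp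
qed

lemma poly_lexp: "f \<in> qring ==> x ~= 0 ==> poly (evl (lexp f) x) z = f (chart x z)"
  using expands_lexp by (simp add: expands_def)

lemma lexp_const [simp]: "lexp (\<lambda>_. c) = lmon 0 [:c:]"
  and lexp_cx [simp]: "lexp cx = lmon 1 1"
  and lexp_cy [simp]: "lexp cy = lmon (-1) [:-1, 0, 1:]"
  and lexp_cz [simp]: "lexp cz = lmon 0 [:0, 1:]"
  by (rule lexp_eqI expands_const expands_cx expands_cy expands_cz)+

lemma lexp_add [simp]: "f \<in> qring ==> g \<in> qring ==> lexp (\<lambda>s. f s + g s) = lexp f + lexp g"
  and lexp_mult [simp]: "f \<in> qring ==> g \<in> qring ==> lexp (\<lambda>s. f s * g s) = lexp f * lexp g"
  by (intro lexp_eqI expands_add expands_mult expands_lexp; assumption)+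

lemma lexp_cmult [simp]: "f \<in> qring ==> lexp (\<lambda>s. c * f s) = lmon 0 [:c:] * lexp f"
  using lexp_mult[OF qring_const] by simp

lemma lmon_minus_1: "lmon 0 [:-1:] = -1"
  by (metis pCons_one single_one single_uminus minus_pCons minus_zero)

lemma lexp_uminus [simp]: "f \<in> qring ==> lexp (\<lambda>s. - f s) = - lexp f"
  using lexp_cmult[of f "-1"] by (simp add: lmon_minus_1)

lemma lexp_diff [simp]: "f \<in> qring ==> g \<in> qring ==> lexp (\<lambda>s. f s - g s) = lexp f - lexp g"
  using lexp_add[of f "\<lambda>s. - g s"] by simp

lemma lexp_sum: "(\<And>a. a \<in> A ==> f a \<in> qring) ==> lexp (\<lambda>s. \<Sum>a\<in>A. f a s) = (\<Sum>a\<in>A. lexp (f a))"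
  by (induction A rule: infinite_finite_induct) auto

lemma lexp_eq_iff:
  assumes "f \<in> qring" "g \<in> qring"
  shows "lexp f = lexp g \<longleftrightarrow> (\<forall>s\<in>quadric. f s = g s)"
proof
  assume eq: "lexp f = lexp g"
  have "f s - g s = 0" if "s \<in> quadric" for s
  proof (rule qring_zero_on_chart[OF qring_diff[OF assms] _ that])
    fix x z :: complex assume "x ~= 0"
    then show "f (chart x z) - g (chart x z) = 0"
      using poly_lexp[OF assms(1)] poly_lexp[OF assms(2)] eq by simp
  qed
  then show "\<forall>s\<in>quadric. f s = g s" by simp
qed (use lexp_cong in blast)

lemma lexp_eqD: "lexp f = lexp g ==> f \<in> qring ==> g \<in> qring ==> s \<in> quadric ==> f s = g s"
  using lexp_eq_iff by blast

subsection \<open>Which Laurent polynomials are regular on the quadric\<close>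

definition wfac :: "int => complex poly" where "wfac k = [:-1, 0, 1:] ^ nat (- k)"

definition ufun :: "int => pt => complex"
  where "ufun k s = (if k \<ge> 0 then cx s ^ nat k else cy s ^ nat (- k))"

definition lshape :: "laur => bool" where "lshape t \<longleftrightarrow> (\<forall>k. wfac k dvd lrow t k)"

lemma wfac_dvd: "wfac (k + l) dvd wfac k * wfac l"
  unfolding wfac_def power_add[symmetric] by (rule le_imp_power_dvd) auto

lemma degree_wfac: "degree (wfac k) = 2 * nat (- k)"
  by (simp add: wfac_def degree_power_eq)

lemma wfac_nonzero [simp]: "wfac k ~= 0"
  by (simp add: wfac_def)

lemma lshape_mon: "lshape (lmon k p) \<longleftrightarrow> wfac k dvd p"
  by (auto simp: lshape_def lookup_single when_def)

lemma lshape_add: "lshape f ==> lshape g ==> lshape (f + g)"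
  by (simp add: lshape_def lookup_add)

lemma lshape_sum: "(\<And>a. a \<in> A ==> lshape (f a)) ==> lshape (sum f A)"
  by (induction A rule: infinite_finite_induct) (auto simp: lshape_add, simp_all add: lshape_def)

lemma lshape_mult: assumes "lshape f" "lshape g" shows "lshape (f * g)"
proof -
  have "f * g = (\<Sum>k\<in>lkeys f. lmon k (lrow f k)) * (\<Sum>l\<in>lkeys g. lmon l (lrow g l))"
    using laur_expand by simp
  also have "\<dots> = (\<Sum>k\<in>lkeys f. \<Sum>l\<in>lkeys g. lmon (k + l) (lrow f k * lrow g l))"
    by (simp add: sum_product mult_single)
  moreover have "lshape (lmon (k + l) (lrow f k * lrow g l))" for k l
    unfolding lshape_mon using assms wfac_dvd[of k l]
    by (meson lshape_def dvd_trans mult_dvd_mono)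
  ultimately show ?thesis by (simp add: lshape_sum)
qed

lemma lshape_lexp: "f \<in> qring ==> lshape (lexp f)"
proof -
  assume "f \<in> qring"
  then obtain P where P: "P \<in> polyfun" and fP: "\<And>s. s \<in> quadric ==> f s = P s"
    unfolding qring_def by blast
  from P have "lshape (lexp P)"
    by induction (auto simp: polyfun_qring lshape_add lshape_mult lshape_mon wfac_def)
  then show ?thesis using lexp_cong[OF fP] by simp
qed

lemma ufun_qring [simp]: "ufun k \<in> qring"
  by (cases "k \<ge> 0") (simp_all add: ufun_def[abs_def])

lemma lexp_ufun: "p = wfac k * q ==> lexp (\<lambda>s. ufun k s * poly q (cz s)) = lmon k p"
  by (rule lexp_eqI)
     (auto simp: expands_def ufun_def wfac_def power_int_def field_simps power2_eq_square poly_power)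

lemma lshape_regular:
  assumes "lshape t"
  obtains g where "\<And>k. lrow t k = wfac k * g k"
    "(\<lambda>s. \<Sum>k\<in>lkeys t. ufun k s * poly (g k) (cz s)) \<in> qring"
    "lexp (\<lambda>s. \<Sum>k\<in>lkeys t. ufun k s * poly (g k) (cz s)) = t"
proof -
  have "\<forall>k. \<exists>q. lrow t k = wfac k * q" using assms unfolding lshape_def dvd_def by blast
  then obtain g where g: "\<And>k. lrow t k = wfac k * g k" by metis
  have q: "(\<lambda>s. ufun k s * poly (g k) (cz s)) \<in> qring" for k by simp
  have "lexp (\<lambda>s. \<Sum>k\<in>lkeys t. ufun k s * poly (g k) (cz s)) = (\<Sum>k\<in>lkeys t. lmon k (lrow t k))"
    by (subst lexp_sum) (auto intro!: sum.cong lexp_ufun g simp del: lexp_mult)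
  then show ?thesis using that[OF g] laur_expand[of t] by simp
qed

lemma lrow_degree_ge: "f \<in> qring ==> lrow (lexp f) k ~= 0 ==> - 2 * k \<le> int (degree (lrow (lexp f) k))"
  using lshape_lexp[of f] dvd_imp_degree_le[of "wfac k" "lrow (lexp f) k"]
  by (auto simp: lshape_def degree_wfac)

definition qswap :: "pt => pt" where "qswap s = (cy s, cx s, - cz s)"

lemma qswap_simps [simp]: "cx (qswap s) = cy s" "cy (qswap s) = cx s" "cz (qswap s) = - cz s"
  "qswap (qswap s) = s"
  by (auto simp: qswap_def intro: pt_eqI)

text \<open>
  The swap maps a monomial \<open>x^k z^j\<close> that is extreme in its row to one with exponents
  \<open>-k\<close> and \<open>2 k + j\<close>, because \<open>y = (z^2 - 1) / x\<close>.
\<close>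

lemma degree_lrow_swap:
  assumes f: "f \<in> qring" and nz: "lrow (lexp (\<lambda>s. f (qswap s))) (- k) ~= 0"
  shows "lrow (lexp f) k ~= 0"
    and "int (degree (lrow (lexp (\<lambda>s. f (qswap s))) (- k))) = 2 * k + int (degree (lrow (lexp f) k))"
proof -
  let ?t = "lexp f"
  obtain g where g: "\<And>k. lrow ?t k = wfac k * g k"
    "(\<lambda>s. \<Sum>k\<in>lkeys ?t. ufun k s * poly (g k) (cz s)) \<in> qring"
    "lexp (\<lambda>s. \<Sum>k\<in>lkeys ?t. ufun k s * poly (g k) (cz s)) = ?t"
    using lshape_regular[OF lshape_lexp[OF f]] by blast
  have fs: "f s = (\<Sum>k\<in>lkeys ?t. ufun k s * poly (g k) (cz s))" if "s \<in> quadric" for s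
    using lexp_eqD[OF g(3) g(2) f that] by simp
  have sw: "qswap s \<in> quadric" if "s \<in> quadric" for s
    using that by (simp add: quadric_iff mult.commute)
  have us: "ufun k (qswap s) = ufun (- k) s" for k s
    by (auto simp: ufun_def)
  let ?g = "\<lambda>k. pcompose (g k) [:0, -1:]"
  have "lexp (\<lambda>s. f (qswap s)) = lexp (\<lambda>s. \<Sum>k\<in>lkeys ?t. ufun (- k) s * poly (?g k) (cz s))"
    by (rule lexp_cong) (simp add: fs sw us poly_pcompose)
  also have "\<dots> = (\<Sum>k\<in>lkeys ?t. lmon (- k) (wfac (- k) * ?g k))"
    by (subst lexp_sum) (auto intro!: sum.cong lexp_ufun simp del: lexp_mult)
  finally have eq: "lexp (\<lambda>s. f (qswap s)) = (\<Sum>k\<in>lkeys ?t. lmon (- k) (wfac (- k) * ?g k))" .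
  have row: "lrow (lexp (\<lambda>s. f (qswap s))) (- k) = (if k \<in> lkeys ?t then wfac (- k) * ?g k else 0)"
    unfolding eq lookup_sum lookup_single by (simp add: when_def sum.delta)
  with nz show k: "lrow ?t k ~= 0" by (auto simp: in_keys_iff split: if_splits)
  then have gk: "g k ~= 0" "?g k ~= 0" using g(1)[of k] nz row by (auto split: if_splits)
  have "degree (lrow ?t k) = degree (wfac k) + degree (g k)"
    using gk by (simp add: g(1) degree_mult_eq)
  moreover have "degree (wfac (- k) * ?g k) = degree (wfac (- k)) + degree (g k)"
    using gk by (simp add: degree_mult_eq degree_pcompose)
  ultimately show "int (degree (lrow (lexp (\<lambda>s. f (qswap s))) (- k))) = 2 * k + int (degree (lrow ?t k))"
    using k by (auto simp: row in_keys_iff degree_wfac)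
qed

lemma lmon_one [simp]: "lmon 0 [:1:] = 1"
  by (simp add: pCons_one)

lemma lmon_eq_0_iff [simp]: "lmon k p = 0 \<longleftrightarrow> p = 0"
  by (metis lookup_single_eq lookup_zero single_zero)

lemma dz_0 [simp]: "dz 0 = 0"
  by (rule poly_mapping_eqI) (simp add: lookup_dz)

lemma dlx_0 [simp]: "dlx 0 = 0"
  by (rule poly_mapping_eqI) (simp add: lookup_dlx)

lemma br_diff_right: "br h (f - g) = br h f - br h g"
  by (simp add: br_def algebra_simps)

lemma br_diff_left: "br (f - g) h = br f h - br g h"
  by (simp add: br_def algebra_simps)

subsection \<open>The bracket and polynomial symmetries\<close>

definition polymap :: "(pt => pt) => bool"
  where "polymap \<phi> \<longleftrightarrow> (\<lambda>s. cx (\<phi> s)) \<in> polyfun \<and> (\<lambda>s. cy (\<phi> s)) \<in> polyfun \<and>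
    (\<lambda>s. cz (\<phi> s)) \<in> polyfun \<and> \<phi> ` quadric \<subseteq> quadric"

lemma polymap_polyfun:
  assumes "polymap \<phi>" "P \<in> polyfun"
  shows "(\<lambda>s. P (\<phi> s)) \<in> polyfun"
  using assms(2,1) by induction (auto simp: polymap_def intro: polyfun.intros)

lemma polymap_qring:
  assumes "polymap \<phi>" "f \<in> qring"
  shows "(\<lambda>s. f (\<phi> s)) \<in> qring"
proof -
  obtain P where P: "P \<in> polyfun" and fP: "\<And>s. s \<in> quadric ==> f s = P s"
    using assms(2) unfolding qring_def by blast
  have "f (\<phi> s) = P (\<phi> s)" if "s \<in> quadric" for s
    using assms(1) that by (intro fP) (auto simp: polymap_def)
  then show ?thesis using polymap_polyfun[OF assms(1) P] by (auto simp: qring_def)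
qed

lemma polymap_quadric: "polymap \<phi> ==> s \<in> quadric ==> \<phi> s \<in> quadric"
  by (auto simp: polymap_def)

lemma polymap_comp: "polymap \<phi> ==> polymap \<psi> ==> polymap (\<lambda>s. \<phi> (\<psi> s))"
  using polymap_polyfun[of \<psi> "\<lambda>s. cx (\<phi> s)"] polymap_polyfun[of \<psi> "\<lambda>s. cy (\<phi> s)"]
    polymap_polyfun[of \<psi> "\<lambda>s. cz (\<phi> s)"]
  by (auto simp: polymap_def)

definition poisson_scaling :: "complex => (pt => pt) => bool"
  where "poisson_scaling e \<phi> \<longleftrightarrow> (\<forall>f g k. f \<in> qring --> g \<in> qring --> k \<in> qring -->
    lexp k = br (lexp f) (lexp g) -->
    br (lexp (\<lambda>s. f (\<phi> s))) (lexp (\<lambda>s. g (\<phi> s))) = lmon 0 [:e:] * lexp (\<lambda>s. k (\<phi> s)))"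

text \<open>
  A bracket is a derivation in each argument, so it is determined by its values on the three
  coordinates; and these follow from \<open>{z, x}\<close> alone because \<open>x y = z^2 - 1\<close>.
\<close>

lemma bracket_polymap:
  assumes \<phi>: "polymap \<phi>" and nz: "lexp (\<lambda>s. cx (\<phi> s)) ~= 0"
    and zx: "br (lexp (\<lambda>s. cz (\<phi> s))) (lexp (\<lambda>s. cx (\<phi> s))) = lmon 0 [:e:] * lexp (\<lambda>s. cx (\<phi> s))"
    and f: "f \<in> qring" and g: "g \<in> qring"
  shows "\<exists>k\<in>qring. lexp k = br (lexp f) (lexp g) \<and>
    br (lexp (\<lambda>s. f (\<phi> s))) (lexp (\<lambda>s. g (\<phi> s))) = lmon 0 [:e:] * lexp (\<lambda>s. k (\<phi> s))"
proof -
  define Q where "Q f g \<longleftrightarrow> (\<exists>k\<in>qring. lexp k = br (lexp f) (lexp g) \<and>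
    br (lexp (\<lambda>s. f (\<phi> s))) (lexp (\<lambda>s. g (\<phi> s))) = lmon 0 [:e:] * lexp (\<lambda>s. k (\<phi> s)))"
    for f g :: "pt => complex"
  note pq = polymap_qring[OF \<phi>]
  have sym: "Q g f" if "Q f g" for f g
  proof -
    obtain k where k: "k \<in> qring" "lexp k = br (lexp f) (lexp g)"
      "br (lexp (\<lambda>s. f (\<phi> s))) (lexp (\<lambda>s. g (\<phi> s))) = lmon 0 [:e:] * lexp (\<lambda>s. k (\<phi> s))"
      using \<open>Q f g\<close> by (auto simp: Q_def)
    show ?thesis unfolding Q_def
    proof (intro bexI[of _ "\<lambda>s. - k s"] conjI)
      show "lexp (\<lambda>s. - k s) = br (lexp g) (lexp f)"
        using k(1,2) by (simp add: br_swap[of "lexp g"])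
      show "br (lexp (\<lambda>s. g (\<phi> s))) (lexp (\<lambda>s. f (\<phi> s))) = lmon 0 [:e:] * lexp (\<lambda>s. - k (\<phi> s))"
        using k(3) pq[OF k(1)] by (simp add: br_swap[of "lexp (\<lambda>s. g (\<phi> s))"])
    qed (use k in simp)
  qed
  have const: "Q (\<lambda>_. c) g" for c g
    unfolding Q_def by (intro bexI[of _ "\<lambda>_. 0"]) auto
  have add: "Q (\<lambda>s. f1 s + f2 s) g" if a: "f1 \<in> qring" "f2 \<in> qring" "Q f1 g" "Q f2 g" for f1 f2 g
  proof -
    obtain k1 k2 where k: "k1 \<in> qring" "lexp k1 = br (lexp f1) (lexp g)"
      "br (lexp (\<lambda>s. f1 (\<phi> s))) (lexp (\<lambda>s. g (\<phi> s))) = lmon 0 [:e:] * lexp (\<lambda>s. k1 (\<phi> s))"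
      "k2 \<in> qring" "lexp k2 = br (lexp f2) (lexp g)"
      "br (lexp (\<lambda>s. f2 (\<phi> s))) (lexp (\<lambda>s. g (\<phi> s))) = lmon 0 [:e:] * lexp (\<lambda>s. k2 (\<phi> s))"
      using a(3,4) unfolding Q_def by blast
    then show ?thesis unfolding Q_def using a pq
      by (intro bexI[of _ "\<lambda>s. k1 s + k2 s"]) (auto simp: br_add_left distrib_left)
  qed
  have mult: "Q (\<lambda>s. f1 s * f2 s) g" if a: "f1 \<in> qring" "f2 \<in> qring" "Q f1 g" "Q f2 g" for f1 f2 g
  proof -
    obtain k1 k2 where k: "k1 \<in> qring" "lexp k1 = br (lexp f1) (lexp g)"
      "br (lexp (\<lambda>s. f1 (\<phi> s))) (lexp (\<lambda>s. g (\<phi> s))) = lmon 0 [:e:] * lexp (\<lambda>s. k1 (\<phi> s))"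
      "k2 \<in> qring" "lexp k2 = br (lexp f2) (lexp g)"
      "br (lexp (\<lambda>s. f2 (\<phi> s))) (lexp (\<lambda>s. g (\<phi> s))) = lmon 0 [:e:] * lexp (\<lambda>s. k2 (\<phi> s))"
      using a(3,4) unfolding Q_def by blast
    then show ?thesis unfolding Q_def using a pq
      by (intro bexI[of _ "\<lambda>s. f1 s * k2 s + f2 s * k1 s"])
         (auto simp: br_mult_left distrib_left mult_ac)
  qed
  have ind: "Q P g" if "P \<in> polyfun" "Q cx g" "Q cy g" "Q cz g" for P g
    using that(1) by induction (auto intro: const add mult that polyfun_qring)
  define X where "X = lexp (\<lambda>s. cx (\<phi> s))"
  define Y where "Y = lexp (\<lambda>s. cy (\<phi> s))"
  define Z where "Z = lexp (\<lambda>s. cz (\<phi> s))"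
  define E where "E = lmon 0 [:e:]"
  have XYZ: "X * Y = Z * Z - 1"
  proof -
    have "X * Y = lexp (\<lambda>s. cx (\<phi> s) * cy (\<phi> s))"
      unfolding X_def Y_def by (simp add: pq)
    also have "\<dots> = lexp (\<lambda>s. cz (\<phi> s) * cz (\<phi> s) - 1)"
      using polymap_quadric[OF \<phi>] by (intro lexp_cong) (simp add: quadric_iff power2_eq_square)
    also have "\<dots> = Z * Z - 1"
      unfolding Z_def by (simp add: pq)
    finally show ?thesis .
  qed
  have br1: "br f 1 = 0" for f using br_const_right[of f 1] by simp
  have brself: "br f f = 0" for f by (simp add: br_def)
  have zx': "br Z X = E * X" using zx by (simp add: X_def Z_def E_def)
  have "X * br Z Y = br Z (X * Y) - Y * br Z X" by (simp add: br_mult_right)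
  also have "br Z (X * Y) = 0" unfolding XYZ by (simp add: br_diff_right br_mult_right br1 brself)
  finally have "X * br Z Y = X * (- (E * Y))" using zx' by (simp add: mult_ac)
  then have zy: "br Z Y = - (E * Y)" using nz unfolding X_def[symmetric] by (metis mult_left_cancel)
  have "X * br X Y = br X (X * Y) - Y * br X X" by (simp add: br_mult_right)
  also have "br X (X * Y) = 2 * Z * br X Z"
    unfolding XYZ by (simp add: br_diff_right br_mult_right br1)
  also have "br X Z = - (E * X)" using zx' by (simp add: br_swap[of X])
  finally have "X * br X Y = X * (E * (- 2 * Z))" by (simp add: brself mult_ac)
  then have xy: "br X Y = E * (- 2 * Z)" using nz unfolding X_def[symmetric] by (metis mult_left_cancel)
  have brz1: "br (lmon 0 [:0, 1:]) (lmon 1 1) = lmon 1 1"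
    by (simp add: br_def mult_single pderiv_pCons pCons_one)
  have brz2: "br (lmon 0 [:0, 1:]) (lmon (-1) [:-1, 0, 1:]) = - lmon (-1) [:-1, 0, 1:]"
    "br (lmon 1 1) (lmon (-1) [:-1, 0, 1:]) = - lmon 0 [:0, 2:]"
    by (simp_all add: br_def mult_single pderiv_pCons flip: single_uminus)
  note brz = brz1 brz2
  have Zq: "lexp (\<lambda>s. - 2 * cz s) = - lmon 0 [:0, 2:]"
    by (subst lexp_cmult) (simp_all add: mult_single flip: single_uminus)
  have Q3: "Q cz cx" "Q cz cy" "Q cx cy"
  proof -
    show "Q cz cx" unfolding Q_def
      by (intro bexI[of _ cx]) (use zx in \<open>simp_all add: brz\<close>)
    show "Q cz cy" unfolding Q_def
      by (intro bexI[of _ "\<lambda>s. - cy s"])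
         (use zy pq[of cy] in \<open>simp_all add: brz Y_def[symmetric] Z_def[symmetric] E_def[symmetric]\<close>)
    have "lexp (\<lambda>s. - 2 * cz (\<phi> s)) = - 2 * Z"
    proof -
      have "lexp (\<lambda>s. - 2 * cz (\<phi> s)) = lexp (\<lambda>s. - (cz (\<phi> s) + cz (\<phi> s)))"
        by (rule lexp_cong) simp
      also have "\<dots> = - (Z + Z)" unfolding Z_def
        by (simp only: lexp_uminus[OF qring_add[OF pq[OF qring_cz] pq[OF qring_cz]]]
          lexp_add[OF pq[OF qring_cz] pq[OF qring_cz]])
      finally show ?thesis by simp
    qed
    then show "Q cx cy" unfolding Q_def
      by (intro bexI[of _ "\<lambda>s. - 2 * cz s"])
         (use xy Zq in \<open>simp_all add: brz X_def[symmetric] Y_def[symmetric] E_def[symmetric] del: lexp_cmult\<close>)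
  qed
  have self: "Q f f" if "f \<in> qring" for f
    unfolding Q_def by (intro bexI[of _ "\<lambda>_. 0"]) (auto simp: brself)
  have gen: "Q P cx" "Q P cy" "Q P cz" if "P \<in> polyfun" for P
    by (rule ind[OF that]; (rule self | rule Q3 | rule sym, rule Q3); simp)+
  obtain P where P: "P \<in> polyfun" "\<And>s. s \<in> quadric ==> f s = P s" using f unfolding qring_def by blast
  obtain R where R: "R \<in> polyfun" "\<And>s. s \<in> quadric ==> g s = R s" using g unfolding qring_def by blast
  have "Q P R" by (rule ind[OF P(1)]; rule sym; rule gen[OF R(1)])
  moreover have "lexp f = lexp P" "lexp g = lexp R"
    "lexp (\<lambda>s. f (\<phi> s)) = lexp (\<lambda>s. P (\<phi> s))" "lexp (\<lambda>s. g (\<phi> s)) = lexp (\<lambda>s. R (\<phi> s))"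
    by (intro lexp_cong; simp add: P(2) R(2) polymap_quadric[OF \<phi>])+
  ultimately show ?thesis by (simp add: Q_def)
qed

lemma poisson_scalingI:
  assumes \<phi>: "polymap \<phi>" and nz: "lexp (\<lambda>s. cx (\<phi> s)) ~= 0"
    and zx: "br (lexp (\<lambda>s. cz (\<phi> s))) (lexp (\<lambda>s. cx (\<phi> s))) = lmon 0 [:e:] * lexp (\<lambda>s. cx (\<phi> s))"
  shows "poisson_scaling e \<phi>"
  unfolding poisson_scaling_def
proof (intro allI impI)
  fix f g k assume a: "f \<in> qring" "g \<in> qring" "k \<in> qring" "lexp k = br (lexp f) (lexp g)"
  obtain k' where k': "k' \<in> qring" "lexp k' = br (lexp f) (lexp g)"
    "br (lexp (\<lambda>s. f (\<phi> s))) (lexp (\<lambda>s. g (\<phi> s))) = lmon 0 [:e:] * lexp (\<lambda>s. k' (\<phi> s))"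
    using bracket_polymap[OF assms a(1,2)] by blast
  have "lexp (\<lambda>s. k' (\<phi> s)) = lexp (\<lambda>s. k (\<phi> s))"
    using polymap_quadric[OF \<phi>] lexp_eqD[of k' k] k' a by (intro lexp_cong) auto
  then show "br (lexp (\<lambda>s. f (\<phi> s))) (lexp (\<lambda>s. g (\<phi> s))) = lmon 0 [:e:] * lexp (\<lambda>s. k (\<phi> s))"
    using k'(3) by simp
qed

definition qbr :: "(pt => complex) => (pt => complex) => pt => complex"
  where "qbr f g = (SOME k. k \<in> qring \<and> lexp k = br (lexp f) (lexp g))"

lemma polymap_id: "polymap (\<lambda>s. s)"
  by (simp add: polymap_def polyfun.intros(2,3,4))

lemma qbr:
  assumes "f \<in> qring" "g \<in> qring"
  shows "qbr f g \<in> qring" "lexp (qbr f g) = br (lexp f) (lexp g)"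
proof -
  have "\<exists>k\<in>qring. lexp k = br (lexp f) (lexp g)"
    using bracket_polymap[OF polymap_id _ _ assms, of 1]
    by (auto simp: br_def mult_single pderiv_pCons pCons_one)
  then have "\<exists>k. k \<in> qring \<and> lexp k = br (lexp f) (lexp g)" by blast
  then have "qbr f g \<in> qring \<and> lexp (qbr f g) = br (lexp f) (lexp g)"
    unfolding qbr_def by (rule someI_ex)
  then show "qbr f g \<in> qring" "lexp (qbr f g) = br (lexp f) (lexp g)" by auto
qed

lemma poisson_scalingD:
  assumes "poisson_scaling e \<phi>" "f \<in> qring" "g \<in> qring"
  shows "br (lexp (\<lambda>s. f (\<phi> s))) (lexp (\<lambda>s. g (\<phi> s))) = lmon 0 [:e:] * lexp (\<lambda>s. qbr f g (\<phi> s))"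
  using assms qbr[OF assms(2,3)] unfolding poisson_scaling_def by blast

lemma poisson_scaling_comp:
  assumes "polymap \<phi>" "polymap \<psi>" "poisson_scaling 1 \<phi>" "poisson_scaling 1 \<psi>"
  shows "poisson_scaling 1 (\<lambda>s. \<phi> (\<psi> s))"
  unfolding poisson_scaling_def
proof (intro allI impI)
  fix f g k assume a: "f \<in> qring" "g \<in> qring" "k \<in> qring" "lexp k = br (lexp f) (lexp g)"
  have "lexp (\<lambda>s. k (\<phi> s)) = br (lexp (\<lambda>s. f (\<phi> s))) (lexp (\<lambda>s. g (\<phi> s)))"
    using assms(3) a unfolding poisson_scaling_def by simp
  then show "br (lexp (\<lambda>s. f (\<phi> (\<psi> s)))) (lexp (\<lambda>s. g (\<phi> (\<psi> s)))) = lmon 0 [:1:] * lexp (\<lambda>s. k (\<phi> (\<psi> s)))"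
    using assms(4) polymap_qring[OF assms(1)] a(1,2,3)
    unfolding poisson_scaling_def by blast
qed

lemma poisson_scaling_uminus: "poisson_scaling (-1) (\<lambda>s. - s)"
proof (rule poisson_scalingI)
  show "polymap (\<lambda>s. - s)"
    using polyfun.mult[OF polyfun.const[of "-1"] polyfun.cx]
      polyfun.mult[OF polyfun.const[of "-1"] polyfun.cy]
      polyfun.mult[OF polyfun.const[of "-1"] polyfun.cz]
    by (auto simp: polymap_def quadric_iff)
qed (auto simp: br_def mult_single pderiv_pCons pderiv_minus pCons_one lmon_minus_1 simp flip: single_uminus)

text \<open>
  The automorphisms of the quadric that occur below: polynomial bijections that preserve the
  bracket and, when \<open>anti\<close> is set, commute with the antipodal map, so that they descend to the
  quotient by it.
\<close>

definition qaut :: "bool => (pt => pt) => (pt => pt) => bool"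
  where "qaut anti \<phi> \<psi> \<longleftrightarrow> polymap \<phi> \<and> polymap \<psi> \<and> poisson_scaling 1 \<phi> \<and> poisson_scaling 1 \<psi> \<and>
    (\<forall>s. \<phi> (\<psi> s) = s \<and> \<psi> (\<phi> s) = s) \<and> (anti --> (\<forall>s. \<phi> (- s) = - \<phi> s \<and> \<psi> (- s) = - \<psi> s))"

lemma qaut_sym: "qaut anti \<phi> \<psi> ==> qaut anti \<psi> \<phi>"
  by (auto simp: qaut_def)

lemma qaut_comp:
  "qaut anti \<phi> \<psi> ==> qaut anti \<phi>' \<psi>' ==> qaut anti (\<lambda>s. \<phi> (\<phi>' s)) (\<lambda>s. \<psi>' (\<psi> s))"
  unfolding qaut_def by (auto simp: polymap_comp poisson_scaling_comp simp del: split_paired_All)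

lemma qaut_qbr:
  assumes "qaut anti \<phi> \<psi>" "f \<in> qring" "g \<in> qring"
  shows "br (lexp (\<lambda>s. f (\<phi> s))) (lexp (\<lambda>s. g (\<phi> s))) = lexp (\<lambda>s. qbr f g (\<phi> s))"
  using poisson_scalingD[of 1 \<phi> f g] assms by (simp add: qaut_def)

lemma qaut_qswap: "qaut anti qswap qswap"
proof -
  have p: "polymap qswap"
    using polyfun.mult[OF polyfun.const[of "-1"] polyfun.cz]
    by (auto simp: polymap_def polyfun.cx polyfun.cy quadric_iff mult.commute)
  moreover have "poisson_scaling 1 qswap"
    by (rule poisson_scalingI[OF p])
       (auto simp: br_def mult_single pderiv_pCons simp flip: single_uminus)
  moreover have "qswap (- s) = - qswap s" for s by (rule pt_eqI) auto
  ultimately show ?thesis by (simp add: qaut_def)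
qed

definition shear :: "complex poly => pt => pt"
  where "shear p s = (cx s, cy s + 2 * cz s * poly p (cx s) + cx s * poly p (cx s) ^ 2,
    cz s + cx s * poly p (cx s))"

lemma shear_simps [simp]: "cx (shear p s) = cx s"
  "cy (shear p s) = cy s + 2 * cz s * poly p (cx s) + cx s * poly p (cx s) ^ 2"
  "cz (shear p s) = cz s + cx s * poly p (cx s)"
  by (simp_all add: shear_def)

lemma shear_chart: "x ~= 0 ==> shear p (chart x z) = chart x (z + x * poly p x)"
  by (rule pt_eqI) (auto simp: field_simps power2_eq_square)

lemma polymap_shear: "polymap (shear p)"
proof -
  have px: "(\<lambda>s. poly p (cx s)) \<in> polyfun" by (rule polyfun_poly) (rule polyfun.cx)
  have z: "(\<lambda>s. cz s + cx s * poly p (cx s)) \<in> polyfun"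
    by (intro polyfun.add polyfun.mult polyfun.cx polyfun.cz px)
  have y: "(\<lambda>s. cy s + 2 * cz s * poly p (cx s) + cx s * poly p (cx s) ^ 2) \<in> polyfun"
    unfolding power2_eq_square
    by (intro polyfun.add polyfun.mult polyfun.cx polyfun.cy polyfun.cz polyfun.const px)
  have "shear p s \<in> quadric" if "s \<in> quadric" for s
  proof -
    have "cx s * cy s = cz s ^ 2 - 1" using that by (simp add: quadric_iff)
    then show ?thesis by (simp add: quadric_iff algebra_simps power2_eq_square)
  qed
  then show ?thesis using y z by (auto simp: polymap_def polyfun.cx)
qed

lemma lexp_cx_fun: "\<exists>t. lexp (\<lambda>s. poly p (cx s)) = t \<and> dz t = 0"
proof (induction p)
  case 0 show ?case by simp
next
  case (pCons a p)
  have "lexp (\<lambda>s. poly (pCons a p) (cx s)) = lmon 0 [:a:] + lmon 1 1 * lexp (\<lambda>s. poly p (cx s))"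
    by simp
  then show ?case using pCons by (auto simp: dz_mult pderiv_pCons)
qed

lemma qaut_shear:
  assumes "anti ==> pcompose p [:0, -1:] = p"
  shows "qaut anti (shear p) (shear (- p))"
proof -
  have ps: "poisson_scaling 1 (shear p)" for p
  proof (rule poisson_scalingI[OF polymap_shear])
    have d: "dz (lexp (\<lambda>s. poly p (cx s))) = 0" using lexp_cx_fun by blast
    show "br (lexp (\<lambda>s. cz (shear p s))) (lexp (\<lambda>s. cx (shear p s))) =
        lmon 0 [:1:] * lexp (\<lambda>s. cx (shear p s))"
      by (simp add: br_def dz_mult d pderiv_pCons pCons_one mult_single)
  qed simp
  have inv: "shear p (shear (- p) s) = s" for p s
    by (rule pt_eqI) (auto simp: algebra_simps power2_eq_square)
  have "shear p (- s) = - shear p s" if "pcompose p [:0, -1:] = p" for p s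
  proof -
    have "poly p (- cx s) = poly p (cx s)"
      using poly_pcompose[of p "[:0, -1:]" "cx s"] that by simp
    then show ?thesis by (intro pt_eqI) (auto simp: algebra_simps)
  qed
  moreover have "pcompose (- p) [:0, -1:] = - p" if anti using assms[OF that] by (simp add: pcompose_uminus)
  ultimately show ?thesis
    using inv[of p] inv[of "- p"] assms by (auto simp: qaut_def polymap_shear ps)
qed

section \<open>Leading forms\<close>

text \<open>
  Give \<open>x\<close> the weight \<open>\<xi>\<close> and \<open>z\<close> the weight \<open>1\<close>. The form of weight \<open>a\<close> of a Laurent
  polynomial is recorded as a polynomial in \<open>z\<close>; since \<open>\<xi>\<close> is nonzero, the exponent of \<open>z\<close>
  determines that of \<open>x\<close>.
\<close>

definition tform :: "real => real => int => complex poly => complex poly"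
  where "tform \<xi> a k p = (if \<exists>j::nat. real j = a - \<xi> * k
    then monom (coeff p (nat \<lfloor>a - \<xi> * k\<rfloor>)) (nat \<lfloor>a - \<xi> * k\<rfloor>) else 0)"

definition wform :: "real => real => laur => complex poly"
  where "wform \<xi> a f = (\<Sum>k\<in>lkeys f. tform \<xi> a k (lrow f k))"

definition wle :: "real => real => laur => bool"
  where "wle \<xi> a f \<longleftrightarrow> (\<forall>k. lrow f k ~= 0 --> \<xi> * k + degree (lrow f k) \<le> a)"

lemma tform_nat: "real j = a - \<xi> * k ==> tform \<xi> a k p = monom (coeff p j) j"
  unfolding tform_def by (metis floor_of_nat nat_int)

lemma tform_0 [simp]: "tform \<xi> a k 0 = 0"
  by (simp add: tform_def)

lemma tform_add: "tform \<xi> a k (p + q) = tform \<xi> a k p + tform \<xi> a k q"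
  by (simp add: tform_def add_monom)

lemma wform_superset:
  "finite K ==> lkeys f \<subseteq> K ==> wform \<xi> a f = (\<Sum>k\<in>K. tform \<xi> a k (lrow f k))"
  unfolding wform_def by (rule sum.mono_neutral_left) (auto simp: in_keys_iff)

lemma wform_add: "wform \<xi> a (f + g) = wform \<xi> a f + wform \<xi> a g"
proof -
  have "lkeys (f + g) \<subseteq> lkeys f \<union> lkeys g" by (rule keys_add)
  then show ?thesis
    by (simp add: wform_superset[of "lkeys f \<union> lkeys g"] lookup_add tform_add sum.distrib)
qed

lemma wform_0 [simp]: "wform \<xi> a 0 = 0"
  by (simp add: wform_def)

lemma wform_sum: "wform \<xi> a (sum f A) = (\<Sum>i\<in>A. wform \<xi> a (f i))"
  by (induction A rule: infinite_finite_induct) (auto simp: wform_add)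

lemma wform_mon [simp]: "wform \<xi> a (lmon k p) = tform \<xi> a k p"
  by (simp add: wform_superset[of "{k}"])

lemma wform_above:
  assumes "wle \<xi> b f" "b < a"
  shows "wform \<xi> a f = 0"
  unfolding wform_def
proof (rule sum.neutral, rule ballI)
  fix k assume "k \<in> lkeys f"
  then have d: "\<xi> * k + degree (lrow f k) \<le> b" using assms by (simp add: wle_def in_keys_iff)
  show "tform \<xi> a k (lrow f k) = 0"
  proof (cases "\<exists>j::nat. real j = a - \<xi> * k")
    case True
    then obtain j :: nat where j: "real j = a - \<xi> * k" by blast
    then have "degree (lrow f k) < j" using d assms by linarith
    then show ?thesis by (simp add: tform_nat[OF j] coeff_eq_0)
  qed (simp add: tform_def)
qed

lemma wle_mon: "wle \<xi> a (lmon k p) \<longleftrightarrow> p = 0 \<or> \<xi> * k + degree p \<le> a"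
  by (auto simp: wle_def lookup_single when_def)

lemma wle_add: assumes "wle \<xi> a f" "wle \<xi> a g" shows "wle \<xi> a (f + g)"
  unfolding wle_def
proof (intro allI impI)
  fix k assume nz: "lrow (f + g) k ~= 0"
  let ?p = "lrow f k" and ?q = "lrow g k"
  have "degree (?p + ?q) \<le> max (degree ?p) (degree ?q)" by (rule degree_add_le_max)
  moreover have "?p = 0 \<or> \<xi> * k + degree ?p \<le> a" "?q = 0 \<or> \<xi> * k + degree ?q \<le> a"
    using assms by (auto simp: wle_def)
  ultimately show "\<xi> * k + degree (lrow (f + g) k) \<le> a"
    using nz by (auto simp: lookup_add max_def split: if_splits)
qed

lemma wle_sum: "(\<And>i. i \<in> A ==> wle \<xi> a (f i)) ==> wle \<xi> a (sum f A)"
  by (induction A rule: infinite_finite_induct) (auto simp: wle_add, simp_all add: wle_def)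

lemma degree_pderiv_less: "pderiv p ~= 0 ==> degree (pderiv p) < degree p" for p :: "complex poly"
  by (metis degree_pderiv diff_less pderiv_eq_0_iff zero_less_iff_neq_zero zero_less_one)

lemma degree_pderiv_mult:
  fixes p q :: "complex poly"
  assumes "pderiv p * q ~= 0"
  shows "degree (pderiv p * q) < degree p + degree q"
  using degree_pderiv_less[of p] assms degree_mult_le[of "pderiv p" q] by fastforce

lemma coeff_pderiv_mult_0:
  fixes p q :: "complex poly"
  shows "degree p + degree q \<le> n ==> coeff (pderiv p * q) n = 0"
  using degree_pderiv_mult[of p q] by (metis coeff_0 coeff_eq_0 order_less_le_trans)

lemma coeff_mult_top:
  fixes p q :: "complex poly"
  assumes "degree p \<le> i" "degree q \<le> j"
  shows "coeff (p * q) (i + j) = coeff p i * coeff q j"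
proof (cases "degree p = i \<and> degree q = j")
  case True
  then show ?thesis using coeff_mult_degree_sum[of p q] by simp
next
  case False
  then have "degree (p * q) < i + j" using degree_mult_le[of p q] assms by linarith
  moreover have "coeff p i = 0 \<or> coeff q j = 0" using False assms by (auto intro: coeff_eq_0)
  ultimately show ?thesis by (auto simp: coeff_eq_0)
qed

lemma pderiv_sum_right: "pderiv (sum f A) = (\<Sum>i\<in>A. pderiv (f i))"
  by (induction A rule: infinite_finite_induct) (auto simp: pderiv_add)

lemma smult_sum_right: "smult c (sum f A) = (\<Sum>i\<in>A. smult c (f i))"
  by (induction A rule: infinite_finite_induct) (auto simp: smult_add_right)

lemma br_mon: "br (lmon k p) (lmon l q) =
    lmon (k + l) (smult (of_int l) (pderiv p * q) - smult (of_int k) (pderiv q * p))"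
  by (simp add: br_def mult_single single_diff mult.commute add.commute)

lemma degree_smult_pderiv_mult:
  fixes p q :: "complex poly"
  shows "smult c (pderiv p * q) = 0 \<or> degree (smult c (pderiv p * q)) + 1 \<le> degree p + degree q"
proof (cases "pderiv p * q = 0")
  case False
  from degree_pderiv_mult[OF this] have "degree (pderiv p * q) + 1 \<le> degree p + degree q" by simp
  then show ?thesis using degree_smult_le[of c "pderiv p * q"] by linarith
qed simp

lemma wle_br_mon:
  fixes \<xi> a b :: real and k l :: int
  assumes p: "p = 0 \<or> \<xi> * k + degree p \<le> a" and q: "q = 0 \<or> \<xi> * l + degree q \<le> b"
  shows "wle \<xi> (a + b - 1) (br (lmon k p) (lmon l q))"
proof (cases "p = 0 \<or> q = 0")
  case False
  let ?A = "smult (of_int l) (pderiv p * q)" and ?B = "smult (of_int k) (pderiv q * p)"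
  have "?A - ?B = 0 \<or> degree (?A - ?B) + 1 \<le> degree p + degree q"
    using degree_smult_pderiv_mult[of "of_int l" p q] degree_smult_pderiv_mult[of "of_int k" q p]
      degree_diff_le_max[of ?A ?B] by (auto simp: add.commute)
  then show ?thesis using p q False unfolding br_mon wle_mon by (auto simp: algebra_simps)
qed (auto simp: br_def wle_def)

lemma tform_br_mon:
  fixes \<xi> a b :: real and k l :: int
  assumes p: "p = 0 \<or> \<xi> * k + degree p \<le> a" and q: "q = 0 \<or> \<xi> * l + degree q \<le> b"
  defines "P \<equiv> tform \<xi> a k p" and "Q \<equiv> tform \<xi> b l q"
  shows "smult (of_real \<xi>) (wform \<xi> (a + b - 1) (br (lmon k p) (lmon l q))) =
    smult (of_real b) (pderiv P * Q) - smult (of_real a) (P * pderiv Q)"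
proof -
  let ?A = "smult (of_int l) (pderiv p * q) - smult (of_int k) (pderiv q * p)"
  consider "p = 0 \<or> q = 0" | "p ~= 0" "q ~= 0" "\<exists>j::nat. real j = a - \<xi> * k" "\<exists>m::nat. real m = b - \<xi> * l"
    | "p ~= 0" "q ~= 0" "\<not> ((\<exists>j::nat. real j = a - \<xi> * k) \<and> (\<exists>m::nat. real m = b - \<xi> * l))"
    by blast
  then show ?thesis
  proof cases
    case 1 then show ?thesis by (auto simp: br_def P_def Q_def)
  next
    case 2
    then obtain j m :: nat where j: "real j = a - \<xi> * k" and m: "real m = b - \<xi> * l" by blast
    have dp: "degree p \<le> j" and dq: "degree q \<le> m" using p q j m 2 by auto
    have P: "P = monom (coeff p j) j" and Q: "Q = monom (coeff q m) m"
      using j m by (simp_all add: P_def Q_def tform_nat)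
    let ?c = "coeff p j" and ?d = "coeff q m"
    have "a = real j + \<xi> * of_int k" "b = real m + \<xi> * of_int l" using j m by simp_all
    then have ab: "of_real a = complex_of_nat j + of_real \<xi> * of_int k"
      "of_real b = complex_of_nat m + of_real \<xi> * of_int l" by simp_all
    show ?thesis
    proof (cases "j + m = 0")
      case True
      then have "pderiv p = 0" "pderiv q = 0" using dp dq by (simp_all add: pderiv_eq_0_iff)
      moreover have "pderiv P = 0" "pderiv Q = 0" using True P Q by (simp_all add: pderiv_monom)
      ultimately show ?thesis by (simp add: br_mon)
    next
      case False
      have dpd: "coeff (pderiv p * q) (j + m - 1) = of_nat j * (?c * ?d)"
      proof (cases j)
        case 0
        then have "pderiv p = 0" using dp by (simp add: pderiv_eq_0_iff)
        then show ?thesis using 0 by simp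
      next
        case (Suc i)
        have "degree (pderiv p) \<le> i" using dp Suc by (simp add: degree_pderiv)
        from coeff_mult_top[OF this dq] show ?thesis using Suc by (simp add: coeff_pderiv)
      qed
      have dqd: "coeff (pderiv q * p) (j + m - 1) = of_nat m * (?c * ?d)"
      proof (cases m)
        case 0
        then have "pderiv q = 0" using dq by (simp add: pderiv_eq_0_iff)
        then show ?thesis using 0 by simp
      next
        case (Suc i)
        have "degree (pderiv q) \<le> i" using dq Suc by (simp add: degree_pderiv)
        from coeff_mult_top[OF this dp] show ?thesis using Suc by (simp add: coeff_pderiv add.commute)
      qed
      have jm: "real (j + m - 1) = a + b - 1 - \<xi> * of_int (k + l)"
      proof -
        have "real (j + m - 1) = real j + real m - 1" using False by (subst of_nat_diff) auto
        then show ?thesis using j m by (simp add: algebra_simps)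
      qed
      have PQ: "pderiv P * Q = monom (of_nat j * (?c * ?d)) (j + m - 1)"
        "P * pderiv Q = monom (of_nat m * (?c * ?d)) (j + m - 1)"
        using False by (cases j; cases m; simp add: P Q pderiv_monom mult_monom)+
      have "of_real \<xi> * (of_int l * of_nat j - of_int k * of_nat m) =
          of_real b * of_nat j - of_real a * (of_nat m :: complex)"
        unfolding ab by (simp add: algebra_simps)
      then have "of_real \<xi> * (of_int l * (of_nat j * (?c * ?d)) - of_int k * (of_nat m * (?c * ?d))) =
          of_real b * (of_nat j * (?c * ?d)) - of_real a * (of_nat m * (?c * ?d))"
        by algebra
      then show ?thesis
        unfolding br_mon wform_mon tform_nat[OF jm] PQ
        by (simp add: dpd[unfolded One_nat_def] dqd[unfolded One_nat_def] smult_monom diff_monom)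
    qed
  next
    case 3
    have PQ: "P = 0 \<or> Q = 0" using 3(3) by (auto simp: P_def Q_def tform_def)
    have "\<xi> * k + degree p ~= a \<or> \<xi> * l + degree q ~= b" using 3(3) by (auto simp: algebra_simps)
    then have less: "real (degree p + degree q) < a + b - \<xi> * of_int (k + l)"
      using p q 3 by (auto simp: algebra_simps)
    have "tform \<xi> (a + b - 1) (k + l) ?A = 0"
    proof (cases "\<exists>n::nat. real n = a + b - 1 - \<xi> * of_int (k + l)")
      case True
      then obtain n :: nat where n: "real n = a + b - 1 - \<xi> * of_int (k + l)" by blast
      then have "degree p + degree q \<le> n" using less by linarith
      then have "coeff ?A n = 0" by (simp add: coeff_pderiv_mult_0 add.commute)
      then show ?thesis by (simp add: tform_nat[OF n])
    qed (simp add: tform_def)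
    then show ?thesis using PQ by (auto simp: br_mon)
  qed
qed

lemma br_expand: "br h f = (\<Sum>k\<in>lkeys h. \<Sum>l\<in>lkeys f. br (lmon k (lrow h k)) (lmon l (lrow f l)))"
proof -
  have "br h f = br (\<Sum>k\<in>lkeys h. lmon k (lrow h k)) (\<Sum>l\<in>lkeys f. lmon l (lrow f l))"
    using laur_expand by simp
  also have "\<dots> = (\<Sum>k\<in>lkeys h. br (lmon k (lrow h k)) (\<Sum>l\<in>lkeys f. lmon l (lrow f l)))"
    by (rule br_sum_left)
  also have "\<dots> = (\<Sum>k\<in>lkeys h. \<Sum>l\<in>lkeys f. br (lmon k (lrow h k)) (lmon l (lrow f l)))"
    by (simp only: br_sum_right)
  finally show ?thesis .
qed

lemma wle_br:
  assumes "wle \<xi> a h" "wle \<xi> b f"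
  shows "wle \<xi> (a + b - 1) (br h f)"
  unfolding br_expand[of h f]
proof (intro wle_sum wle_br_mon)
  show "lrow h k = 0 \<or> \<xi> * k + degree (lrow h k) \<le> a" for k using assms(1) by (auto simp: wle_def)
  show "lrow f l = 0 \<or> \<xi> * l + degree (lrow f l) \<le> b" for l using assms(2) by (auto simp: wle_def)
qed

text \<open>
  The bracket of two leading forms: Euler's identity eliminates \<open>\<partial>/\<partial>x\<close> in favour of the
  weights.
\<close>

lemma wform_br:
  assumes h: "wle \<xi> a h" and f: "wle \<xi> b f"
  shows "smult (of_real \<xi>) (wform \<xi> (a + b - 1) (br h f)) =
    smult (of_real b) (pderiv (wform \<xi> a h) * wform \<xi> b f) -
    smult (of_real a) (wform \<xi> a h * pderiv (wform \<xi> b f))"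
proof -
  let ?H = "\<lambda>k. tform \<xi> a k (lrow h k)" and ?F = "\<lambda>l. tform \<xi> b l (lrow f l)"
  have "smult (of_real \<xi>) (wform \<xi> (a + b - 1) (br h f)) =
    (\<Sum>k\<in>lkeys h. \<Sum>l\<in>lkeys f.
      smult (of_real \<xi>) (wform \<xi> (a + b - 1) (br (lmon k (lrow h k)) (lmon l (lrow f l)))))"
    unfolding br_expand[of h f] wform_sum by (simp add: smult_sum_right)
  also have "\<dots> = (\<Sum>k\<in>lkeys h. \<Sum>l\<in>lkeys f.
      smult (of_real b) (pderiv (?H k) * ?F l) - smult (of_real a) (?H k * pderiv (?F l)))"
    using h f by (intro sum.cong refl tform_br_mon) (auto simp: wle_def)
  also have "\<dots> = smult (of_real b) (pderiv (wform \<xi> a h) * wform \<xi> b f) -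
    smult (of_real a) (wform \<xi> a h * pderiv (wform \<xi> b f))"
    by (simp add: wform_def pderiv_sum_right sum_product smult_sum_right sum_subtractf)
  finally show ?thesis .
qed

primrec fseq :: "complex poly => real => complex poly => real => nat => complex poly" where
  "fseq H a F b 0 = F"
| "fseq H a F b (Suc n) = smult (of_real (b + n * (a - 1))) (pderiv H * fseq H a F b n) -
    smult (of_real a) (H * pderiv (fseq H a F b n))"

lemma wform_funpow:
  assumes "wle \<xi> a h" "wle \<xi> b f" "\<xi> ~= 0"
  shows "wle \<xi> (b + n * (a - 1)) ((br h ^^ n) f) \<and>
    smult (of_real \<xi> ^ n) (wform \<xi> (b + n * (a - 1)) ((br h ^^ n) f)) =
      fseq (wform \<xi> a h) a (wform \<xi> b f) b n"
proof (induction n)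
  case 0 then show ?case using assms by simp
next
  case (Suc n)
  let ?b = "b + n * (a - 1)" and ?f = "(br h ^^ n) f"
  have eq: "b + Suc n * (a - 1) = a + ?b - 1" by (simp add: algebra_simps)
  have w: "wle \<xi> ?b ?f" using Suc by blast
  have F: "fseq (wform \<xi> a h) a (wform \<xi> b f) b n = smult (of_real \<xi> ^ n) (wform \<xi> ?b ?f)"
    using Suc by simp
  have "smult (of_real \<xi> ^ Suc n) (wform \<xi> (a + ?b - 1) (br h ?f)) =
     smult (of_real \<xi> ^ n) (smult (of_real \<xi>) (wform \<xi> (a + ?b - 1) (br h ?f)))"
    by (simp add: mult.commute)
  also have "\<dots> = fseq (wform \<xi> a h) a (wform \<xi> b f) b (Suc n)"
    unfolding wform_br[OF assms(1) w] fseq.simps F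
    by (simp add: smult_diff_right pderiv_smult mult.commute)
  finally show ?case using wle_br[OF assms(1) w] unfolding eq by simp
qed

lemma fseq_step_identity:
  fixes A B L H1 dH P dP :: "complex poly"
  shows "smult b ((smult m A * H1 + L * A * dH) * (B * P)) -
      smult a (A * H1 * (smult e B * P + L * B * dP)) =
    B * A * (smult (b * m - a * e) (H1 * P) + L * (smult b (dH * P) - smult a (H1 * dP)))"
  by (simp add: algebra_simps smult_add_right smult_diff_left smult_diff_right)

text \<open>
  At a root of \<open>H\<close> the order of vanishing of the iterates is known exactly unless an integer
  coincidence kills the leading coefficient; without it no iterate vanishes.
\<close>

lemma fseq_nonzero:
  fixes a b :: real
  assumes H: "H = [:- s, 1:] ^ m * H1" "poly H1 s ~= 0" "m \<ge> 1"
    and F: "F = [:- s, 1:] ^ r * F1" "poly F1 s ~= 0"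
    and ne: "\<And>n::nat. b * m - a * r + n * (a - m) ~= 0"
  shows "fseq H a F b n ~= 0"
proof -
  obtain m' where m': "m = Suc m'" using H(3) by (cases m) auto
  define L where "L = [:- s, 1:]"
  have Ls: "poly L s = 0" by (simp add: L_def)
  have dL: "pderiv L = 1" by (simp add: L_def pderiv_pCons pCons_one)
  have LdL: "L * pderiv (L ^ e) = smult (of_nat e) (L ^ e)" for e
    by (cases e) (simp_all add: pderiv_power_Suc dL del: power_Suc, simp add: power_Suc)
  have "\<exists>P. fseq H a F b n = L ^ (r + n * m') * P \<and> poly P s ~= 0"
  proof (induction n)
    case 0 then show ?case using F by (auto simp: L_def)
  next
    case (Suc n)
    then obtain P where P: "fseq H a F b n = L ^ (r + n * m') * P" "poly P s ~= 0" by blast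
    let ?e = "r + n * m'" and ?b = "of_real (b + n * (a - 1)) :: complex" and ?a = "of_real a :: complex"
    have H': "pderiv H = smult (of_nat m) (L ^ m') * H1 + L ^ m * pderiv H1"
      unfolding H(1) L_def[symmetric] m'
      by (simp only: pderiv_mult pderiv_power_Suc dL) (simp add: algebra_simps)
    have HF: "H * pderiv (L ^ ?e * P) = L ^ m' * H1 * (smult (of_nat ?e) (L ^ ?e) * P + L * L ^ ?e * pderiv P)"
    proof -
      have "H * pderiv (L ^ ?e * P) = L ^ m' * H1 * ((L * pderiv (L ^ ?e)) * P + L * L ^ ?e * pderiv P)"
        unfolding H(1) L_def[symmetric] m' pderiv_mult by (simp add: algebra_simps)
      then show ?thesis unfolding LdL .
    qed
    define P' where "P' = smult (?b * of_nat m - ?a * of_nat ?e) (H1 * P) +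
        L * (smult ?b (pderiv H1 * P) - smult ?a (H1 * pderiv P))"
    have "fseq H a F b (Suc n) = smult ?b (pderiv H * (L ^ ?e * P)) - smult ?a (H * pderiv (L ^ ?e * P))"
      by (simp add: P)
    also have "\<dots> = smult ?b ((smult (of_nat m) (L ^ m') * H1 + L ^ m * pderiv H1) * (L ^ ?e * P)) -
        smult ?a (L ^ m' * H1 * (smult (of_nat ?e) (L ^ ?e) * P + L * L ^ ?e * pderiv P))"
      by (simp only: HF H')
    also have "\<dots> = L ^ (?e + m') * P'"
      using fseq_step_identity[of ?b "of_nat m" "L ^ m'" H1 L "pderiv H1" "L ^ ?e" P ?a "of_nat ?e" "pderiv P"]
      by (simp only: P'_def power_add m' power_Suc)
    also have "?e + m' = r + Suc n * m'" by simp
    finally have F': "fseq H a F b (Suc n) = L ^ (r + Suc n * m') * P'" .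
    have "(b + n * (a - 1)) * m - a * ?e = b * m - a * r + n * (a - m)"
      unfolding m' by (simp add: algebra_simps)
    then have "(b + n * (a - 1)) * m - a * ?e ~= 0" using ne by simp
    then have "complex_of_real ((b + n * (a - 1)) * m - a * ?e) ~= 0" by (metis of_real_eq_0_iff)
    then have "?b * of_nat m - ?a * of_nat ?e ~= 0" by simp
    then have "poly P' s ~= 0" using P H(2) Ls by (simp add: P'_def)
    then show ?case using F' by blast
  qed
  then obtain P where "fseq H a F b n = L ^ (r + n * m') * P" "poly P s ~= 0" by blast
  moreover have "L ~= 0" by (simp add: L_def)
  ultimately show ?thesis by auto
qed

definition lbounded :: "(nat => laur) => bool"
  where "lbounded S \<longleftrightarrow> (\<exists>K N. finite K \<and> (\<forall>n. lkeys (S n) \<subseteq> K \<and> (\<forall>k. degree (lrow (S n) k) \<le> N)))"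

lemma lbounded_wle: "lbounded S ==> \<exists>B. \<forall>n. wle \<xi> B (S n)"
proof -
  assume "lbounded S"
  then obtain K N where K: "finite K" and S: "\<And>n. lkeys (S n) \<subseteq> K" "\<And>n k. degree (lrow (S n) k) \<le> N"
    unfolding lbounded_def by blast
  have "wle \<xi> ((\<Sum>k\<in>K. \<bar>\<xi> * of_int k\<bar>) + N) (S n)" for n
    unfolding wle_def
  proof (intro allI impI)
    fix k assume "lrow (S n) k ~= 0"
    then have "k \<in> K" using S(1)[of n] by (auto simp: in_keys_iff)
    then have "\<bar>\<xi> * of_int k\<bar> \<le> (\<Sum>k\<in>K. \<bar>\<xi> * of_int k\<bar>)" using K by (intro member_le_sum) auto
    moreover have "real (degree (lrow (S n) k)) \<le> N" using S(2) by simp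
    ultimately show "\<xi> * of_int k + real (degree (lrow (S n) k)) \<le> (\<Sum>k\<in>K. \<bar>\<xi> * of_int k\<bar>) + N" by linarith
  qed
  then show ?thesis by blast
qed

text \<open>
  If \<open>h\<close> has weight greater than 1, bracketing with \<open>h\<close> raises weights, so on elements with
  bounded iterates its leading form must act nilpotently; a root of the leading form as above
  forbids that.
\<close>

lemma bounded_iterates_contradiction:
  fixes a b :: real
  assumes h: "wle \<xi> a h" and f: "wle \<xi> b f" and "\<xi> ~= 0" "a > 1"
    and bd: "lbounded (\<lambda>n. (br h ^^ n) f)"
    and H: "wform \<xi> a h = [:- s, 1:] ^ m * H1" "poly H1 s ~= 0" "m \<ge> 1"
    and F: "wform \<xi> b f = [:- s, 1:] ^ r * F1" "poly F1 s ~= 0"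
    and ne: "\<And>n::nat. b * m - a * r + n * (a - m) ~= 0"
  shows False
proof -
  obtain B where B: "\<And>n. wle \<xi> B ((br h ^^ n) f)" using lbounded_wle[OF bd] by blast
  obtain n :: nat where "(B - b) / (a - 1) < n" using reals_Archimedean2 by blast
  then have "B < b + n * (a - 1)" using assms(4) by (simp add: field_simps)
  then have "wform \<xi> (b + n * (a - 1)) ((br h ^^ n) f) = 0" by (rule wform_above[OF B])
  then have "fseq (wform \<xi> a h) a (wform \<xi> b f) b n = 0"
    using wform_funpow[OF h f \<open>\<xi> ~= 0\<close>, of n] by simp
  then show False using fseq_nonzero[OF H F ne] by blast
qed

section \<open>Eigenvectors\<close>

lemma eigen_sum_zero:
  fixes v :: "int => laur" and D :: "laur => laur"
  assumes add: "\<And>f g. D (f + g) = D f + D g" and scale: "\<And>c f. D (lmon 0 [:c:] * f) = lmon 0 [:c:] * D f"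
    and K: "finite K"
    and ev: "\<And>k. k \<in> K ==> D (v k) = lmon 0 [:of_int k:] * v k" and sum0: "(\<Sum>k\<in>K. v k) = 0"
    and k: "k \<in> K"
  shows "v k = 0"
  using K ev sum0 k
proof (induction K arbitrary: v k)
  case (insert k0 K)
  have D0: "D 0 = 0" using scale[of 0 0] by simp
  have Dsum: "D (sum g A) = (\<Sum>a\<in>A. D (g a))" for g and A :: "int set"
    by (induction A rule: infinite_finite_induct) (auto simp: add D0)
  let ?w = "\<lambda>k. lmon 0 [:of_int (k - k0):] * v k"
  have "(\<Sum>k\<in>insert k0 K. ?w k) = (\<Sum>k\<in>insert k0 K. D (v k) - lmon 0 [:of_int k0:] * v k)"
    by (rule sum.cong[OF refl])
       (simp add: insert.prems(1) single_diff[symmetric] left_diff_distrib[symmetric])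
  also have "\<dots> = D (\<Sum>k\<in>insert k0 K. v k) - lmon 0 [:of_int k0:] * (\<Sum>k\<in>insert k0 K. v k)"
    by (simp only: sum_subtractf Dsum sum_distrib_left)
  also have "\<dots> = 0" using insert.prems(2) D0 by simp
  finally have s: "(\<Sum>k\<in>K. ?w k) = 0" using insert.hyps by simp
  have w0: "?w k = 0" if "k \<in> K" for k
  proof (rule insert.IH[OF _ s that])
    fix k assume "k \<in> K"
    then show "D (?w k) = lmon 0 [:of_int k:] * ?w k"
      using insert.prems(1)[of k] by (simp add: scale mult.left_commute)
  qed
  have vk: "v k = 0" if "k \<in> K" for k
    using w0[OF that] that insert.hyps by auto
  then have "v k0 = 0" using insert.prems(2) insert.hyps by (simp add: sum.neutral)
  then show ?case using vk insert.prems(3) by auto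
qed simp

section \<open>Hamiltonians with a semisimple vector field\<close>

definition inv_ring :: "bool => (pt => complex) set"
  where "inv_ring anti = {f \<in> qring. anti --> (\<forall>s\<in>quadric. f (- s) = f s)}"

text \<open>
  A Hamiltonian is good when its vector field is nonzero and diagonalisable with integer
  eigenvalues on the ring of the surface under consideration.
\<close>

definition good :: "bool => (pt => complex) => bool"
  where "good anti h \<longleftrightarrow> h \<in> qring \<and> (anti --> (\<forall>s\<in>quadric. h (- s) = - h s)) \<and>
    (\<forall>f\<in>inv_ring anti. \<exists>K F. finite K \<and>
      (\<forall>k\<in>K. F k \<in> inv_ring anti \<and> (\<forall>s\<in>quadric. qbr h (F k) s = of_int k * F k s)) \<and>
      (\<forall>s\<in>quadric. f s = (\<Sum>k\<in>K. F k s))) \<and>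
    (\<exists>f\<in>inv_ring anti. \<exists>s\<in>quadric. qbr h f s ~= 0)"

lemma good_split:
  assumes "good anti h" "f \<in> inv_ring anti"
  obtains K F where "finite K" "\<And>k. k \<in> K ==> F k \<in> inv_ring anti"
    "\<And>k s. k \<in> K ==> s \<in> quadric ==> qbr h (F k) s = of_int k * F k s"
    "\<And>s. s \<in> quadric ==> f s = (\<Sum>k\<in>K. F k s)"
proof -
  have "\<exists>K F. finite K \<and>
      (\<forall>k\<in>K. F k \<in> inv_ring anti \<and> (\<forall>s\<in>quadric. qbr h (F k) s = of_int k * F k s)) \<and>
      (\<forall>s\<in>quadric. f s = (\<Sum>k\<in>K. F k s))"
    using assms unfolding good_def by simp
  then show ?thesis by (elim exE conjE) (rule that; simp)
qed

lemma inv_ring_qring: "f \<in> inv_ring anti ==> f \<in> qring"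
  by (simp add: inv_ring_def)

lemma inv_ring_qaut:
  assumes "qaut anti \<phi> \<psi>" "f \<in> inv_ring anti"
  shows "(\<lambda>s. f (\<phi> s)) \<in> inv_ring anti"
proof -
  have "(\<lambda>s. f (\<phi> s)) \<in> qring"
    using assms polymap_qring[of \<phi> f] by (simp add: qaut_def inv_ring_def)
  moreover have "f (\<phi> (- s)) = f (\<phi> s)" if anti "s \<in> quadric" for s
  proof -
    have "\<phi> s \<in> quadric" using assms(1) that(2) polymap_quadric[of \<phi> s] by (simp add: qaut_def)
    then show ?thesis using assms that by (simp add: qaut_def inv_ring_def del: split_paired_All)
  qed
  ultimately show ?thesis by (simp add: inv_ring_def)
qed

lemma qaut_quadric: "qaut anti \<phi> \<psi> ==> s \<in> quadric ==> \<phi> s \<in> quadric"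
  using polymap_quadric[of \<phi> s] by (simp add: qaut_def)

lemma qaut_qring: "qaut anti \<phi> \<psi> ==> f \<in> qring ==> (\<lambda>s. f (\<phi> s)) \<in> qring"
  using polymap_qring[of \<phi> f] by (simp add: qaut_def)

lemma qaut_qbr_fun:
  assumes "qaut anti \<phi> \<psi>" "f \<in> qring" "g \<in> qring" "s \<in> quadric"
  shows "qbr (\<lambda>s. f (\<phi> s)) (\<lambda>s. g (\<phi> s)) s = qbr f g (\<phi> s)"
  using qaut_qbr[OF assms(1-3)] qbr[OF qaut_qring[OF assms(1,2)] qaut_qring[OF assms(1,3)]]
    qaut_qring[OF assms(1) qbr(1)[OF assms(2,3)]] assms(4) by (intro lexp_eqD) auto

lemma good_qaut:
  assumes h: "good anti h" and \<phi>: "qaut anti \<phi> \<psi>"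
  shows "good anti (\<lambda>s. h (\<phi> s))"
proof -
  have inv: "\<phi> (\<psi> s) = s" "\<psi> (\<phi> s) = s" for s using \<phi> by (auto simp: qaut_def simp del: split_paired_All)
  have hq: "h \<in> qring" using h by (simp add: good_def)
  have "h (\<phi> (- s)) = - h (\<phi> s)" if anti "s \<in> quadric" for s
  proof -
    have "\<phi> s \<in> quadric" using \<phi> that(2) by (rule qaut_quadric)
    then show ?thesis using h \<phi> that by (simp add: qaut_def good_def del: split_paired_All)
  qed
  moreover have "\<exists>K F. finite K \<and>
      (\<forall>k\<in>K. F k \<in> inv_ring anti \<and> (\<forall>s\<in>quadric. qbr (\<lambda>s. h (\<phi> s)) (F k) s = of_int k * F k s)) \<and>
      (\<forall>s\<in>quadric. f s = (\<Sum>k\<in>K. F k s))" if f: "f \<in> inv_ring anti" for f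
  proof -
    obtain K F where K: "finite K" and F: "\<And>k. k \<in> K ==> F k \<in> inv_ring anti"
      "\<And>k s. k \<in> K ==> s \<in> quadric ==> qbr h (F k) s = of_int k * F k s"
      "\<And>s. s \<in> quadric ==> f (\<psi> s) = (\<Sum>k\<in>K. F k s)"
      using good_split[OF h inv_ring_qaut[OF qaut_sym[OF \<phi>] f]] by blast
    show ?thesis
    proof (intro exI[of _ K] exI[of _ "\<lambda>k s. F k (\<phi> s)"] conjI ballI K)
      fix k assume k: "k \<in> K"
      show "(\<lambda>s. F k (\<phi> s)) \<in> inv_ring anti" using \<phi> F(1)[OF k] by (rule inv_ring_qaut)
      fix s assume s: "s \<in> quadric"
      show "qbr (\<lambda>s. h (\<phi> s)) (\<lambda>s. F k (\<phi> s)) s = of_int k * F k (\<phi> s)"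
        using qaut_qbr_fun[OF \<phi> hq inv_ring_qring[OF F(1)[OF k]] s] F(2)[OF k qaut_quadric[OF \<phi> s]]
        by simp
    next
      fix s assume "s \<in> quadric"
      then show "f s = (\<Sum>k\<in>K. F k (\<phi> s))" using F(3)[of "\<phi> s"] qaut_quadric[OF \<phi>] inv by simp
    qed
  qed
  moreover have "\<exists>f\<in>inv_ring anti. \<exists>s\<in>quadric. qbr (\<lambda>s. h (\<phi> s)) f s ~= 0"
  proof -
    obtain f s where f: "f \<in> inv_ring anti" "s \<in> quadric" "qbr h f s ~= 0" using h by (auto simp: good_def)
    have "qbr (\<lambda>s. h (\<phi> s)) (\<lambda>s. f (\<phi> s)) (\<psi> s) ~= 0"
      using qaut_qbr_fun[OF \<phi> hq inv_ring_qring[OF f(1)] qaut_quadric[OF qaut_sym[OF \<phi>] f(2)]] f(3) inv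
      by simp
    then show ?thesis using inv_ring_qaut[OF \<phi> f(1)] qaut_quadric[OF qaut_sym[OF \<phi>] f(2)] by blast
  qed
  ultimately show ?thesis using qaut_qring[OF \<phi> hq] by (simp add: good_def)
qed

lemma lookup_scale: "lrow (lmon 0 [:c:] * f) k = smult c (lrow f k)"
proof (induction f rule: laur_induct)
  case (mon l p)
  then show ?case by (simp add: mult_single lookup_single when_def)
qed (simp add: distrib_left lookup_add smult_add_right)

lemma br_scale_right: "br h (lmon 0 [:c:] * f) = lmon 0 [:c:] * br h f"
  by (simp add: br_mult_right)

lemma good_decomp:
  assumes h: "good anti h" and f: "f \<in> inv_ring anti"
  obtains K v where "finite K" "\<And>k. k \<in> K ==> br (lexp h) (v k) = lmon 0 [:of_int k:] * v k"
    "lexp f = (\<Sum>k\<in>K. v k)"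
proof -
  obtain K F where K: "finite K" and F: "\<And>k. k \<in> K ==> F k \<in> inv_ring anti"
    "\<And>k s. k \<in> K ==> s \<in> quadric ==> qbr h (F k) s = of_int k * F k s"
    "\<And>s. s \<in> quadric ==> f s = (\<Sum>k\<in>K. F k s)"
    using good_split[OF h f] by blast
  have hq: "h \<in> qring" using h by (simp add: good_def)
  have Fq: "k \<in> K ==> F k \<in> qring" for k using F(1) inv_ring_qring by blast
  show ?thesis
  proof (rule that[OF K, of "\<lambda>k. lexp (F k)"])
    fix k assume k: "k \<in> K"
    have "br (lexp h) (lexp (F k)) = lexp (qbr h (F k))" using qbr(2)[OF hq Fq[OF k]] by simp
    also have "\<dots> = lexp (\<lambda>s. of_int k * F k s)" using F(2)[OF k] by (intro lexp_cong) auto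
    also have "\<dots> = lmon 0 [:of_int k:] * lexp (F k)" using Fq[OF k] by simp
    finally show "br (lexp h) (lexp (F k)) = lmon 0 [:of_int k:] * lexp (F k)" .
  next
    have "lexp f = lexp (\<lambda>s. \<Sum>k\<in>K. F k s)" using F(3) by (rule lexp_cong)
    then show "lexp f = (\<Sum>k\<in>K. lexp (F k))" using Fq by (simp add: lexp_sum)
  qed
qed

lemma funpow_eigen_sum:
  assumes ev: "\<And>k. k \<in> K ==> br h (v k) = lmon 0 [:of_int k:] * v k"
  shows "(br h ^^ n) (\<Sum>k\<in>K. v k) = (\<Sum>k\<in>K. lmon 0 [:of_int k ^ n:] * v k)"
proof (induction n)
  case (Suc n)
  have "(br h ^^ Suc n) (\<Sum>k\<in>K. v k) = (\<Sum>k\<in>K. br h (lmon 0 [:of_int k ^ n:] * v k))"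
    using Suc by (simp add: br_sum_right)
  also have "\<dots> = (\<Sum>k\<in>K. lmon 0 [:of_int k ^ Suc n:] * v k)"
  proof (intro sum.cong refl)
    fix k assume k: "k \<in> K"
    have "br h (lmon 0 [:of_int k ^ n:] * v k) = (lmon 0 [:of_int k ^ n:] * lmon 0 [:of_int k:]) * v k"
      by (simp only: br_scale_right ev[OF k] mult.assoc)
    also have "lmon 0 [:of_int k ^ n:] * lmon 0 [:of_int k:] = lmon 0 [:of_int k ^ Suc n:]"
      by (simp add: mult_single)
    finally show "br h (lmon 0 [:of_int k ^ n:] * v k) = lmon 0 [:of_int k ^ Suc n:] * v k" .
  qed
  finally show ?case .
qed simp

lemma good_bounded:
  assumes h: "good anti h" and f: "f \<in> inv_ring anti"
  shows "lbounded (\<lambda>n. (br (lexp h) ^^ n) (lexp f))"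
proof -
  obtain K v where K: "finite K" and v: "\<And>k. k \<in> K ==> br (lexp h) (v k) = lmon 0 [:of_int k:] * v k"
    and fv: "lexp f = (\<Sum>k\<in>K. v k)" using good_decomp[OF assms] by blast
  define L where "L = (\<Union>k\<in>K. lkeys (v k))"
  define N where "N = (\<Sum>k\<in>K. \<Sum>l\<in>L. degree (lrow (v k) l))"
  have L: "finite L" using K by (simp add: L_def)
  have row: "lrow ((br (lexp h) ^^ n) (lexp f)) l = (\<Sum>k\<in>K. smult (of_int k ^ n) (lrow (v k) l))" for n l
    unfolding fv using funpow_eigen_sum[of K "lexp h" v n, OF v] by (simp add: lookup_sum lookup_scale)
  have v0: "lrow (v k) l = 0" if "l \<notin> L" "k \<in> K" for k l
    using that by (auto simp: L_def in_keys_iff)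
  have "lkeys ((br (lexp h) ^^ n) (lexp f)) \<subseteq> L" for n
  proof
    fix l assume "l \<in> lkeys ((br (lexp h) ^^ n) (lexp f))"
    then have "(\<Sum>k\<in>K. smult (of_int k ^ n) (lrow (v k) l)) ~= 0" by (simp add: in_keys_iff row)
    then show "l \<in> L" using v0[of l] by (metis (no_types, lifting) smult_0_right sum.neutral)
  qed
  moreover have "degree (lrow ((br (lexp h) ^^ n) (lexp f)) l) \<le> N" for n l
    unfolding row
  proof (rule degree_sum_le[OF K])
    fix k assume k: "k \<in> K"
    have "degree (lrow (v k) l) \<le> N"
    proof (cases "l \<in> L")
      case True
      have "degree (lrow (v k) l) \<le> (\<Sum>l\<in>L. degree (lrow (v k) l))" using L True by (intro member_le_sum) auto
      also have "\<dots> \<le> N" unfolding N_def using K k by (intro member_le_sum) auto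
      finally show ?thesis .
    qed (use v0 k in simp)
    then show "degree (smult (of_int k ^ n) (lrow (v k) l)) \<le> N" using degree_smult_le order_trans by blast
  qed
  ultimately show ?thesis unfolding lbounded_def using L by blast
qed

lemma good_cube:
  assumes h: "good anti h" and f: "f \<in> inv_ring anti"
    and cube: "br (lexp h) (br (lexp h) (br (lexp h) (lexp f))) = 0"
  shows "br (lexp h) (lexp f) = 0"
proof -
  obtain K v where K: "finite K" and v: "\<And>k. k \<in> K ==> br (lexp h) (v k) = lmon 0 [:of_int k:] * v k"
    and fv: "lexp f = (\<Sum>k\<in>K. v k)" using good_decomp[OF h f] by blast
  have "(br (lexp h) ^^ 3) (lexp f) = 0" using cube by (simp add: numeral_3_eq_3)
  then have s: "(\<Sum>k\<in>K. lmon 0 [:of_int k ^ 3:] * v k) = 0"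
    using funpow_eigen_sum[of K "lexp h" v 3, OF v] by (simp add: fv)
  have v0: "lmon 0 [:of_int k ^ 3:] * v k = 0" if "k \<in> K" for k
  proof (rule eigen_sum_zero[where D = "br (lexp h)" and K = K and v = "\<lambda>k. lmon 0 [:of_int k ^ 3:] * v k"])
    show "br (lexp h) (f + g) = br (lexp h) f + br (lexp h) g" for f g by (rule br_add_right)
    show "br (lexp h) (lmon 0 [:c:] * f) = lmon 0 [:c:] * br (lexp h) f" for c f by (rule br_scale_right)
    show "br (lexp h) (lmon 0 [:of_int k ^ 3:] * v k) = lmon 0 [:of_int k:] * (lmon 0 [:of_int k ^ 3:] * v k)"
      if "k \<in> K" for k using v[OF that] by (simp add: br_scale_right mult.left_commute)
  qed (use K s that in auto)
  have "br (lexp h) (lexp f) = (\<Sum>k\<in>K. lmon 0 [:of_int k:] * v k)"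
    using funpow_eigen_sum[of K "lexp h" v 1, OF v] by (simp add: fv)
  also have "\<dots> = 0" by (rule sum.neutral) (use v0 in auto)
  finally show ?thesis .
qed

lemma squares_inv_ring:
  assumes "f \<in> {cx, cy, cz}" "g \<in> {cx, cy, cz}"
  shows "(\<lambda>s. f s * g s) \<in> inv_ring anti"
proof -
  have "f (- s) * g (- s) = f s * g s" for s using assms by auto
  moreover have "f \<in> qring" "g \<in> qring" using assms by auto
  ultimately show ?thesis by (simp add: inv_ring_def)
qed

section \<open>Newton polygons of good Hamiltonians\<close>

lemma coeff_wform:
  fixes \<xi> a :: real
  assumes "\<xi> ~= 0" and j: "real j = a - \<xi> * k"
  shows "coeff (wform \<xi> a t) j = coeff (lrow t k) j"
proof -
  have "coeff (tform \<xi> a l (lrow t l)) j = (if l = k then coeff (lrow t k) j else 0)" for l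
  proof (cases "l = k")
    case True then show ?thesis by (simp add: tform_nat[OF j])
  next
    case False
    show ?thesis
    proof (cases "\<exists>i::nat. real i = a - \<xi> * l")
      case True
      then obtain i :: nat where i: "real i = a - \<xi> * l" by blast
      then have "i ~= j" using j False assms(1) by auto
      then show ?thesis using False by (simp add: tform_nat[OF i])
    qed (use False in \<open>simp add: tform_def\<close>)
  qed
  then have "coeff (wform \<xi> a t) j = (\<Sum>l\<in>lkeys t. if l = k then coeff (lrow t k) j else 0)"
    by (simp add: wform_def coeff_sum)
  then show ?thesis by (auto simp: in_keys_iff)
qed

lemma coeff_wform_0:
  fixes \<xi> a :: real
  assumes "\<And>k::int. real j = a - \<xi> * k ==> coeff (lrow t k) j = 0"
  shows "coeff (wform \<xi> a t) j = 0"
  unfolding wform_def coeff_sum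
proof (rule sum.neutral, rule ballI)
  fix k :: int
  show "coeff (tform \<xi> a k (lrow t k)) j = 0"
  proof (cases "\<exists>i::nat. real i = a - \<xi> * k")
    case True
    then obtain i :: nat where i: "real i = a - \<xi> * k" by blast
    show ?thesis using assms[of k] i by (auto simp: tform_nat[OF i])
  qed (simp add: tform_def)
qed

lemma coeff_X_power: "coeff ([:0, 1:] ^ n) j = (if j = n then 1 else 0 :: complex)"
proof -
  have "[:0, 1:] ^ n = monom (1 :: complex) n" using monom_altdef[of "1 :: complex" n] by simp
  then show ?thesis by simp
qed

text \<open>
  A leading form that is a monomial \<open>x^i z^n\<close> must be the leading monomial of a power of \<open>y\<close>:
  bracketing \<open>x^2\<close> with it repeatedly gives 0 only if \<open>i < 0\<close>, and for \<open>y^2\<close> only if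
  \<open>n = - 2 i\<close>.
\<close>

lemma good_corner:
  fixes i :: int and \<xi> :: real
  assumes h: "good anti h" and \<xi>: "\<xi> ~= 0" and nz: "lrow (lexp h) i ~= 0"
    and n: "degree (lrow (lexp h) i) = n" "n \<ge> 1"
    and top: "\<And>k. k ~= i ==> lrow (lexp h) k ~= 0 ==> \<xi> * k + degree (lrow (lexp h) k) < \<xi> * i + n"
    and big: "\<xi> * i + n > 1"
  shows "int n = - 2 * i"
proof -
  let ?t = "lexp h" and ?a = "\<xi> * i + n"
  have hq: "h \<in> qring" using h by (simp add: good_def)
  have w: "wle \<xi> ?a ?t"
    unfolding wle_def
  proof (intro allI impI)
    fix k assume "lrow ?t k ~= 0"
    then show "\<xi> * k + degree (lrow ?t k) \<le> ?a" using top[of k] n by (cases "k = i") auto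
  qed
  define c where "c = coeff (lrow ?t i) n"
  have c: "c ~= 0" using nz n by (auto simp: c_def)
  have H: "wform \<xi> ?a ?t = [:- 0, 1:] ^ n * [:c:]"
  proof (rule poly_eqI)
    fix j
    show "coeff (wform \<xi> ?a ?t) j = coeff ([:- 0, 1:] ^ n * [:c:]) j"
    proof (cases "j = n")
      case True
      have "coeff (wform \<xi> ?a ?t) n = c" unfolding c_def by (rule coeff_wform[OF \<xi>]) simp
      then show ?thesis using True by (simp add: coeff_X_power)
    next
      case False
      have "coeff (wform \<xi> ?a ?t) j = 0"
      proof (rule coeff_wform_0)
        fix k :: int assume j: "real j = ?a - \<xi> * k"
        have "k ~= i" using j False by auto
        then show "coeff (lrow ?t k) j = 0"
          using top[of k] j by (cases "lrow ?t k = 0") (auto intro: coeff_eq_0)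
      qed
      moreover have "coeff ([:0, 1:] ^ n * [:c:]) j = 0"
        using False by (simp add: coeff_X_power)
      ultimately show ?thesis by simp
    qed
  qed
  have i: "i < 0"
  proof (rule ccontr)
    assume "\<not> i < 0"
    then have i0: "i \<ge> 0" by simp
    let ?f = "\<lambda>s. cx s * cx s"
    have f: "?f \<in> inv_ring anti" by (rule squares_inv_ring) auto
    have lf: "lexp ?f = lmon 2 1" by (simp add: mult_single)
    have wf: "wle \<xi> (2 * \<xi>) (lexp ?f)" unfolding lf wle_mon by simp
    have F: "wform \<xi> (2 * \<xi>) (lexp ?f) = [:- 0, 1:] ^ 0 * 1"
      unfolding lf by (simp add: tform_nat[of 0] pCons_one)
    have ne: "2 * \<xi> * n - ?a * (0::nat) + N * (?a - n) ~= 0" for N :: nat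
    proof -
      have "2 * \<xi> * n - ?a * (0::nat) + N * (?a - n) = \<xi> * real_of_int (2 * n + N * i)"
        by (simp add: algebra_simps)
      moreover have "2 * n + N * i > 0" using n i0 by (simp add: add_pos_nonneg)
      ultimately show ?thesis using \<xi> by (simp add: mult_eq_0_iff del: of_int_add)
    qed
    show False
      by (rule bounded_iterates_contradiction[OF w wf \<xi> big good_bounded[OF h f] H _ n(2) F _ ne])
        (use c in auto)
  qed
  have ge: "- 2 * i \<le> int n" using lrow_degree_ge[OF hq nz] n by simp
  show ?thesis
  proof (rule ccontr)
    assume neq: "int n ~= - 2 * i"
    let ?f = "\<lambda>s. cy s * cy s"
    have f: "?f \<in> inv_ring anti" by (rule squares_inv_ring) auto
    have lf: "lexp ?f = lmon (-2) [:1, 0, -2, 0, 1:]" by (simp add: mult_single)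
    have wf: "wle \<xi> (4 - 2 * \<xi>) (lexp ?f)" unfolding lf wle_mon by simp
    have F: "wform \<xi> (4 - 2 * \<xi>) (lexp ?f) = [:- 0, 1:] ^ 4 * 1"
      unfolding lf by (simp add: tform_nat[of 4] numeral_eq_Suc monom_altdef)
    have ne: "(4 - 2 * \<xi>) * n - ?a * (4::nat) + N * (?a - n) ~= 0" for N :: nat
    proof -
      have "(4 - 2 * \<xi>) * n - ?a * (4::nat) + N * (?a - n) = \<xi> * real_of_int (- 2 * n - 4 * i + N * i)"
        by (simp add: algebra_simps)
      moreover have "- 2 * n - 4 * i + N * i < 0"
      proof -
        have "N * i \<le> 0" using i by (simp add: mult_nonneg_nonpos)
        then show ?thesis using ge neq by linarith
      qed
      ultimately show ?thesis using \<xi> by (simp add: mult_eq_0_iff del: of_int_add of_int_diff)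
    qed
    show False
      by (rule bounded_iterates_contradiction[OF w wf \<xi> big good_bounded[OF h f] H _ n(2) F _ ne])
        (use c in auto)
  qed
qed

definition nxle :: "nat => (pt => complex) => bool"
  where "nxle n h \<longleftrightarrow> (\<forall>k. degree (lrow (lexp h) k) \<le> n)"

definition nyle :: "nat => (pt => complex) => bool"
  where "nyle n h \<longleftrightarrow> (\<forall>k. lrow (lexp h) k ~= 0 --> 2 * k + int (degree (lrow (lexp h) k)) \<le> int n)"

lemma nxle_swap: "h \<in> qring ==> nyle n h ==> nxle n (\<lambda>s. h (qswap s))"
  unfolding nxle_def
proof
  fix k assume h: "h \<in> qring" "nyle n h"
  show "degree (lrow (lexp (\<lambda>s. h (qswap s))) k) \<le> n"
  proof (cases "lrow (lexp (\<lambda>s. h (qswap s))) k = 0")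
    case False
    then show ?thesis using degree_lrow_swap[OF h(1), of "- k"] h(2)
      by (auto simp: nyle_def)
  qed simp
qed

lemma nyle_swap: "h \<in> qring ==> nxle n h ==> nyle n (\<lambda>s. h (qswap s))"
  unfolding nyle_def
proof (intro allI impI)
  fix k assume h: "h \<in> qring" "nxle n h" and nz: "lrow (lexp (\<lambda>s. h (qswap s))) k ~= 0"
  have "int (degree (lrow (lexp (\<lambda>s. h (qswap s))) k)) = 2 * (- k) + int (degree (lrow (lexp h) (- k)))"
    using degree_lrow_swap(2)[OF h(1), of "- k"] nz by simp
  moreover have "degree (lrow (lexp h) (- k)) \<le> n" using h(2) by (simp add: nxle_def)
  ultimately show "2 * k + int (degree (lrow (lexp (\<lambda>s. h (qswap s))) k)) \<le> int n" by simp
qed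

lemma max_degree_row:
  assumes "nxle n h" "\<not> nxle (n - 1) h"
  shows "\<exists>k. lrow (lexp h) k ~= 0 \<and> degree (lrow (lexp h) k) = n" "n \<ge> 1"
proof -
  obtain k where "\<not> degree (lrow (lexp h) k) \<le> n - 1" using assms(2) by (auto simp: nxle_def)
  moreover have "degree (lrow (lexp h) k) \<le> n" using assms(1) by (simp add: nxle_def)
  ultimately have "degree (lrow (lexp h) k) = n" "n \<ge> 1" by auto
  moreover from this have "lrow (lexp h) k ~= 0" by auto
  ultimately show "\<exists>k. lrow (lexp h) k ~= 0 \<and> degree (lrow (lexp h) k) = n" "n \<ge> 1" by blast+
qed

lemma laur_key_bound: "\<exists>M\<ge>0. \<forall>k. lrow t k ~= 0 --> \<bar>k\<bar> \<le> M"
proof (intro exI[of _ "\<Sum>k\<in>lkeys t. \<bar>k\<bar>"] conjI allI impI)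
  fix k assume "lrow t k ~= 0"
  then show "\<bar>k\<bar> \<le> (\<Sum>k\<in>lkeys t. \<bar>k\<bar>)" by (intro member_le_sum) (auto simp: in_keys_iff)
qed (simp add: sum_nonneg)

text \<open>
  The rows of maximal degree in \<open>z\<close>: tilting the weights slightly towards \<open>x\<close> or away from it
  isolates the extreme ones among them.
\<close>

lemma good_max_rows:
  assumes h: "good anti h" and n: "nxle n h" "n \<ge> 1"
    and k: "lrow (lexp h) k ~= 0" "degree (lrow (lexp h) k) = n"
  shows "n = 1 \<and> k = 0 \<or> int n = - 2 * k"
proof -
  let ?t = "lexp h"
  have hq: "h \<in> qring" using h by (simp add: good_def)
  obtain M where M: "M \<ge> 0" "\<And>k. lrow ?t k ~= 0 ==> \<bar>k\<bar> \<le> M" using laur_key_bound[of ?t] by blast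
  \<comment> \<open>Exponents of \<open>x\<close> differ by at most \<open>2 M\<close>, so a tilt by \<open>e\<close> changes differences of weights by less than 1.\<close>
  define e :: real where "e = 1 / (2 * M + 1)"
  have e: "e > 0" using M(1) by (simp add: e_def add_nonneg_pos)
  have small: "\<bar>e * (of_int k' - of_int l')\<bar> < 1" "\<bar>e * of_int k'\<bar> < 1"
    if "lrow ?t k' ~= 0" "lrow ?t l' ~= 0" for k' l'
  proof -
    have "\<bar>k' - l'\<bar> < 2 * M + 1" "\<bar>k'\<bar> < 2 * M + 1" using M(2)[OF that(1)] M(2)[OF that(2)] M(1) by auto
    then have "\<bar>real_of_int k' - of_int l'\<bar> < 2 * M + 1" "\<bar>real_of_int k'\<bar> < 2 * M + 1"
      by (simp_all flip: of_int_diff of_int_abs)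
    then show "\<bar>e * (of_int k' - of_int l')\<bar> < 1" "\<bar>e * of_int k'\<bar> < 1"
      using M(1) by (simp_all add: e_def abs_mult field_simps)
  qed
  define I where "I = {k \<in> lkeys ?t. degree (lrow ?t k) = n}"
  have I: "finite I" "k \<in> I" using k by (auto simp: I_def in_keys_iff)
  have less: "degree (lrow ?t l) + 1 \<le> n" if "l \<notin> I" "lrow ?t l ~= 0" for l
  proof -
    have "degree (lrow ?t l) \<le> n" using n by (simp add: nxle_def)
    moreover have "degree (lrow ?t l) ~= n" using that by (auto simp: I_def in_keys_iff)
    ultimately show ?thesis by simp
  qed
  have corner: "int n = - 2 * i"
    if i: "i \<in> I" and \<xi>: "\<xi> = e \<or> \<xi> = - e" and ext: "\<And>l. l \<in> I ==> l ~= i ==> \<xi> * of_int l < \<xi> * of_int i"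
      and big: "n \<ge> 2 \<or> \<xi> * of_int i > 0" for i \<xi>
  proof (rule good_corner[OF h])
    show "\<xi> ~= 0" using e \<xi> by auto
    show nz: "lrow ?t i ~= 0" and "degree (lrow ?t i) = n" using i by (auto simp: I_def in_keys_iff)
    show "n \<ge> 1" by fact
    show "\<xi> * of_int i + real n > 1"
      using small(2)[OF nz nz] \<xi> big n(2) by (auto simp: abs_less_iff)
    fix l assume l: "l ~= i" "lrow ?t l ~= 0"
    show "\<xi> * of_int l + degree (lrow ?t l) < \<xi> * of_int i + n"
    proof (cases "l \<in> I")
      case True
      then show ?thesis using ext[OF True l(1)] by (simp add: I_def)
    next
      case False
      have "\<bar>\<xi> * of_int l - \<xi> * of_int i\<bar> < 1"
        using small(1)[OF l(2) nz] \<xi> by (auto simp: algebra_simps abs_less_iff)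
      then show ?thesis using less[OF False l(2)] by linarith
    qed
  qed
  have "I ~= {}" using I(2) by blast
  then have MI: "Max I \<in> I" "Min I \<in> I" "Min I \<le> k" "k \<le> Max I"
    using I(2) Max_in[OF I(1)] Min_in[OF I(1)] Max_ge[OF I] Min_le[OF I] by blast+
  show ?thesis
  proof (cases "n \<ge> 2")
    case True
    have "int n = - 2 * Max I"
    proof (rule corner[OF MI(1), of e])
      fix l assume "l \<in> I" "l ~= Max I"
      then have "l < Max I" using I(1) by (metis Max_ge order_le_neq_trans)
      then show "e * of_int l < e * of_int (Max I)" using e by simp
    qed (use True in auto)
    moreover have "int n = - 2 * Min I"
    proof (rule corner[OF MI(2), of "- e"])
      fix l assume "l \<in> I" "l ~= Min I"
      then have "Min I < l" using I(1) by (metis Min_le order_le_neq_trans)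
      then show "- e * of_int l < - e * of_int (Min I)" using e by simp
    qed (use True in auto)
    ultimately show ?thesis using MI by auto
  next
    case False
    then have n1: "n = 1" using n by simp
    have "Max I \<le> 0"
    proof (rule ccontr)
      assume pos: "\<not> Max I \<le> 0"
      have "int n = - 2 * Max I"
      proof (rule corner[OF MI(1), of e])
        fix l assume "l \<in> I" "l ~= Max I"
        then have "l < Max I" using I(1) by (metis Max_ge order_le_neq_trans)
        then show "e * of_int l < e * of_int (Max I)" using e by simp
      qed (use e pos in auto)
      then show False using pos by simp
    qed
    moreover have "- 2 * k \<le> int n" using lrow_degree_ge[OF hq k(1)] k(2) by simp
    ultimately show ?thesis using n1 MI by auto
  qed
qed

section \<open>Reduction of a good Hamiltonian to normal form\<close>

lemma coeff_evl: "finite K ==> lkeys t \<subseteq> K ==> coeff (evl t x) n = (\<Sum>k\<in>K. coeff (lrow t k) n * x powi k)"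
  by (simp add: evl_superset coeff_sum mult.commute)

lemma lrow_coeffs_eqI:
  assumes K: "finite K" and c: "\<And>k. k \<notin> K ==> c k = 0"
    and eq: "\<And>x. x ~= 0 ==> coeff (evl t x) n = (\<Sum>k\<in>K. c k * x powi k)"
  shows "coeff (lrow t k) n = c k"
proof -
  let ?K = "lkeys t \<union> K \<union> {k}"
  have "coeff (lrow t k) n - c k = 0"
  proof (rule laurent_coeffs_zero[where K = ?K and X = "- {0}"])
    fix x :: complex assume x: "x ~= 0"
    have "(\<Sum>k\<in>?K. (coeff (lrow t k) n - c k) * x powi k) =
        (\<Sum>k\<in>?K. coeff (lrow t k) n * x powi k) - (\<Sum>k\<in>?K. c k * x powi k)"
      by (simp add: left_diff_distrib sum_subtractf)
    also have "(\<Sum>k\<in>?K. coeff (lrow t k) n * x powi k) = coeff (evl t x) n"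
      by (rule coeff_evl[symmetric]) (use K in auto)
    also have "(\<Sum>k\<in>?K. c k * x powi k) = (\<Sum>k\<in>K. c k * x powi k)"
      by (rule sum.mono_neutral_right) (use K c in auto)
    finally show "(\<Sum>k\<in>?K. (coeff (lrow t k) n - c k) * x powi k) = 0" using eq[OF x] by simp
  qed (use K infinite_nonzero in auto)
  then show ?thesis by simp
qed

lemma coeff_pcompose_shift_top:
  fixes p :: "complex poly"
  assumes "degree p \<le> n"
  shows "coeff (pcompose p [:e, 1:]) n = coeff p n"
proof (cases "degree p = n")
  case True
  have "lead_coeff (pcompose p [:e, 1:]) = lead_coeff p" by (subst lead_coeff_comp) auto
  then show ?thesis using True by (simp add: degree_pcompose)
next
  case False
  then show ?thesis using assms by (simp add: coeff_eq_0 degree_pcompose)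
qed

lemma coeff_pcompose_shift:
  fixes p :: "complex poly"
  assumes "degree p \<le> Suc n"
  shows "coeff (pcompose p [:e, 1:]) n = coeff p n + of_nat (Suc n) * e * coeff p (Suc n)"
  using assms
proof (induction p arbitrary: n)
  case (pCons a p)
  show ?case
  proof (cases "p = 0")
    case False
    then have d: "degree p \<le> n" using pCons.prems by simp
    have eq: "coeff (pcompose (pCons a p) [:e, 1:]) n = coeff [:a:] n + e * coeff (pcompose p [:e, 1:]) n +
        coeff (pCons 0 (pcompose p [:e, 1:])) n"
      by (simp add: pcompose_pCons)
    show ?thesis
    proof (cases n)
      case 0
      then show ?thesis using eq coeff_pcompose_shift_top[OF d, of e] d by simp
    next
      case (Suc m)
      then show ?thesis using eq coeff_pcompose_shift_top[OF d, of e] pCons.IH[of m] d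
        by (simp add: algebra_simps)
    qed
  qed (simp add: pcompose_pCons)
qed simp

text \<open>
  The antipodal map multiplies \<open>x^k z^j\<close> by \<open>(-1)^(k + j)\<close> and changes the sign of the Hamiltonian.
\<close>

lemma good_parity:
  assumes h: "good True h" and c: "coeff (lrow (lexp h) k) j ~= 0"
  shows "odd (k + int j)"
proof -
  let ?t = "lexp h"
  have hq: "h \<in> qring" and anti: "\<And>s. s \<in> quadric ==> h (- s) = - h s" using h by (auto simp: good_def)
  have "coeff (lrow ?t k) j = - ((-1) ^ nat \<bar>k\<bar> * (-1) ^ j * coeff (lrow ?t k) j)"
  proof (rule lrow_coeffs_eqI[where K = "lkeys ?t"])
    fix x :: complex assume x: "x ~= 0"
    have "poly (evl ?t x) z = poly (- pcompose (evl ?t (- x)) [:0, -1:]) z" for z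
    proof -
      have "chart (- x) (- z) = - chart x z" using x by (intro pt_eqI) auto
      then have "h (chart (- x) (- z)) = - h (chart x z)" using anti x by simp
      then show ?thesis using poly_lexp[OF hq, of x z] poly_lexp[OF hq, of "- x" "- z"] x
        by (simp add: poly_pcompose)
    qed
    then have "evl ?t x = - pcompose (evl ?t (- x)) [:0, -1:]"
      by (simp add: poly_eq_poly_eq_iff[symmetric] fun_eq_iff)
    then have "coeff (evl ?t x) j = - ((-1) ^ j * coeff (evl ?t (- x)) j)"
      by (simp add: coeff_pcompose_linear)
    also have "\<dots> = (\<Sum>k\<in>lkeys ?t. - ((-1) ^ nat \<bar>k\<bar> * (-1) ^ j * coeff (lrow ?t k) j) * x powi k)"
      unfolding coeff_evl[OF finite_keys order_refl] sum_distrib_left sum_negf[symmetric]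
    proof (intro sum.cong refl)
      fix k :: int
      have "(- x) powi k = (-1) powi k * x powi k" by (simp flip: power_int_mult_distrib)
      moreover have "(-1 :: complex) powi k = (-1) ^ nat \<bar>k\<bar>"
        by (cases "even k") (auto simp: even_nat_iff)
      ultimately show "- ((- 1) ^ j * (coeff (lrow ?t k) j * (- x) powi k)) =
          - ((-1) ^ nat \<bar>k\<bar> * (-1) ^ j * coeff (lrow ?t k) j) * x powi k" by simp
    qed
    finally show "coeff (evl ?t x) j =
        (\<Sum>k\<in>lkeys ?t. - ((-1) ^ nat \<bar>k\<bar> * (-1) ^ j * coeff (lrow ?t k) j) * x powi k)" .
  qed (auto simp: in_keys_iff)
  then have "(-1 :: complex) ^ (nat \<bar>k\<bar> + j) = -1" using c by (simp add: power_add)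
      (metis add.inverse_inverse mult_cancel_right2 mult_minus_left)
  then have "odd (nat \<bar>k\<bar> + j)" by (metis neg_one_even_power one_neq_neg_one)
  then show ?thesis by (auto simp: even_nat_iff)
qed

text \<open>
  Every Laurent polynomial in \<open>x\<close> with exponents above \<open>l\<close> is \<open>x^l\<close> times the value
  \<open>x \<chi>(x)\<close> by which a shear translates \<open>z\<close>.
\<close>

lemma shear_poly:
  fixes c :: "int => complex"
  assumes K: "finite K" and l: "\<And>k. k \<in> K ==> l < k"
  obtains p where "\<And>x. x ~= 0 ==> x * poly p x * x powi l = (\<Sum>k\<in>K. c k * x powi k)"
    "\<And>i. coeff p i ~= 0 ==> l + 1 + int i \<in> K \<and> c (l + 1 + int i) ~= 0"
proof -
  define p where "p = (\<Sum>k\<in>K. monom (c k) (nat (k - l - 1)))"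
  have "x * poly p x * x powi l = (\<Sum>k\<in>K. c k * x powi k)" if x: "x ~= 0" for x
    unfolding p_def poly_sum poly_monom sum_distrib_left sum_distrib_right
  proof (intro sum.cong refl)
    fix k assume "k \<in> K"
    then have "l < k" by (rule l)
    then have "x ^ nat (k - l - 1) = x powi (k - l - 1)" by (simp add: power_int_def)
    moreover have "x * x powi (k - l - 1) * x powi l = x powi k"
      using power_int_add[of x 1 "k - l - 1"] power_int_add[of x "k - l" l] x by simp
    ultimately show "x * (c k * x ^ nat (k - l - 1)) * x powi l = c k * x powi k"
      by (simp add: mult.assoc mult.left_commute)
  qed
  moreover have "l + 1 + int i \<in> K \<and> c (l + 1 + int i) ~= 0" if "coeff p i ~= 0" for i
  proof -
    have "(\<Sum>k\<in>K. if nat (k - l - 1) = i then c k else 0) ~= 0"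
      using that by (simp add: p_def coeff_sum)
    then obtain k where k: "k \<in> K" "(if nat (k - l - 1) = i then c k else 0) ~= 0"
      by (rule sum.not_neutral_contains_not_neutral)
    then have "k = l + 1 + int i" using l[OF k(1)] by (auto split: if_splits)
    then show ?thesis using k by (auto split: if_splits)
  qed
  ultimately show ?thesis using that by blast
qed

lemma even_poly_pcompose:
  assumes "\<And>i. coeff p i ~= 0 ==> even i"
  shows "pcompose p [:0, -1:] = (p :: complex poly)"
  by (rule poly_eqI) (use assms in \<open>force simp: coeff_pcompose_linear\<close>)

definition reducible_to_linear :: "bool => (pt => complex) => bool"
  where "reducible_to_linear anti h \<longleftrightarrow> (\<exists>\<phi> \<psi> b c. qaut anti \<phi> \<psi> \<and> b ~= 0 \<and>
    lexp (\<lambda>s. h (\<phi> s)) = lmon 0 [:c, b:])"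

lemma reducible_qaut:
  assumes "qaut anti \<phi> \<psi>" "reducible_to_linear anti (\<lambda>s. h (\<phi> s))"
  shows "reducible_to_linear anti h"
proof -
  obtain \<phi>' \<psi>' b c where r: "qaut anti \<phi>' \<psi>'" "b ~= 0" "lexp (\<lambda>s. h (\<phi> (\<phi>' s))) = lmon 0 [:c, b:]"
    using assms(2) unfolding reducible_to_linear_def by blast
  show ?thesis
    using qaut_comp[OF assms(1) r(1)] r(2,3) unfolding reducible_to_linear_def by blast
qed

lemma good_not_nxle_0:
  assumes h: "good anti h" shows "\<not> nxle 0 h"
proof
  assume n: "nxle 0 h"
  let ?t = "lexp h"
  have hq: "h \<in> qring" using h by (simp add: good_def)
  have dzt: "dz ?t = 0"
    by (rule poly_mapping_eqI) (use n in \<open>simp add: lookup_dz nxle_def pderiv_eq_0_iff\<close>)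
  have br_t: "br ?t f = - (dlx ?t * dz f)" for f by (simp add: br_def dzt)
  have dzd: "dz (dlx ?t) = 0" by (simp add: dlx_dz[symmetric] dzt)
  let ?f = "\<lambda>s. cz s * cz s"
  have f: "?f \<in> inv_ring anti" by (rule squares_inv_ring) auto
  have lf: "lexp ?f = lmon 0 [:0, 0, 1:]" by (simp add: mult_single)
  have "br ?t (br ?t (br ?t (lexp ?f))) = 0"
    by (simp add: br_t lf dz_mult dzd pderiv_pCons)
  then have "br ?t (lexp ?f) = 0" by (rule good_cube[OF h f])
  then have "dlx ?t = 0" by (simp add: br_t lf pderiv_pCons)
  then have "br ?t g = 0" for g by (simp add: br_t)
  moreover obtain g s where g: "g \<in> inv_ring anti" "s \<in> quadric" "qbr h g s ~= 0"
    using h by (auto simp: good_def)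
  ultimately have "lexp (qbr h g) = lexp (\<lambda>_. 0)"
    using qbr(2)[OF hq inv_ring_qring[OF g(1)]] by simp
  then have "qbr h g s = 0" using qbr(1)[OF hq inv_ring_qring[OF g(1)]] g(2) by (intro lexp_eqD) auto
  then show False using g(3) by simp
qed

lemma good_nxle_1:
  assumes h: "good anti h" and n: "nxle 1 h"
  shows "reducible_to_linear anti h"
proof -
  let ?t = "lexp h"
  have hq: "h \<in> qring" using h by (simp add: good_def)
  obtain k0 where k0: "lrow ?t k0 ~= 0" "degree (lrow ?t k0) = 1"
    using max_degree_row[OF n] good_not_nxle_0[OF h] by auto
  have only: "k = 0" if "lrow ?t k ~= 0" "degree (lrow ?t k) = 1" for k
    using good_max_rows[OF h n _ that] by presburger
  have const: "degree (lrow ?t k) = 0" if "k ~= 0" for k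
  proof -
    have "degree (lrow ?t k) \<le> 1" using n by (simp add: nxle_def)
    moreover have "degree (lrow ?t k) ~= 1" using only[of k] that by (cases "lrow ?t k = 0") auto
    ultimately show ?thesis by simp
  qed
  have neg: "lrow ?t k = 0" if "k < 0" for k
    using lrow_degree_ge[OF hq, of k] const[of k] that by fastforce
  define K where "K = lkeys ?t - {0}"
  have K: "finite K" "\<And>k. k \<in> K ==> 0 < k" using neg by (auto simp: K_def in_keys_iff) (metis linorder_neqE_linordered_idom)
  obtain c b where cb: "lrow ?t 0 = [:c, b:]" "b ~= 0"
  proof -
    have k00: "k0 = 0" using only k0 by blast
    have "lrow ?t 0 = [:coeff (lrow ?t 0) 0, coeff (lrow ?t 0) 1:]"
    proof (rule poly_eqI)
      fix i show "coeff (lrow ?t 0) i = coeff [:coeff (lrow ?t 0) 0, coeff (lrow ?t 0) 1:] i"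
        using k0 k00 by (auto simp: coeff_pCons coeff_eq_0 split: nat.splits)
    qed
    moreover have "coeff (lrow ?t 0) 1 ~= 0" using k0 k00 by (metis leading_coeff_0_iff)
    ultimately show ?thesis using that by blast
  qed
  obtain p where p: "\<And>x. x ~= 0 ==> x * poly p x * x powi 0 = (\<Sum>k\<in>K. - coeff (lrow ?t k) 0 / b * x powi k)"
    "\<And>i. coeff p i ~= 0 ==> 0 + 1 + int i \<in> K \<and> - coeff (lrow ?t (0 + 1 + int i)) 0 / b ~= 0"
    using shear_poly[OF K, of "\<lambda>k. - coeff (lrow ?t k) 0 / b"] by blast
  have ev: "h (chart x z) = c + b * z + (\<Sum>k\<in>K. coeff (lrow ?t k) 0 * x powi k)" if x: "x ~= 0" for x z
  proof -
    have "h (chart x z) = poly (evl ?t x) z" using poly_lexp[OF hq x] by simp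
    also have "evl ?t x = (\<Sum>k\<in>insert 0 K. smult (x powi k) (lrow ?t k))"
      by (rule evl_superset) (auto simp: K_def)
    also have "\<dots> = [:c, b:] + (\<Sum>k\<in>K. smult (x powi k) (lrow ?t k))"
      using K(1) by (subst sum.insert) (auto simp: K_def cb)
    also have "poly \<dots> z = c + b * z + (\<Sum>k\<in>K. x powi k * poly (lrow ?t k) z)"
      by (simp add: poly_sum mult.commute)
    also have "(\<Sum>k\<in>K. x powi k * poly (lrow ?t k) z) = (\<Sum>k\<in>K. coeff (lrow ?t k) 0 * x powi k)"
    proof (intro sum.cong refl)
      fix k assume "k \<in> K"
      then have "degree (lrow ?t k) = 0" using const by (simp add: K_def)
      then obtain a where "lrow ?t k = [:a:]" by (rule degree_eq_zeroE)
      then show "x powi k * poly (lrow ?t k) z = coeff (lrow ?t k) 0 * x powi k" by simp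
    qed
    finally show ?thesis .
  qed
  have "lexp (\<lambda>s. h (shear p s)) = lmon 0 [:c, b:]"
  proof (rule lexp_eqI, unfold expands_def, intro allI impI)
    fix x z :: complex assume x: "x ~= 0"
    have "b * (x * poly p x) = (\<Sum>k\<in>K. - (coeff (lrow ?t k) 0 * x powi k))"
      using p(1)[OF x] cb(2) by (simp add: sum_distrib_left)
    then show "h (shear p (chart x z)) = poly (evl (lmon 0 [:c, b:]) x) z"
      by (simp add: shear_chart[OF x] ev[OF x] sum_negf algebra_simps)
  qed
  moreover have "qaut anti (shear p) (shear (- p))"
  proof (rule qaut_shear, rule even_poly_pcompose)
    fix i assume anti and i: "coeff p i ~= 0"
    then have "good True h" using h by simp
    moreover have "coeff (lrow ?t (1 + int i)) 0 ~= 0" using p(2)[OF i] by auto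
    ultimately have "odd (1 + int i + int 0)" by (rule good_parity)
    then show "even i" by simp
  qed
  ultimately show ?thesis using cb(2) unfolding reducible_to_linear_def by blast
qed

text \<open>
  A polynomial of degree \<open>2 d\<close> whose next coefficient vanishes has roots with sum zero; unless it is a
  monomial, one of them has multiplicity at most \<open>d\<close>.
\<close>

lemma small_root:
  fixes H :: "complex poly"
  assumes deg: "degree H = 2 * d" and d: "d \<ge> 1" and c: "coeff H (2 * d - 1) = 0"
    and j: "coeff H j ~= 0" "j ~= 2 * d"
  obtains s m H1 where "H = [:- s, 1:] ^ m * H1" "poly H1 s ~= 0" "1 \<le> m" "m \<le> d"
proof -
  have nz: "H ~= 0" using j by auto
  have fact: "\<exists>H1. H = [:- s, 1:] ^ Polynomial.order s H * H1 \<and> poly H1 s ~= 0" for s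
    using order_decomp[OF nz, of s] by (auto simp: poly_eq_0_iff_dvd)
  obtain s where s: "poly H s = 0" using alg_closed_imp_poly_has_root[of H] deg d by auto
  have s1: "Polynomial.order s H \<ge> 1" using s nz order_root[of H s] by simp
  show ?thesis
  proof (cases "Polynomial.order s H \<le> d")
    case True then show ?thesis using fact[of s] s1 that by blast
  next
    case False
    obtain H1 where H1: "H = [:- s, 1:] ^ Polynomial.order s H * H1" "poly H1 s ~= 0" using fact by blast
    have H1nz: "H1 ~= 0" using H1 by auto
    have "degree H = degree ([:- s, 1:] ^ Polynomial.order s H) + degree H1"
      using H1nz by (subst H1(1)) (auto intro: degree_mult_eq)
    then have d1: "2 * d = Polynomial.order s H + degree H1" using deg by (simp add: degree_power_eq)
    show ?thesis
    proof (cases "degree H1 = 0")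
      case True
      then obtain q where q: "H1 = [:q:]" "q ~= 0" using H1nz by (metis degree_eq_zeroE pCons_eq_0_iff)
      have ord: "Polynomial.order s H = 2 * d" using d1 True by simp
      have X: "[:- s, 1:] ^ n = pcompose (monom 1 n) [:- s, 1:]" for n
        by (rule poly_eqI_cofinite[of "{}"]) (simp_all add: poly_pcompose poly_monom)
      obtain e where e: "2 * d = Suc e" using d by (cases "2 * d") auto
      have "coeff ([:- s, 1:] ^ (2 * d)) e = - of_nat (2 * d) * s"
        unfolding X e by (subst coeff_pcompose_shift) (auto simp: degree_monom_eq algebra_simps)
      then have "coeff H e = q * (- of_nat (2 * d) * s)"
        using H1(1) ord q by simp
      moreover have "coeff H e = 0" using c e by simp
      ultimately have "s = 0" using q d by auto
      then have "H = monom q (2 * d)" using H1(1) ord q by (simp add: monom_altdef)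
      then show ?thesis using j by simp
    next
      case False
      then obtain s' where s': "poly H1 s' = 0" using alg_closed_imp_poly_has_root[of H1] by auto
      have ne: "s' ~= s" using s' H1 by auto
      have "Polynomial.order s' H = Polynomial.order s' ([:- s, 1:] ^ Polynomial.order s H) + Polynomial.order s' H1"
        using order_mult[of "[:- s, 1:] ^ Polynomial.order s H" H1 s'] nz H1(1) by simp
      also have "Polynomial.order s' ([:- s, 1:] ^ Polynomial.order s H) = 0"
        using ne by (intro order_0I) simp
      finally have "Polynomial.order s' H = Polynomial.order s' H1" by simp
      moreover have "Polynomial.order s' H1 \<le> degree H1" using H1nz by (rule order_degree)
      ultimately have "Polynomial.order s' H \<le> d" using d1 \<open>\<not> Polynomial.order s H \<le> d\<close> by linarith
      moreover have "poly H s' = 0" using s' H1(1) by (metis poly_mult mult_zero_right)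
      then have "Polynomial.order s' H \<ge> 1" using nz order_root[of H s'] by simp
      ultimately show ?thesis using fact[of s'] that by blast
    qed
  qed
qed

text \<open>
  The edge of the Newton polygon that starts at \<open>y^d\<close>: if it were flat enough to reach total
  degree \<open>d\<close>, its form would have a root of small multiplicity, and the iterates on \<open>x^2\<close> could not
  stay bounded. The only exception is a quadratic edge with \<open>d = 1\<close>.
\<close>

lemma good_edge:
  assumes h: "good anti h" and d: "d \<ge> 1" and n: "nxle (2 * d) h"
    and row: "degree (lrow (lexp h) (- int d)) = 2 * d"
    and low: "\<And>k. coeff (lrow (lexp h) k) (2 * d - 1) = 0"
  shows "(\<forall>k. k ~= - int d --> lrow (lexp h) k ~= 0 --> - int d < k \<and> k + int (degree (lrow (lexp h) k)) < int d) \<or>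
    (d = 1 \<and> (\<forall>k. k ~= -1 --> lrow (lexp h) k ~= 0 --> -1 < k \<and> k + int (degree (lrow (lexp h) k)) \<le> 1))"
proof -
  let ?t = "lexp h" and ?D = "- int d"
  have hq: "h \<in> qring" using h by (simp add: good_def)
  have rowD: "lrow ?t ?D ~= 0" using row d by auto
  have deg_less: "degree (lrow ?t k) < 2 * d" if "k ~= ?D" "lrow ?t k ~= 0" for k
  proof -
    have "degree (lrow ?t k) \<le> 2 * d" using n by (simp add: nxle_def)
    moreover have "degree (lrow ?t k) ~= 2 * d"
      using good_max_rows[OF h n _ that(2)] d that(1) by auto
    ultimately show ?thesis by simp
  qed
  have right: "?D < k" if "k ~= ?D" "lrow ?t k ~= 0" for k
    using lrow_degree_ge[OF hq that(2)] deg_less[OF that] that(1) by linarith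
  define r where "r k = (2 * real d - real (degree (lrow ?t k))) / (real_of_int k + real d)" for k
  define J where "J = {k \<in> lkeys ?t. k ~= ?D}"
  have J: "finite J" by (simp add: J_def)
  have Jpos: "real_of_int k + real d > 0" if "k \<in> J" for k
  proof -
    have "?D < k" using right[of k] that by (auto simp: J_def in_keys_iff)
    then have "0 < k + int d" by simp
    then have "0 < real_of_int (k + int d)" by (simp only: of_int_0_less_iff)
    then show ?thesis by simp
  qed
  show ?thesis
  proof (cases "\<exists>k\<in>J. r k \<le> 1")
    case False
    have "- int d < k \<and> k + int (degree (lrow ?t k)) < int d" if k: "k ~= ?D" "lrow ?t k ~= 0" for k
    proof -
      have kJ: "k \<in> J" using k by (auto simp: J_def in_keys_iff)
      then have "r k > 1" using False by auto
      then have "real_of_int k + real d < 2 * real d - real (degree (lrow ?t k))"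
        using Jpos[OF kJ] by (simp add: r_def field_simps)
      then have "real_of_int (k + int (degree (lrow ?t k))) < real_of_int (int d)" by simp
      then have "k + int (degree (lrow ?t k)) < int d" by (simp only: of_int_less_iff)
      then show ?thesis using right[OF k] by simp
    qed
    then show ?thesis by blast
  next
    case True
    then have Jne: "J ~= {}" by blast
    define \<xi> where "\<xi> = Min (r ` J)"
    have \<xi>le: "\<xi> \<le> r k" if "k \<in> J" for k unfolding \<xi>_def using J that by simp
    have "\<xi> \<in> r ` J" unfolding \<xi>_def using J Jne by (intro Min_in) auto
    then obtain k0 where k0: "k0 \<in> J" "\<xi> = r k0" by blast
    have \<xi>1: "\<xi> \<le> 1" using True \<xi>le by force
    have \<xi>0: "\<xi> > 0"
    proof -
      have "degree (lrow ?t k0) < 2 * d" using deg_less k0(1) by (auto simp: J_def in_keys_iff)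
      then show ?thesis using Jpos[OF k0(1)] k0(2) by (simp add: r_def)
    qed
    define a where "a = 2 * real d - \<xi> * real d"
    have le: "\<xi> * (real_of_int k + real d) \<le> 2 * real d - real (degree (lrow ?t k))" if "k \<in> J" for k
      using \<xi>le[OF that] Jpos[OF that] by (simp add: r_def field_simps)
    have w: "wle \<xi> a ?t"
      unfolding wle_def
    proof (intro allI impI)
      fix k assume k: "lrow ?t k ~= 0"
      show "\<xi> * k + degree (lrow ?t k) \<le> a"
      proof (cases "k = ?D")
        case True then show ?thesis using row by (simp add: a_def)
      next
        case False
        then have "k \<in> J" using k by (auto simp: J_def in_keys_iff)
        from le[OF this] show ?thesis by (simp add: a_def algebra_simps)
      qed
    qed
    show ?thesis
    proof (cases "a > 1")
      case a1: True
      define H where "H = wform \<xi> a ?t"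
      have cH: "coeff H (2 * d) = coeff (lrow ?t ?D) (2 * d)"
        unfolding H_def using \<xi>0 by (intro coeff_wform) (auto simp: a_def)
      then have "coeff H (2 * d) ~= 0" using row rowD by (metis leading_coeff_0_iff)
      moreover have "coeff H i = 0" if "2 * d < i" for i
        unfolding H_def
      proof (rule coeff_wform_0)
        fix k
        have "degree (lrow ?t k) \<le> 2 * d" using n by (simp add: nxle_def)
        then show "coeff (lrow ?t k) i = 0" using that by (intro coeff_eq_0) simp
      qed
      ultimately have dH: "degree H = 2 * d"
        by (metis degree_le le_antisym le_degree)
      have H1: "coeff H (2 * d - 1) = 0" unfolding H_def by (rule coeff_wform_0) (rule low)
      have "\<xi> * (real_of_int k0 + real d) = 2 * real d - real (degree (lrow ?t k0))"
        using k0(2) Jpos[OF k0(1)] by (simp add: r_def)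
      then have "real (degree (lrow ?t k0)) = a - \<xi> * k0" by (simp add: a_def algebra_simps)
      then have "coeff H (degree (lrow ?t k0)) = coeff (lrow ?t k0) (degree (lrow ?t k0))"
        unfolding H_def using \<xi>0 by (intro coeff_wform) auto
      then have Hj: "coeff H (degree (lrow ?t k0)) ~= 0" using k0(1) by (auto simp: J_def in_keys_iff)
      have j: "degree (lrow ?t k0) ~= 2 * d" using deg_less[of k0] k0(1) by (auto simp: J_def in_keys_iff)
      obtain s m H1 where root: "H = [:- s, 1:] ^ m * H1" "poly H1 s ~= 0" "1 \<le> m" "m \<le> d"
        using small_root[OF dH d H1 Hj j] by blast
      let ?f = "\<lambda>s. cx s * cx s"
      have f: "?f \<in> inv_ring anti" by (rule squares_inv_ring) auto
      have lf: "lexp ?f = lmon 2 1" by (simp add: mult_single)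
      have wf: "wle \<xi> (2 * \<xi>) (lexp ?f)" unfolding lf wle_mon by simp
      have F: "wform \<xi> (2 * \<xi>) (lexp ?f) = [:- s, 1:] ^ 0 * 1"
        unfolding lf by (simp add: tform_nat[of 0] pCons_one)
      have ne: "2 * \<xi> * m - a * (0::nat) + N * (a - m) ~= 0" for N :: nat
      proof -
        have "\<xi> * real d \<le> real d" using \<xi>1 \<xi>0 by (simp add: mult_left_le_one_le)
        then have "a - m \<ge> 0" using root(4) by (simp add: a_def)
        then have "N * (a - m) \<ge> 0" by simp
        moreover have "2 * \<xi> * m > 0" using \<xi>0 root(3) by simp
        ultimately show ?thesis by simp
      qed
      have False
        by (rule bounded_iterates_contradiction[OF w wf _ a1 good_bounded[OF h f] _ root(2,3) F _ ne])
          (use \<xi>0 root(1) H_def in auto)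
      then show ?thesis ..
    next
      case False
      have "real d * \<xi> \<le> real d * 1" using \<xi>1 by (intro mult_left_mono) auto
      then have "real d \<le> 1" using False by (simp add: a_def mult.commute)
      then have d1: "d = 1" using d by simp
      then have "\<xi> = 1" using False \<xi>1 by (simp add: a_def)
      then have "-1 < k \<and> k + int (degree (lrow ?t k)) \<le> 1" if k: "k ~= -1" "lrow ?t k ~= 0" for k
      proof -
        have kJ: "k \<in> J" using k d1 by (auto simp: J_def in_keys_iff)
        have "real_of_int (k + int (degree (lrow ?t k))) \<le> real_of_int 1"
          using le[OF kJ] \<open>\<xi> = 1\<close> d1 by simp
        then have "k + int (degree (lrow ?t k)) \<le> 1" by (simp only: of_int_le_iff)
        then show ?thesis using right[of k] k d1 by simp
      qed
      then show ?thesis using d1 by blast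
    qed
  qed
qed

lemma coeff_wfac_odd: "odd i ==> coeff ([:-1, 0, 1:] ^ n :: complex poly) i = 0"
proof -
  assume i: "odd i"
  let ?p = "[:-1, 0, 1:] ^ n :: complex poly"
  have "pcompose ?p [:0, -1:] = ?p"
    by (rule poly_eqI_cofinite[of "{}"]) (simp_all add: poly_pcompose poly_power)
  then have "(-1) ^ i * coeff ?p i = coeff ?p i" by (metis coeff_pcompose_linear)
  then show ?thesis using i by simp
qed

text \<open>
  A shear completes the power: it removes all terms of degree \<open>2 d - 1\<close> in \<open>z\<close>.
\<close>

lemma good_tschirnhaus:
  assumes h: "good anti h" and d: "d \<ge> 1" and n: "nxle (2 * d) h"
    and row: "degree (lrow (lexp h) (- int d)) = 2 * d"
  obtains p where "qaut anti (shear p) (shear (- p))" "nxle (2 * d) (\<lambda>s. h (shear p s))"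
    "degree (lrow (lexp (\<lambda>s. h (shear p s))) (- int d)) = 2 * d"
    "\<And>k. coeff (lrow (lexp (\<lambda>s. h (shear p s))) k) (2 * d - 1) = 0"
proof -
  let ?t = "lexp h" and ?D = "- int d"
  have hq: "h \<in> qring" using h by (simp add: good_def)
  have rowD: "lrow ?t ?D ~= 0" using row d by auto
  have le: "degree (lrow ?t k) \<le> 2 * d" for k using n by (simp add: nxle_def)
  define c where "c = coeff (lrow ?t ?D) (2 * d)"
  have c: "c ~= 0" using row rowD by (metis c_def leading_coeff_0_iff)
  have c2: "coeff (lrow ?t k) (2 * d) = 0" if "k ~= ?D" for k
  proof (rule ccontr)
    assume a: "coeff (lrow ?t k) (2 * d) ~= 0"
    then have "degree (lrow ?t k) = 2 * d" using le[of k] le_degree[OF a] by simp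
    moreover have "lrow ?t k ~= 0" using a by auto
    ultimately show False using good_max_rows[OF h n] d that by fastforce
  qed
  define K where "K = {k \<in> lkeys ?t. coeff (lrow ?t k) (2 * d - 1) ~= 0}"
  have K: "finite K" by (simp add: K_def)
  have Kpos: "?D < k" if "k \<in> K" for k
  proof -
    have nz: "lrow ?t k ~= 0" using that by (auto simp: K_def)
    have "- 2 * k \<le> 2 * int d" using lrow_degree_ge[OF hq nz] le[of k] by linarith
    moreover have "k ~= ?D"
    proof
      assume kD: "k = ?D"
      have "wfac ?D dvd lrow ?t ?D" using lshape_lexp[OF hq] by (simp add: lshape_def)
      then obtain q where q: "lrow ?t ?D = wfac ?D * q" by (elim dvdE)
      then have "q ~= 0" using rowD by auto
      then have "degree (lrow ?t ?D) = 2 * d + degree q" by (simp add: q degree_mult_eq degree_wfac)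
      then obtain a where "q = [:a:]" using row by (metis add_cancel_left_right degree_eq_zeroE)
      then have "lrow ?t ?D = smult a ([:-1, 0, 1:] ^ d)" by (simp add: q wfac_def)
      moreover have "odd (2 * d - 1)" using d by simp
      ultimately have "coeff (lrow ?t ?D) (2 * d - 1) = 0" by (simp add: coeff_wfac_odd)
      then show False using that kD by (simp add: K_def)
    qed
    ultimately show ?thesis by simp
  qed
  let ?c = "\<lambda>k. - coeff (lrow ?t k) (2 * d - 1) / (of_nat (2 * d) * c)"
  obtain p where p: "\<And>x. x ~= 0 ==> x * poly p x * x powi ?D = (\<Sum>k\<in>K. ?c k * x powi k)"
    "\<And>i. coeff p i ~= 0 ==> ?D + 1 + int i \<in> K \<and> ?c (?D + 1 + int i) ~= 0"
    using shear_poly[OF K Kpos, of ?c] by blast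
  have qa: "qaut anti (shear p) (shear (- p))"
  proof (rule qaut_shear, rule even_poly_pcompose)
    fix i assume anti and i: "coeff p i ~= 0"
    then have g: "good True h" using h by simp
    have "coeff (lrow ?t (?D + 1 + int i)) (2 * d - 1) ~= 0" using p(2)[OF i] by (simp add: K_def)
    from good_parity[OF g this] have "odd (?D + 1 + int i + int (2 * d - 1))" .
    moreover have "odd (?D + int (2 * d))" using good_parity[OF g] c unfolding c_def by blast
    ultimately show "even i" using d by (simp add: of_nat_diff)
  qed
  let ?h = "\<lambda>s. h (shear p s)"
  let ?u = "lexp ?h"
  have hq': "?h \<in> qring" using qa hq by (rule qaut_qring)
  have ev: "evl ?u x = pcompose (evl ?t x) [:x * poly p x, 1:]" if x: "x ~= 0" for x
  proof (rule poly_eqI_cofinite[of "{}"])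
    fix z
    show "poly (evl ?u x) z = poly (pcompose (evl ?t x) [:x * poly p x, 1:]) z"
      using poly_lexp[OF hq' x, of z] poly_lexp[OF hq x, of "z + x * poly p x"] x
      by (simp add: shear_chart poly_pcompose add.commute)
  qed simp
  have degt: "degree (evl ?t x) \<le> 2 * d" for x
    unfolding evl_def by (rule degree_sum_le[OF finite_keys]) (rule order_trans[OF degree_smult_le le])
  have top: "coeff (lrow ?u k) (2 * d) = coeff (lrow ?t k) (2 * d)" for k
  proof (rule lrow_coeffs_eqI[where K = "lkeys ?t"])
    fix x :: complex assume x: "x ~= 0"
    show "coeff (evl ?u x) (2 * d) = (\<Sum>k\<in>lkeys ?t. coeff (lrow ?t k) (2 * d) * x powi k)"
      unfolding ev[OF x] coeff_pcompose_shift_top[OF degt] by (rule coeff_evl) auto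
  qed (auto simp: in_keys_iff)
  have above: "coeff (lrow ?u k) i = 0" if "2 * d < i" for k i
  proof (rule lrow_coeffs_eqI[where K = "{}" and c = "\<lambda>_. 0"])
    fix x :: complex assume x: "x ~= 0"
    have "degree (pcompose (evl ?t x) [:x * poly p x, 1:]) \<le> 2 * d"
      using degt[of x] by (simp add: degree_pcompose)
    then show "coeff (evl ?u x) i = (\<Sum>k\<in>{}. 0 * x powi k)"
      using that by (simp add: ev[OF x] coeff_eq_0)
  qed auto
  have n': "degree (lrow ?u k) \<le> 2 * d" for k
    using above[of _ k] by (intro degree_le) auto
  moreover have "coeff (lrow ?u ?D) (2 * d) ~= 0" using top c by (simp add: c_def)
  ultimately have "degree (lrow ?u ?D) = 2 * d" by (meson le_antisym le_degree)
  moreover have "coeff (lrow ?u k) (2 * d - 1) = 0" for k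
  proof (rule lrow_coeffs_eqI[where K = "{}" and c = "\<lambda>_. 0"])
    fix x :: complex assume x: "x ~= 0"
    obtain e where e: "2 * d = Suc e" using d by (cases "2 * d") auto
    have "coeff (evl ?t x) (2 * d) = (\<Sum>k\<in>insert ?D (lkeys ?t). coeff (lrow ?t k) (2 * d) * x powi k)"
      by (rule coeff_evl) auto
    also have "\<dots> = (\<Sum>k\<in>insert ?D (lkeys ?t). if k = ?D then c * x powi ?D else 0)"
      by (intro sum.cong refl) (auto simp: c_def c2)
    finally have 1: "coeff (evl ?t x) (2 * d) = c * x powi ?D" by simp
    have 2: "coeff (evl ?t x) e = (\<Sum>k\<in>K. coeff (lrow ?t k) (2 * d - 1) * x powi k)"
    proof -
      have e1: "2 * d - 1 = e" using e by simp
      show ?thesis unfolding coeff_evl[OF finite_keys order_refl] e1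
        by (rule sum.mono_neutral_right) (use e1 in \<open>auto simp: K_def\<close>)
    qed
    have "of_nat (Suc e) * (x * poly p x) * (c * x powi ?D) =
        of_nat (2 * d) * c * (x * poly p x * x powi ?D)" unfolding e by simp
    also have "\<dots> = (\<Sum>k\<in>K. - (coeff (lrow ?t k) (2 * d - 1) * x powi k))"
      unfolding p(1)[OF x] sum_distrib_left using c d by (intro sum.cong refl) simp
    finally have 3: "of_nat (Suc e) * (x * poly p x) * (c * x powi ?D) =
        - (\<Sum>k\<in>K. coeff (lrow ?t k) (2 * d - 1) * x powi k)" by (simp add: sum_negf)
    have "coeff (evl ?u x) e = coeff (evl ?t x) e + of_nat (Suc e) * (x * poly p x) * coeff (evl ?t x) (Suc e)"
      unfolding ev[OF x] by (rule coeff_pcompose_shift) (use degt[of x] e in simp)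
    then have "coeff (evl ?u x) e = 0" using 1 2 3 by (simp add: e)
    then show "coeff (evl ?u x) (2 * d - 1) = (\<Sum>k\<in>{}. 0 * x powi k)" by (simp add: e)
  qed auto
  ultimately show ?thesis using that[OF qa] n' by (simp add: nxle_def)
qed

lemma good_quadratic:
  assumes h: "good anti h" and row: "degree (lrow (lexp h) (-1)) = 2"
    and low: "\<And>k. coeff (lrow (lexp h) k) 1 = 0"
    and rows: "\<And>k. k ~= -1 ==> lrow (lexp h) k ~= 0 ==> -1 < k \<and> k + int (degree (lrow (lexp h) k)) \<le> 1"
  shows "reducible_to_linear anti h"
proof -
  let ?t = "lexp h"
  have hq: "h \<in> qring" using h by (simp add: good_def)
  have "wfac (-1) dvd lrow ?t (-1)" using lshape_lexp[OF hq] by (simp add: lshape_def)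
  then obtain q where q: "lrow ?t (-1) = wfac (-1) * q" by (elim dvdE)
  then have "q ~= 0" using row by auto
  then have "degree (lrow ?t (-1)) = 2 + degree q" by (simp add: q degree_mult_eq degree_wfac)
  then obtain c where "q = [:c:]" using row by (metis add_cancel_left_right degree_eq_zeroE)
  then have rm: "lrow ?t (-1) = [:- c, 0, c:]" by (simp add: q wfac_def)
  have c: "c ~= 0" using row by (auto simp: rm)
  have "degree (lrow ?t 0) = 0"
  proof (rule ccontr)
    assume "degree (lrow ?t 0) ~= 0"
    then have "degree (lrow ?t 0) = 1" "lrow ?t 0 ~= 0" using rows[of 0] by (cases "lrow ?t 0 = 0"; auto)+
    then show False using low[of 0] by (metis leading_coeff_0_iff)
  qed
  then obtain c0 where r0: "lrow ?t 0 = [:c0:]" by (rule degree_eq_zeroE)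
  have "degree (lrow ?t 1) = 0" using rows[of 1] by (cases "lrow ?t 1 = 0") auto
  then obtain e where r1: "lrow ?t 1 = [:e:]" by (rule degree_eq_zeroE)
  have other: "lrow ?t k = 0" if "k ~= -1" "k ~= 0" "k ~= 1" for k
    using rows[of k] that by (cases "lrow ?t k = 0") auto
  let ?f = "\<lambda>s. c * cy s + c0 + e * cx s"
  have fq: "?f \<in> qring" by (intro qring_add qring_cmult) auto
  have "lexp ?f = lmon (-1) [:- c, 0, c:] + lmon 0 [:c0:] + lmon 1 [:e:]"
    by (simp add: mult_single)
  also have "\<dots> = ?t"
    by (rule poly_mapping_eqI) (auto simp: lookup_add lookup_single when_def rm r0 r1 other)
  finally have hf: "h s = ?f s" if "s \<in> quadric" for s
    using lexp_eqD[of h ?f s] hq fq that by simp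
  define l where "l = csqrt (- e / c)"
  have l: "c * l ^ 2 = - e" using c by (simp add: l_def)
  let ?\<phi> = "shear [:l:]"
  have qa: "qaut anti ?\<phi> (shear (- [:l:]))" by (rule qaut_shear) simp
  let ?h1 = "\<lambda>s. h (?\<phi> s)"
  let ?h2 = "\<lambda>s. ?h1 (qswap s)"
  have g2: "good anti ?h2" by (rule good_qaut[OF good_qaut[OF h qa] qaut_qswap])
  have h2: "?h2 s = (c * cx s + c0) + (- 2 * c * l) * cz s" if s: "s \<in> quadric" for s
  proof -
    have "?\<phi> (qswap s) \<in> quadric" using qaut_quadric[OF qa] qaut_quadric[OF qaut_qswap s] by blast
    then have "?h2 s = c * (cx s + 2 * (- cz s) * l + cy s * l ^ 2) + c0 + e * cy s"
      by (simp add: hf)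
    also have "\<dots> = c * cx s + c0 + (- 2 * c * l) * cz s + (c * l ^ 2 + e) * cy s"
      by (simp add: algebra_simps)
    finally show ?thesis using l by simp
  qed
  have "lexp ?h2 = lexp (\<lambda>s. (c * cx s + c0) + (- 2 * c * l) * cz s)"
    by (rule lexp_cong) (rule h2)
  also have "\<dots> = lmon 1 [:c:] + lmon 0 [:c0:] + lmon 0 [:0, - 2 * c * l:]"
  proof -
    have "(\<lambda>s. (- 2 * c * l) * cz s) \<in> qring" "(\<lambda>s. c * cx s + c0) \<in> qring"
      by (intro qring_add qring_cmult, simp_all)
    moreover have "- lmon 0 [:0, 2 * c * l:] = lmon 0 [:0, - (2 * c * l):]"
      by (simp flip: single_uminus)
    ultimately show ?thesis by (subst lexp_add) (simp_all add: mult_single)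
  qed
  finally have "nxle 1 ?h2"
    unfolding nxle_def by (auto simp: lookup_add lookup_single when_def)
  then have "reducible_to_linear anti ?h2" by (rule good_nxle_1[OF g2])
  then have "reducible_to_linear anti ?h1" by (rule reducible_qaut[OF qaut_qswap])
  then show ?thesis by (rule reducible_qaut[OF qa])
qed

text \<open>
  The induction is on the sum of the degrees in \<open>z\<close> in the two charts \<open>x \<noteq> 0\<close> and \<open>y \<noteq> 0\<close>;
  completing the power in the chart with the smaller degree lowers the degree in the other one.
\<close>

theorem good_reducible: "good anti h ==> reducible_to_linear anti h"
proof -
  have main: "reducible_to_linear anti h"
    if "good anti h" "nxle a h" "nyle b h" "a + b \<le> N" for h a b N
    using that
  proof (induction N arbitrary: h a b rule: less_induct)
    case (less N)
    have step: "reducible_to_linear anti h"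
      if h: "good anti h" and a: "nxle a h" and ab: "a \<le> b" "a + b \<le> N" for h a b
    proof -
      define n where "n = (LEAST n. nxle n h)"
      have n: "nxle n h" unfolding n_def using a by (rule LeastI)
      have na: "n \<le> a" unfolding n_def using a by (rule Least_le)
      have n0: "n ~= 0" using n good_not_nxle_0[OF h] by metis
      show ?thesis
      proof (cases "n = 1")
        case True then show ?thesis using good_nxle_1[OF h] n by simp
      next
        case False
        have "\<not> nxle (n - 1) h"
        proof
          assume "nxle (n - 1) h"
          then have "n \<le> n - 1" unfolding n_def by (rule Least_le)
          then show False using n0 by simp
        qed
        from max_degree_row[OF n this] obtain k where
          k: "lrow (lexp h) k ~= 0" "degree (lrow (lexp h) k) = n" by blast
        have "int n = - 2 * k" using good_max_rows[OF h n _ k] n0 False by auto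
        define d where "d = nat (- k)"
        have kd: "k = - int d" "n = 2 * d" "d \<ge> 1" using \<open>int n = - 2 * k\<close> n0 by (auto simp: d_def)
        obtain p where p: "qaut anti (shear p) (shear (- p))" "nxle (2 * d) (\<lambda>s. h (shear p s))"
          "degree (lrow (lexp (\<lambda>s. h (shear p s))) (- int d)) = 2 * d"
          "\<And>k. coeff (lrow (lexp (\<lambda>s. h (shear p s))) k) (2 * d - 1) = 0"
          using good_tschirnhaus[OF h kd(3)] n k kd by metis
        let ?h = "\<lambda>s. h (shear p s)"
        have g: "good anti ?h" by (rule good_qaut[OF h p(1)])
        have "reducible_to_linear anti ?h"
          using good_edge[OF g kd(3) p(2,3,4)]
        proof (elim disjE)
          assume e: "\<forall>k. k ~= - int d --> lrow (lexp ?h) k ~= 0 -->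
            - int d < k \<and> k + int (degree (lrow (lexp ?h) k)) < int d"
          have "nyle (2 * d - 1) ?h"
            unfolding nyle_def
          proof (intro allI impI)
            fix k assume "lrow (lexp ?h) k ~= 0"
            then show "2 * k + int (degree (lrow (lexp ?h) k)) \<le> int (2 * d - 1)"
              using e[rule_format, of k] p(3) kd(3) by (cases "k = - int d") (auto simp: of_nat_diff)
          qed
          moreover have "2 * d + (2 * d - 1) < N" using kd na ab by linarith
          ultimately show ?thesis using less.IH[OF _ g p(2)] by blast
        next
          assume e: "d = 1 \<and> (\<forall>k. k ~= -1 --> lrow (lexp ?h) k ~= 0 -->
            -1 < k \<and> k + int (degree (lrow (lexp ?h) k)) \<le> 1)"
          then show ?thesis using p(3,4) by (intro good_quadratic[OF g]) auto
        qed
        then show ?thesis by (rule reducible_qaut[OF p(1)])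
      qed
    qed
    show ?case
    proof (cases "a \<le> b")
      case True then show ?thesis using step less.prems by blast
    next
      case False
      have hq: "h \<in> qring" using less.prems(1) by (simp add: good_def)
      have "reducible_to_linear anti (\<lambda>s. h (qswap s))"
        using good_qaut[OF less.prems(1) qaut_qswap] nxle_swap[OF hq less.prems(3)] False less.prems(4)
        by (intro step[of _ b a]) auto
      then show ?thesis by (rule reducible_qaut[OF qaut_qswap])
    qed
  qed
  assume h: "good anti h"
  have ex: "\<exists>n. nxle n h" if "h \<in> qring" for h
  proof -
    have "nxle (\<Sum>k\<in>lkeys (lexp h). degree (lrow (lexp h) k)) h"
      unfolding nxle_def
    proof
      fix k
      show "degree (lrow (lexp h) k) \<le> (\<Sum>k\<in>lkeys (lexp h). degree (lrow (lexp h) k))"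
        by (cases "k \<in> lkeys (lexp h)") (auto intro!: member_le_sum simp: in_keys_iff)
    qed
    then show ?thesis by blast
  qed
  have hq: "h \<in> qring" using h by (simp add: good_def)
  obtain a where a: "nxle a h" using ex[OF hq] by blast
  have "(\<lambda>s. h (qswap s)) \<in> qring" using qaut_qswap hq by (rule qaut_qring)
  then obtain b where "nxle b (\<lambda>s. h (qswap s))" using ex by blast
  then have "nyle b (\<lambda>s. h (qswap (qswap s)))"
    using nyle_swap[of "\<lambda>s. h (qswap s)" b] qaut_qring[OF qaut_qswap hq] by simp
  then have "nyle b h" by simp
  then show ?thesis using main[OF h a] by blast
qed

section \<open>Even functions\<close>

inductive_set evenfun :: "(pt => complex) set" where
  const: "(\<lambda>_. c) \<in> evenfun"
| prod: "u \<in> {cx, cy, cz} ==> v \<in> {cx, cy, cz} ==> (\<lambda>s. u s * v s) \<in> evenfun"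
| add: "f \<in> evenfun ==> g \<in> evenfun ==> (\<lambda>s. f s + g s) \<in> evenfun"
| mult: "f \<in> evenfun ==> g \<in> evenfun ==> (\<lambda>s. f s * g s) \<in> evenfun"

lemma evenfun_uminus: "f \<in> evenfun ==> f (- s) = f s"
  by (induction rule: evenfun.induct) auto

lemma evenfun_inv_ring: "f \<in> evenfun ==> f \<in> inv_ring anti"
proof -
  assume f: "f \<in> evenfun"
  then have "f \<in> qring" by (induction rule: evenfun.induct) auto
  then show ?thesis using evenfun_uminus[OF f] by (simp add: inv_ring_def)
qed

lemma inv_ring_evenfun:
  assumes f: "f \<in> inv_ring True"
  obtains g where "g \<in> evenfun" "\<And>s. s \<in> quadric ==> f s = g s"
proof -
  define odf where "odf = {o'. \<exists>a b c. a \<in> evenfun \<and> b \<in> evenfun \<and> c \<in> evenfun \<and>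
    o' = (\<lambda>s. cx s * a s + cy s * b s + cz s * c s)}"
  have zero: "(\<lambda>_. 0) \<in> evenfun" and one: "(\<lambda>_. 1) \<in> evenfun" by (rule evenfun.const)+
  have odfI: "(\<lambda>s. cx s * a s + cy s * b s + cz s * c s) \<in> odf"
    if "a \<in> evenfun" "b \<in> evenfun" "c \<in> evenfun" for a b c using that by (auto simp: odf_def)
  have odf_add: "(\<lambda>s. p s + q s) \<in> odf" if pq: "p \<in> odf" "q \<in> odf" for p q
  proof -
    obtain a b c where 1: "a \<in> evenfun" "b \<in> evenfun" "c \<in> evenfun"
      and p: "p = (\<lambda>s. cx s * a s + cy s * b s + cz s * c s)" using pq(1) by (auto simp: odf_def)
    obtain a' b' c' where 2: "a' \<in> evenfun" "b' \<in> evenfun" "c' \<in> evenfun"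
      and q: "q = (\<lambda>s. cx s * a' s + cy s * b' s + cz s * c' s)" using pq(2) by (auto simp: odf_def)
    have "(\<lambda>s. p s + q s) = (\<lambda>s. cx s * (a s + a' s) + cy s * (b s + b' s) + cz s * (c s + c' s))"
      by (simp add: p q algebra_simps)
    then show ?thesis using odfI[OF evenfun.add[OF 1(1) 2(1)] evenfun.add[OF 1(2) 2(2)] evenfun.add[OF 1(3) 2(3)]]
      by simp
  qed
  have odf_mult: "(\<lambda>s. e s * p s) \<in> odf" if e: "e \<in> evenfun" and p: "p \<in> odf" for e p
  proof -
    obtain a b c where 1: "a \<in> evenfun" "b \<in> evenfun" "c \<in> evenfun"
      and p: "p = (\<lambda>s. cx s * a s + cy s * b s + cz s * c s)" using p by (auto simp: odf_def)
    have "(\<lambda>s. e s * p s) = (\<lambda>s. cx s * (e s * a s) + cy s * (e s * b s) + cz s * (e s * c s))"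
      by (simp add: p algebra_simps)
    then show ?thesis using odfI[OF evenfun.mult[OF e 1(1)] evenfun.mult[OF e 1(2)] evenfun.mult[OF e 1(3)]]
      by simp
  qed
  have odf_odf: "(\<lambda>s. p s * q s) \<in> evenfun" if pq: "p \<in> odf" "q \<in> odf" for p q
  proof -
    have lin: "(\<lambda>s. u s * q s) \<in> evenfun" if u: "u \<in> {cx, cy, cz}" for u
    proof -
      obtain a' b' c' where 2: "a' \<in> evenfun" "b' \<in> evenfun" "c' \<in> evenfun"
        and q: "q = (\<lambda>s. cx s * a' s + cy s * b' s + cz s * c' s)" using pq(2) by (auto simp: odf_def)
      have "(\<lambda>s. (u s * cx s) * a' s + (u s * cy s) * b' s + (u s * cz s) * c' s) \<in> evenfun"
        by (rule evenfun.add[OF evenfun.add[OF evenfun.mult[OF evenfun.prod[OF u] 2(1)]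
          evenfun.mult[OF evenfun.prod[OF u] 2(2)]] evenfun.mult[OF evenfun.prod[OF u] 2(3)]]) simp_all
      moreover have "(\<lambda>s. u s * q s) = (\<lambda>s. (u s * cx s) * a' s + (u s * cy s) * b' s + (u s * cz s) * c' s)"
        by (simp add: q algebra_simps)
      ultimately show ?thesis by simp
    qed
    obtain a b c where 1: "a \<in> evenfun" "b \<in> evenfun" "c \<in> evenfun"
      and p: "p = (\<lambda>s. cx s * a s + cy s * b s + cz s * c s)" using pq(1) by (auto simp: odf_def)
    have "(\<lambda>s. (cx s * q s) * a s + (cy s * q s) * b s + (cz s * q s) * c s) \<in> evenfun"
      by (rule evenfun.add[OF evenfun.add[OF evenfun.mult[OF lin 1(1)] evenfun.mult[OF lin 1(2)]]
        evenfun.mult[OF lin 1(3)]]) simp_all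
    moreover have "(\<lambda>s. p s * q s) = (\<lambda>s. (cx s * q s) * a s + (cy s * q s) * b s + (cz s * q s) * c s)"
      by (simp add: p algebra_simps)
    ultimately show ?thesis by simp
  qed
  have odf_uminus: "p (- s) = - p s" if "p \<in> odf" for p s
    using that by (auto simp: odf_def evenfun_uminus)
  have odf_zero: "(\<lambda>_. 0) \<in> odf" using odfI[OF zero zero zero] by simp
  have coords: "cx \<in> odf" "cy \<in> odf" "cz \<in> odf"
    using odfI[OF one zero zero] odfI[OF zero one zero] odfI[OF zero zero one] by simp_all
  have split: "\<exists>e\<in>evenfun. \<exists>p\<in>odf. P = (\<lambda>s. e s + p s)" if "P \<in> polyfun" for P
    using that
  proof induction
    case (const c)
    show ?case using evenfun.const[of c] odf_zero by (intro bexI[of _ "\<lambda>_. c"] bexI[of _ "\<lambda>_. 0"]) auto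
  next
    case (add f g)
    then obtain e p e' p' where "e \<in> evenfun" "p \<in> odf" "f = (\<lambda>s. e s + p s)"
      "e' \<in> evenfun" "p' \<in> odf" "g = (\<lambda>s. e' s + p' s)" by blast
    then show ?case
      by (intro bexI[of _ "\<lambda>s. e s + e' s"] bexI[of _ "\<lambda>s. p s + p' s"])
        (auto intro: evenfun.add odf_add simp: algebra_simps)
  next
    case (mult f g)
    then obtain e p e' p' where ep: "e \<in> evenfun" "p \<in> odf" "f = (\<lambda>s. e s + p s)"
      "e' \<in> evenfun" "p' \<in> odf" "g = (\<lambda>s. e' s + p' s)" by blast
    show ?case
    proof (intro bexI)
      show "(\<lambda>s. f s * g s) = (\<lambda>s. (e s * e' s + p s * p' s) + (e s * p' s + e' s * p s))"
        by (simp add: ep(3,6) algebra_simps)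
      show "(\<lambda>s. e s * p' s + e' s * p s) \<in> odf"
        by (rule odf_add[OF odf_mult[OF ep(1,5)] odf_mult[OF ep(4,2)]])
      show "(\<lambda>s. e s * e' s + p s * p' s) \<in> evenfun"
        by (rule evenfun.add[OF evenfun.mult[OF ep(1,4)] odf_odf[OF ep(2,5)]])
    qed
  qed (use zero coords in \<open>force+\<close>)
  obtain P where P: "P \<in> polyfun" "\<And>s. s \<in> quadric ==> f s = P s"
    using f unfolding inv_ring_def qring_def by blast
  obtain e p where ep: "e \<in> evenfun" "p \<in> odf" "P = (\<lambda>s. e s + p s)" using split[OF P(1)] by blast
  have "f s = e s" if s: "s \<in> quadric" for s
  proof -
    have "f (- s) = f s" using f s by (simp add: inv_ring_def)
    then have "e s - p s = e s + p s"
      using P(2)[OF s] P(2)[of "- s"] s by (simp add: ep(3) evenfun_uminus[OF ep(1)] odf_uminus[OF ep(2)])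
    then show ?thesis using P(2)[OF s] by (simp add: ep(3))
  qed
  then show ?thesis using that ep(1) by blast
qed

lemma qbr_parity:
  assumes f: "f \<in> qring" and g: "g \<in> qring" and s: "s \<in> quadric"
    and fe: "\<And>s. s \<in> quadric ==> f (- s) = a * f s" and ge: "\<And>s. s \<in> quadric ==> g (- s) = b * g s"
  shows "qbr f g (- s) = - (a * b) * qbr f g s"
proof -
  have pm: "polymap (\<lambda>s. - s)"
    using polyfun.mult[OF polyfun.const[of "-1"] polyfun.cx] polyfun.mult[OF polyfun.const[of "-1"] polyfun.cy]
      polyfun.mult[OF polyfun.const[of "-1"] polyfun.cz] by (auto simp: polymap_def quadric_iff)
  have k: "qbr f g \<in> qring" using f g by (rule qbr(1))
  have "lmon 0 [:-1:] * lexp (\<lambda>s. qbr f g (- s)) = br (lexp (\<lambda>s. f (- s))) (lexp (\<lambda>s. g (- s)))"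
    using poisson_scalingD[OF poisson_scaling_uminus f g] by simp
  also have "lexp (\<lambda>s. f (- s)) = lexp (\<lambda>s. a * f s)" using fe by (rule lexp_cong)
  also have "lexp (\<lambda>s. g (- s)) = lexp (\<lambda>s. b * g s)" using ge by (rule lexp_cong)
  also have "br (lexp (\<lambda>s. a * f s)) (lexp (\<lambda>s. b * g s)) = lmon 0 [:a:] * (lmon 0 [:b:] * br (lexp f) (lexp g))"
    using f g by (simp add: br_mult_left br_mult_right)
  also have "\<dots> = lexp (\<lambda>s. a * (b * qbr f g s))"
    using k qbr(2)[OF f g] by simp
  finally have "lexp (\<lambda>s. - qbr f g (- s)) = lexp (\<lambda>s. a * (b * qbr f g s))"
    using polymap_qring[OF pm k] by (simp add: lmon_minus_1)
  then have "- qbr f g (- s) = a * (b * qbr f g s)"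
    using polymap_qring[OF pm k] k s by (intro lexp_eqD[of "\<lambda>s. - qbr f g (- s)"]) auto
  then show ?thesis by (simp add: algebra_simps) (metis minus_equation_iff)
qed

section \<open>Diagonalisable derivations are Hamiltonian\<close>

lemma poly_antiderivative: "\<exists>q. pderiv q = (p :: complex poly)"
proof (induction "degree p" arbitrary: p rule: less_induct)
  case less
  define n where "n = degree p"
  define m where "m = monom (coeff p n / of_nat (Suc n)) (Suc n)"
  have dm: "pderiv m = monom (coeff p n) n" by (simp add: m_def pderiv_monom del: of_nat_Suc)
  show ?case
  proof (cases "n = 0")
    case True
    then have "p = monom (coeff p n) n" using degree_0_id[of p] by (simp add: n_def monom_0)
    then show ?thesis using dm by metis
  next
    case False
    define p' where "p' = p - monom (coeff p n) n"
    have "degree p' \<le> n" unfolding p'_def n_def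
      by (rule degree_diff_le) (auto simp: degree_monom_le)
    moreover have "coeff p' n = 0" by (simp add: p'_def)
    ultimately have "degree p' < n" using False by (metis leading_coeff_0_iff le_neq_implies_less degree_0 not_gr_zero)
    then obtain q where "pderiv q = p'" using less n_def by blast
    then have "pderiv (q + m) = p" by (simp add: pderiv_add dm p'_def)
    then show ?thesis by blast
  qed
qed

text \<open>
  In a graded domain, an element by which a homogeneous equation of this kind multiplies a
  nonzero element must be a constant: otherwise the product of the extreme components would
  have a weight that does not occur on the other side.
\<close>

lemma eigen_multiplier_const:
  fixes D :: "laur => laur" and e W :: laur
  assumes add: "\<And>f g. D (f + g) = D f + D g" and scale: "\<And>c f. D (lmon 0 [:c:] * f) = lmon 0 [:c:] * D f"
    and leib: "\<And>f g. D (f * g) = f * D g + g * D f"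
    and L: "finite L" "\<And>l. l \<in> L ==> D (E l) = lmon 0 [:of_int l:] * E l" "e = (\<Sum>l\<in>L. E l)"
    and M: "finite M" "\<And>m. m \<in> M ==> D (V m) = lmon 0 [:of_int m:] * V m" "W = (\<Sum>m\<in>M. V m)"
    and W: "W ~= 0" and eq: "D W = lmon 0 [:c:] * W - 2 * e * W"
  shows "\<exists>c. e = lmon 0 [:c:]"
proof -
  define L' where "L' = {l \<in> L. E l ~= 0}"
  define M' where "M' = {m \<in> M. V m ~= 0}"
  have fin: "finite L'" "finite M'" using L(1) M(1) by (simp_all add: L'_def M'_def)
  have eL: "e = (\<Sum>l\<in>L'. E l)" unfolding L(3) L'_def using L(1) by (intro sum.mono_neutral_right) auto
  have WM: "W = (\<Sum>m\<in>M'. V m)" unfolding M(3) M'_def using M(1) by (intro sum.mono_neutral_right) auto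
  have M'ne: "M' ~= {}" using W WM by auto
  define N where "N = M' \<union> (\<lambda>(l, m). l + m) ` (L' \<times> M')"
  have N: "finite N" using fin by (simp add: N_def)
  define u where "u n = (if n \<in> M' then lmon 0 [:c - of_int n:] * V n else 0) -
    2 * (\<Sum>l\<in>L'. if n - l \<in> M' then E l * V (n - l) else 0)" for n
  have D0: "D 0 = 0" using scale[of 0 0] by simp
  have Dsum: "D (sum g A) = (\<Sum>a\<in>A. D (g a))" for g and A :: "int set"
    by (induction A rule: infinite_finite_induct) (auto simp: add D0)
  have c1: "lmon 0 [:-1:] = -1" by (rule lmon_minus_1)
  have Dminus: "D (- f) = - D f" for f using scale[of "-1" f] by (simp add: c1)
  have Ddiff: "D (f - g) = D f - D g" for f g using add[of f "- g"] Dminus[of g] by simp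
  have D2: "D (2 * f) = 2 * D f" for f using add[of f f] by simp
  have u_eig: "D (u n) = lmon 0 [:of_int n:] * u n" for n
  proof -
    have t1: "D (if n \<in> M' then lmon 0 [:c - of_int n:] * V n else 0) =
        lmon 0 [:of_int n:] * (if n \<in> M' then lmon 0 [:c - of_int n:] * V n else 0)"
      using M(2)[of n] by (auto simp: scale D0 M'_def mult.left_commute)
    have t2: "D (if n - l \<in> M' then E l * V (n - l) else 0) =
        lmon 0 [:of_int n:] * (if n - l \<in> M' then E l * V (n - l) else 0)" if "l \<in> L'" for l
    proof (cases "n - l \<in> M'")
      case True
      have s: "lmon 0 [:of_int n:] = lmon 0 [:of_int (n - l):] + lmon 0 [:of_int l:]"
        by (simp add: single_add[symmetric])
      have "D (E l * V (n - l)) = E l * (lmon 0 [:of_int (n - l):] * V (n - l)) + V (n - l) * (lmon 0 [:of_int l:] * E l)"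
        using True that L(2)[of l] M(2)[of "n - l"] by (simp add: leib L'_def M'_def)
      also have "\<dots> = lmon 0 [:of_int n:] * (E l * V (n - l))"
        unfolding s by (simp add: algebra_simps)
      finally show ?thesis using True by simp
    qed (simp add: D0)
    have "D (\<Sum>l\<in>L'. if n - l \<in> M' then E l * V (n - l) else 0) =
        lmon 0 [:of_int n:] * (\<Sum>l\<in>L'. if n - l \<in> M' then E l * V (n - l) else 0)"
      unfolding Dsum sum_distrib_left by (intro sum.cong refl t2)
    then show ?thesis unfolding u_def Ddiff t1 D2 by (simp add: algebra_simps)
  qed
  have s1: "(\<Sum>n\<in>N. if n \<in> M' then lmon 0 [:c - of_int n:] * V n else 0) = lmon 0 [:c:] * W - D W"
  proof -
    have "(\<Sum>n\<in>N. if n \<in> M' then lmon 0 [:c - of_int n:] * V n else 0) = (\<Sum>n\<in>M'. lmon 0 [:c - of_int n:] * V n)"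
      using N by (intro sum.mono_neutral_cong_right) (auto simp: N_def)
    also have "\<dots> = (\<Sum>n\<in>M'. lmon 0 [:c:] * V n - D (V n))"
    proof (intro sum.cong refl)
      fix n assume "n \<in> M'"
      then have "D (V n) = lmon 0 [:of_int n:] * V n" using M(2) by (simp add: M'_def)
      moreover have "lmon 0 [:c - of_int n:] = lmon 0 [:c:] - lmon 0 [:of_int n:]"
        by (simp add: single_diff[symmetric])
      ultimately show "lmon 0 [:c - of_int n:] * V n = lmon 0 [:c:] * V n - D (V n)" by (simp add: left_diff_distrib)
    qed
    also have "\<dots> = lmon 0 [:c:] * W - D W" unfolding WM Dsum sum_subtractf sum_distrib_left ..
    finally show ?thesis .
  qed
  have s2: "(\<Sum>n\<in>N. \<Sum>l\<in>L'. if n - l \<in> M' then E l * V (n - l) else 0) = e * W"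
  proof -
    have "(\<Sum>n\<in>N. \<Sum>l\<in>L'. if n - l \<in> M' then E l * V (n - l) else 0) =
        (\<Sum>l\<in>L'. \<Sum>n\<in>N. if n - l \<in> M' then E l * V (n - l) else 0)" by (rule sum.swap)
    also have "\<dots> = (\<Sum>l\<in>L'. \<Sum>m\<in>M'. E l * V m)"
    proof (rule sum.cong[OF refl])
      fix l assume l: "l \<in> L'"
      have "(\<Sum>n\<in>N. if n - l \<in> M' then E l * V (n - l) else 0) = (\<Sum>n\<in>(\<lambda>m. l + m) ` M'. E l * V (n - l))"
      proof (rule sum.mono_neutral_cong_right)
        have img: "n \<in> (\<lambda>m. l + m) ` M' \<longleftrightarrow> n - l \<in> M'" for n
          by (force simp: image_iff)
        show "(\<lambda>m. l + m) ` M' \<subseteq> N" using l by (auto simp: N_def)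
        show "\<forall>n\<in>N - (\<lambda>m. l + m) ` M'. (if n - l \<in> M' then E l * V (n - l) else 0) = 0"
          by (simp add: img)
        show "(if n - l \<in> M' then E l * V (n - l) else 0) = E l * V (n - l)"
          if "n \<in> (\<lambda>m. l + m) ` M'" for n using that by (simp only: img if_True)
      qed (rule N)
      also have "\<dots> = (\<Sum>m\<in>M'. E l * V m)" by (subst sum.reindex) (auto simp: inj_on_def)
      finally show "(\<Sum>n\<in>N. if n - l \<in> M' then E l * V (n - l) else 0) = (\<Sum>m\<in>M'. E l * V m)" .
    qed
    also have "\<dots> = e * W" by (simp add: eL WM sum_product)
    finally show ?thesis .
  qed
  have "(\<Sum>n\<in>N. u n) = 0"
    unfolding u_def sum_subtractf sum_distrib_left[symmetric] s1 s2 eq by (simp add: algebra_simps)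
  then have u0: "u n = 0" if "n \<in> N" for n
    using eigen_sum_zero[where D = D and K = N and v = u and k = n, OF add scale N u_eig _ that] by blast
  have extreme: False
    if l1: "l1 \<in> L'" and m1: "m1 \<in> M'" and out: "l1 + m1 \<notin> M'"
      and ext: "\<And>l. l \<in> L' ==> l ~= l1 ==> l1 + m1 - l \<notin> M'" for l1 m1
  proof -
    have "l1 + m1 \<in> N" using l1 m1 by (auto simp: N_def)
    then have "u (l1 + m1) = 0" by (rule u0)
    moreover have "(\<Sum>l\<in>L'. if l1 + m1 - l \<in> M' then E l * V (l1 + m1 - l) else 0) =
        (\<Sum>l\<in>L'. if l = l1 then E l1 * V m1 else 0)"
      using ext m1 by (intro sum.cong refl) auto
    ultimately have "2 * (E l1 * V m1) = 0" using fin l1 out by (simp add: u_def)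
    moreover have "E l1 ~= 0" "V m1 ~= 0" using l1 m1 by (auto simp: L'_def M'_def)
    ultimately show False by (simp del: mult_2)
  qed
  have l0: "l = 0" if l: "l \<in> L'" for l
  proof -
    have L'ne: "L' ~= {}" using l by blast
    have "Max L' \<le> 0"
    proof (rule ccontr)
      assume pos: "\<not> Max L' \<le> 0"
      show False
      proof (rule extreme[of "Max L'" "Max M'"])
        show "Max L' + Max M' \<notin> M'" using pos Max_ge[OF fin(2), of "Max L' + Max M'"] by auto
        fix l assume "l \<in> L'" "l ~= Max L'"
        then have "l < Max L'" using Max_ge[OF fin(1), of l] by linarith
        then show "Max L' + Max M' - l \<notin> M'" using Max_ge[OF fin(2), of "Max L' + Max M' - l"] by linarith
      qed (use fin L'ne M'ne in auto)
    qed
    moreover have "Min L' \<ge> 0"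
    proof (rule ccontr)
      assume neg: "\<not> Min L' \<ge> 0"
      show False
      proof (rule extreme[of "Min L'" "Min M'"])
        show "Min L' + Min M' \<notin> M'" using neg Min_le[OF fin(2), of "Min L' + Min M'"] by auto
        fix l assume "l \<in> L'" "l ~= Min L'"
        then have "Min L' < l" using Min_le[OF fin(1), of l] by linarith
        then show "Min L' + Min M' - l \<notin> M'" using Min_le[OF fin(2), of "Min L' + Min M' - l"] by linarith
      qed (use fin L'ne M'ne in auto)
    qed
    ultimately show ?thesis using Max_ge[OF fin(1) l] Min_le[OF fin(1) l] by linarith
  qed
  show ?thesis
  proof (cases "L' = {}")
    case True
    then have "e = lmon 0 [:0:]" by (simp add: eL)
    then show ?thesis by blast
  next
    case False
    then have L'0: "L' = {0}" using l0 by blast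
    obtain m where m: "m \<in> M'" using M'ne by blast
    then have "u m = 0" by (intro u0) (simp add: N_def)
    then have "V m * (lmon 0 [:c - of_int m:] - 2 * E 0) = 0"
      using m by (simp add: u_def L'0 algebra_simps)
    then have "2 * E 0 = lmon 0 [:c - of_int m:]" using m by (auto simp: M'_def)
    then have "lmon 0 [:1 / 2:] * (2 * E 0) = lmon 0 [:(c - of_int m) / 2:]" by (simp add: mult_single)
    moreover have "lmon 0 [:1 / 2:] * (2 * E 0) = E 0"
    proof -
      have "lmon 0 [:1 / 2:] * (2 * E 0) = (lmon 0 [:1 / 2:] + lmon 0 [:1 / 2:]) * E 0" by (simp add: algebra_simps)
      also have "lmon 0 [:1 / 2:] + lmon 0 [:1 / 2:] = (1 :: laur)" by (simp add: single_add[symmetric])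
      finally show ?thesis by simp
    qed
    ultimately have "e = lmon 0 [:(c - of_int m) / 2:]" by (simp add: eL L'0)
    then show ?thesis by blast
  qed
qed

lemma lookup_mon_mult: "lrow (lmon k p * f) n = p * lrow f (n - k)"
proof (induction f rule: laur_induct)
  case (mon l q)
  then show ?case by (auto simp: mult_single lookup_single when_def)
qed (simp add: distrib_left lookup_add)

locale diagonal_derivation =
  fixes anti :: bool and D :: "(pt => complex) => pt => complex"
  assumes D_in: "f \<in> inv_ring anti ==> D f \<in> inv_ring anti"
    and D_cong: "f \<in> inv_ring anti ==> g \<in> inv_ring anti ==> (\<And>s. s \<in> quadric ==> f s = g s) ==>
      s \<in> quadric ==> D f s = D g s"
    and D_add: "f \<in> inv_ring anti ==> g \<in> inv_ring anti ==> s \<in> quadric ==>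
      D (\<lambda>s. f s + g s) s = D f s + D g s"
    and D_mult: "f \<in> inv_ring anti ==> g \<in> inv_ring anti ==> s \<in> quadric ==>
      D (\<lambda>s. f s * g s) s = f s * D g s + g s * D f s"
    and D_const: "s \<in> quadric ==> D (\<lambda>_. c) s = 0"
    and D_diagonal: "f \<in> inv_ring anti ==> \<exists>K F. finite K \<and>
      (\<forall>k\<in>K. F k \<in> inv_ring anti \<and> (\<forall>s\<in>quadric. D (F k) s = of_int k * F k s)) \<and>
      (\<forall>s\<in>quadric. f s = (\<Sum>k\<in>K. F k s))"
    and D_nonzero: "\<exists>f\<in>inv_ring anti. \<exists>s\<in>quadric. D f s ~= 0"
begin

lemma inv_const: "(\<lambda>_. c) \<in> inv_ring anti"
  by (simp add: inv_ring_def)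

lemma inv_add: "f \<in> inv_ring anti ==> g \<in> inv_ring anti ==> (\<lambda>s. f s + g s) \<in> inv_ring anti"
  by (simp add: inv_ring_def)

lemma inv_mult: "f \<in> inv_ring anti ==> g \<in> inv_ring anti ==> (\<lambda>s. f s * g s) \<in> inv_ring anti"
  by (simp add: inv_ring_def)

lemma D_cmult: "f \<in> inv_ring anti ==> s \<in> quadric ==> D (\<lambda>s. c * f s) s = c * D f s"
  using D_mult[OF inv_const, of f s c] D_const by simp

lemma prod_inv: "u \<in> {cx, cy, cz} ==> v \<in> {cx, cy, cz} ==> (\<lambda>s. u s * v s) \<in> inv_ring anti"
  by (rule squares_inv_ring)

text \<open>
  The derivation extends from the invariant ring to all functions: pairing the products
  \<open>u x, u y, u z\<close> with the coordinates by the polar form of \<open>z^2 - x y = 1\<close> recovers \<open>D u\<close>.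
\<close>

definition ext :: "(pt => complex) => pt => complex"
  where "ext u s = cz s * D (\<lambda>s. u s * cz s) s - (1/2) * (cy s * D (\<lambda>s. u s * cx s) s)
    - (1/2) * (cx s * D (\<lambda>s. u s * cy s) s)"

lemma ext_qring: "u \<in> {cx, cy, cz} ==> ext u \<in> qring"
  unfolding ext_def[abs_def]
  by (intro qring_diff qring_mult qring_const qring_cx qring_cy qring_cz
    inv_ring_qring[OF D_in[OF prod_inv]]) auto

lemma ext_uminus: "u \<in> {cx, cy, cz} ==> anti ==> s \<in> quadric ==> ext u (- s) = - ext u s"
proof -
  assume u: "u \<in> {cx, cy, cz}" and anti and s: "s \<in> quadric"
  then have "D (\<lambda>s. u s * v s) (- s) = D (\<lambda>s. u s * v s) s" if "v \<in> {cx, cy, cz}" for v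
    using D_in[OF prod_inv[OF u that]] by (simp add: inv_ring_def)
  then show ?thesis by (simp add: ext_def algebra_simps)
qed

lemma quadric_eq: "s \<in> quadric ==> cz s * cz s - cx s * cy s = 1"
  by (simp add: quadric_iff power2_eq_square)

lemma D_prod:
  assumes u: "u \<in> {cx, cy, cz}" and v: "v \<in> {cx, cy, cz}" and s: "s \<in> quadric"
  shows "D (\<lambda>s. u s * v s) s = u s * ext v s + v s * ext u s"
proof -
  have c: "cx \<in> {cx, cy, cz}" "cy \<in> {cx, cy, cz}" "cz \<in> {cx, cy, cz}" by auto
  let ?z = "\<lambda>s. (u s * cz s) * (v s * cz s)"
  let ?xy = "\<lambda>s. (-1/2) * ((u s * cx s) * (v s * cy s))"
  let ?yx = "\<lambda>s. (-1/2) * ((u s * cy s) * (v s * cx s))"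
  note i = prod_inv[OF u] prod_inv[OF v]
  have m: "?z \<in> inv_ring anti" "(\<lambda>s. (u s * cx s) * (v s * cy s)) \<in> inv_ring anti"
    "(\<lambda>s. (u s * cy s) * (v s * cx s)) \<in> inv_ring anti"
    by (intro inv_mult i c)+
  have m': "?xy \<in> inv_ring anti" "?yx \<in> inv_ring anti"
    by (rule inv_mult[OF inv_const m(2)], rule inv_mult[OF inv_const m(3)])
  have e: "u s * v s = (?z s + ?xy s) + ?yx s" if "s \<in> quadric" for s
  proof -
    have "(?z s + ?xy s) + ?yx s = u s * v s * (cz s * cz s - cx s * cy s)" by (simp add: algebra_simps)
    then show ?thesis using quadric_eq[OF that] by simp
  qed
  have "D (\<lambda>s. u s * v s) s = D (\<lambda>s. (?z s + ?xy s) + ?yx s) s"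
    by (rule D_cong[OF prod_inv[OF u v] inv_add[OF inv_add[OF m(1) m'(1)] m'(2)] e s])
  also have "\<dots> = D ?z s + D ?xy s + D ?yx s"
    using D_add[OF inv_add[OF m(1) m'(1)] m'(2) s] D_add[OF m(1) m'(1) s] by simp
  also have "D ?z s = (u s * cz s) * D (\<lambda>s. v s * cz s) s + (v s * cz s) * D (\<lambda>s. u s * cz s) s"
    by (rule D_mult[OF i(1)[OF c(3)] i(2)[OF c(3)] s])
  also have "D ?xy s = (-1/2) * ((u s * cx s) * D (\<lambda>s. v s * cy s) s + (v s * cy s) * D (\<lambda>s. u s * cx s) s)"
    by (subst D_cmult[OF m(2) s], subst D_mult[OF i(1)[OF c(1)] i(2)[OF c(2)] s]) simp
  also have "D ?yx s = (-1/2) * ((u s * cy s) * D (\<lambda>s. v s * cx s) s + (v s * cx s) * D (\<lambda>s. u s * cy s) s)"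
    by (subst D_cmult[OF m(3) s], subst D_mult[OF i(1)[OF c(2)] i(2)[OF c(1)] s]) simp
  finally show ?thesis by (simp add: ext_def algebra_simps)
qed

lemma ext_tangent: "s \<in> quadric ==> cx s * ext cy s + cy s * ext cx s = 2 * (cz s * ext cz s)"
proof -
  assume s: "s \<in> quadric"
  have "D (\<lambda>s. cz s * cz s) s = D (\<lambda>s. cx s * cy s + 1) s"
    by (rule D_cong[OF prod_inv inv_add[OF prod_inv inv_const] _ s])
      (auto simp: quadric_iff power2_eq_square)
  also have "\<dots> = D (\<lambda>s. cx s * cy s) s + D (\<lambda>_. 1) s"
    by (rule D_add[OF prod_inv inv_const s]) auto
  finally show ?thesis using s by (simp add: D_prod D_const)
qed

lemma D_coord:
  assumes u: "u \<in> {cx, cy, cz}" and na: "\<not> anti" and s: "s \<in> quadric"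
  shows "D u s = ext u s"
proof -
  have c: "v \<in> inv_ring anti" if "v \<in> {cx, cy, cz}" for v using that na by (auto simp: inv_ring_def)
  have p: "D (\<lambda>s. a s * v s) s = a s * D v s + v s * D a s" if "a \<in> {cx, cy, cz}" "v \<in> {cx, cy, cz}" for a v
    by (rule D_mult[OF c[OF that(1)] c[OF that(2)] s])
  have "D (\<lambda>s. cz s * cz s) s = D (\<lambda>s. cx s * cy s + 1) s"
    by (rule D_cong[OF prod_inv inv_add[OF prod_inv inv_const] _ s])
      (auto simp: quadric_iff power2_eq_square)
  also have "\<dots> = D (\<lambda>s. cx s * cy s) s + D (\<lambda>_. 1) s"
    by (rule D_add[OF prod_inv inv_const s]) auto
  finally have t: "2 * (cz s * D cz s) = cx s * D cy s + cy s * D cx s" using s by (simp add: p D_const)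
  have "ext u s = D u s * (cz s * cz s - cx s * cy s) +
      u s * ((1/2) * (2 * (cz s * D cz s) - (cx s * D cy s + cy s * D cx s)))"
    unfolding ext_def using u by (subst p p, simp, simp)+ (simp add: algebra_simps)
  then show ?thesis using t quadric_eq[OF s] by simp
qed

definition A :: laur where "A = lexp (ext cx)"
definition B :: laur where "B = lexp (ext cz)"
definition C :: laur where "C = lexp (ext cy)"
definition a :: laur where "a = lmon (-1) 1 * A"
definition der :: "laur => laur" where "der t = a * dlx t + B * dz t"

lemma ABC_rel: "lmon 1 1 * C + lmon (-1) [:-1, 0, 1:] * A = 2 * (lmon 0 [:0, 1:] * B)"
proof -
  have q: "ext cx \<in> qring" "ext cy \<in> qring" "ext cz \<in> qring" by (auto intro: ext_qring)
  have "lmon 1 1 * C + lmon (-1) [:-1, 0, 1:] * A = lexp (\<lambda>s. cx s * ext cy s + cy s * ext cx s)"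
    using q by (simp add: A_def C_def)
  also have "\<dots> = lexp (\<lambda>s. cz s * ext cz s + cz s * ext cz s)"
    by (rule lexp_cong) (simp add: ext_tangent)
  also have "\<dots> = lmon 0 [:0, 1:] * B + lmon 0 [:0, 1:] * B"
    by (subst lexp_add) (use q in \<open>simp_all add: B_def\<close>)
  finally show ?thesis by simp
qed

lemma der_add: "der (f + g) = der f + der g"
  by (simp add: der_def algebra_simps)

lemma der_uminus: "der (- f) = - der f"
  by (simp add: der_def)

lemma der_mult: "der (f * g) = f * der g + g * der f"
  by (simp add: der_def dlx_mult dz_mult algebra_simps)

lemma der_const: "der (lmon 0 [:c:]) = 0"
  by (simp add: der_def pderiv_pCons)

lemma der_scale: "der (lmon 0 [:c:] * f) = lmon 0 [:c:] * der f"
  by (simp add: der_mult der_const)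

lemma der_x: "der (lmon 1 1) = A"
proof -
  have "der (lmon 1 1) = (lmon (-1) 1 * lmon 1 1) * A"
    by (simp add: der_def a_def mult_ac pCons_one)
  also have "lmon (-1) 1 * lmon 1 1 = (1 :: laur)" by (simp add: mult_single pCons_one)
  finally show ?thesis by simp
qed

lemma der_z: "der (lmon 0 [:0, 1:]) = B"
  by (simp add: der_def pderiv_pCons)

lemma der_y: "der (lmon (-1) [:-1, 0, 1:]) = C"
proof -
  let ?X = "lmon 1 1" and ?Y = "lmon (-1) [:-1, 0, 1:]" and ?Z = "lmon 0 [:0, 1:]"
  have xy: "?X * ?Y = ?Z * ?Z - lmon 0 [:1:]" by (simp add: mult_single single_diff[symmetric] del: lmon_one)
  have "?X * der ?Y + ?Y * A = der (?X * ?Y)" by (simp add: der_mult der_x)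
  also have "\<dots> = der (?Z * ?Z - lmon 0 [:1:])" unfolding xy ..
  also have "\<dots> = 2 * (?Z * B)"
  proof -
    have "der (?Z * ?Z - lmon 0 [:1:]) + der (lmon 0 [:1:]) = der (?Z * ?Z)"
      by (simp add: der_add[symmetric] del: lmon_one)
    then show ?thesis by (simp add: der_const der_mult der_z del: lmon_one)
  qed
  also have "\<dots> = ?X * C + ?Y * A" using ABC_rel by simp
  finally have "?X * der ?Y = ?X * C" by simp
  moreover have "?X ~= 0" by simp
  ultimately show ?thesis by (metis mult_left_cancel)
qed

lemma lexp_D: "f \<in> inv_ring anti ==> lexp (D f) = der (lexp f)"
proof -
  assume f: "f \<in> inv_ring anti"
  have addS: "lexp (D (\<lambda>s. f s + g s)) = der (lexp (\<lambda>s. f s + g s))"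
    if "f \<in> inv_ring anti" "g \<in> inv_ring anti" "lexp (D f) = der (lexp f)" "lexp (D g) = der (lexp g)" for f g
  proof -
    have "lexp (D (\<lambda>s. f s + g s)) = lexp (\<lambda>s. D f s + D g s)" by (rule lexp_cong) (rule D_add[OF that(1,2)])
    then show ?thesis using that by (simp add: inv_ring_qring[OF D_in] inv_ring_qring der_add)
  qed
  have multS: "lexp (D (\<lambda>s. f s * g s)) = der (lexp (\<lambda>s. f s * g s))"
    if "f \<in> inv_ring anti" "g \<in> inv_ring anti" "lexp (D f) = der (lexp f)" "lexp (D g) = der (lexp g)" for f g
  proof -
    have "lexp (D (\<lambda>s. f s * g s)) = lexp (\<lambda>s. f s * D g s + g s * D f s)" by (rule lexp_cong) (rule D_mult[OF that(1,2)])
    then show ?thesis using that by (simp add: inv_ring_qring[OF D_in] inv_ring_qring der_mult)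
  qed
  have constS: "lexp (D (\<lambda>_. c)) = der (lexp (\<lambda>_. c))" for c
  proof -
    have "lexp (D (\<lambda>_. c)) = lexp (\<lambda>_. 0)" by (rule lexp_cong) (rule D_const)
    then show ?thesis by (simp add: der_const)
  qed
  have coord: "lexp (ext u) = der (lexp u)" if "u \<in> {cx, cy, cz}" for u
    using that by (auto simp: der_x der_y der_z A_def[symmetric] B_def[symmetric] C_def[symmetric])
  show ?thesis
  proof (cases anti)
    case True
    then obtain g where g: "g \<in> evenfun" "\<And>s. s \<in> quadric ==> f s = g s"
      using inv_ring_evenfun[of f] f by auto
    have "lexp (D g) = der (lexp g)" using g(1)
    proof induction
      case (prod u v)
      have q: "u \<in> qring" "v \<in> qring" using prod by auto
      have "lexp (D (\<lambda>s. u s * v s)) = lexp (\<lambda>s. u s * ext v s + v s * ext u s)"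
        by (rule lexp_cong) (rule D_prod[OF prod])
      also have "\<dots> = lexp u * lexp (ext v) + lexp v * lexp (ext u)"
        using q ext_qring[OF prod(1)] ext_qring[OF prod(2)] by simp
      also have "\<dots> = der (lexp u * lexp v)" by (simp only: coord[OF prod(1)] coord[OF prod(2)] der_mult)
      finally show ?case using q by simp
    next
      case (const c) show ?case by (rule constS)
    next
      case (add f g)
      show ?case by (rule addS[OF evenfun_inv_ring[OF add(1)] evenfun_inv_ring[OF add(2)] add(3,4)])
    next
      case (mult f g)
      show ?case by (rule multS[OF evenfun_inv_ring[OF mult(1)] evenfun_inv_ring[OF mult(2)] mult(3,4)])
    qed
    moreover have "lexp (D f) = lexp (D g)"
      by (rule lexp_cong) (rule D_cong[OF f evenfun_inv_ring[OF g(1)] g(2)])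
    ultimately show ?thesis using lexp_cong[of f g] g(2) by simp
  next
    case False
    obtain P where P: "P \<in> polyfun" "\<And>s. s \<in> quadric ==> f s = P s"
      using f unfolding inv_ring_def qring_def by blast
    have pi: "P \<in> inv_ring anti" if "P \<in> polyfun" for P using False polyfun_qring[OF that] by (simp add: inv_ring_def)
    have cS: "lexp (D u) = der (lexp u)" if "u \<in> {cx, cy, cz}" for u
    proof -
      have "lexp (D u) = lexp (ext u)" by (rule lexp_cong) (rule D_coord[OF that False])
      then show ?thesis using coord[OF that] by simp
    qed
    have "lexp (D P) = der (lexp P)" using P(1)
    proof induction
      case (const c) show ?case by (rule constS)
    next
      case (add f g)
      show ?case by (rule addS[OF pi[OF add(1)] pi[OF add(2)] add(3,4)])
    next
      case (mult f g)
      show ?case by (rule multS[OF pi[OF mult(1)] pi[OF mult(2)] mult(3,4)])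
    qed (rule cS, simp)+
    moreover have "lexp (D f) = lexp (D P)"
      by (rule lexp_cong) (rule D_cong[OF f pi[OF P(1)] P(2)])
    ultimately show ?thesis using lexp_cong[of f P] P(2) by simp
  qed
qed

definition e :: laur where "e = dlx a + dz B"

lemma der_br: "der (br f g) = br (der f) g + br f (der g) - e * br f g"
  by (simp add: br_def der_def e_def dlx_mult dz_mult dlx_dz algebra_simps)

lemma eigen_decomp:
  assumes "f \<in> inv_ring anti"
  obtains K F where "finite K" "\<And>k. k \<in> K ==> F k \<in> inv_ring anti"
    "\<And>k. k \<in> K ==> der (lexp (F k)) = lmon 0 [:of_int k:] * lexp (F k)" "lexp f = (\<Sum>k\<in>K. lexp (F k))"
proof -
  obtain K F where K: "finite K" and KF: "(\<forall>k\<in>K. F k \<in> inv_ring anti \<and> (\<forall>s\<in>quadric. D (F k) s = of_int k * F k s))"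
    and f: "(\<forall>s\<in>quadric. f s = (\<Sum>k\<in>K. F k s))" using D_diagonal[OF assms] by (elim exE conjE)
  have F: "F k \<in> inv_ring anti" "F k \<in> qring" if "k \<in> K" for k using KF that inv_ring_qring by auto
  show ?thesis
  proof (rule that[OF K, of F])
    fix k assume k: "k \<in> K"
    show "F k \<in> inv_ring anti" by (rule F(1)[OF k])
    have "lexp (D (F k)) = lexp (\<lambda>s. of_int k * F k s)" using KF k by (intro lexp_cong) auto
    then show "der (lexp (F k)) = lmon 0 [:of_int k:] * lexp (F k)" using lexp_D[OF F(1)[OF k]] F(2)[OF k] by simp
  next
    have "lexp f = lexp (\<lambda>s. \<Sum>k\<in>K. F k s)" using f by (intro lexp_cong) auto
    then show "lexp f = (\<Sum>k\<in>K. lexp (F k))" using F by (simp add: lexp_sum)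
  qed
qed

text \<open>
  The divergence \<open>e\<close> is computed in the chart \<open>x \<noteq> 0\<close>, but \<open>e x\<close> and \<open>e z\<close> are combinations of
  brackets of regular functions, and \<open>e = z (e z) - y (e x)\<close> because \<open>z^2 - x y = 1\<close>.
\<close>

lemma e_regular: "\<exists>g\<in>inv_ring anti. lexp g = e"
proof -
  let ?X = "lmon 1 1" and ?Y = "lmon (-1) [:-1, 0, 1:]" and ?Z = "lmon 0 [:0, 1:]"
  have q: "ext cx \<in> qring" "ext cy \<in> qring" "ext cz \<in> qring" by (auto intro: ext_qring)
  have brzx: "br ?Z ?X = ?X" by (simp add: br_def mult_single pderiv_pCons pCons_one)
  have brxy: "br ?X ?Y = - (?Z + ?Z)"
    by (simp add: br_def mult_single pderiv_pCons single_add[symmetric])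
  have ex: "e * ?X = br B ?X + br ?Z A - A"
    using der_br[of ?Z ?X] by (simp add: brzx der_x der_z algebra_simps)
  have "der (br ?X ?Y) = - (B + B)"
    unfolding brxy der_uminus der_add der_z ..
  then have ez: "e * ?Z + e * ?Z = - (B + B) - br A ?Y - br ?X C"
    using der_br[of ?X ?Y] unfolding der_x der_y unfolding brxy by (simp add: algebra_simps)
  let ?gx = "\<lambda>s. qbr (ext cz) cx s + qbr cz (ext cx) s - ext cx s"
  let ?gz = "\<lambda>s. (1/2) * (- (ext cz s + ext cz s) - qbr (ext cx) cy s - qbr cx (ext cy) s)"
  let ?g = "\<lambda>s. cz s * ?gz s - cy s * ?gx s"
  have gq: "qbr (ext cz) cx \<in> qring" "qbr cz (ext cx) \<in> qring" "qbr (ext cx) cy \<in> qring" "qbr cx (ext cy) \<in> qring"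
    using q by (auto intro: qbr(1))
  have gxq: "?gx \<in> qring" "lexp ?gx = e * ?X"
    using q gq by (simp_all add: ex qbr A_def B_def)
  have i: "(\<lambda>s. - (ext cz s + ext cz s) - qbr (ext cx) cy s - qbr cx (ext cy) s) \<in> qring"
    "lexp (\<lambda>s. - (ext cz s + ext cz s) - qbr (ext cx) cy s - qbr cx (ext cy) s) = e * ?Z + e * ?Z"
  proof -
    have t: "(\<lambda>s. - (ext cz s + ext cz s)) \<in> qring" "lexp (\<lambda>s. - (ext cz s + ext cz s)) = - (B + B)"
      using q lexp_uminus[OF qring_add[OF q(3) q(3)]] lexp_add[OF q(3) q(3)]
      by (auto simp only: B_def intro: qring_uminus qring_add)
    show "(\<lambda>s. - (ext cz s + ext cz s) - qbr (ext cx) cy s - qbr cx (ext cy) s) \<in> qring"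
      by (intro qring_diff t gq)
    have "lexp (\<lambda>s. - (ext cz s + ext cz s) - qbr (ext cx) cy s - qbr cx (ext cy) s) =
        lexp (\<lambda>s. - (ext cz s + ext cz s)) - lexp (qbr (ext cx) cy) - lexp (qbr cx (ext cy))"
      by (subst lexp_diff[OF qring_diff[OF t(1) gq(3)] gq(4)], subst lexp_diff[OF t(1) gq(3)]) simp
    then show "lexp (\<lambda>s. - (ext cz s + ext cz s) - qbr (ext cx) cy s - qbr cx (ext cy) s) = e * ?Z + e * ?Z"
      unfolding t(2) using q by (simp add: ez qbr A_def C_def)
  qed
  have gzq: "?gz \<in> qring" by (rule qring_cmult[OF i(1)])
  have lgz: "lexp ?gz = e * ?Z"
  proof -
    have "lexp ?gz = lmon 0 [:1/2:] * (e * ?Z + e * ?Z)" unfolding lexp_cmult[OF i(1)] i(2) ..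
    also have "\<dots> = (lmon 0 [:1/2:] + lmon 0 [:1/2:]) * (e * ?Z)" by (simp add: algebra_simps)
    also have "lmon 0 [:1/2:] + lmon 0 [:1/2:] = (1 :: laur)" by (simp add: single_add[symmetric])
    finally show ?thesis by simp
  qed
  have gq': "?g \<in> qring" by (intro qring_diff qring_mult qring_cz qring_cy gzq gxq(1))
  have "lexp ?g = ?Z * (e * ?Z) - ?Y * (e * ?X)"
    by (subst lexp_diff[OF qring_mult[OF qring_cz gzq] qring_mult[OF qring_cy gxq(1)]],
        subst lexp_mult[OF qring_cz gzq], subst lexp_mult[OF qring_cy gxq(1)]) (simp only: lgz gxq(2) lexp_cz lexp_cy)
  also have "\<dots> = e * (?Z * ?Z - ?X * ?Y)" by (simp add: algebra_simps)
  also have "?Z * ?Z - ?X * ?Y = 1"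
    by (simp add: mult_single single_diff[symmetric])
  finally have lg: "lexp ?g = e" by simp
  have "?g (- s) = ?g s" if anti and s: "s \<in> quadric" for s
  proof -
    have od: "qbr u v (- s) = - qbr u v s"
      if "u \<in> qring" "v \<in> qring" "\<And>s. s \<in> quadric ==> u (- s) = - u s" "\<And>s. s \<in> quadric ==> v (- s) = - v s" for u v
      using qbr_parity[OF that(1,2) s, of "-1" "-1"] that(3,4) by simp
    have eu: "ext u (- s) = - ext u s" if "u \<in> {cx, cy, cz}" "s \<in> quadric" for u s
      by (rule ext_uminus[OF that(1) \<open>anti\<close> that(2)])
    have "qbr (ext cz) cx (- s) = - qbr (ext cz) cx s" "qbr cz (ext cx) (- s) = - qbr cz (ext cx) s"
      "qbr (ext cx) cy (- s) = - qbr (ext cx) cy s" "qbr cx (ext cy) (- s) = - qbr cx (ext cy) s"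
      by (rule od; (simp add: q eu)?)+
    then show ?thesis using eu s by (simp add: algebra_simps)
  qed
  then have "?g \<in> inv_ring anti" using gq' by (simp add: inv_ring_def)
  then show ?thesis using lg by blast
qed

lemma e_const: "\<exists>c. e = lmon 0 [:c:]"
proof -
  have pf: "(\<lambda>s. cx s * cx s) \<in> inv_ring anti" "(\<lambda>s. cx s * cz s) \<in> inv_ring anti" by (auto intro: prod_inv)
  obtain K F where K: "finite K" "\<And>k. k \<in> K ==> F k \<in> inv_ring anti"
    "\<And>k. k \<in> K ==> der (lexp (F k)) = lmon 0 [:of_int k:] * lexp (F k)"
    "lexp (\<lambda>s. cx s * cx s) = (\<Sum>k\<in>K. lexp (F k))" using eigen_decomp[OF pf(1)] by blast
  obtain L G where L: "finite L" "\<And>k. k \<in> L ==> G k \<in> inv_ring anti"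
    "\<And>k. k \<in> L ==> der (lexp (G k)) = lmon 0 [:of_int k:] * lexp (G k)"
    "lexp (\<lambda>s. cx s * cz s) = (\<Sum>k\<in>L. lexp (G k))" using eigen_decomp[OF pf(2)] by blast
  have "br (lexp (\<lambda>s. cx s * cx s)) (lexp (\<lambda>s. cx s * cz s)) ~= 0"
    by (simp add: br_def mult_single pderiv_pCons pCons_one)
  moreover have "br (lexp (\<lambda>s. cx s * cx s)) (lexp (\<lambda>s. cx s * cz s)) =
      (\<Sum>k\<in>K. br (lexp (F k)) (\<Sum>l\<in>L. lexp (G l)))" unfolding K(4) L(4) by (rule br_sum_left)
  moreover have "\<dots> = (\<Sum>k\<in>K. \<Sum>l\<in>L. br (lexp (F k)) (lexp (G l)))" by (simp only: br_sum_right)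
  ultimately have "(\<Sum>k\<in>K. \<Sum>l\<in>L. br (lexp (F k)) (lexp (G l))) ~= 0" by metis
  then obtain k where k: "k \<in> K" "(\<Sum>l\<in>L. br (lexp (F k)) (lexp (G l))) ~= 0"
    by (rule sum.not_neutral_contains_not_neutral)
  from k(2) obtain l where l: "l \<in> L" "br (lexp (F k)) (lexp (G l)) ~= 0"
    by (rule sum.not_neutral_contains_not_neutral)
  define w where "w = qbr (F k) (G l)"
  have Fq: "F k \<in> qring" "G l \<in> qring" using K(2)[OF k(1)] L(2)[OF l(1)] inv_ring_qring by auto
  have wq: "w \<in> qring" "lexp w = br (lexp (F k)) (lexp (G l))" unfolding w_def using qbr[OF Fq] by auto
  have dw: "der (lexp w) = lmon 0 [:of_int (k + l):] * lexp w - e * lexp w"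
  proof -
    have "lmon 0 [:of_int (k + l):] = lmon 0 [:of_int k:] + lmon 0 [:of_int l:]" by (simp add: single_add[symmetric])
    then show ?thesis unfolding wq(2) der_br K(3)[OF k(1)] L(3)[OF l(1)]
      by (simp add: br_mult_left br_mult_right algebra_simps)
  qed
  let ?w2 = "\<lambda>s. w s * w s"
  have w2: "?w2 \<in> inv_ring anti"
  proof -
    have "w (- s) * w (- s) = w s * w s" if anti "s \<in> quadric" for s
    proof -
      have "w (- s) = - (1 * 1) * w s" unfolding w_def
        using K(2)[OF k(1)] L(2)[OF l(1)] that by (intro qbr_parity[OF Fq]) (auto simp: inv_ring_def)
      then show ?thesis by simp
    qed
    then show ?thesis using wq(1) by (simp add: inv_ring_def)
  qed
  obtain M V where M: "finite M" "\<And>k. k \<in> M ==> V k \<in> inv_ring anti"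
    "\<And>k. k \<in> M ==> der (lexp (V k)) = lmon 0 [:of_int k:] * lexp (V k)"
    "lexp ?w2 = (\<Sum>k\<in>M. lexp (V k))" using eigen_decomp[OF w2] by blast
  obtain g where g: "g \<in> inv_ring anti" "lexp g = e" using e_regular by blast
  obtain N E where N: "finite N" "\<And>k. k \<in> N ==> E k \<in> inv_ring anti"
    "\<And>k. k \<in> N ==> der (lexp (E k)) = lmon 0 [:of_int k:] * lexp (E k)"
    "lexp g = (\<Sum>k\<in>N. lexp (E k))" using eigen_decomp[OF g(1)] by blast
  have W: "lexp ?w2 = lexp w * lexp w" using wq(1) by simp
  show ?thesis
  proof (rule eigen_multiplier_const[where D = der and L = N and M = M and E = "\<lambda>k. lexp (E k)" and V = "\<lambda>k. lexp (V k)" and W = "lexp ?w2"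
      and c = "2 * of_int (k + l)"])
    show "e = (\<Sum>l\<in>N. lexp (E l))" using g(2) N(4) by simp
    show "lexp ?w2 ~= 0" unfolding W wq(2) using l(2) by simp
    have two: "lmon 0 [:2 * of_int (k + l):] = lmon 0 [:of_int (k + l):] + lmon 0 [:of_int (k + l):]"
      by (simp add: single_add[symmetric])
    show "der (lexp ?w2) = lmon 0 [:2 * of_int (k + l):] * lexp ?w2 - 2 * e * lexp ?w2"
      unfolding W der_mult dw two by (simp add: algebra_simps)
  qed (fact der_add der_scale der_mult N M)+
qed

text \<open>
  The constant divergence vanishes and \<open>D z\<close> has no term without \<open>x\<close>, because the equation
  \<open>x D y + y D x = 2 z D z\<close> forces that term to vanish at \<open>z = 1\<close> and \<open>z = -1\<close>. Then the
  vector field can be integrated term by term.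
\<close>

lemma hamiltonian: "\<exists>h. h \<in> qring \<and> (\<forall>t. der t = br (lexp h) t)"
proof -
  obtain c where c: "e = lmon 0 [:c:]" using e_const by blast
  let ?b0 = "lrow B 0"
  have row_e: "smult (of_int k) (lrow a k) + pderiv (lrow B k) = (if k = 0 then [:c:] else 0)" for k
  proof -
    have "lrow e k = smult (of_int k) (lrow a k) + pderiv (lrow B k)"
      by (simp add: e_def lookup_add lookup_dlx lookup_dz)
    then show ?thesis by (simp add: c lookup_single when_def)
  qed
  have dB0: "pderiv ?b0 = [:c:]" using row_e[of 0] by simp
  have "lshape C" unfolding C_def by (intro lshape_lexp ext_qring) simp
  then have "wfac (-1) dvd lrow C (-1)" by (simp add: lshape_def)
  then obtain r where r: "lrow C (-1) = [:-1, 0, 1:] * r" by (auto simp: wfac_def elim!: dvdE)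
  have "lrow (lmon 1 1 * C + lmon (-1) [:-1, 0, 1:] * A) 0 = lrow (lmon 0 [:0, 1:] * B + lmon 0 [:0, 1:] * B) 0"
    by (simp only: ABC_rel mult_2)
  then have rel: "[:-1, 0, 1:] * r + [:-1, 0, 1:] * lrow A 1 = [:0, 1:] * ?b0 + [:0, 1:] * ?b0"
    by (simp only: lookup_add lookup_mon_mult) (simp add: r)
  have z1: "poly ?b0 1 = 0" "poly ?b0 (-1) = 0"
  proof -
    have "poly ([:-1, 0, 1:] * r + [:-1, 0, 1:] * lrow A 1) z = poly ([:0, 1:] * ?b0 + [:0, 1:] * ?b0) z" for z
      using rel by simp
    from this[of 1] this[of "-1"] show "poly ?b0 1 = 0" "poly ?b0 (-1) = 0" by auto
  qed
  have "pderiv (?b0 - [:0, c:]) = 0" by (simp add: pderiv_diff dB0 pderiv_pCons)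
  then obtain d where "?b0 - [:0, c:] = [:d:]" using pderiv_eq_0_iff degree_eq_zeroE by metis
  then have b0': "?b0 = [:d, c:]" by (simp add: diff_eq_eq)
  have dc: "d = 0" "c = 0"
  proof -
    have s: "d + c = 0" "d - c = 0" using z1 by (simp_all add: b0')
    then have "d = c" by simp
    then show "d = 0" "c = 0" using s(1) by simp_all
  qed
  have b0: "?b0 = 0" using b0' dc by simp
  obtain q where q: "pderiv q = lrow a 0" using poly_antiderivative by blast
  define t where "t = (\<Sum>k\<in>lkeys B. lmon k (smult (- 1 / of_int k) (lrow B k))) + lmon 0 q"
  have row_t: "lrow t k = (if k = 0 then q else smult (- 1 / of_int k) (lrow B k))" for k
  proof -
    have "lrow (\<Sum>k\<in>lkeys B. lmon k (smult (- 1 / of_int k) (lrow B k))) k = smult (- 1 / of_int k) (lrow B k)"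
      by (auto simp: lookup_sum lookup_single when_def in_keys_iff)
    then show ?thesis using b0 by (simp add: t_def lookup_add lookup_single when_def)
  qed
  have dlt: "dlx t = - B"
    by (rule poly_mapping_eqI) (simp add: lookup_dlx row_t b0)
  have dzt: "dz t = a"
  proof (rule poly_mapping_eqI)
    fix k
    show "lrow (dz t) k = lrow a k"
    proof (cases "k = 0")
      case True then show ?thesis by (simp add: lookup_dz row_t q)
    next
      case False
      then have "smult (of_int k) (lrow a k) = - pderiv (lrow B k)"
        using row_e[of k] by (simp add: add_eq_0_iff2)
      then have "smult (- 1 / of_int k) (pderiv (lrow B k)) = smult (1 / of_int k) (smult (of_int k) (lrow a k))"
        by simp
      then show ?thesis using False by (simp add: lookup_dz row_t pderiv_smult pderiv_minus)
    qed
  qed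
  have "lshape t"
    unfolding lshape_def
  proof
    fix k
    have "lshape B" unfolding B_def by (intro lshape_lexp ext_qring) simp
    then show "wfac k dvd lrow t k"
      by (auto simp: lshape_def row_t wfac_def intro: dvd_smult)
  qed
  then obtain h where h: "h \<in> qring" "lexp h = t" using lshape_regular by blast
  have "der f = br (lexp h) f" for f
    by (simp add: h(2) br_def dzt dlt der_def)
  then show ?thesis using h(1) by blast
qed

theorem good_hamiltonian:
  "\<exists>h. good anti h \<and> (\<forall>f\<in>inv_ring anti. \<forall>s\<in>quadric. qbr h f s = D f s)"
proof -
  obtain h0 where h0: "h0 \<in> qring" "\<And>t. der t = br (lexp h0) t" using hamiltonian by blast
  define h where "h = (if anti then (\<lambda>s. (1/2) * (h0 s - h0 (- s))) else h0)"
  have pm: "polymap (\<lambda>s. - s)"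
    using polyfun.mult[OF polyfun.const[of "-1"] polyfun.cx] polyfun.mult[OF polyfun.const[of "-1"] polyfun.cy]
      polyfun.mult[OF polyfun.const[of "-1"] polyfun.cz] by (auto simp: polymap_def quadric_iff)
  have h0n: "(\<lambda>s. h0 (- s)) \<in> qring" by (rule polymap_qring[OF pm h0(1)])
  have hq: "h \<in> qring"
    unfolding h_def using qring_cmult[OF qring_diff[OF h0(1) h0n], of "1/2"] h0(1)
    by (cases anti) (simp_all only: if_True if_False)
  have D0: "qbr h0 f s = D f s" if f: "f \<in> inv_ring anti" and s: "s \<in> quadric" for f s
    using qbr[OF h0(1) inv_ring_qring[OF f]] h0(2)[of "lexp f"] lexp_D[OF f] inv_ring_qring[OF D_in[OF f]] s
    by (intro lexp_eqD) auto
  have hD: "qbr h f s = D f s" if f: "f \<in> inv_ring anti" and s: "s \<in> quadric" for f s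
  proof (cases anti)
    case True
    have fq: "f \<in> qring" using f by (rule inv_ring_qring)
    have Df: "D f \<in> qring" using D_in[OF f] by (rule inv_ring_qring)
    have "br (lexp (\<lambda>s. h0 (- s))) (lexp (\<lambda>s. f (- s))) = lmon 0 [:-1:] * lexp (\<lambda>s. qbr h0 f (- s))"
      by (rule poisson_scalingD[OF poisson_scaling_uminus h0(1) fq])
    also have "lexp (\<lambda>s. f (- s)) = lexp f" using f True by (intro lexp_cong) (simp add: inv_ring_def)
    also have "lexp (\<lambda>s. qbr h0 f (- s)) = lexp (D f)"
      using D_in[OF f] True by (intro lexp_cong) (simp add: D0[OF f] inv_ring_def)
    finally have n: "br (lexp (\<lambda>s. h0 (- s))) (lexp f) = - lexp (D f)" by (simp add: lmon_minus_1)
    have "lexp h = lmon 0 [:1/2:] * (lexp h0 - lexp (\<lambda>s. h0 (- s)))"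
      using True lexp_cmult[OF qring_diff[OF h0(1) h0n], of "1/2"] lexp_diff[OF h0(1) h0n]
      by (simp only: h_def if_True)
    then have "br (lexp h) (lexp f) = lmon 0 [:1/2:] * (lexp (D f) + lexp (D f))"
      using n lexp_D[OF f] h0(2)[of "lexp f"] by (simp add: br_mult_left br_diff_left)
    also have "\<dots> = (lmon 0 [:1/2:] + lmon 0 [:1/2:]) * lexp (D f)" by (simp add: algebra_simps)
    also have "lmon 0 [:1/2:] + lmon 0 [:1/2:] = (1 :: laur)" by (simp add: single_add[symmetric])
    finally show ?thesis using qbr[OF hq fq] Df s by (intro lexp_eqD) auto
  next
    case False then show ?thesis using D0[OF f s] by (simp add: h_def)
  qed
  have "good anti h"
    unfolding good_def
  proof (intro conjI ballI impI)
    show "h (- s) = - h s" if anti for s using that by (simp add: h_def diff_divide_distrib)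
    show "\<exists>f\<in>inv_ring anti. \<exists>s\<in>quadric. qbr h f s ~= 0" using D_nonzero hD by auto
    fix f assume f: "f \<in> inv_ring anti"
    obtain K F where K: "finite K" and KF: "(\<forall>k\<in>K. F k \<in> inv_ring anti \<and> (\<forall>s\<in>quadric. D (F k) s = of_int k * F k s))"
      and fs: "(\<forall>s\<in>quadric. f s = (\<Sum>k\<in>K. F k s))" using D_diagonal[OF f] by (elim exE conjE)
    show "\<exists>K F. finite K \<and>
      (\<forall>k\<in>K. F k \<in> inv_ring anti \<and> (\<forall>s\<in>quadric. qbr h (F k) s = of_int k * F k s)) \<and>
      (\<forall>s\<in>quadric. f s = (\<Sum>k\<in>K. F k s))"
      using K KF fs hD by (intro exI[of _ K] exI[of _ F]) auto
  qed (use hq in auto)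
  then show ?thesis using hD by blast
qed

end

section \<open>Spaces with a sheaf of local rings of functions\<close>

text \<open>
  All spaces below carry a sheaf of rings of functions in which a function can be inverted where it
  does not vanish. This is what makes maps out of them recognisable by their components.
\<close>

definition nice :: "'a fun_space => bool"
  where "nice Z \<longleftrightarrow>
    (\<forall>U f g. openin (zariski Z) U \<and> f \<in> regfuns Z U \<and> (\<forall>x\<in>U. f x = g x) --> g \<in> regfuns Z U) \<and>
    (\<forall>U c. openin (zariski Z) U --> (\<lambda>_. c) \<in> regfuns Z U) \<and>
    (\<forall>U f g. openin (zariski Z) U \<and> f \<in> regfuns Z U \<and> g \<in> regfuns Z U -->
      (\<lambda>x. f x + g x) \<in> regfuns Z U \<and> (\<lambda>x. f x * g x) \<in> regfuns Z U) \<and>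
    (\<forall>U f. openin (zariski Z) U \<and> f \<in> regfuns Z U -->
      openin (zariski Z) {x \<in> U. f x ~= 0} \<and> (\<lambda>x. inverse (f x)) \<in> regfuns Z {x \<in> U. f x ~= 0}) \<and>
    (\<forall>U V f. openin (zariski Z) U \<and> openin (zariski Z) V \<and> V \<subseteq> U \<and> f \<in> regfuns Z U --> f \<in> regfuns Z V) \<and>
    (\<forall>U f. openin (zariski Z) U \<and>
      (\<forall>x\<in>U. \<exists>N. openin (zariski Z) N \<and> x \<in> N \<and> N \<subseteq> U \<and> f \<in> regfuns Z N) --> f \<in> regfuns Z U)"

lemma nice_cong: "nice Z ==> openin (zariski Z) U ==> f \<in> regfuns Z U ==> (\<And>x. x \<in> U ==> f x = g x) ==>
    g \<in> regfuns Z U"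
proof -
  assume "nice Z"
  then have "\<forall>U f g. openin (zariski Z) U \<and> f \<in> regfuns Z U \<and> (\<forall>x\<in>U. f x = g x) --> g \<in> regfuns Z U"
    unfolding nice_def by (elim conjE)
  then show "openin (zariski Z) U ==> f \<in> regfuns Z U ==> (\<And>x. x \<in> U ==> f x = g x) ==> g \<in> regfuns Z U"
    by blast
qed

lemma nice_const: "nice Z ==> openin (zariski Z) U ==> (\<lambda>_. c) \<in> regfuns Z U"
proof -
  assume "nice Z"
  then have "\<forall>U c. openin (zariski Z) U --> (\<lambda>_. c) \<in> regfuns Z U"
    unfolding nice_def by (elim conjE)
  then show "openin (zariski Z) U ==> (\<lambda>_. c) \<in> regfuns Z U" by blast
qed

lemma nice_add_mult:
  assumes "nice Z" "openin (zariski Z) U" "f \<in> regfuns Z U" "g \<in> regfuns Z U"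
  shows nice_add: "(\<lambda>x. f x + g x) \<in> regfuns Z U" and nice_mult: "(\<lambda>x. f x * g x) \<in> regfuns Z U"
proof -
  have "\<forall>U f g. openin (zariski Z) U \<and> f \<in> regfuns Z U \<and> g \<in> regfuns Z U -->
      (\<lambda>x. f x + g x) \<in> regfuns Z U \<and> (\<lambda>x. f x * g x) \<in> regfuns Z U"
    using assms(1) unfolding nice_def by (elim conjE)
  then show "(\<lambda>x. f x + g x) \<in> regfuns Z U" "(\<lambda>x. f x * g x) \<in> regfuns Z U"
    using assms(2-4) by blast+
qed

lemma nice_nonzero:
  assumes "nice Z" "openin (zariski Z) U" "f \<in> regfuns Z U"
  shows nice_open_nonzero: "openin (zariski Z) {x \<in> U. f x ~= 0}"
    and nice_inverse_nonzero: "(\<lambda>x. inverse (f x)) \<in> regfuns Z {x \<in> U. f x ~= 0}"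
proof -
  have "\<forall>U f. openin (zariski Z) U \<and> f \<in> regfuns Z U -->
      openin (zariski Z) {x \<in> U. f x ~= 0} \<and> (\<lambda>x. inverse (f x)) \<in> regfuns Z {x \<in> U. f x ~= 0}"
    using assms(1) unfolding nice_def by (elim conjE)
  then show "openin (zariski Z) {x \<in> U. f x ~= 0}"
    "(\<lambda>x. inverse (f x)) \<in> regfuns Z {x \<in> U. f x ~= 0}" using assms(2,3) by blast+
qed

lemma nice_restrict: "nice Z ==> openin (zariski Z) U ==> openin (zariski Z) V ==> V \<subseteq> U ==>
    f \<in> regfuns Z U ==> f \<in> regfuns Z V"
proof -
  assume "nice Z"
  then have "\<forall>U V f. openin (zariski Z) U \<and> openin (zariski Z) V \<and> V \<subseteq> U \<and> f \<in> regfuns Z U -->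
      f \<in> regfuns Z V"
    unfolding nice_def by (elim conjE)
  then show "openin (zariski Z) U ==> openin (zariski Z) V ==> V \<subseteq> U ==> f \<in> regfuns Z U ==> f \<in> regfuns Z V"
    by blast
qed

lemma nice_glue:
  assumes "nice Z" "openin (zariski Z) U"
    "\<And>x. x \<in> U ==> \<exists>N. openin (zariski Z) N \<and> x \<in> N \<and> N \<subseteq> U \<and> f \<in> regfuns Z N"
  shows "f \<in> regfuns Z U"
proof -
  have "\<forall>U f. openin (zariski Z) U \<and>
      (\<forall>x\<in>U. \<exists>N. openin (zariski Z) N \<and> x \<in> N \<and> N \<subseteq> U \<and> f \<in> regfuns Z N) --> f \<in> regfuns Z U"
    using assms(1) unfolding nice_def by (elim conjE)
  then show ?thesis using assms(2,3) by blast
qed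

lemma nice_inverse:
  assumes Z: "nice Z" and U: "openin (zariski Z) U" and f: "f \<in> regfuns Z U" and nz: "\<And>x. x \<in> U ==> f x ~= 0"
  shows "(\<lambda>x. inverse (f x)) \<in> regfuns Z U"
proof -
  have "{x \<in> U. f x ~= 0} = U" using nz by auto
  moreover have "(\<lambda>x. inverse (f x)) \<in> regfuns Z {x \<in> U. f x ~= 0}" by (rule nice_inverse_nonzero[OF Z U f])
  ultimately show ?thesis by simp
qed

lemma nice_divide:
  assumes "nice Z" "openin (zariski Z) U" "f \<in> regfuns Z U" "g \<in> regfuns Z U" "\<And>x. x \<in> U ==> g x ~= 0"
  shows "(\<lambda>x. f x / g x) \<in> regfuns Z U"
  using nice_mult[OF assms(1-3) nice_inverse[OF assms(1,2,4,5)]] by (simp add: divide_inverse)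

lemma nice_sum: "nice Z ==> openin (zariski Z) U ==> (\<And>i. i \<in> A ==> f i \<in> regfuns Z U) ==>
    (\<lambda>x. \<Sum>i\<in>A. f i x) \<in> regfuns Z U"
  by (induction A rule: infinite_finite_induct) (auto intro: nice_const nice_add)

lemma nice_prod: "nice Z ==> openin (zariski Z) U ==> (\<And>i. i \<in> A ==> f i \<in> regfuns Z U) ==>
    (\<lambda>x. \<Prod>i\<in>A. f i x) \<in> regfuns Z U"
  by (induction A rule: infinite_finite_induct) (auto intro: nice_const nice_mult)

lemma nice_power: "nice Z ==> openin (zariski Z) U ==> f \<in> regfuns Z U ==> (\<lambda>x. f x ^ n) \<in> regfuns Z U"
  by (induction n) (auto intro: nice_const nice_mult)

lemma nice_sheafify:
  fixes Z :: "'a fun_space"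
  assumes reg: "\<And>W. regfuns Z W = {f. \<forall>p\<in>W. \<exists>N. openin (zariski Z) N \<and> p \<in> N \<and> N \<subseteq> W \<and> f \<in> Q N}"
    and cong: "\<And>N f g. openin (zariski Z) N ==> f \<in> Q N ==> (\<And>x. x \<in> N ==> f x = g x) ==> g \<in> Q N"
    and const: "\<And>N c. openin (zariski Z) N ==> (\<lambda>_. c) \<in> Q N"
    and add: "\<And>N f g. openin (zariski Z) N ==> f \<in> Q N ==> g \<in> Q N ==> (\<lambda>x. f x + g x) \<in> Q N"
    and mult: "\<And>N f g. openin (zariski Z) N ==> f \<in> Q N ==> g \<in> Q N ==> (\<lambda>x. f x * g x) \<in> Q N"
    and open_nz: "\<And>N f. openin (zariski Z) N ==> f \<in> Q N ==> openin (zariski Z) {x \<in> N. f x ~= 0}"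
    and inv: "\<And>N f. openin (zariski Z) N ==> f \<in> Q N ==> (\<lambda>x. inverse (f x)) \<in> Q {x \<in> N. f x ~= 0}"
    and restr: "\<And>N V f. openin (zariski Z) N ==> openin (zariski Z) V ==> V \<subseteq> N ==> f \<in> Q N ==> f \<in> Q V"
  shows "nice Z"
proof -
  let ?o = "openin (zariski Z)"
  have regD: "\<exists>N. ?o N \<and> p \<in> N \<and> N \<subseteq> W \<and> f \<in> Q N" if "f \<in> regfuns Z W" "p \<in> W" for f W p
    using that by (simp add: reg)
  have regI: "f \<in> regfuns Z W" if "\<And>p. p \<in> W ==> \<exists>N. ?o N \<and> p \<in> N \<and> N \<subseteq> W \<and> f \<in> Q N" for f W
    using that by (simp add: reg)
  have two: "\<exists>N. ?o N \<and> p \<in> N \<and> N \<subseteq> W \<and> f \<in> Q N \<and> g \<in> Q N"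
    if f: "f \<in> regfuns Z W" and g: "g \<in> regfuns Z W" and p: "p \<in> W" for f g W p
  proof -
    obtain N N' where N: "?o N" "p \<in> N" "N \<subseteq> W" "f \<in> Q N" "?o N'" "p \<in> N'" "N' \<subseteq> W" "g \<in> Q N'"
      using regD[OF f p] regD[OF g p] by blast
    have "?o (N \<inter> N')" using N by blast
    then show ?thesis using N restr[of N "N \<inter> N'" f] restr[of N' "N \<inter> N'" g]
      by (intro exI[of _ "N \<inter> N'"]) auto
  qed
  have r: "f \<in> regfuns Z V" if U: "?o U" "?o V" "V \<subseteq> U" "f \<in> regfuns Z U" for U V f
  proof (rule regI)
    fix p assume p: "p \<in> V"
    then obtain N where N: "?o N" "p \<in> N" "N \<subseteq> U" "f \<in> Q N" using regD[OF U(4), of p] U(3) by blast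
    have "?o (N \<inter> V)" using N U by blast
    then show "\<exists>N. ?o N \<and> p \<in> N \<and> N \<subseteq> V \<and> f \<in> Q N"
      using N p restr[of N "N \<inter> V" f] by (intro exI[of _ "N \<inter> V"]) auto
  qed
  have i1: "?o {x \<in> U. f x ~= 0}" if U: "?o U" "f \<in> regfuns Z U" for U f
  proof (subst openin_subopen, intro ballI)
    fix p assume p: "p \<in> {x \<in> U. f x ~= 0}"
    then obtain N where N: "?o N" "p \<in> N" "N \<subseteq> U" "f \<in> Q N" using regD[OF U(2), of p] by blast
    then show "\<exists>T. ?o T \<and> p \<in> T \<and> T \<subseteq> {x \<in> U. f x ~= 0}"
      using p open_nz[OF N(1,4)] by (intro exI[of _ "{x \<in> N. f x ~= 0}"]) auto
  qed
  have i2: "(\<lambda>x. inverse (f x)) \<in> regfuns Z {x \<in> U. f x ~= 0}" if U: "?o U" "f \<in> regfuns Z U" for U f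
  proof (rule regI)
    fix p assume p: "p \<in> {x \<in> U. f x ~= 0}"
    then obtain N where N: "?o N" "p \<in> N" "N \<subseteq> U" "f \<in> Q N" using regD[OF U(2), of p] by blast
    then show "\<exists>N. ?o N \<and> p \<in> N \<and> N \<subseteq> {x \<in> U. f x ~= 0} \<and> (\<lambda>x. inverse (f x)) \<in> Q N"
      using p open_nz[OF N(1,4)] inv[OF N(1,4)] by (intro exI[of _ "{x \<in> N. f x ~= 0}"]) auto
  qed
  show ?thesis
    unfolding nice_def
  proof (intro conjI allI impI; (elim conjE)?)
    fix U f g assume U: "?o U" "f \<in> regfuns Z U" "\<forall>x\<in>U. f x = g x"
    show "g \<in> regfuns Z U"
    proof (rule regI)
      fix p assume "p \<in> U"
      then obtain N where N: "?o N" "p \<in> N" "N \<subseteq> U" "f \<in> Q N" using regD[OF U(2)] by blast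
      then have "g \<in> Q N" using cong[OF N(1,4), of g] U(3) by blast
      then show "\<exists>N. ?o N \<and> p \<in> N \<and> N \<subseteq> U \<and> g \<in> Q N" using N by blast
    qed
  next
    fix U c assume "?o U"
    then show "(\<lambda>_. c) \<in> regfuns Z U" using const by (intro regI) blast
  next
    fix U f g assume U: "?o U" "f \<in> regfuns Z U" "g \<in> regfuns Z U"
    show "(\<lambda>x. f x + g x) \<in> regfuns Z U"
    proof (rule regI)
      fix p assume "p \<in> U"
      from two[OF U(2,3) this] add show "\<exists>N. ?o N \<and> p \<in> N \<and> N \<subseteq> U \<and> (\<lambda>x. f x + g x) \<in> Q N" by meson
    qed
    show "(\<lambda>x. f x * g x) \<in> regfuns Z U"
    proof (rule regI)
      fix p assume "p \<in> U"
      from two[OF U(2,3) this] mult show "\<exists>N. ?o N \<and> p \<in> N \<and> N \<subseteq> U \<and> (\<lambda>x. f x * g x) \<in> Q N" by meson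
    qed
  next
    fix U f assume "?o U" "\<forall>x\<in>U. \<exists>N. ?o N \<and> x \<in> N \<and> N \<subseteq> U \<and> f \<in> regfuns Z N"
    then show "f \<in> regfuns Z U" using regD by (intro regI) (meson order_trans)
  qed (use r i1 i2 in blast)+
qed

subsection \<open>Open subspaces, products, projective and affine spaces\<close>

lemma nice_open_subspace:
  assumes X: "nice X" and U: "openin (zariski X) U"
  shows "nice (open_subspace X U)"
proof -
  have o: "openin (subtopology (zariski X) U) V \<longleftrightarrow> openin (zariski X) V \<and> V \<subseteq> U" for V
    using U by (rule openin_open_subtopology)
  show ?thesis
    unfolding nice_def open_subspace_def fun_space.simps o
  proof (intro conjI allI impI; (elim conjE)?)
    fix W f assume W: "openin (zariski X) W" "W \<subseteq> U"
      and f: "\<forall>x\<in>W. \<exists>N. (openin (zariski X) N \<and> N \<subseteq> U) \<and> x \<in> N \<and> N \<subseteq> W \<and> f \<in> regfuns X N"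
    show "f \<in> regfuns X W" by (rule nice_glue[OF X W(1)]) (use f in blast)
  next
    fix W f g assume "openin (zariski X) W" "f \<in> regfuns X W" "\<forall>x\<in>W. f x = g x"
    then show "g \<in> regfuns X W" using nice_cong[OF X] by blast
  next
    fix W c assume "openin (zariski X) W" "W \<subseteq> U"
    then show "(\<lambda>_. c) \<in> regfuns X W" using nice_const[OF X] by blast
  next
    fix W f g assume W: "openin (zariski X) W" "f \<in> regfuns X W" "g \<in> regfuns X W"
    show "(\<lambda>x. f x + g x) \<in> regfuns X W" "(\<lambda>x. f x * g x) \<in> regfuns X W"
      by (rule nice_add_mult[OF X W])+
  next
    fix W f assume W: "openin (zariski X) W" "W \<subseteq> U" "f \<in> regfuns X W"
    show "openin (zariski X) {x \<in> W. f x ~= 0}" "(\<lambda>x. inverse (f x)) \<in> regfuns X {x \<in> W. f x ~= 0}"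
      by (rule nice_nonzero[OF X W(1,3)])+
    show "{x \<in> W. f x ~= 0} \<subseteq> U" using W(2) by blast
  next
    fix W V f assume "openin (zariski X) W" "openin (zariski X) V" "V \<subseteq> W" "f \<in> regfuns X W"
    then show "f \<in> regfuns X V" by (rule nice_restrict[OF X])
  qed
qed

lemma points_open_subspace: "openin (zariski X) U ==> points (open_subspace X U) = U"
  using openin_subset[of "zariski X" U] by (auto simp: open_subspace_def)

lemma regfuns_open_subspace: "regfuns (open_subspace X U) = regfuns X"
  by (simp add: open_subspace_def)

definition function_ring :: "('a => complex) set => bool"
  where "function_ring R \<longleftrightarrow> (\<forall>c. (\<lambda>_. c) \<in> R) \<and> (\<forall>f\<in>R. \<forall>g\<in>R. (\<lambda>x. f x + g x) \<in> R \<and> (\<lambda>x. f x * g x) \<in> R)"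

text \<open>The affine variety with points \<open>S\<close> and coordinate ring \<open>R\<close>.\<close>

definition aff :: "'a set => ('a => complex) set => 'a fun_space"
  where "aff S R = \<lparr>zariski = topology_generated_by {{x \<in> S. f x ~= 0} | f. f \<in> R},
    regfuns = (\<lambda>W. {f. \<forall>p\<in>W. \<exists>N g h. openin (topology_generated_by {{x \<in> S. f x ~= 0} | f. f \<in> R}) N \<and>
      p \<in> N \<and> N \<subseteq> W \<and> g \<in> R \<and> h \<in> R \<and> (\<forall>q\<in>N. h q ~= 0 \<and> f q = g q / h q)})\<rparr>"

lemma aff_basic_open: "f \<in> R ==> openin (zariski (aff S R)) {x \<in> S. f x ~= 0}"
  unfolding aff_def fun_space.simps by (rule topology_generated_by_Basis) blast

lemma points_aff:
  assumes "function_ring R" shows "points (aff S R) = S"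
proof -
  have "(\<lambda>_. 1) \<in> R" using assms by (simp add: function_ring_def)
  then have "S \<subseteq> \<Union> {{x \<in> S. f x ~= 0} | f. f \<in> R}" by (intro Union_upper CollectI exI[of _ "\<lambda>_. 1"]) auto
  moreover have "\<Union> {{x \<in> S. f x ~= 0} | f. f \<in> R} \<subseteq> S" by blast
  ultimately show ?thesis by (simp add: aff_def)
qed

lemma regular_aff:
  assumes R: "function_ring R" and f: "f \<in> R" and W: "openin (zariski (aff S R)) W"
  shows "f \<in> regfuns (aff S R) W"
proof -
  have one: "(\<lambda>_. 1) \<in> R" using R by (simp add: function_ring_def)
  show ?thesis
    unfolding aff_def fun_space.simps
  proof (intro CollectI ballI)
    fix p assume "p \<in> W"
    then show "\<exists>N g h. openin (topology_generated_by {{x \<in> S. f x ~= 0} | f. f \<in> R}) N \<and>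
      p \<in> N \<and> N \<subseteq> W \<and> g \<in> R \<and> h \<in> R \<and> (\<forall>q\<in>N. h q ~= 0 \<and> f q = g q / h q)"
      using W f one by (intro exI[of _ W] exI[of _ f] exI[of _ "\<lambda>_. 1"]) (auto simp: aff_def)
  qed
qed

lemma nice_aff:
  assumes R: "function_ring R" shows "nice (aff S R)"
proof (rule nice_sheafify[where Q = "\<lambda>N. {u. \<exists>g\<in>R. \<exists>h\<in>R. \<forall>q\<in>N. h q ~= 0 \<and> u q = g q / h q}"])
  let ?o = "openin (zariski (aff S R))"
  have c: "(\<lambda>_. c) \<in> R" for c using R by (simp add: function_ring_def)
  have ad: "(\<lambda>x. f x + g x) \<in> R" "(\<lambda>x. f x * g x) \<in> R" if "f \<in> R" "g \<in> R" for f g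
    using R that by (simp_all add: function_ring_def)
  show "regfuns (aff S R) W = {f. \<forall>p\<in>W. \<exists>N. ?o N \<and> p \<in> N \<and> N \<subseteq> W \<and>
      f \<in> {u. \<exists>g\<in>R. \<exists>h\<in>R. \<forall>q\<in>N. h q ~= 0 \<and> u q = g q / h q}}" for W
    unfolding aff_def fun_space.simps by (intro Collect_cong ball_cong refl) blast
  show "(\<lambda>_. c) \<in> {u. \<exists>g\<in>R. \<exists>h\<in>R. \<forall>q\<in>N. h q ~= 0 \<and> u q = g q / h q}" for N c
    using c[of c] c[of 1] by (intro CollectI bexI[of _ "\<lambda>_. c"] bexI[of _ "\<lambda>_. 1"]) auto
  fix N f assume N: "?o N" and "f \<in> {u. \<exists>g\<in>R. \<exists>h\<in>R. \<forall>q\<in>N. h q ~= 0 \<and> u q = g q / h q}"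
  then obtain g h where gh: "g \<in> R" "h \<in> R" "\<forall>q\<in>N. h q ~= 0 \<and> f q = g q / h q" by blast
  have "N \<subseteq> S" using openin_subset[OF N] points_aff[OF R] by simp
  then have eq: "{x \<in> N. f x ~= 0} = N \<inter> {x \<in> S. g x ~= 0}" using gh(3) by auto
  show "?o {x \<in> N. f x ~= 0}" unfolding eq using N aff_basic_open[OF gh(1)] by blast
  show "(\<lambda>x. inverse (f x)) \<in> {u. \<exists>g\<in>R. \<exists>h\<in>R. \<forall>q\<in>{x \<in> N. f x ~= 0}. h q ~= 0 \<and> u q = g q / h q}"
    using gh by (intro CollectI bexI[of _ h] bexI[of _ g]) auto
  show "g' \<in> {u. \<exists>g\<in>R. \<exists>h\<in>R. \<forall>q\<in>N. h q ~= 0 \<and> u q = g q / h q}" if "\<And>x. x \<in> N ==> f x = g' x" for g'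
    using gh that by (intro CollectI bexI[of _ g] bexI[of _ h]) auto
  show "f \<in> {u. \<exists>g\<in>R. \<exists>h\<in>R. \<forall>q\<in>V. h q ~= 0 \<and> u q = g q / h q}" if "V \<subseteq> N" for V
    using gh that by (intro CollectI bexI[of _ g] bexI[of _ h]) auto
  fix f' assume "f' \<in> {u. \<exists>g\<in>R. \<exists>h\<in>R. \<forall>q\<in>N. h q ~= 0 \<and> u q = g q / h q}"
  then obtain g' h' where gh': "g' \<in> R" "h' \<in> R" "\<forall>q\<in>N. h' q ~= 0 \<and> f' q = g' q / h' q" by blast
  show "(\<lambda>x. f x + f' x) \<in> {u. \<exists>g\<in>R. \<exists>h\<in>R. \<forall>q\<in>N. h q ~= 0 \<and> u q = g q / h q}"
    using gh gh' by (intro CollectI bexI[of _ "\<lambda>x. g x * h' x + g' x * h x"] bexI[of _ "\<lambda>x. h x * h' x"])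
      (auto intro: ad simp: field_simps)
  show "(\<lambda>x. f x * f' x) \<in> {u. \<exists>g\<in>R. \<exists>h\<in>R. \<forall>q\<in>N. h q ~= 0 \<and> u q = g q / h q}"
    using gh gh' by (intro CollectI bexI[of _ "\<lambda>x. g x * g' x"] bexI[of _ "\<lambda>x. h x * h' x"])
      (auto intro: ad)
qed

lemma affine_line_aff: "affine_line = aff UNIV (range poly)"
proof -
  have "affine_line_zariski = topology_generated_by {{x \<in> UNIV. f x ~= 0} | f. f \<in> range (poly :: complex poly => _)}"
    unfolding affine_line_zariski_def by (rule arg_cong[of _ _ topology_generated_by]) auto
  then show ?thesis unfolding affine_line_def aff_def by (auto intro!: ext Collect_cong ball_cong)
qed

lemma function_ring_poly: "function_ring (range (poly :: complex poly => _))"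
  unfolding function_ring_def
proof (intro conjI allI ballI)
  show "(\<lambda>_. c) \<in> range poly" for c :: complex by (rule image_eqI[of _ _ "[:c:]"]) auto
  fix f g :: "complex => complex" assume "f \<in> range poly" "g \<in> range poly"
  then obtain p q where "f = poly p" "g = poly q" by blast
  then show "(\<lambda>x. f x + g x) \<in> range poly" "(\<lambda>x. f x * g x) \<in> range poly"
    by (auto simp: fun_eq_iff image_iff intro: exI[of _ "p + q"] exI[of _ "p * q"])
qed

lemma nice_affine_line: "nice affine_line"
  unfolding affine_line_aff by (rule nice_aff[OF function_ring_poly])

lemma open_Cstar: "openin (zariski affine_line) (- {0})"
proof -
  have "poly [:0, 1:] \<in> range (poly :: complex poly => _)" by blast
  from aff_basic_open[OF this, of UNIV] show ?thesis
    unfolding affine_line_aff by (simp add: Compl_eq)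
qed

lemma nice_Cstar: "nice Cstar"
  unfolding Cstar_def by (rule nice_open_subspace[OF nice_affine_line open_Cstar])

lemma proj_points_class: "x ~= 0 ==> scaling_rel `` {x} \<in> proj_points"
  unfolding proj_points_def by (rule quotientI) simp

lemma class_iff: "x ~= 0 ==> y \<in> scaling_rel `` {x} \<longleftrightarrow> y ~= 0 \<and> (\<exists>c. y = c *s x)"
  by (auto simp: scaling_rel_def)

lemma proj_pointsE:
  assumes "p \<in> proj_points" obtains x where "x ~= 0" "p = scaling_rel `` {x}" "x \<in> p"
proof -
  from assms obtain x where x: "x \<in> - {0}" "p = scaling_rel `` {x}" unfolding proj_points_def by (rule quotientE)
  then have "x \<in> p" using class_iff[of x x] by (auto intro: exI[of _ 1])
  then show ?thesis using that x by auto
qed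

lemma class_eq_iff: "x ~= 0 ==> y ~= 0 ==> scaling_rel `` {x} = scaling_rel `` {y} \<longleftrightarrow> (\<exists>c. y = c *s x)"
proof
  assume x: "x ~= 0" "y ~= 0" and "scaling_rel `` {x} = scaling_rel `` {y}"
  moreover have "y \<in> scaling_rel `` {y}" using x class_iff[of y y] by (auto intro: exI[of _ 1])
  ultimately show "\<exists>c. y = c *s x" using class_iff[OF x(1), of y] by simp
next
  assume x: "x ~= 0" "y ~= 0" and "\<exists>c. y = c *s x"
  then obtain c where c: "y = c *s x" by blast
  then have c0: "c ~= 0" using x by auto
  have "w \<in> scaling_rel `` {x} \<longleftrightarrow> w \<in> scaling_rel `` {y}" for w
  proof -
    have "(\<exists>d. w = d *s x) \<longleftrightarrow> (\<exists>d. w = d *s y)"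
    proof
      assume "\<exists>d. w = d *s x"
      then obtain d where "w = d *s x" by blast
      then have "w = (d / c) *s y" using c c0 by (simp add: vector_smult_assoc)
      then show "\<exists>d. w = d *s y" by blast
    next
      assume "\<exists>d. w = d *s y"
      then obtain d where "w = d *s y" by blast
      then have "w = (d * c) *s x" using c by (simp add: vector_smult_assoc)
      then show "\<exists>d. w = d *s x" by blast
    qed
    then show ?thesis using x class_iff[OF x(1), of w] class_iff[OF x(2), of w] by blast
  qed
  then show "scaling_rel `` {x} = scaling_rel `` {y}" by blast
qed

lemma homogeneous_form_scale:
  assumes "homogeneous_form d f" shows "f (c *s x) = c ^ d * f (x :: complex ^ 'n)"
proof -
  obtain a where f: "f = (\<lambda>x. \<Sum>m | (\<Sum>i\<in>UNIV. m i) = d. a m * (\<Prod>i\<in>UNIV. (x $ i) ^ m i))"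
    using assms by (auto simp: homogeneous_form_def)
  show ?thesis
    unfolding f sum_distrib_left
  proof (intro sum.cong refl)
    fix m :: "'n => nat" assume "m \<in> {m. (\<Sum>i\<in>UNIV. m i) = d}"
    then have "(\<Prod>i\<in>UNIV. ((c *s x) $ i) ^ m i) = c ^ d * (\<Prod>i\<in>UNIV. (x $ i) ^ m i)"
      by (simp add: power_mult_distrib prod.distrib power_sum[symmetric])
    then show "a m * (\<Prod>i\<in>UNIV. ((c *s x) $ i) ^ m i) = c ^ d * (a m * (\<Prod>i\<in>UNIV. (x $ i) ^ m i))" by simp
  qed
qed

lemma finite_exponents: "finite {m :: 'n::finite => nat. (\<Sum>i\<in>UNIV. m i) = d}"
proof (rule finite_subset)
  show "{m. (\<Sum>i\<in>UNIV. m i) = d} \<subseteq> (UNIV :: 'n set) \<rightarrow>\<^sub>E {..d}"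
    by (auto simp: PiE_def intro: member_le_sum[of _ UNIV])
qed (simp add: finite_PiE)

lemma homogeneous_form_monomial:
  "(\<Sum>i\<in>UNIV. m i) = d ==> homogeneous_form d (\<lambda>x :: complex ^ 'n. c * (\<Prod>i\<in>UNIV. (x $ i) ^ m i))"
  unfolding homogeneous_form_def
proof (intro exI[of _ "\<lambda>m'. if m' = m then c else 0"] ext)
  fix x :: "complex ^ 'n" assume "(\<Sum>i\<in>UNIV. m i) = d"
  then show "c * (\<Prod>i\<in>UNIV. (x $ i) ^ m i) =
      (\<Sum>m' | (\<Sum>i\<in>UNIV. m' i) = d. (if m' = m then c else 0) * (\<Prod>i\<in>UNIV. (x $ i) ^ m' i))"
    by (simp add: if_distrib[of "\<lambda>u. u * _"] finite_exponents cong: if_cong)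
qed

lemma homogeneous_form_add:
  assumes "homogeneous_form d f" "homogeneous_form d g"
  shows "homogeneous_form d (\<lambda>x. f x + g x)"
proof -
  obtain a b where f: "f = (\<lambda>x. \<Sum>m | (\<Sum>i\<in>UNIV. m i) = d. a m * (\<Prod>i\<in>UNIV. (x $ i) ^ m i))"
    and g: "g = (\<lambda>x. \<Sum>m | (\<Sum>i\<in>UNIV. m i) = d. b m * (\<Prod>i\<in>UNIV. (x $ i) ^ m i))"
    using assms by (auto simp: homogeneous_form_def)
  show ?thesis unfolding homogeneous_form_def f g
    by (intro exI[of _ "\<lambda>m. a m + b m"]) (simp add: algebra_simps sum.distrib)
qed

lemma homogeneous_form_0: "homogeneous_form d (\<lambda>_. 0)"
  unfolding homogeneous_form_def by (intro exI[of _ "\<lambda>_. 0"]) simp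

lemma homogeneous_form_sum:
  "(\<And>i. i \<in> A ==> homogeneous_form d (f i)) ==> homogeneous_form d (\<lambda>x. \<Sum>i\<in>A. f i x)"
  by (induction A rule: infinite_finite_induct) (auto intro: homogeneous_form_0 homogeneous_form_add)

lemma homogeneous_form_mult:
  assumes "homogeneous_form d f" "homogeneous_form d' g"
  shows "homogeneous_form (d + d') (\<lambda>x :: complex ^ 'n. f x * g x)"
proof -
  obtain a b where f: "f = (\<lambda>x. \<Sum>m | (\<Sum>i\<in>UNIV. m i) = d. a m * (\<Prod>i\<in>UNIV. (x $ i) ^ m i))"
    and g: "g = (\<lambda>x. \<Sum>m | (\<Sum>i\<in>UNIV. m i) = d'. b m * (\<Prod>i\<in>UNIV. (x $ i) ^ m i))"
    using assms by (auto simp: homogeneous_form_def)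
  have eq: "(\<lambda>x. f x * g x) = (\<lambda>x. \<Sum>m | (\<Sum>i\<in>UNIV. m i) = d. \<Sum>m' | (\<Sum>i\<in>UNIV. m' i) = d'.
      (a m * b m') * (\<Prod>i\<in>UNIV. (x $ i) ^ (m i + m' i)))"
    unfolding f g by (rule ext) (simp add: sum_product power_add prod.distrib mult_ac)
  show ?thesis unfolding eq
    by (intro homogeneous_form_sum homogeneous_form_monomial) (auto simp: sum.distrib)
qed

lemma homogeneous_form_coord: "homogeneous_form 1 (\<lambda>x :: complex ^ 'n. x $ i)"
proof -
  have "(\<lambda>x :: complex ^ 'n. x $ i) = (\<lambda>x. 1 * (\<Prod>j\<in>UNIV. (x $ j) ^ (if j = i then 1 else 0)))"
    by (rule ext) (simp add: if_distrib[of "\<lambda>n. _ ^ n"] prod.delta cong: if_cong)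
  moreover have "homogeneous_form 1 (\<lambda>x :: complex ^ 'n. 1 * (\<Prod>j\<in>UNIV. (x $ j) ^ (if j = i then 1 else 0)))"
    by (rule homogeneous_form_monomial) (simp add: sum.delta)
  ultimately show ?thesis by simp
qed

lemma homogeneous_form_cmult: "homogeneous_form d f ==> homogeneous_form d (\<lambda>x. c * f x)"
proof -
  assume f: "homogeneous_form d f"
  have "homogeneous_form 0 (\<lambda>x :: complex ^ 'a. c)"
    using homogeneous_form_monomial[of "\<lambda>_. 0" 0 c] by simp
  from homogeneous_form_mult[OF this f] show ?thesis by simp
qed

lemma proj_open_nonzero:
  "homogeneous_form d f ==> openin proj_zariski {p \<in> proj_points. \<forall>x\<in>p. f x ~= 0}"
  unfolding proj_zariski_def by (rule topology_generated_by_Basis) blast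

lemma nice_proj_space: "nice (proj_space :: (complex ^ 'n) set fun_space)"
proof -
  define Q where "Q N = {f :: (complex ^ 'n) set => complex. \<exists>d g h. homogeneous_form d g \<and> homogeneous_form d h \<and>
    (\<forall>q\<in>N. \<forall>x\<in>q. h x ~= 0 \<and> f q = g x / h x)}" for N
  let ?Z = "proj_space :: (complex ^ 'n) set fun_space"
  let ?o = "openin (zariski ?Z)"
  have z: "zariski ?Z = proj_zariski" by (simp add: proj_space_def)
  show ?thesis
  proof (rule nice_sheafify[where Q = Q])
    show "regfuns ?Z W = {f. \<forall>p\<in>W. \<exists>N. ?o N \<and> p \<in> N \<and> N \<subseteq> W \<and> f \<in> Q N}" for W
      unfolding proj_space_def fun_space.simps Q_def by (intro Collect_cong ball_cong refl) blast
    show "(\<lambda>_. c) \<in> Q N" for N c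
      unfolding Q_def using homogeneous_form_1 homogeneous_form_cmult[OF homogeneous_form_1, of c]
      by (intro CollectI exI[of _ 0] exI[of _ "\<lambda>_. c * 1"] exI[of _ "\<lambda>_. 1"]) auto
    fix N f assume N: "?o N" and "f \<in> Q N"
    then obtain d g h where gh: "homogeneous_form d g" "homogeneous_form d h"
      "\<forall>q\<in>N. \<forall>x\<in>q. h x ~= 0 \<and> f q = g x / h x" unfolding Q_def by blast
    have NP: "N \<subseteq> proj_points" using openin_subset[OF N] points_proj_space by metis
    have ne: "q ~= {}" if "q \<in> N" for q using that NP by (auto elim: proj_pointsE)
    have eq: "{x \<in> N. f x ~= 0} = N \<inter> {p \<in> proj_points. \<forall>x\<in>p. g x ~= 0}"
    proof -
      have "f q ~= 0 \<longleftrightarrow> g x ~= 0" if "q \<in> N" "x \<in> q" for q x using gh(3) that by simp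
      then show ?thesis using NP ne by blast
    qed
    show "?o {x \<in> N. f x ~= 0}" unfolding eq
      by (rule openin_Int[OF N]) (simp only: z, rule proj_open_nonzero[OF gh(1)])
    have ghD: "h x ~= 0" "f q = g x / h x" if "q \<in> N" "x \<in> q" for q x using gh(3) that by auto
    show "(\<lambda>x. inverse (f x)) \<in> Q {x \<in> N. f x ~= 0}"
      unfolding Q_def
    proof (intro CollectI exI conjI ballI)
      fix q x assume "q \<in> {x \<in> N. f x ~= 0}" "x \<in> q"
      then have "h x ~= 0" "f q = g x / h x" "f q ~= 0" using ghD by auto
      then show "g x ~= 0" "inverse (f q) = h x / g x" by auto
    qed (fact gh)+
    show "g' \<in> Q N" if e: "\<And>x. x \<in> N ==> f x = g' x" for g'
      unfolding Q_def
    proof (intro CollectI exI conjI ballI)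
      fix q x assume q: "q \<in> N" "x \<in> q"
      show "h x ~= 0" "g' q = g x / h x" using ghD[OF q] e[OF q(1)] by auto
    qed (fact gh)+
    show "f \<in> Q V" if V: "V \<subseteq> N" for V
      unfolding Q_def
    proof (intro CollectI exI conjI ballI)
      fix q x assume q: "q \<in> V" "x \<in> q"
      show "h x ~= 0" "f q = g x / h x" using ghD[of q x] q V by auto
    qed (fact gh)+
    fix f' assume "f' \<in> Q N"
    then obtain d' g' h' where gh': "homogeneous_form d' g'" "homogeneous_form d' h'"
      "\<forall>q\<in>N. \<forall>x\<in>q. h' x ~= 0 \<and> f' q = g' x / h' x" unfolding Q_def by blast
    have hom: "homogeneous_form (d + d') (\<lambda>x. g x * h' x + h x * g' x)"
      "homogeneous_form (d + d') (\<lambda>x. h x * h' x)" "homogeneous_form (d + d') (\<lambda>x. g x * g' x)"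
      using gh gh' by (auto intro: homogeneous_form_mult homogeneous_form_add)
    show "(\<lambda>x. f x + f' x) \<in> Q N"
      unfolding Q_def
    proof (intro CollectI exI conjI ballI)
      fix q x assume "q \<in> N" "x \<in> q"
      then have "h x ~= 0" "f q = g x / h x" "h' x ~= 0" "f' q = g' x / h' x" using gh(3) gh'(3) by auto
      then show "h x * h' x ~= 0" "f q + f' q = (g x * h' x + h x * g' x) / (h x * h' x)" by (auto simp: field_simps)
    qed (fact hom)+
    show "(\<lambda>x. f x * f' x) \<in> Q N"
      unfolding Q_def
    proof (intro CollectI exI conjI ballI)
      fix q x assume "q \<in> N" "x \<in> q"
      then have "h x ~= 0" "f q = g x / h x" "h' x ~= 0" "f' q = g' x / h' x" using gh(3) gh'(3) by auto
      then show "h x * h' x ~= 0" "f q * f' q = (g x * g' x) / (h x * h' x)" by auto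
    qed (fact hom)+
  qed
qed

lemma tensorE:
  assumes "t \<in> tensor_funs X Y U U'"
  obtains n :: nat and a b where "\<forall>i<n. a i \<in> regfuns X U \<and> b i \<in> regfuns Y U'"
    "\<forall>x\<in>U. \<forall>y\<in>U'. t (x, y) = (\<Sum>i<n. a i x * b i y)"
  using assms unfolding tensor_funs_def by (elim CollectE exE conjE) (rule that)

lemma tensor_pure:
  "a \<in> regfuns X U ==> b \<in> regfuns Y U' ==> (\<lambda>p. a (fst p) * b (snd p)) \<in> tensor_funs X Y U U'"
  unfolding tensor_funs_def by (intro CollectI exI[of _ "1::nat"] exI[of _ "\<lambda>_. a"] exI[of _ "\<lambda>_. b"]) auto

lemma tensorI:
  fixes n :: nat
  assumes "\<And>i. i < n ==> a i \<in> regfuns X U" "\<And>i. i < n ==> b i \<in> regfuns Y U'"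
    "\<And>x y. x \<in> U ==> y \<in> U' ==> t (x, y) = (\<Sum>i<n. a i x * b i y)"
  shows "t \<in> tensor_funs X Y U U'"
proof -
  have "(\<forall>i<n. a i \<in> regfuns X U \<and> b i \<in> regfuns Y U') \<and> (\<forall>x\<in>U. \<forall>y\<in>U'. t (x, y) = (\<Sum>i<n. a i x * b i y))"
    using assms by blast
  then show ?thesis unfolding tensor_funs_def by (intro CollectI exI)
qed

lemma tensor_cong:
  assumes "f \<in> tensor_funs X Y U U'" "\<And>p. p \<in> U \<times> U' ==> f p = g p"
  shows "g \<in> tensor_funs X Y U U'"
proof -
  obtain n :: nat and a b where 1: "\<forall>i<n. a i \<in> regfuns X U \<and> b i \<in> regfuns Y U'"
    "\<forall>x\<in>U. \<forall>y\<in>U'. f (x, y) = (\<Sum>i<n. a i x * b i y)" by (rule tensorE[OF assms(1)])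
  show ?thesis
  proof (rule tensorI)
    fix x y assume "x \<in> U" "y \<in> U'"
    then show "g (x, y) = (\<Sum>i<n. a i x * b i y)" using 1(2) assms(2)[of "(x, y)"] by simp
  qed (use 1(1) in auto)
qed

lemma sum_append: "(\<Sum>i<n + m. if i < n then u i else v (i - n)) = (\<Sum>i<n. u i) + (\<Sum>i<m. v i)"
  for u v :: "nat => complex"
  by (induction m) (simp_all add: add.assoc)

lemma tensor_add:
  assumes "f \<in> tensor_funs X Y U U'" "g \<in> tensor_funs X Y U U'"
  shows "(\<lambda>p. f p + g p) \<in> tensor_funs X Y U U'"
proof -
  obtain n :: nat and a b where 1: "\<forall>i<n. a i \<in> regfuns X U \<and> b i \<in> regfuns Y U'"
    "\<forall>x\<in>U. \<forall>y\<in>U'. f (x, y) = (\<Sum>i<n. a i x * b i y)" by (rule tensorE[OF assms(1)])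
  obtain m :: nat and c d where 2: "\<forall>i<m. c i \<in> regfuns X U \<and> d i \<in> regfuns Y U'"
    "\<forall>x\<in>U. \<forall>y\<in>U'. g (x, y) = (\<Sum>i<m. c i x * d i y)" by (rule tensorE[OF assms(2)])
  let ?a = "\<lambda>i. if i < n then a i else c (i - n)" and ?b = "\<lambda>i. if i < n then b i else d (i - n)"
  show ?thesis
    unfolding tensor_funs_def
  proof (intro CollectI exI[of _ "n + m"] exI[of _ ?a] exI[of _ ?b] conjI allI impI ballI)
    fix i assume "i < n + m"
    then show "?a i \<in> regfuns X U" "?b i \<in> regfuns Y U'" using 1(1) 2(1) by auto
  next
    fix x y assume xy: "x \<in> U" "y \<in> U'"
    have "(\<Sum>i<n + m. ?a i x * ?b i y) = (\<Sum>i<n + m. if i < n then a i x * b i y else c (i - n) x * d (i - n) y)"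
      by (rule sum.cong) auto
    also have "\<dots> = f (x, y) + g (x, y)"
      using 1(2) 2(2) xy sum_append[where n = n and m = m and u = "\<lambda>i. a i x * b i y" and v = "\<lambda>i. c i x * d i y"] by simp
    finally show "f (x, y) + g (x, y) = (\<Sum>i<n + m. ?a i x * ?b i y)" by simp
  qed
qed

lemma tensor_mult:
  assumes X: "nice X" "openin (zariski X) U" and Y: "nice Y" "openin (zariski Y) U'"
    and f: "f \<in> tensor_funs X Y U U'" and g: "g \<in> tensor_funs X Y U U'"
  shows "(\<lambda>p. f p * g p) \<in> tensor_funs X Y U U'"
proof -
  obtain n :: nat and a b where 1: "\<forall>i<n. a i \<in> regfuns X U \<and> b i \<in> regfuns Y U'"
    "\<forall>x\<in>U. \<forall>y\<in>U'. f (x, y) = (\<Sum>i<n. a i x * b i y)" by (rule tensorE[OF f])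
  obtain m :: nat and c d where 2: "\<forall>i<m. c i \<in> regfuns X U \<and> d i \<in> regfuns Y U'"
    "\<forall>x\<in>U. \<forall>y\<in>U'. g (x, y) = (\<Sum>i<m. c i x * d i y)" by (rule tensorE[OF g])
  have pure: "(\<lambda>p. (a i (fst p) * b i (snd p)) * g p) \<in> tensor_funs X Y U U'" if "i < n" for i
    unfolding tensor_funs_def
  proof (intro CollectI exI[of _ m] exI[of _ "\<lambda>j x. a i x * c j x"] exI[of _ "\<lambda>j y. b i y * d j y"]
      conjI allI impI ballI)
    fix j assume "j < m"
    then show "(\<lambda>x. a i x * c j x) \<in> regfuns X U" "(\<lambda>y. b i y * d j y) \<in> regfuns Y U'"
      using 1(1) 2(1) that nice_mult[OF X] nice_mult[OF Y] by auto
  next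
    fix x y assume "x \<in> U" "y \<in> U'"
    then show "a i (fst (x, y)) * b i (snd (x, y)) * g (x, y) = (\<Sum>j<m. a i x * c j x * (b i y * d j y))"
      using 2(2) by (simp add: sum_distrib_left mult_ac)
  qed
  have "(\<lambda>p. (\<Sum>i<k. a i (fst p) * b i (snd p)) * g p) \<in> tensor_funs X Y U U'" if "k \<le> n" for k
    using that
  proof (induction k)
    case 0
    show ?case unfolding tensor_funs_def by (intro CollectI exI[of _ "0::nat"]) auto
  next
    case (Suc k)
    then have "(\<lambda>p. (\<Sum>i<k. a i (fst p) * b i (snd p)) * g p + (a k (fst p) * b k (snd p)) * g p) \<in> tensor_funs X Y U U'"
      by (intro tensor_add pure) auto
    then show ?case by (simp add: distrib_right)
  qed
  from this[of n] show ?thesis by (rule tensor_cong[OF _]) (use 1(2) in auto)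
qed

lemma tensor_restrict:
  assumes "nice X" "openin (zariski X) U" "openin (zariski X) V" "V \<subseteq> U"
    and "nice Y" "openin (zariski Y) U'" "openin (zariski Y) V'" "V' \<subseteq> U'"
    and f: "f \<in> tensor_funs X Y U U'"
  shows "f \<in> tensor_funs X Y V V'"
proof -
  obtain n :: nat and a b where 1: "\<forall>i<n. a i \<in> regfuns X U \<and> b i \<in> regfuns Y U'"
    "\<forall>x\<in>U. \<forall>y\<in>U'. f (x, y) = (\<Sum>i<n. a i x * b i y)" by (rule tensorE[OF f])
  show ?thesis
    unfolding tensor_funs_def
  proof (intro CollectI exI[of _ n] exI[of _ a] exI[of _ b] conjI allI impI ballI)
    fix i assume "i < n"
    then show "a i \<in> regfuns X V" "b i \<in> regfuns Y V'"
      using 1(1) nice_restrict[OF assms(1-4)] nice_restrict[OF assms(5-8)] by auto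
  next
    fix x y assume "x \<in> V" "y \<in> V'"
    then show "f (x, y) = (\<Sum>i<n. a i x * b i y)" using 1(2) assms(4,8) by blast
  qed
qed

lemma product_basic_open:
  "openin (zariski X) U ==> openin (zariski Y) U' ==> f \<in> tensor_funs X Y U U' ==>
    openin (product_zariski X Y) {p \<in> U \<times> U'. f p ~= 0}"
  unfolding product_zariski_def by (rule topology_generated_by_Basis) blast

lemma nice_one: "nice X ==> (\<lambda>_. 1) \<in> regfuns X (points X)"
  by (rule nice_const) auto

lemma points_product_nice: "nice X ==> nice Y ==> points (product_space X Y) = points X \<times> points Y"
  by (rule points_product_space) (auto intro: nice_one)

lemma nice_product_space:
  assumes X: "nice X" and Y: "nice Y"
  shows "nice (product_space X Y)"
proof -
  define Q where "Q N = {f. \<exists>U U' g h. openin (zariski X) U \<and> openin (zariski Y) U' \<and> N \<subseteq> U \<times> U' \<and>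
        g \<in> tensor_funs X Y U U' \<and> h \<in> tensor_funs X Y U U' \<and> (\<forall>q\<in>N. h q ~= 0 \<and> f q = g q / h q)}" for N
  let ?Z = "product_space X Y"
  let ?o = "openin (zariski ?Z)"
  have z: "zariski ?Z = product_zariski X Y" by (simp add: product_space_def)
  have QI: "f \<in> Q N" if "openin (zariski X) U" "openin (zariski Y) U'" "N \<subseteq> U \<times> U'"
    "g \<in> tensor_funs X Y U U'" "h \<in> tensor_funs X Y U U'" "\<And>q. q \<in> N ==> h q ~= 0 \<and> f q = g q / h q" for f N U U' g h
    unfolding Q_def using that by blast
  show ?thesis
  proof (rule nice_sheafify[where Q = Q])
    show "regfuns ?Z W = {f. \<forall>p\<in>W. \<exists>N. ?o N \<and> p \<in> N \<and> N \<subseteq> W \<and> f \<in> Q N}" for W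
      unfolding product_space_def fun_space.simps Q_def by (intro Collect_cong ball_cong refl) blast
    show "(\<lambda>_. c) \<in> Q N" if N: "?o N" for N c
    proof (rule QI[of "points X" "points Y" _ "\<lambda>p. c * 1" "\<lambda>p. 1 * 1"])
      show "N \<subseteq> points X \<times> points Y" using openin_subset[OF N] points_product_nice[OF X Y] by simp
      show "(\<lambda>p. c * 1) \<in> tensor_funs X Y (points X) (points Y)"
        using tensor_pure[OF nice_const[OF X] nice_one[OF Y]] by simp
      show "(\<lambda>p. 1 * 1) \<in> tensor_funs X Y (points X) (points Y)"
        using tensor_pure[OF nice_one[OF X] nice_one[OF Y]] by simp
    qed auto
    fix N f assume N: "?o N" and "f \<in> Q N"
    then obtain U U' g h where U: "openin (zariski X) U" "openin (zariski Y) U'" "N \<subseteq> U \<times> U'"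
      "g \<in> tensor_funs X Y U U'" "h \<in> tensor_funs X Y U U'" "\<And>q. q \<in> N ==> h q ~= 0 \<and> f q = g q / h q"
      unfolding Q_def by blast
    have eq: "{x \<in> N. f x ~= 0} = N \<inter> {p \<in> U \<times> U'. g p ~= 0}"
    proof -
      have "f q ~= 0 \<longleftrightarrow> g q ~= 0" if "q \<in> N" for q using U(6)[OF that] by simp
      then show ?thesis using U(3) by blast
    qed
    show "?o {x \<in> N. f x ~= 0}" unfolding eq
      by (rule openin_Int[OF N]) (simp only: z, rule product_basic_open[OF U(1,2,4)])
    show "(\<lambda>x. inverse (f x)) \<in> Q {x \<in> N. f x ~= 0}"
    proof (rule QI[OF U(1,2) _ U(5,4)])
      show "{x \<in> N. f x ~= 0} \<subseteq> U \<times> U'" using U(3) by blast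
      fix q assume "q \<in> {x \<in> N. f x ~= 0}"
      then show "g q ~= 0 \<and> inverse (f q) = h q / g q" using U(6)[of q] by auto
    qed
    show "g' \<in> Q N" if e: "\<And>x. x \<in> N ==> f x = g' x" for g'
    proof (rule QI[OF U(1-5)])
      fix q assume "q \<in> N"
      then show "h q ~= 0 \<and> g' q = g q / h q" using U(6)[of q] e[of q] by simp
    qed
    show "f \<in> Q V" if V: "V \<subseteq> N" for V
    proof (rule QI[OF U(1,2) _ U(4,5)])
      show "V \<subseteq> U \<times> U'" using V U(3) by blast
    qed (use V U(6) in blast)
    fix f' assume "f' \<in> Q N"
    then obtain V V' g' h' where V: "openin (zariski X) V" "openin (zariski Y) V'" "N \<subseteq> V \<times> V'"
      "g' \<in> tensor_funs X Y V V'" "h' \<in> tensor_funs X Y V V'" "\<And>q. q \<in> N ==> h' q ~= 0 \<and> f' q = g' q / h' q"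
      unfolding Q_def by blast
    let ?U = "U \<inter> V" and ?U' = "U' \<inter> V'"
    have o: "openin (zariski X) ?U" "openin (zariski Y) ?U'" using U(1,2) V(1,2) by blast+
    have sub: "N \<subseteq> ?U \<times> ?U'" using U(3) V(3) by blast
    have t: "t \<in> tensor_funs X Y ?U ?U'" if "t \<in> tensor_funs X Y U U'" for t
      by (rule tensor_restrict[OF X U(1) o(1) _ Y U(2) o(2) _ that]) auto
    have t': "t \<in> tensor_funs X Y ?U ?U'" if "t \<in> tensor_funs X Y V V'" for t
      by (rule tensor_restrict[OF X V(1) o(1) _ Y V(2) o(2) _ that]) auto
    note m = tensor_mult[OF X o(1) Y o(2)]
    show "(\<lambda>x. f x + f' x) \<in> Q N"
    proof (rule QI[OF o sub])
      show "(\<lambda>p. g p * h' p + h p * g' p) \<in> tensor_funs X Y ?U ?U'"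
        by (intro tensor_add m t t' U V)
      show "(\<lambda>p. h p * h' p) \<in> tensor_funs X Y ?U ?U'" by (intro m t t' U V)
      fix q assume "q \<in> N"
      then show "h q * h' q ~= 0 \<and> f q + f' q = (g q * h' q + h q * g' q) / (h q * h' q)"
        using U(6)[of q] V(6)[of q] by (simp add: field_simps)
    qed
    show "(\<lambda>x. f x * f' x) \<in> Q N"
    proof (rule QI[OF o sub])
      show "(\<lambda>p. g p * g' p) \<in> tensor_funs X Y ?U ?U'" by (intro m t t' U V)
      show "(\<lambda>p. h p * h' p) \<in> tensor_funs X Y ?U ?U'" by (intro m t t' U V)
      fix q assume "q \<in> N"
      then show "h q * h' q ~= 0 \<and> f q * f' q = (g q * g' q) / (h q * h' q)"
        using U(6)[of q] V(6)[of q] by simp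
    qed
  qed
qed

subsection \<open>Recognising morphisms\<close>

lemma morphism_points: "morphism Z X f ==> z \<in> points Z ==> f z \<in> points X"
  by (auto simp: morphism_def continuous_map_def)

lemma morphism_preimage: "morphism Z X f ==> openin (zariski X) U ==> openin (zariski Z) {z \<in> points Z. f z \<in> U}"
  by (auto simp: morphism_def continuous_map_def)

lemma morphism_pullback:
  "morphism Z X f ==> openin (zariski X) U ==> a \<in> regfuns X U ==>
    (\<lambda>z. a (f z)) \<in> regfuns Z {z \<in> points Z. f z \<in> U}"
  unfolding morphism_def comp_def by blast

lemma morphism_pullback_points:
  assumes "morphism Z X f" "a \<in> regfuns X (points X)"
  shows "(\<lambda>z. a (f z)) \<in> regfuns Z (points Z)"
proof -
  have "{z \<in> points Z. f z \<in> points X} = points Z" using morphism_points[OF assms(1)] by blast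
  then show ?thesis using morphism_pullback[OF assms(1) _ assms(2)] by simp
qed

lemma morphism_const:
  assumes Z: "nice Z" and c: "c \<in> points X"
  shows "morphism Z X (\<lambda>_. c)"
  unfolding morphism_def comp_def
proof (intro conjI allI impI)
  show "continuous_map (zariski Z) (zariski X) (\<lambda>_. c)" using c by simp
  fix U g assume "openin (zariski X) U \<and> g \<in> regfuns X U"
  have "openin (zariski Z) {x \<in> points Z. c \<in> U}" by (cases "c \<in> U") auto
  then show "(\<lambda>x. g c) \<in> regfuns Z {x \<in> points Z. c \<in> U}" by (rule nice_const[OF Z])
qed

lemma morphism_open_subspace:
  assumes f: "morphism Z X f" and U: "openin (zariski X) U" and fU: "\<And>z. z \<in> points Z ==> f z \<in> U"
  shows "morphism Z (open_subspace X U) f"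
proof -
  have o: "openin (subtopology (zariski X) U) V \<longleftrightarrow> openin (zariski X) V \<and> V \<subseteq> U" for V
    using U by (rule openin_open_subtopology)
  have "continuous_map (zariski Z) (subtopology (zariski X) U) f"
    using f fU by (auto simp: morphism_def continuous_map_in_subtopology)
  then show ?thesis using f unfolding morphism_def open_subspace_def fun_space.simps o by blast
qed

lemma continuous_map_generated:
  assumes "\<And>B. B \<in> S ==> openin T {x \<in> topspace T. f x \<in> B}" and "\<And>x. x \<in> topspace T ==> f x \<in> \<Union> S"
  shows "continuous_map T (topology_generated_by S) f"
proof (rule continuous_on_generated_topo)
  fix B assume "B \<in> S"
  moreover have "f -` B \<inter> topspace T = {x \<in> topspace T. f x \<in> B}" by blast
  ultimately show "openin T (f -` B \<inter> topspace T)" using assms(1) by simp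
qed (use assms(2) in blast)

lemma morphism_pair:
  assumes Z: "nice Z" and X: "nice X" and Y: "nice Y" and f: "morphism Z X f" and g: "morphism Z Y g"
  shows "morphism Z (product_space X Y) (\<lambda>z. (f z, g z))"
proof -
  let ?p = "\<lambda>z. (f z, g z)"
  have pre: "openin (zariski Z) {z \<in> points Z. f z \<in> U \<and> g z \<in> U'}"
    if "openin (zariski X) U" "openin (zariski Y) U'" for U U'
  proof -
    have "{z \<in> points Z. f z \<in> U \<and> g z \<in> U'} = {z \<in> points Z. f z \<in> U} \<inter> {z \<in> points Z. g z \<in> U'}" by blast
    then show ?thesis using openin_Int[OF morphism_preimage[OF f that(1)] morphism_preimage[OF g that(2)]] by simp
  qed
  have pull: "(\<lambda>z. t (?p z)) \<in> regfuns Z {z \<in> points Z. f z \<in> U \<and> g z \<in> U'}"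
    if U: "openin (zariski X) U" "openin (zariski Y) U'" and t: "t \<in> tensor_funs X Y U U'" for U U' t
  proof -
    let ?W = "{z \<in> points Z. f z \<in> U \<and> g z \<in> U'}"
    obtain n :: nat and a b where 1: "\<forall>i<n. a i \<in> regfuns X U \<and> b i \<in> regfuns Y U'"
      "\<forall>x\<in>U. \<forall>y\<in>U'. t (x, y) = (\<Sum>i<n. a i x * b i y)" by (rule tensorE[OF t])
    have "(\<lambda>z. \<Sum>i\<in>{..<n}. a i (f z) * b i (g z)) \<in> regfuns Z ?W"
    proof (rule nice_sum[OF Z pre[OF U]], rule nice_mult[OF Z pre[OF U]])
      fix i assume "i \<in> {..<n}"
      then have i: "a i \<in> regfuns X U" "b i \<in> regfuns Y U'" using 1(1) by auto
      show "(\<lambda>z. a i (f z)) \<in> regfuns Z ?W"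
        by (rule nice_restrict[OF Z morphism_preimage[OF f U(1)] pre[OF U] _ morphism_pullback[OF f U(1) i(1)]]) auto
      show "(\<lambda>z. b i (g z)) \<in> regfuns Z ?W"
        by (rule nice_restrict[OF Z morphism_preimage[OF g U(2)] pre[OF U] _ morphism_pullback[OF g U(2) i(2)]]) auto
    qed
    then show ?thesis by (rule nice_cong[OF Z pre[OF U]]) (use 1(2) in auto)
  qed
  have cont: "continuous_map (zariski Z) (product_zariski X Y) ?p"
    unfolding product_zariski_def
  proof (rule continuous_map_generated)
    fix B assume "B \<in> {{p \<in> U \<times> U'. t p ~= 0} | U U' t.
       openin (zariski X) U \<and> openin (zariski Y) U' \<and> t \<in> tensor_funs X Y U U'}"
    then obtain U U' t where B: "B = {p \<in> U \<times> U'. t p ~= 0}" and U: "openin (zariski X) U" "openin (zariski Y) U'"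
      and t: "t \<in> tensor_funs X Y U U'" by blast
    have "{x \<in> points Z. ?p x \<in> B} = {x \<in> {z \<in> points Z. f z \<in> U \<and> g z \<in> U'}. t (?p x) ~= 0}"
      unfolding B by auto
    then show "openin (zariski Z) {x \<in> points Z. ?p x \<in> B}"
      using nice_open_nonzero[OF Z pre[OF U] pull[OF U t]] by simp
  next
    fix x assume "x \<in> points Z"
    then have "?p x \<in> points X \<times> points Y" using morphism_points[OF f] morphism_points[OF g] by simp
    then have "?p x \<in> points (product_space X Y)" using points_product_nice[OF X Y] by simp
    then show "?p x \<in> \<Union> {{p \<in> U \<times> U'. t p ~= 0} | U U' t.
       openin (zariski X) U \<and> openin (zariski Y) U' \<and> t \<in> tensor_funs X Y U U'}"
      by (simp add: product_space_def product_zariski_def)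
  qed
  show ?thesis
    unfolding morphism_def comp_def
  proof (intro conjI allI impI)
    show "continuous_map (zariski Z) (zariski (product_space X Y)) ?p" using cont by (simp add: product_space_def)
    fix W t assume "openin (zariski (product_space X Y)) W \<and> t \<in> regfuns (product_space X Y) W"
    then have W: "openin (product_zariski X Y) W" and t: "t \<in> regfuns (product_space X Y) W"
      by (simp_all add: product_space_def)
    let ?V = "{x \<in> points Z. ?p x \<in> W}"
    have V: "openin (zariski Z) ?V" using cont W by (rule openin_continuous_map_preimage)
    show "(\<lambda>x. t (?p x)) \<in> regfuns Z ?V"
    proof (rule nice_glue[OF Z V])
      fix z assume z: "z \<in> ?V"
      then have "?p z \<in> W" by simp
      then obtain N U U' g' h where N: "openin (product_zariski X Y) N" "?p z \<in> N" "N \<subseteq> W"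
        "openin (zariski X) U" "openin (zariski Y) U'" "N \<subseteq> U \<times> U'"
        "g' \<in> tensor_funs X Y U U'" "h \<in> tensor_funs X Y U U'" "\<forall>q\<in>N. h q ~= 0 \<and> t q = g' q / h q"
        using t unfolding product_space_def fun_space.simps by (elim CollectE) (drule bspec, assumption, blast)
      let ?M = "{x \<in> points Z. ?p x \<in> N}"
      have M: "openin (zariski Z) ?M" using cont N(1) by (rule openin_continuous_map_preimage)
      have sub: "?M \<subseteq> {z \<in> points Z. f z \<in> U \<and> g z \<in> U'}" using N(6) by blast
      note r = nice_restrict[OF Z pre[OF N(4,5)] M sub]
      have "(\<lambda>x. g' (?p x) / h (?p x)) \<in> regfuns Z ?M"
        by (rule nice_divide[OF Z M r[OF pull[OF N(4,5,7)]] r[OF pull[OF N(4,5,8)]]]) (use N(9) in auto)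
      then have "(\<lambda>x. t (?p x)) \<in> regfuns Z ?M" by (rule nice_cong[OF Z M]) (use N(9) in auto)
      then show "\<exists>N. openin (zariski Z) N \<and> z \<in> N \<and> N \<subseteq> ?V \<and> (\<lambda>x. t (?p x)) \<in> regfuns Z N"
        using M N(2,3) z by (intro exI[of _ ?M]) auto
    qed
  qed
qed

lemma morphism_aff:
  assumes Z: "nice Z" and R: "function_ring R" and \<phi>: "\<And>z. z \<in> points Z ==> \<phi> z \<in> S"
    and pull: "\<And>f. f \<in> R ==> (\<lambda>z. f (\<phi> z)) \<in> regfuns Z (points Z)"
  shows "morphism Z (aff S R) \<phi>"
proof -
  have top: "openin (zariski Z) (points Z)" by simp
  have one: "(\<lambda>_. 1) \<in> R" using R by (simp add: function_ring_def)
  have cont: "continuous_map (zariski Z) (topology_generated_by {{x \<in> S. f x ~= 0} | f. f \<in> R}) \<phi>"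
  proof (rule continuous_map_generated)
    fix B assume "B \<in> {{x \<in> S. f x ~= 0} | f. f \<in> R}"
    then obtain f where f: "B = {x \<in> S. f x ~= 0}" "f \<in> R" by blast
    have "{x \<in> points Z. \<phi> x \<in> B} = {x \<in> points Z. f (\<phi> x) ~= 0}" using \<phi> f(1) by blast
    then show "openin (zariski Z) {x \<in> points Z. \<phi> x \<in> B}"
      using nice_open_nonzero[OF Z top pull[OF f(2)]] by simp
  next
    fix x assume "x \<in> points Z"
    then have "\<phi> x \<in> {x \<in> S. (\<lambda>_. 1 :: complex) x ~= 0}" using \<phi> by simp
    then show "\<phi> x \<in> \<Union> {{x \<in> S. f x ~= 0} | f. f \<in> R}" using one by blast
  qed
  show ?thesis
    unfolding morphism_def comp_def
  proof (intro conjI allI impI)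
    show "continuous_map (zariski Z) (zariski (aff S R)) \<phi>" using cont by (simp add: aff_def)
    fix W t assume "openin (zariski (aff S R)) W \<and> t \<in> regfuns (aff S R) W"
    then have W: "openin (zariski (aff S R)) W" and t: "t \<in> regfuns (aff S R) W" by simp_all
    let ?V = "{x \<in> points Z. \<phi> x \<in> W}"
    have c': "continuous_map (zariski Z) (zariski (aff S R)) \<phi>" using cont by (simp add: aff_def)
    have V: "openin (zariski Z) ?V" using c' W by (rule openin_continuous_map_preimage)
    show "(\<lambda>x. t (\<phi> x)) \<in> regfuns Z ?V"
    proof (rule nice_glue[OF Z V])
      fix z assume z: "z \<in> ?V"
      then have "\<phi> z \<in> W" by simp
      then obtain N g h where N: "openin (zariski (aff S R)) N" "\<phi> z \<in> N" "N \<subseteq> W" "g \<in> R" "h \<in> R"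
        "\<forall>q\<in>N. h q ~= 0 \<and> t q = g q / h q"
        using t unfolding aff_def fun_space.simps by (elim CollectE) (drule bspec, assumption, blast)
      let ?M = "{x \<in> points Z. \<phi> x \<in> N}"
      have M: "openin (zariski Z) ?M" using c' N(1) by (rule openin_continuous_map_preimage)
      have sub: "?M \<subseteq> points Z" by blast
      note r = nice_restrict[OF Z top M sub]
      have "(\<lambda>x. g (\<phi> x) / h (\<phi> x)) \<in> regfuns Z ?M"
        by (rule nice_divide[OF Z M r[OF pull[OF N(4)]] r[OF pull[OF N(5)]]]) (use N(6) in auto)
      then have "(\<lambda>x. t (\<phi> x)) \<in> regfuns Z ?M" by (rule nice_cong[OF Z M]) (use N(6) in auto)
      then show "\<exists>N. openin (zariski Z) N \<and> z \<in> N \<and> N \<subseteq> ?V \<and> (\<lambda>x. t (\<phi> x)) \<in> regfuns Z N"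
        using M N(2,3) z by (intro exI[of _ ?M]) auto
    qed
  qed
qed

lemma nice_homogeneous_form:
  assumes Z: "nice Z" "openin (zariski Z) N" and v: "\<And>i. (\<lambda>z. v z $ i) \<in> regfuns Z N"
    and f: "homogeneous_form d (f :: complex ^ 'n => complex)"
  shows "(\<lambda>z. f (v z)) \<in> regfuns Z N"
proof -
  obtain a where f: "f = (\<lambda>x. \<Sum>m | (\<Sum>i\<in>UNIV. m i) = d. a m * (\<Prod>i\<in>UNIV. (x $ i) ^ m i))"
    using f by (auto simp: homogeneous_form_def)
  show ?thesis unfolding f
    by (intro nice_sum[OF Z] nice_mult[OF Z] nice_const[OF Z] nice_prod[OF Z] nice_power[OF Z] v)
qed

text \<open>
  Regular homogeneous coordinates suffice, since the value of a quotient of forms of equal degree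
  does not depend on their common factor.
\<close>

lemma morphism_proj_space:
  assumes Z: "nice Z"
    and loc: "\<And>z. z \<in> points Z ==> \<exists>N v. openin (zariski Z) N \<and> z \<in> N \<and>
      (\<forall>i. (\<lambda>w. v w $ i) \<in> regfuns Z N) \<and> (\<forall>w\<in>N. v w ~= 0 \<and> \<phi> w = scaling_rel `` {v w :: complex ^ 'n})"
  shows "morphism Z proj_space \<phi>"
proof -
  have val: "(\<forall>x\<in>\<phi> w. f x ~= 0) \<longleftrightarrow> f (v w) ~= 0"
    if "homogeneous_form d f" "v w ~= 0" "\<phi> w = scaling_rel `` {v w}" for f d and v :: "'a => complex ^ 'n" and w
  proof
    have "v w \<in> \<phi> w" using that class_iff[of "v w" "v w"] by (auto intro: exI[of _ 1])
    then show "\<forall>x\<in>\<phi> w. f x ~= 0 ==> f (v w) ~= 0" by blast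
    assume nz: "f (v w) ~= 0"
    show "\<forall>x\<in>\<phi> w. f x ~= 0"
    proof
      fix x assume "x \<in> \<phi> w"
      then have "x ~= 0 \<and> (\<exists>c. x = c *s v w)" using that(2,3) class_iff[of "v w" x] by metis
      then obtain c where c: "x = c *s v w" "x ~= 0" by blast
      then have "c ~= 0" by auto
      then show "f x ~= 0" using nz homogeneous_form_scale[OF that(1)] c by simp
    qed
  qed
  have pts: "\<phi> z \<in> proj_points" if "z \<in> points Z" for z
    using loc[OF that] proj_points_class by metis
  have cont: "continuous_map (zariski Z) proj_zariski \<phi>"
    unfolding proj_zariski_def
  proof (rule continuous_map_generated)
    fix B assume "B \<in> {{p \<in> proj_points. \<forall>x\<in>p. f x ~= 0} | f :: complex ^ 'n => complex. \<exists>d. homogeneous_form d f}"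
    then obtain f d where B: "B = {p \<in> proj_points. \<forall>x\<in>p. f x ~= 0}" and f: "homogeneous_form d f" by blast
    show "openin (zariski Z) {x \<in> points Z. \<phi> x \<in> B}"
    proof (subst openin_subopen, intro ballI)
      fix z assume z: "z \<in> {x \<in> points Z. \<phi> x \<in> B}"
      obtain N v where N: "openin (zariski Z) N" "z \<in> N" "\<forall>i. (\<lambda>w. v w $ i) \<in> regfuns Z N"
        "\<forall>w\<in>N. v w ~= 0 \<and> \<phi> w = scaling_rel `` {v w}" using loc[of z] z by blast
      have r: "(\<lambda>w. f (v w)) \<in> regfuns Z N" by (rule nice_homogeneous_form[OF Z N(1) _ f]) (use N(3) in blast)
      have NZ: "N \<subseteq> points Z" using N(1) by (rule openin_subset)
      have eq: "{w \<in> N. f (v w) ~= 0} = {x \<in> N. \<phi> x \<in> B}"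
        unfolding B using val[OF f] N(4) pts NZ by blast
      have "openin (zariski Z) {w \<in> N. f (v w) ~= 0}" by (rule nice_open_nonzero[OF Z N(1) r])
      then show "\<exists>T. openin (zariski Z) T \<and> z \<in> T \<and> T \<subseteq> {x \<in> points Z. \<phi> x \<in> B}"
        unfolding eq using z N(2) NZ by (intro exI[of _ "{x \<in> N. \<phi> x \<in> B}"]) auto
    qed
  next
    fix x assume "x \<in> points Z"
    then have "\<phi> x \<in> {p \<in> proj_points. \<forall>x\<in>p. (\<lambda>_. 1 :: complex) x ~= 0}" using pts by simp
    then show "\<phi> x \<in> \<Union> {{p \<in> proj_points. \<forall>x\<in>p. f x ~= 0} | f :: complex ^ 'n => complex. \<exists>d. homogeneous_form d f}"
      using homogeneous_form_1 by blast
  qed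
  show ?thesis
    unfolding morphism_def comp_def
  proof (intro conjI allI impI)
    show "continuous_map (zariski Z) (zariski proj_space) \<phi>" using cont by (simp add: proj_space_def)
    fix W t assume "openin (zariski proj_space) W \<and> t \<in> regfuns (proj_space :: (complex ^ 'n) set fun_space) W"
    then have W: "openin proj_zariski W" and t: "t \<in> regfuns (proj_space :: (complex ^ 'n) set fun_space) W"
      by (simp_all add: proj_space_def)
    let ?V = "{x \<in> points Z. \<phi> x \<in> W}"
    have V: "openin (zariski Z) ?V" using cont W by (rule openin_continuous_map_preimage)
    show "(\<lambda>x. t (\<phi> x)) \<in> regfuns Z ?V"
    proof (rule nice_glue[OF Z V])
      fix z assume z: "z \<in> ?V"
      then have "\<phi> z \<in> W" by simp
      then obtain M d g h where M: "openin proj_zariski M" "\<phi> z \<in> M" "M \<subseteq> W"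
        "homogeneous_form d g" "homogeneous_form d h" "\<forall>q\<in>M. \<forall>x\<in>q. h x ~= 0 \<and> t q = g x / h x"
        using t unfolding proj_space_def fun_space.simps by (elim CollectE) (drule bspec, assumption, blast)
      obtain N v where N: "openin (zariski Z) N" "z \<in> N" "\<forall>i. (\<lambda>w. v w $ i) \<in> regfuns Z N"
        "\<forall>w\<in>N. v w ~= 0 \<and> \<phi> w = scaling_rel `` {v w}" using loc[of z] z by blast
      let ?M = "N \<inter> {x \<in> points Z. \<phi> x \<in> M}"
      have oM: "openin (zariski Z) ?M"
        by (rule openin_Int[OF N(1) openin_continuous_map_preimage[OF cont M(1)]])
      have r: "(\<lambda>w. f (v w)) \<in> regfuns Z ?M" if "homogeneous_form d f" for f
        by (rule nice_restrict[OF Z N(1) oM _ nice_homogeneous_form[OF Z N(1) _ that]]) (use N(3) in auto)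
      have mem: "v w \<in> \<phi> w" if "w \<in> N" for w
        using N(4) that class_iff[of "v w" "v w"] by (auto intro: exI[of _ 1])
      have q: "h (v w) ~= 0" "t (\<phi> w) = g (v w) / h (v w)" if "w \<in> ?M" for w
        using M(6) mem[of w] that by blast+
      have "(\<lambda>w. g (v w) / h (v w)) \<in> regfuns Z ?M"
        by (rule nice_divide[OF Z oM r[OF M(4)] r[OF M(5)]]) (rule q(1))
      then have "(\<lambda>x. t (\<phi> x)) \<in> regfuns Z ?M" by (rule nice_cong[OF Z oM]) (rule q(2)[symmetric])
      then show "\<exists>N. openin (zariski Z) N \<and> z \<in> N \<and> N \<subseteq> ?V \<and> (\<lambda>x. t (\<phi> x)) \<in> regfuns Z N"
        using oM N(2) M(2,3) z by (intro exI[of _ ?M]) auto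
    qed
  qed
qed

section \<open>Regular functions of one variable\<close>

lemma affine_line_open_cofinite:
  assumes "openin affine_line_zariski N" shows "N = {} \<or> finite (- N)"
proof -
  have "generate_topology_on {{z. poly p z ~= 0} | p :: complex poly. True} N"
    using assms unfolding affine_line_zariski_def openin_topology_generated_by_iff .
  then show ?thesis
  proof induction
    case (Int a b)
    then show ?case by (auto simp: Compl_Int)
  next
    case (UN K)
    show ?case
    proof (cases "\<Union>K = {}")
      case False
      then obtain k where k: "k \<in> K" "k ~= {}" by blast
      then have "finite (- k)" using UN by blast
      moreover have "- \<Union>K \<subseteq> - k" using k by blast
      ultimately show ?thesis using finite_subset by blast
    qed simp
  next
    case (Basis s)
    then obtain p :: "complex poly" where s: "s = {z. poly p z ~= 0}" by blast
    show ?case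
    proof (cases "p = 0")
      case False
      have "- s = {z. poly p z = 0}" unfolding s by blast
      then have "finite (- s)" using poly_roots_finite[OF False] by (simp only:)
      then show ?thesis by blast
    qed (simp add: s)
  qed simp
qed

lemma cofinite_infinite: "finite (- N) ==> infinite (N :: complex set)"
  by (metis Compl_eq_Diff_UNIV Diff_infinite_finite double_complement infinite_UNIV_char_0)

lemma poly_eq_on_infinite:
  assumes "infinite N" "\<And>x. x \<in> N ==> poly p x = poly q (x :: complex)" shows "p = q"
proof (rule ccontr)
  assume "p ~= q"
  then have "finite {x. poly (p - q) x = 0}" by (intro poly_roots_finite) auto
  moreover have "N \<subseteq> {x. poly (p - q) x = 0}" using assms(2) by auto
  ultimately show False using assms(1) finite_subset by blast
qed

text \<open>
  The local quotients that define a regular function on the line are all equal to one global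
  quotient: a denominator of least degree cannot vanish anywhere.
\<close>

lemma regular_affine_line:
  assumes W: "openin affine_line_zariski W" and f: "f \<in> regfuns affine_line W" and ne: "W ~= {}"
  shows "\<exists>g h. h ~= 0 \<and> (\<forall>w\<in>W. poly h w ~= 0 \<and> f w = poly g w / poly h w)"
proof -
  let ?o = "openin affine_line_zariski"
  have loc: "\<exists>N (g :: complex poly) h. ?o N \<and> w \<in> N \<and> N \<subseteq> W \<and>
        (\<forall>w\<in>N. poly h w ~= 0 \<and> f w = poly g w / poly h w)" if "w \<in> W" for w
    using f that unfolding affine_line_def by simp
  define rep where "rep g h \<longleftrightarrow> h ~= 0 \<and> (\<exists>N. ?o N \<and> N ~= {} \<and> N \<subseteq> W \<and> (\<forall>w\<in>N. f w * poly h w = poly g w))"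
    for g h :: "complex poly"
  have "\<exists>gh. rep (fst gh) (snd gh)"
  proof -
    obtain w where w: "w \<in> W" using ne by blast
    obtain N g h where N: "?o N" "w \<in> N" "N \<subseteq> W" "\<forall>w\<in>N. poly h w ~= 0 \<and> f w = poly g w / poly h w"
      using loc[OF w] by blast
    then have "h ~= 0" by auto
    moreover have "\<forall>w\<in>N. f w * poly h w = poly g w" using N(4) by auto
    ultimately have "rep g h" unfolding rep_def using N by blast
    then show ?thesis by (intro exI[of _ "(g, h)"]) simp
  qed
  then obtain gh where gh: "rep (fst gh) (snd gh)"
    "\<And>gh'. rep (fst gh') (snd gh') ==> degree (snd gh) \<le> degree (snd gh')"
    using ex_has_least_nat[of "\<lambda>gh. rep (fst gh) (snd gh)" _ "\<lambda>gh. degree (snd gh)"] by blast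
  define g where "g = fst gh"
  define h where "h = snd gh"
  have rep: "rep g h" and least: "\<And>g' h'. rep g' h' ==> degree h \<le> degree h'"
    using gh(1) gh(2)[of "(_, _)"] by (auto simp: g_def h_def)
  obtain N where h0: "h ~= 0" and N: "?o N" "N ~= {}" "N \<subseteq> W" "\<forall>w\<in>N. f w * poly h w = poly g w"
    using rep unfolding rep_def by blast
  have Nc: "finite (- N)" using affine_line_open_cofinite[OF N(1)] N(2) by blast
  have "poly h w ~= 0 \<and> f w = poly g w / poly h w" if w: "w \<in> W" for w
  proof -
    obtain N' g' h' where N': "?o N'" "w \<in> N'" "N' \<subseteq> W" "\<forall>w\<in>N'. poly h' w ~= 0 \<and> f w = poly g' w / poly h' w"
      using loc[OF w] by blast
    have "finite (- N')" using affine_line_open_cofinite[OF N'(1)] N'(2) by blast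
    then have "infinite (N \<inter> N')" using Nc by (intro cofinite_infinite) (simp add: Compl_Int)
    moreover have "poly (g * h') x = poly (g' * h) x" if "x \<in> N \<inter> N'" for x
      using N(4) N'(4) that by (auto simp: field_simps)
    ultimately have eq: "g * h' = g' * h" by (rule poly_eq_on_infinite)
    then have eqw: "poly g w * poly h' w = poly g' w * poly h w" by (metis poly_mult)
    have hw': "poly h' w ~= 0" "f w = poly g' w / poly h' w" using N'(2,4) by auto
    have hw: "poly h w ~= 0"
    proof
      assume h_zero: "poly h w = 0"
      then have "poly g w = 0" using eqw hw' by simp
      then obtain g1 where g1: "g = [:- w, 1:] * g1" by (auto simp: poly_eq_0_iff_dvd elim: dvdE)
      obtain h1 where h1: "h = [:- w, 1:] * h1" using h_zero by (auto simp: poly_eq_0_iff_dvd elim: dvdE)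
      have h1nz: "h1 ~= 0" using h0 h1 by auto
      let ?M = "N \<inter> {z. poly [:- w, 1:] z ~= 0}"
      have "?o {z. poly [:- w, 1:] z ~= 0}"
        unfolding affine_line_zariski_def by (rule topology_generated_by_Basis) blast
      then have "?o ?M" using N(1) by (intro openin_Int)
      moreover have "?M ~= {}"
      proof -
        have "- {z. poly [:- w, 1:] z ~= 0} = {w}" by auto
        then have "finite (- ?M)" using Nc by (simp only: Compl_Int) simp
        then show ?thesis by (intro infinite_imp_nonempty cofinite_infinite)
      qed
      moreover have "\<forall>z\<in>?M. f z * poly h1 z = poly g1 z"
      proof
        fix z assume z: "z \<in> ?M"
        then have "(z - w) * (f z * poly h1 z) = (z - w) * poly g1 z"
          using N(4) by (auto simp: g1 h1 algebra_simps)
        then show "f z * poly h1 z = poly g1 z" using z by simp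
      qed
      ultimately have "rep g1 h1" unfolding rep_def using h1nz N(3) by blast
      then have "degree h \<le> degree h1" by (rule least)
      moreover have "degree h = Suc (degree h1)" unfolding h1 using h1nz by (subst degree_mult_eq) auto
      ultimately show False by simp
    qed
    have "poly h' w * (f w * poly h w) = poly h' w * poly g w" using hw' eqw by (simp add: mult_ac)
    then have "f w * poly h w = poly g w" using hw'(1) by simp
    then show ?thesis using hw by (simp add: field_simps)
  qed
  then show ?thesis using h0 by blast
qed

lemma affine_line_zariski_eq: "zariski affine_line = affine_line_zariski"
  by (simp add: affine_line_def)

lemma regular_affine_line_UNIV:
  assumes "f \<in> regfuns affine_line UNIV" shows "\<exists>p. \<forall>c. f c = poly p c"
proof -
  have "openin affine_line_zariski UNIV"
    using openin_topspace[of affine_line_zariski] points_affine_line by (simp only: affine_line_zariski_eq)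
  from regular_affine_line[OF this assms] obtain g h where gh: "\<forall>w. poly h w ~= 0 \<and> f w = poly g w / poly h w" by auto
  have "degree h = 0" using alg_closed_imp_poly_has_root[of h] gh by auto
  then obtain c where "h = [:c:]" by (rule degree_eq_zeroE)
  then have "\<forall>w. f w = poly (smult (1 / c) g) w" using gh by auto
  then show ?thesis by blast
qed

lemma regular_affine_line_punctured:
  assumes "f \<in> regfuns affine_line (- {0})" shows "\<exists>p n. \<forall>c. c ~= 0 --> f c = poly p c / c ^ n"
proof -
  have "(1 :: complex) \<in> - {0}" by simp
  then have ne: "- {0} ~= ({} :: complex set)" by blast
  from regular_affine_line[OF open_Cstar[unfolded affine_line_zariski_eq] assms ne] obtain g h
    where gh: "h ~= 0" "\<forall>w. w ~= 0 --> poly h w ~= 0 \<and> f w = poly g w / poly h w" by auto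
  obtain q where q: "h = [:- 0, 1:] ^ Polynomial.order 0 h * q" "\<not> [:- 0, 1:] dvd q" using order_decomp[OF gh(1), of 0] by blast
  have "poly q w ~= 0" for w
  proof (cases "w = 0")
    case True then show ?thesis using q(2) by (simp add: poly_eq_0_iff_dvd)
  next
    case False
    then have "poly h w ~= 0" using gh(2) by blast
    then show ?thesis using q(1) by (metis mult_zero_right poly_mult)
  qed
  then have "degree q = 0" using alg_closed_imp_poly_has_root[of q] by auto
  then obtain c where c: "q = [:c:]" by (rule degree_eq_zeroE)
  have "f w = poly (smult (1 / c) g) w / w ^ Polynomial.order 0 h" if "w ~= 0" for w
  proof -
    have "poly h w = w ^ Polynomial.order 0 h * c" by (subst q(1)) (simp add: c poly_power)
    then show ?thesis using gh(2) that by (simp add: field_simps)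
  qed
  then show ?thesis by blast
qed

section \<open>Functions that are polynomial in each variable separately\<close>

lemma lagrange:
  fixes t :: "nat => complex"
  assumes t: "inj_on t {..n}"
  obtains L :: "nat => complex poly" where "\<And>i. i \<le> n ==> degree (L i) \<le> n"
    "\<And>p. degree p \<le> n ==> p = (\<Sum>i\<le>n. smult (poly p (t i)) (L i))"
proof -
  define L where "L i = (\<Prod>j\<in>{..n} - {i}. smult (1 / (t i - t j)) [:- t j, 1:])" for i
  have dL: "degree (L i) \<le> n" if "i \<le> n" for i
  proof -
    have "degree (L i) \<le> (\<Sum>j\<in>{..n} - {i}. degree (smult (1 / (t i - t j)) [:- t j, 1:]))"
      unfolding L_def using degree_prod_sum_le[of "{..n} - {i}" "\<lambda>j. smult (1 / (t i - t j)) [:- t j, 1:]"]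
      by (simp add: comp_def)
    also have "\<dots> \<le> (\<Sum>j\<in>{..n} - {i}. 1)" by (intro sum_mono) (rule order_trans[OF degree_smult_le], simp)
    also have "\<dots> = n" using that by simp
    finally show ?thesis .
  qed
  have val: "poly (L i) (t k) = (if k = i then 1 else 0)" if "i \<le> n" "k \<le> n" for i k
  proof (cases "k = i")
    case True
    have "t i ~= t j" if "j \<in> {..n} - {i}" for j using t that \<open>i \<le> n\<close> by (auto simp: inj_on_def)
    then have "poly (L i) (t i) = 1" unfolding L_def poly_prod by (intro prod.neutral) (simp add: divide_simps)
    then show ?thesis using True by simp
  next
    case False
    then have "poly (L i) (t k) = 0"
      unfolding L_def poly_prod using that by (intro prod_zero) auto
    then show ?thesis using False by simp
  qed
  have "p = (\<Sum>i\<le>n. smult (poly p (t i)) (L i))" if p: "degree p \<le> n" for p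
  proof (rule poly_eqI_degree[of "t ` {..n}"])
    have c: "card (t ` {..n}) = Suc n" using t by (simp add: card_image)
    show "degree p < card (t ` {..n})" using p c by simp
    have "degree (\<Sum>i\<le>n. smult (poly p (t i)) (L i)) \<le> n"
      by (rule degree_sum_le) (auto intro: order_trans[OF degree_smult_le] dL)
    then show "degree (\<Sum>i\<le>n. smult (poly p (t i)) (L i)) < card (t ` {..n})" using c by simp
    fix x assume "x \<in> t ` {..n}"
    then obtain k where k: "k \<le> n" "x = t k" by auto
    have "poly (\<Sum>i\<le>n. smult (poly p (t i)) (L i)) x = (\<Sum>i\<le>n. poly p (t i) * (if k = i then 1 else 0))"
      unfolding poly_sum k(2) by (intro sum.cong refl) (simp add: val k(1))
    also have "\<dots> = (\<Sum>i\<le>n. if i = k then poly p (t i) else 0)" by (intro sum.cong refl) auto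
    also have "\<dots> = poly p x" using k by simp
    finally show "poly p x = poly (\<Sum>i\<le>n. smult (poly p (t i)) (L i)) x" using k by simp
  qed
  then show ?thesis using that dL by blast
qed

text \<open>
  A function of \<open>t\<close> and \<open>y\<close> that is a Laurent polynomial in \<open>t\<close> for every \<open>y\<close> and belongs to a linear
  space of functions of \<open>y\<close> for every \<open>t\<close> is a Laurent polynomial in \<open>t\<close> with coefficients in that
  space, provided that one of any countably many sets that exhaust the space of parameters
  determines its functions: on that set the degrees are bounded, and interpolation applies.
\<close>

lemma separately_laurent:
  fixes F :: "complex => 'b => complex" and V :: "('b => complex) set"
  assumes lin: "\<And>(n::nat) c f. (\<And>i. i \<le> n ==> f i \<in> V) ==> (\<lambda>y. \<Sum>i\<le>n. c i * f i y) \<in> V"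
    and diff: "\<And>f g. f \<in> V ==> g \<in> V ==> (\<lambda>y. f y - g y) \<in> V"
    and det: "\<And>S :: nat => 'b set. (\<And>n. S n \<subseteq> S (Suc n)) ==> Y \<subseteq> (\<Union>n. S n) ==>
      \<exists>n. \<forall>f\<in>V. (\<forall>y\<in>S n. y \<in> Y --> f y = 0) --> (\<forall>y\<in>Y. f y = 0)"
    and Ft: "\<And>t. t ~= 0 ==> F t \<in> V"
    and Fy: "\<And>y. y \<in> Y ==> \<exists>p n. \<forall>t. t ~= 0 --> F t y = poly p t / t ^ n"
  obtains N M :: nat and P where "\<And>k. k \<le> M ==> P k \<in> V"
    "\<And>t y. t ~= 0 ==> y \<in> Y ==> F t y = (\<Sum>k\<le>M. P k y * t ^ k) / t ^ N"
proof -
  define S where "S n = {y. \<exists>p. degree p \<le> 2 * n \<and> (\<forall>t. t ~= 0 --> F t y * t ^ n = poly p t)}" for n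
  have Smono: "S n \<subseteq> S (Suc n)" for n
  proof
    fix y assume "y \<in> S n"
    then obtain p where p: "degree p \<le> 2 * n" "\<forall>t. t ~= 0 --> F t y * t ^ n = poly p t" by (auto simp: S_def)
    have "degree (p * [:0, 1:]) \<le> degree p + degree [:0, 1 :: complex:]" by (rule degree_mult_le)
    then have "degree (p * [:0, 1:]) \<le> 2 * Suc n" using p(1) by simp
    moreover have "F t y * t ^ Suc n = poly (p * [:0, 1:]) t" if "t ~= 0" for t
      using p(2) that by (simp add: mult_ac)
    ultimately show "y \<in> S (Suc n)" unfolding S_def by blast
  qed
  have Scov: "Y \<subseteq> (\<Union>n. S n)"
  proof
    fix y assume "y \<in> Y"
    then obtain p n where p: "\<forall>t. t ~= 0 --> F t y = poly p t / t ^ n" using Fy by blast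
    define m where "m = max n (degree p)"
    have nm: "n \<le> m" "degree p \<le> m" by (auto simp: m_def)
    have "degree (p * monom 1 (m - n)) \<le> degree p + (m - n)"
      using degree_mult_le[of p "monom 1 (m - n)"] by (simp add: degree_monom_eq)
    then have "degree (p * monom 1 (m - n)) \<le> 2 * m" using nm by simp
    moreover have "F t y * t ^ m = poly (p * monom 1 (m - n)) t" if "t ~= 0" for t
    proof -
      have "t ^ m = t ^ n * t ^ (m - n)" using nm by (simp flip: power_add)
      then show ?thesis using p that by (simp add: poly_monom)
    qed
    ultimately have "y \<in> S m" unfolding S_def by blast
    then show "y \<in> (\<Union>n. S n)" by blast
  qed
  obtain n where n': "\<forall>f\<in>V. (\<forall>y\<in>S n. y \<in> Y --> f y = 0) --> (\<forall>y\<in>Y. f y = 0)"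
    using det[OF Smono Scov] by (elim exE)
  have n: "f y = 0" if "f \<in> V" "\<And>y. y \<in> S n ==> y \<in> Y ==> f y = 0" "y \<in> Y" for f y
    using n' that by blast
  define t where "t i = (of_nat (Suc i) :: complex)" for i
  have t0: "t i ~= 0" for i by (simp add: t_def del: of_nat_Suc)
  have tinj: "inj_on t {..2 * n}" by (auto simp: inj_on_def t_def)
  obtain L where L: "\<And>i. i \<le> 2 * n ==> degree (L i) \<le> 2 * n"
    "\<And>p. degree p \<le> 2 * n ==> p = (\<Sum>i\<le>2 * n. smult (poly p (t i)) (L i))"
    using lagrange[OF tinj] by blast
  define P where "P k y = (\<Sum>i\<le>2 * n. (coeff (L i) k * t i ^ n) * F (t i) y)" for k y
  have PV: "P k \<in> V" for k unfolding P_def[abs_def] by (rule lin) (rule Ft[OF t0])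
  have main: "F u y = (\<Sum>k\<le>2 * n. P k y * u ^ k) / u ^ n" if u: "u ~= 0" and y: "y \<in> Y" for u y
  proof -
    let ?G = "\<lambda>y. \<Sum>k\<le>2 * n. (u ^ k / u ^ n) * P k y"
    have G: "?G y = (\<Sum>k\<le>2 * n. P k y * u ^ k) / u ^ n" for y
      by (simp add: sum_divide_distrib mult.commute)
    have "F u y - ?G y = 0"
    proof (rule n[OF diff[OF Ft[OF u] lin[OF PV]] _ y])
      fix y assume "y \<in> S n"
      then obtain p where p: "degree p \<le> 2 * n" "\<And>t. t ~= 0 ==> F t y * t ^ n = poly p t" by (auto simp: S_def)
      have "coeff p k = P k y" for k
      proof -
        have "coeff p k = (\<Sum>i\<le>2 * n. poly p (t i) * coeff (L i) k)"
          by (subst L(2)[OF p(1)]) (simp add: coeff_sum)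
        also have "\<dots> = P k y" unfolding P_def by (intro sum.cong refl) (simp add: p(2)[OF t0, symmetric] mult_ac)
        finally show ?thesis .
      qed
      moreover have "poly p u = (\<Sum>k\<le>2 * n. coeff p k * u ^ k)"
      proof -
        have "poly p u = poly (\<Sum>k\<le>2 * n. monom (coeff p k) k) u"
          using poly_as_sum_of_monoms'[OF p(1)] by simp
        then show ?thesis by (simp add: poly_sum poly_monom)
      qed
      ultimately have "F u y * u ^ n = (\<Sum>k\<le>2 * n. P k y * u ^ k)" using p(2)[OF u] by simp
      then show "F u y - ?G y = 0" unfolding G using u by (simp add: field_simps)
    qed
    then show ?thesis unfolding G by simp
  qed
  show ?thesis by (rule that[OF PV main])
qed

lemma uncountable_cover_infinite:
  fixes S :: "nat => complex set"
  assumes "- {0} \<subseteq> (\<Union>n. S n)" shows "\<exists>n. infinite (S n)"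
proof (rule ccontr)
  assume "\<nexists>n. infinite (S n)"
  then have "countable (\<Union>n. S n)" by (auto intro: countable_finite)
  then have "countable (insert 0 (\<Union>n. S n))" by simp
  moreover have "UNIV \<subseteq> insert 0 (\<Union>n. S n)" using assms by blast
  ultimately have "countable (UNIV :: complex set)" using countable_subset by blast
  then show False using uncountable_UNIV_complex by blast
qed

section \<open>Regular functions on the quadric\<close>

definition qspace :: "pt fun_space" where "qspace = aff quadric qring"

lemma function_ring_qring: "function_ring qring"
  by (auto simp: function_ring_def)

lemma nice_qspace [simp]: "nice qspace"
  unfolding qspace_def by (rule nice_aff[OF function_ring_qring])

lemma points_qspace [simp]: "points qspace = quadric"
  unfolding qspace_def by (rule points_aff[OF function_ring_qring])

lemma qring_regular: "f \<in> qring ==> f \<in> regfuns qspace quadric"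
proof -
  assume f: "f \<in> qring"
  have "openin (zariski qspace) (points qspace)" by (rule openin_topspace)
  then have "openin (zariski (aff quadric qring)) quadric" by (simp only: points_qspace) (simp add: qspace_def)
  from regular_aff[OF function_ring_qring f this] show ?thesis by (simp add: qspace_def)
qed

lemma polyfun_regular:
  assumes Z: "nice Z" "openin (zariski Z) U"
    and c: "(\<lambda>w. cx (\<gamma> w)) \<in> regfuns Z U" "(\<lambda>w. cy (\<gamma> w)) \<in> regfuns Z U" "(\<lambda>w. cz (\<gamma> w)) \<in> regfuns Z U"
    and P: "P \<in> polyfun"
  shows "(\<lambda>w. P (\<gamma> w)) \<in> regfuns Z U"
  using P
proof induction
  case (const c) then show ?case by (rule nice_const[OF Z])
qed (use c nice_add[OF Z] nice_mult[OF Z] in auto)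

lemma qring_pullback:
  assumes Z: "nice Z" "openin (zariski Z) U"
    and c: "(\<lambda>w. cx (\<gamma> w)) \<in> regfuns Z U" "(\<lambda>w. cy (\<gamma> w)) \<in> regfuns Z U" "(\<lambda>w. cz (\<gamma> w)) \<in> regfuns Z U"
    and q: "\<And>w. w \<in> U ==> \<gamma> w \<in> quadric" and f: "f \<in> qring"
  shows "(\<lambda>w. f (\<gamma> w)) \<in> regfuns Z U"
proof -
  obtain P where P: "P \<in> polyfun" "\<And>s. s \<in> quadric ==> f s = P s" using qringE[OF f] by blast
  show ?thesis by (rule nice_cong[OF Z polyfun_regular[OF Z c P(1)]]) (simp add: P(2) q)
qed

lemma morphism_qspace:
  assumes Z: "nice Z"
    and c: "(\<lambda>w. cx (\<gamma> w)) \<in> regfuns Z (points Z)" "(\<lambda>w. cy (\<gamma> w)) \<in> regfuns Z (points Z)"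
      "(\<lambda>w. cz (\<gamma> w)) \<in> regfuns Z (points Z)"
    and q: "\<And>w. w \<in> points Z ==> \<gamma> w \<in> quadric"
  shows "morphism Z qspace \<gamma>"
  unfolding qspace_def
proof (rule morphism_aff[OF Z function_ring_qring q])
  have o: "openin (zariski Z) (points Z)" by simp
  fix f assume "f \<in> qring"
  then show "(\<lambda>z. f (\<gamma> z)) \<in> regfuns Z (points Z)" using qring_pullback[OF Z o c] q by blast
qed

lemma poly_regular_line: "poly p \<in> regfuns affine_line (points affine_line)"
proof -
  have "openin (zariski affine_line) (points affine_line)" by (rule openin_topspace)
  then have "openin (zariski (aff UNIV (range poly))) (points affine_line)" by (simp only: affine_line_aff)
  from regular_aff[OF function_ring_poly _ this, of "poly p"] show ?thesis by (simp add: affine_line_aff)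
qed

lemma morphism_polynomial_curve:
  assumes "\<And>c. (poly p1 c, poly p2 c, poly p3 c) \<in> quadric"
  shows "morphism affine_line qspace (\<lambda>c. (poly p1 c, poly p2 c, poly p3 c))"
  by (rule morphism_qspace[OF nice_affine_line]) (simp_all add: poly_regular_line assms)

lemma poly_X: "poly [:0, 1:] = (\<lambda>x :: complex. x)" "poly [:a:] = (\<lambda>_ :: complex. a)"
  by auto

lemma points_Cstar_eq: "points Cstar = - {0}"
  by (simp add: points_Cstar Cstar_group_def)

lemma poly_regular_Cstar: "poly p \<in> regfuns Cstar (points Cstar)"
proof -
  have "poly p \<in> regfuns affine_line (- {0})"
    by (rule nice_restrict[OF nice_affine_line openin_topspace open_Cstar _ poly_regular_line]) (simp add: points_affine_line)
  then show ?thesis unfolding points_Cstar_eq by (simp only: Cstar_def regfuns_open_subspace)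
qed

lemma morphism_chart_curve: "morphism Cstar qspace (\<lambda>x. chart x z)"
proof (rule morphism_qspace[OF nice_Cstar])
  have o: "openin (zariski Cstar) (points Cstar)" by simp
  have id: "(\<lambda>x. x) \<in> regfuns Cstar (points Cstar)" using poly_regular_Cstar[of "[:0, 1:]"] poly_X by simp
  have c: "(\<lambda>x. a) \<in> regfuns Cstar (points Cstar)" for a using poly_regular_Cstar[of "[:a:]"] poly_X(2)[of a] by simp
  show "(\<lambda>x. cx (chart x z)) \<in> regfuns Cstar (points Cstar)" using id by simp
  show "(\<lambda>x. cz (chart x z)) \<in> regfuns Cstar (points Cstar)" using c by simp
  have "(\<lambda>x. (z^2 - 1) / x) \<in> regfuns Cstar (points Cstar)"
    by (rule nice_divide[OF nice_Cstar o c id]) (simp add: points_Cstar_eq)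
  then show "(\<lambda>x. cy (chart x z)) \<in> regfuns Cstar (points Cstar)" by simp
  show "x \<in> points Cstar ==> chart x z \<in> quadric" for x by (simp add: points_Cstar_eq)
qed

lemma regular_on_line:
  assumes "morphism affine_line X \<gamma>" "f \<in> regfuns X (points X)"
  shows "\<exists>p. \<forall>c. f (\<gamma> c) = poly p c"
  using regular_affine_line_UNIV morphism_pullback_points[OF assms] by (simp add: points_affine_line)

lemma regular_on_Cstar:
  assumes "morphism Cstar X \<gamma>" "f \<in> regfuns X (points X)"
  shows "\<exists>p n. \<forall>c. c ~= 0 --> f (\<gamma> c) = poly p c / c ^ n"
proof -
  have "(\<lambda>c. f (\<gamma> c)) \<in> regfuns affine_line (- {0})"
    using morphism_pullback_points[OF assms] by (simp only: points_Cstar_eq) (simp add: Cstar_def regfuns_open_subspace)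
  then show ?thesis by (rule regular_affine_line_punctured)
qed

lemma poly_sum_atMost: "(\<Sum>i\<le>n. c i * poly (p i) y) = poly (\<Sum>i\<le>n. smult (c i) (p i)) y" for n :: nat
  by (simp add: poly_sum)

text \<open>On the chart \<open>x \<noteq> 0\<close> a regular function is a Laurent polynomial in each variable, hence in both.\<close>

lemma regular_expands:
  assumes G: "G \<in> regfuns qspace quadric"
  shows "\<exists>t. expands G t"
proof -
  let ?F = "\<lambda>x z. G (chart x z)"
  obtain N M :: nat and P where P: "\<And>k. k \<le> M ==> P k \<in> range (poly :: complex poly => _)"
    and F: "\<And>x z. x ~= 0 ==> z \<in> UNIV ==> ?F x z = (\<Sum>k\<le>M. P k z * x ^ k) / x ^ N"
  proof (rule separately_laurent[where F = ?F and Y = UNIV and V = "range poly"])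
    fix n :: nat and c and f :: "nat => complex => complex" assume "\<And>i. i \<le> n ==> f i \<in> range poly"
    then have "\<forall>i\<in>{..n}. \<exists>p. f i = poly p" by auto
    then obtain p where "\<forall>i\<in>{..n}. f i = poly (p i)" by (rule bchoice[THEN exE])
    then have "(\<lambda>y. \<Sum>i\<le>n. c i * f i y) = poly (\<Sum>i\<le>n. smult (c i) (p i))"
      unfolding poly_sum_atMost[symmetric, abs_def] by (intro ext sum.cong refl) auto
    then show "(\<lambda>y. \<Sum>i\<le>n. c i * f i y) \<in> range poly" by simp
  next
    fix f g :: "complex => complex" assume "f \<in> range poly" "g \<in> range poly"
    then obtain p q where "f = poly p" "g = poly q" by auto
    then have "(\<lambda>y. f y - g y) = poly (p - q)" by auto
    then show "(\<lambda>y. f y - g y) \<in> range poly" by simp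
  next
    fix S :: "nat => complex set" assume "UNIV \<subseteq> (\<Union>n. S n)"
    then obtain n where n: "infinite (S n)" using uncountable_cover_infinite[of S] by blast
    have "\<forall>y. f y = 0" if f: "f \<in> range poly" "\<forall>y\<in>S n. f y = 0" for f :: "complex => complex"
    proof -
      obtain p where p: "f = poly p" using f(1) by auto
      have "S n \<subseteq> {y. poly p y = 0}" using f(2) by (auto simp: p)
      then have "infinite {y. poly p y = 0}" using n finite_subset by blast
      then have "p = 0" using poly_roots_finite by blast
      then show ?thesis by (simp add: p)
    qed
    then show "\<exists>n. \<forall>f\<in>range poly. (\<forall>y\<in>S n. y \<in> UNIV --> f y = 0) --> (\<forall>y\<in>UNIV. f (y :: complex) = (0 :: complex))" by blast
  next
    fix x :: complex assume x: "x ~= 0"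
    have "chart x z = (poly [:x:] z, poly [:- 1 / x, 0, 1 / x:] z, poly [:0, 1:] z)" for z
      using x by (simp add: chart_def field_simps power2_eq_square)
    then have "morphism affine_line qspace (\<lambda>z. chart x z)"
      using morphism_polynomial_curve[of "[:x:]" "[:- 1 / x, 0, 1 / x:]" "[:0, 1:]"] chart_in[OF x] by simp
    from regular_on_line[OF this, of G] G obtain p where "\<forall>z. G (chart x z) = poly p z" by auto
    then have "(\<lambda>z. G (chart x z)) = poly p" by auto
    then show "(\<lambda>z. G (chart x z)) \<in> range poly" by simp
  next
    fix z :: complex
    show "\<exists>p n. \<forall>x. x ~= 0 --> G (chart x z) = poly p x / x ^ n"
      using regular_on_Cstar[OF morphism_chart_curve] G by simp
  qed blast
  have "\<forall>k\<in>{..M}. \<exists>p. P k = poly p" using P by auto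
  then obtain p where p: "\<forall>k\<in>{..M}. P k = poly (p k)" by (rule bchoice[THEN exE])
  have "expands G (\<Sum>k\<le>M. lmon (int k - int N) (p k))"
    unfolding expands_def
  proof (intro allI impI)
    fix x z :: complex assume x: "x ~= 0"
    have "G (chart x z) = (\<Sum>k\<le>M. x powi (int k - int N) * poly (p k) z)"
      unfolding F[OF x UNIV_I] sum_divide_distrib
      by (intro sum.cong refl) (use x p in \<open>simp add: power_int_diff\<close>)
    then show "G (chart x z) = poly (evl (\<Sum>k\<le>M. lmon (int k - int N) (p k)) x) z"
      by (simp add: evl_sum poly_sum)
  qed
  then show ?thesis by blast
qed

lemma morphism_qswap: "morphism qspace qspace qswap"
proof (rule morphism_qspace[OF nice_qspace])
  have "(\<lambda>s. - cz s) \<in> qring" by simp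
  then show "(\<lambda>w. cz (qswap w)) \<in> regfuns qspace (points qspace)" using qring_regular by simp
  show "(\<lambda>w. cx (qswap w)) \<in> regfuns qspace (points qspace)" using qring_regular[OF qring_cy] by simp
  show "(\<lambda>w. cy (qswap w)) \<in> regfuns qspace (points qspace)" using qring_regular[OF qring_cx] by simp
qed (auto simp: quadric_iff mult.commute)

lemma chart_swap: "x ~= 0 ==> z^2 ~= 1 ==> chart x z = qswap (chart ((z^2 - 1) / x) (- z))"
  by (rule pt_eqI) simp_all

lemma square_roots_finite: "finite {z :: complex. z^2 = 1}"
proof -
  have "{z :: complex. z^2 = 1} = {1, -1}" by (auto simp: power2_eq_1_iff)
  then show ?thesis by simp
qed

text \<open>
  Comparing the expansions of a regular function on the charts \<open>x \<noteq> 0\<close> and \<open>y \<noteq> 0\<close> shows that its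
  coefficients of negative powers of \<open>x\<close> are divisible by the powers of \<open>z^2 - 1 = x y\<close> that
  make them polynomials in \<open>y\<close>.
\<close>

lemma regular_lshape:
  assumes G: "G \<in> regfuns qspace quadric" and t: "expands G t"
  shows "lshape t"
proof -
  have "(\<lambda>s. G (qswap s)) \<in> regfuns qspace quadric"
    using morphism_pullback_points[OF morphism_qswap, of G] G by simp
  then obtain u where u: "expands (\<lambda>s. G (qswap s)) u" using regular_expands by blast
  \<comment> \<open>Passing from \<open>x\<close> to \<open>y = (z^2 - 1) / x\<close> negates the exponents.\<close>
  define K where "K = lkeys t \<union> uminus ` lkeys u"
  have K: "finite K" "lkeys t \<subseteq> K" by (simp_all add: K_def)
  have Ku: "lkeys u \<subseteq> uminus ` K"
  proof
    fix k assume "k \<in> lkeys u"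
    then have "- k \<in> K" by (simp add: K_def)
    then have "- (- k) \<in> uminus ` K" by (rule imageI)
    then show "k \<in> uminus ` K" by simp
  qed
  have row: "poly (lrow t k) z = poly (lrow u (- k)) (- z) * (z^2 - 1) powi (- k)" if z: "z^2 ~= 1" for k z
  proof -
    let ?c = "\<lambda>k. poly (lrow t k) z - poly (lrow u (- k)) (- z) * (z^2 - 1) powi (- k)"
    have zero: "(\<Sum>k\<in>K. ?c k * x powi k) = 0" if x: "x ~= 0" for x
    proof -
      have y: "(z^2 - 1) / x ~= 0" using z x by simp
      have "poly (evl t x) z = G (chart x z)" using t x by (simp add: expands_def)
      also have "\<dots> = poly (evl u ((z^2 - 1) / x)) (- z)"
        unfolding chart_swap[OF x z] using u[unfolded expands_def, rule_format, OF y, of "- z"] by simp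
      finally have eq: "poly (evl t x) z = poly (evl u ((z^2 - 1) / x)) (- z)" .
      have "poly (evl u ((z^2 - 1) / x)) (- z) = (\<Sum>k\<in>uminus ` K. ((z^2 - 1) / x) powi k * poly (lrow u k) (- z))"
        using evl_superset[OF finite_imageI[OF K(1)] Ku] by (simp add: poly_sum)
      also have "\<dots> = (\<Sum>k\<in>K. ((z^2 - 1) / x) powi (- k) * poly (lrow u (- k)) (- z))"
        by (subst sum.reindex) (auto simp: inj_on_def)
      also have "\<dots> = (\<Sum>k\<in>K. poly (lrow u (- k)) (- z) * (z^2 - 1) powi (- k) * x powi k)"
        using x by (intro sum.cong refl) (simp add: power_int_divide_distrib power_int_minus field_simps)
      finally have 1: "poly (evl u ((z^2 - 1) / x)) (- z) = (\<Sum>k\<in>K. poly (lrow u (- k)) (- z) * (z^2 - 1) powi (- k) * x powi k)" .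
      have 2: "poly (evl t x) z = (\<Sum>k\<in>K. poly (lrow t k) z * x powi k)"
        using evl_superset[OF K] by (simp add: poly_sum mult.commute)
      show ?thesis using eq 1 2 by (simp add: left_diff_distrib sum_subtractf)
    qed
    show ?thesis
    proof (cases "k \<in> K")
      case True
      from laurent_coeffs_zero[OF K(1) infinite_nonzero zero True] show ?thesis by simp
    next
      case False
      then have "k \<notin> lkeys t" "- k \<notin> lkeys u"
        unfolding K_def by (auto simp: image_iff dest: spec[of _ "- k"])
      then show ?thesis by (simp add: in_keys_iff)
    qed
  qed
  show ?thesis
    unfolding lshape_def
  proof
    fix k
    show "wfac k dvd lrow t k"
    proof (cases "k < 0")
      case True
      have "lrow t k = wfac k * pcompose (lrow u (- k)) [:0, -1:]"
      proof (rule poly_eqI_cofinite[OF square_roots_finite])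
        fix z :: complex assume "z \<notin> {z. z^2 = 1}"
        then show "poly (lrow t k) z = poly (wfac k * pcompose (lrow u (- k)) [:0, -1:]) z"
          using row[of z k] True
          by (simp add: wfac_def poly_power poly_pcompose power_int_def power2_eq_square algebra_simps)
      qed
      then show ?thesis by simp
    qed (simp add: wfac_def)
  qed
qed

text \<open>
  The expansion of \<open>G\<close> in one chart already is the expansion of an element of the ring. The two agree
  outside \<open>x = 0\<close>, and every point with \<open>x = 0\<close> lies on a line or a conic that leaves this set.
\<close>

theorem regular_quadric:
  assumes G: "G \<in> regfuns qspace quadric"
  shows "G \<in> qring"
proof -
  have top: "openin (zariski qspace) quadric" using openin_topspace[of "zariski qspace"] by simp
  obtain t where t: "expands G t" by (rule exE[OF regular_expands[OF G]])
  obtain P where P: "P \<in> qring" "lexp P = t"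
    by (rule lshape_regular[OF regular_lshape[OF G t]])
  \<comment> \<open>The difference vanishes on the chart; along a curve it is a polynomial with infinitely many zeros.\<close>
  define H where "H s = G s + - 1 * P s" for s
  have H: "H \<in> regfuns qspace quadric"
    unfolding H_def[abs_def]
    by (rule nice_add[OF nice_qspace top G]) (rule nice_mult[OF nice_qspace top nice_const[OF nice_qspace top] qring_regular[OF P(1)]])
  have chart0: "H (chart x z) = 0" if "x ~= 0" for x z
    using t that poly_lexp[OF P(1) that] P(2) by (simp add: H_def expands_def)
  have line: "H (\<gamma> c) = 0"
    if m: "morphism affine_line qspace \<gamma>" and F: "finite F" and z: "\<And>c. c \<notin> F ==> H (\<gamma> c) = 0" for \<gamma> F c
  proof -
    obtain p where p: "\<forall>c. H (\<gamma> c) = poly p c" using regular_on_line[OF m, of H] H by auto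
    have "p = 0" by (rule poly_eqI_cofinite[OF F]) (use z p in auto)
    then show ?thesis using p by simp
  qed
  have "H s = 0" if s: "s \<in> quadric" for s
  proof -
    consider "cx s ~= 0" | "cx s = 0" "cy s ~= 0" | "cx s = 0" "cy s = 0" by blast
    then show ?thesis
    proof cases
      case 1
      then show ?thesis using chart0[OF 1, of "cz s"] chart_cover[OF s 1] by simp
    next
      case 2
      let ?y = "cy s"
      have e: "qswap (chart ?y (- z)) = (poly [:- 1 / ?y, 0, 1 / ?y:] z, poly [:?y:] z, poly [:0, 1:] z)" for z
        using 2 by (simp add: qswap_def chart_def field_simps power2_eq_square)
      have m: "morphism affine_line qspace (\<lambda>z. (poly [:- 1 / ?y, 0, 1 / ?y:] z, poly [:?y:] z, poly [:0, 1:] z))"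
      proof (rule morphism_polynomial_curve)
        fix z show "(poly [:- 1 / ?y, 0, 1 / ?y:] z, poly [:?y:] z, poly [:0, 1:] z) \<in> quadric"
          using 2 by (simp add: quadric_iff field_simps power2_eq_square)
      qed
      have "H (poly [:- 1 / ?y, 0, 1 / ?y:] c, poly [:?y:] c, poly [:0, 1:] c) = 0" for c
      proof (rule line[OF m square_roots_finite])
        fix c :: complex assume "c \<notin> {z. z\<^sup>2 = 1}"
        then have c: "c^2 ~= 1" by simp
        have "(c^2 - 1) / ?y ~= 0" using c 2 by simp
        from chart0[OF this, of c] have "H (chart ((c^2 - 1) / ?y) c) = 0" .
        moreover have "chart ((c^2 - 1) / ?y) c = qswap (chart ?y (- c))"
          by (rule pt_eqI) (use c 2 in simp_all)
        ultimately show "H (poly [:- 1 / ?y, 0, 1 / ?y:] c, poly [:?y:] c, poly [:0, 1:] c) = 0"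
          by (simp only: e)
      qed
      then have "H (qswap (chart ?y (- cz s))) = 0" by (simp only: e)
      moreover have "qswap (chart ?y (- cz s)) = s"
        by (rule pt_eqI) (use 2 s in \<open>auto simp: quadric_iff field_simps\<close>)
      ultimately show ?thesis by simp
    next
      case 3
      have z1: "cz s ^ 2 = 1" using s 3 by (simp add: quadric_iff)
      have m: "morphism affine_line qspace (\<lambda>c. (poly [:0, 1:] c, poly [:0:] c, poly [:cz s:] c))"
        by (rule morphism_polynomial_curve) (simp add: quadric_iff z1)
      have "H (poly [:0, 1:] c, poly [:0:] c, poly [:cz s:] c) = 0" for c
      proof (rule line[OF m, of "{0}"])
        fix c :: complex assume "c \<notin> {0}"
        then have "c ~= 0" by simp
        moreover have "chart c (cz s) = (poly [:0, 1:] c, poly [:0:] c, poly [:cz s:] c)" by (simp add: chart_def z1)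
        ultimately show "H (poly [:0, 1:] c, poly [:0:] c, poly [:cz s:] c) = 0" using chart0[of c "cz s"] by simp
      qed simp
      from this[of 0] have "H (0, 0, cz s) = 0" by simp
      moreover have "s = (0, 0, cz s)" by (rule pt_eqI) (use 3 in simp_all)
      ultimately show ?thesis by simp
    qed
  qed
  then have "G s = P s" if "s \<in> quadric" for s using that by (simp add: H_def)
  then show ?thesis using qring_cong[OF P(1)] by simp
qed

text \<open>
  The complex numbers are uncountable, so one of countably many sets covering the quadric is
  dense; this makes the powers of the parameter of an algebraic family uniformly bounded.
\<close>

lemma qring_determined:
  assumes cover: "quadric \<subseteq> (\<Union>n. S n)"
  shows "\<exists>n::nat. \<forall>f\<in>qring. (\<forall>s\<in>S n. s \<in> quadric --> f s = 0) --> (\<forall>s\<in>quadric. f s = 0)"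
proof -
  have "\<exists>n. infinite {x. x ~= 0 \<and> chart x z \<in> S n}" for z
  proof (rule uncountable_cover_infinite)
    show "- {0} \<subseteq> (\<Union>n. {x. x ~= 0 \<and> chart x z \<in> S n})"
    proof
      fix x :: complex assume "x \<in> - {0}"
      then have "x ~= 0" by simp
      moreover from this have "chart x z \<in> (\<Union>n. S n)" using chart_in cover by blast
      ultimately show "x \<in> (\<Union>n. {x. x ~= 0 \<and> chart x z \<in> S n})" by blast
    qed
  qed
  then have "- {0} \<subseteq> (\<Union>n. {z. infinite {x. x ~= 0 \<and> chart x z \<in> S n}})" by auto
  then obtain n where n: "infinite {z. infinite {x. x ~= 0 \<and> chart x z \<in> S n}}"
    using uncountable_cover_infinite by blast
  show ?thesis
  proof (intro exI[of _ n] ballI impI)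
    fix f s assume f: "f \<in> qring" and z0: "\<forall>s\<in>S n. s \<in> quadric --> f s = 0" and s: "s \<in> quadric"
    have "lrow (lexp f) k = 0" for k
    proof (cases "k \<in> lkeys (lexp f)")
      case True
      have "poly (lrow (lexp f) k) z = 0" if inf: "infinite {x. x ~= 0 \<and> chart x z \<in> S n}" for z
      proof (rule laurent_coeffs_zero[OF finite_keys inf _ True, of "\<lambda>k. poly (lrow (lexp f) k) z"])
        fix x assume x: "x \<in> {x. x ~= 0 \<and> chart x z \<in> S n}" "x ~= 0"
        then have "f (chart x z) = 0" using z0 by simp
        then show "(\<Sum>k\<in>lkeys (lexp f). poly (lrow (lexp f) k) z * x powi k) = 0"
          using poly_lexp[OF f x(2), of z] by (simp add: evl_def poly_sum mult.commute)
      qed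
      then have "infinite {z. poly (lrow (lexp f) k) z = 0}" using n
        finite_subset[of "{z. infinite {x. x ~= 0 \<and> chart x z \<in> S n}}" "{z. poly (lrow (lexp f) k) z = 0}"] by blast
      then show ?thesis using poly_roots_finite by auto
    qed (simp add: in_keys_iff)
    then have "lexp f = lexp (\<lambda>_. 0)" by (auto simp: poly_mapping_eqI)
    from lexp_eqD[OF this f _ s] show "f s = 0" by simp
  qed
qed

section \<open>Surfaces uniformised by the quadric\<close>

lemma inv_ring_cong:
  assumes "f \<in> inv_ring anti" "\<And>s. s \<in> quadric ==> f s = g s" shows "g \<in> inv_ring anti"
  using assms qring_cong[of f g] by (simp add: inv_ring_def)

lemma inv_ring_ops:
  shows inv_ring_const: "(\<lambda>_. c) \<in> inv_ring anti"
    and inv_ring_add: "f \<in> inv_ring anti ==> g \<in> inv_ring anti ==> (\<lambda>s. f s + g s) \<in> inv_ring anti"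
    and inv_ring_mult: "f \<in> inv_ring anti ==> g \<in> inv_ring anti ==> (\<lambda>s. f s * g s) \<in> inv_ring anti"
    and inv_ring_diff: "f \<in> inv_ring anti ==> g \<in> inv_ring anti ==> (\<lambda>s. f s - g s) \<in> inv_ring anti"
    and inv_ring_sum: "(\<And>i. i \<in> A ==> F i \<in> inv_ring anti) ==> (\<lambda>s. \<Sum>i\<in>A. F i s) \<in> inv_ring anti"
  by (auto simp: inv_ring_def intro: sum.cong)

text \<open>
  A space is presented as the quotient of the quadric by the identity or by the antipodal
  involution: its regular functions are the invariant functions on the quadric, and it is affine.
\<close>

locale surface =
  fixes X :: "'a fun_space" and \<rho> :: "pt => 'a" and anti :: bool
  assumes nice_X: "nice X" and group_Aut_X: "group (Aut X)"
    and rho_onto: "\<rho> ` quadric = points X"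
    and rho_eq: "s \<in> quadric ==> s' \<in> quadric ==> \<rho> s = \<rho> s' \<longleftrightarrow> s' = s \<or> anti \<and> s' = - s"
    and descend: "(\<lambda>s. f (\<rho> s)) \<in> inv_ring anti ==> f \<in> regfuns X (points X)"
    and affine: "morphism (aff (points X) {f. (\<lambda>s. f (\<rho> s)) \<in> inv_ring anti}) X (\<lambda>p. p)"
begin

abbreviation coord_ring :: "('a => complex) set"
  where "coord_ring \<equiv> {f. (\<lambda>s. f (\<rho> s)) \<in> inv_ring anti}"

lemma function_ring_coord: "function_ring coord_ring"
  by (simp add: function_ring_def inv_ring_ops)

lemma rho_points: "s \<in> quadric ==> \<rho> s \<in> points X"
  using rho_onto by blast

definition lift :: "'a => pt" where "lift p = (SOME s. s \<in> quadric \<and> \<rho> s = p)"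

lemma lift: "p \<in> points X ==> lift p \<in> quadric \<and> \<rho> (lift p) = p"
proof -
  assume "p \<in> points X"
  then obtain s where "s \<in> quadric" "p = \<rho> s" unfolding rho_onto[symmetric] by (rule imageE)
  then have "\<exists>s. s \<in> quadric \<and> \<rho> s = p" by (intro exI[of _ s] conjI) simp_all
  then show "lift p \<in> quadric \<and> \<rho> (lift p) = p" unfolding lift_def by (rule someI_ex)
qed

lemma lift_rho: "s \<in> quadric ==> lift (\<rho> s) = s \<or> anti \<and> lift (\<rho> s) = - s"
  using lift[OF rho_points, of s] rho_eq[of s "lift (\<rho> s)"] by auto

text \<open>The value 0 outside the surface makes \<open>push\<close> depend only on the values on the quadric.\<close>

definition push :: "(pt => complex) => 'a => complex"
  where "push P p = (if p \<in> points X then P (lift p) else 0)"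

lemma push_rho: "P \<in> inv_ring anti ==> s \<in> quadric ==> push P (\<rho> s) = P s"
  using lift_rho[of s] rho_points[of s] by (auto simp: push_def inv_ring_def)

lemma push_coord: "P \<in> inv_ring anti ==> push P \<in> coord_ring"
  using inv_ring_cong[of P anti "\<lambda>s. push P (\<rho> s)"] push_rho by simp

lemma push_unique: "(\<And>s. s \<in> quadric ==> f (\<rho> s) = P s) ==> p \<in> points X ==> push P p = f p"
  using lift[of p] by (metis push_def)

lemma push_cong: "(\<And>s. s \<in> quadric ==> f s = g s) ==> push f = push g"
  using lift unfolding push_def by (intro ext if_cong refl) blast

lemma morphism_rho: "morphism qspace X \<rho>"
proof -
  have "morphism qspace (aff (points X) coord_ring) \<rho>"
  proof (rule morphism_aff[OF nice_qspace function_ring_coord])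
    fix f assume "f \<in> coord_ring"
    then show "(\<lambda>z. f (\<rho> z)) \<in> regfuns qspace (points qspace)"
      using qring_regular inv_ring_qring by simp
  qed (simp add: rho_points)
  from morphism_compose[OF this affine] show ?thesis by (simp add: comp_def)
qed

lemma regular_coord:
  assumes f: "f \<in> regfuns X (points X)" shows "f \<in> coord_ring"
proof -
  have "(\<lambda>s. f (\<rho> s)) \<in> qring"
    using regular_quadric morphism_pullback_points[OF morphism_rho f] by simp
  moreover have "\<rho> (- s) = \<rho> s" if anti "s \<in> quadric" for s using rho_eq[of s "- s"] that by simp
  ultimately show ?thesis by (simp add: inv_ring_def)
qed

lemma morphismI_coord:
  assumes "\<And>p. p \<in> points X ==> \<phi> p \<in> points X"
    and "\<And>f. f \<in> coord_ring ==> (\<lambda>s. f (\<phi> (\<rho> s))) \<in> inv_ring anti"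
  shows "morphism X X \<phi>"
proof -
  have "morphism X (aff (points X) coord_ring) \<phi>"
  proof (rule morphism_aff[OF nice_X function_ring_coord assms(1)])
    fix f assume "f \<in> coord_ring"
    then show "(\<lambda>z. f (\<phi> z)) \<in> regfuns X (points X)" using descend[of "\<lambda>z. f (\<phi> z)"] assms(2) by simp
  qed
  from morphism_compose[OF this affine] show ?thesis by (simp add: comp_def)
qed

text \<open>
  Because \<open>z^2 - x y = 1\<close>, some coordinate is nonzero, and its products with all three coordinates
  determine the point up to sign.
\<close>

lemma rho_eqI:
  assumes s: "s \<in> quadric" "s' \<in> quadric"
    and prod: "\<And>u v. u \<in> {cx, cy, cz} ==> v \<in> {cx, cy, cz} ==> u s * v s = u s' * v s'"
    and single: "\<And>u. \<not> anti ==> u \<in> {cx, cy, cz} ==> u s = u s'"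
  shows "\<rho> s = \<rho> s'"
proof (cases anti)
  case False
  then have "s' = s" using single[of cx] single[of cy] single[of cz] by (intro pt_eqI) auto
  then show ?thesis by simp
next
  case True
  obtain u where u: "u \<in> {cx, cy, cz}" "u s ~= 0"
  proof (cases "cz s = 0")
    case True
    then have "cx s ~= 0" using s(1) by (auto simp: quadric_iff)
    then show ?thesis using that[of cx] by simp
  qed (use that[of cz] in simp)
  have "u s' * u s' = u s * u s" by (rule prod[OF u(1) u(1), symmetric])
  then have "u s' = u s \<or> u s' = - u s" by (simp only: square_eq_iff)
  then have "u s' = 1 * u s \<or> u s' = - 1 * u s" by simp
  then obtain e where e: "u s' = e * u s" "e = 1 \<or> e = - 1" by (elim disjE) (rule that, assumption, simp)+
  have "v s' = e * v s" if v: "v \<in> {cx, cy, cz}" for v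
  proof -
    have "u s * v s = e * u s * v s'" using prod[OF u(1) v] e(1) by simp
    then have "u s * v s = u s * (e * v s')" by (simp only: mult_ac)
    then have "v s = e * v s'" using u(2) by (simp only: mult_left_cancel[OF u(2)])
    then show ?thesis using e(2) by (elim disjE) simp_all
  qed
  from this[of cx] this[of cy] this[of cz] have *: "cx s' = e * cx s" "cy s' = e * cy s" "cz s' = e * cz s" by simp_all
  have "s' = s \<or> s' = - s"
    using e(2)
  proof
    assume "e = 1"
    then have "s' = s" by (intro pt_eqI) (simp_all add: *)
    then show ?thesis ..
  next
    assume "e = - 1"
    then have "s' = - s" by (intro pt_eqI) (simp_all add: *)
    then show ?thesis ..
  qed
  then show ?thesis using rho_eq[OF s] True by blast
qed

lemma coord_separates:
  assumes p: "p \<in> points X" "p' \<in> points X"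
    and eq: "\<And>P. P \<in> inv_ring anti ==> push P p = push P p'"
  shows "p = p'"
proof -
  have e: "P (lift p) = P (lift p')" if "P \<in> inv_ring anti" for P
    using eq[OF that] p by (simp add: push_def)
  have "\<rho> (lift p) = \<rho> (lift p')"
  proof (rule rho_eqI)
    show "u (lift p) * v (lift p) = u (lift p') * v (lift p')" if "u \<in> {cx, cy, cz}" "v \<in> {cx, cy, cz}" for u v
      using e[OF squares_inv_ring[OF that]] .
    show "u (lift p) = u (lift p')" if "\<not> anti" "u \<in> {cx, cy, cz}" for u
      by (rule e) (use that in \<open>auto simp: inv_ring_def\<close>)
  qed (use lift p in auto)
  then show ?thesis using lift p by auto
qed

end

section \<open>Torus actions and their weights\<close>

lemma laurent_deriv:
  assumes K: "finite K" and g: "\<And>t. t ~= 0 ==> g t = (\<Sum>k\<in>K. c k * t powi k)"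
  shows "(g has_field_derivative (\<Sum>k\<in>K. of_int k * c k)) (at (1::complex))"
proof -
  have "((\<lambda>t. \<Sum>k\<in>K. c k * t powi k) has_field_derivative (\<Sum>k\<in>K. c k * (of_int k * 1 powi (k - 1) * 1))) (at (1::complex))"
    by (intro DERIV_sum DERIV_cmult DERIV_power_int DERIV_ident) auto
  then have "((\<lambda>t. \<Sum>k\<in>K. c k * t powi k) has_field_derivative (\<Sum>k\<in>K. of_int k * c k)) (at (1::complex))"
    by (simp add: mult.commute)
  then show ?thesis
    by (rule has_field_derivative_transform_within_open[where S = "- {0}"]) (auto simp: g)
qed

lemma laurent_eq:
  fixes a b :: "int => complex"
  assumes "finite K" "\<And>t. t ~= 0 ==> (\<Sum>k\<in>K. a k * t powi k) = (\<Sum>k\<in>K. b k * t powi k)" "k \<in> K"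
  shows "a k = b k"
  using laurent_coeffs_zero[OF assms(1) infinite_nonzero _ assms(3), of "\<lambda>k. a k - b k"] assms(2)
  by (simp add: left_diff_distrib sum_subtractf)

definition hyperbolic :: "int => complex => pt => pt"
  where "hyperbolic n t s = (t powi n * cx s, t powi (- n) * cy s, cz s)"

lemma hyperbolic_simps [simp]: "cx (hyperbolic n t s) = t powi n * cx s"
  "cy (hyperbolic n t s) = t powi (- n) * cy s" "cz (hyperbolic n t s) = cz s"
  by (simp_all add: hyperbolic_def)

lemma hyperbolic_quadric: "t ~= 0 ==> s \<in> quadric ==> hyperbolic n t s \<in> quadric"
  by (simp add: quadric_iff power_int_minus field_simps)

locale surface_action = surface X \<rho> anti for X :: "'a fun_space" and \<rho> anti +
  fixes \<alpha> :: "complex => 'a => 'a"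
  assumes effective: "effective_Cstar_action X \<alpha>"
begin

lemma act_action: "group_action Cstar_group (points X) \<alpha>"
  using effective by (simp add: effective_Cstar_action_def Cstar_action_def)

lemma act_morphism: "morphism (product_space Cstar X) X (\<lambda>(t, x). \<alpha> t x)"
  using effective by (simp add: effective_Cstar_action_def Cstar_action_def)

lemma act_inj: "t ~= 0 ==> u ~= 0 ==> \<alpha> t = \<alpha> u ==> t = u"
  using effective faithful_action.faithful[of Cstar_group "points X" \<alpha>]
  by (auto simp: effective_Cstar_action_def Cstar_group_def dest: inj_onD)

lemma act_Bij: "t ~= 0 ==> \<alpha> t \<in> Bij (points X)"
  using group_action.bij_prop0[OF act_action, of t] by (simp add: Cstar_group_def)

lemma act_points: "t ~= 0 ==> p \<in> points X ==> \<alpha> t p \<in> points X"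
  using act_Bij[of t] by (auto simp: Bij_def bij_betw_def)

lemma act_mult: "t ~= 0 ==> u ~= 0 ==> p \<in> points X ==> \<alpha> (t * u) p = \<alpha> t (\<alpha> u p)"
  using group_action.composition_rule[OF act_action, of p t u] by (simp add: Cstar_group_def)

lemma act_one: "p \<in> points X ==> \<alpha> 1 p = p"
  using fun_cong[OF group_action.id_eq_one[OF act_action], of p] by (simp add: Cstar_group_def)

lemma act_nontrivial:
  assumes "t ~= 0" "t ~= 1" shows "\<exists>p\<in>points X. \<alpha> t p ~= p"
proof (rule ccontr)
  assume "\<not> (\<exists>p\<in>points X. \<alpha> t p ~= p)"
  then have "\<alpha> t p = \<alpha> 1 p" if "p \<in> points X" for p using act_one that by simp
  then have "\<alpha> t = \<alpha> 1"
    using act_Bij[OF assms(1)] act_Bij[of 1] by (intro extensionalityI[of _ "points X"]) (auto simp: Bij_def)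
  then show False using act_inj[of t 1] assms by simp
qed

lemma act_morphism_fixed: assumes t: "t ~= 0" shows "morphism X X (\<alpha> t)"
proof -
  have "morphism X Cstar (\<lambda>_. t)" by (rule morphism_const[OF nice_X]) (simp add: points_Cstar_eq t)
  from morphism_pair[OF nice_X nice_Cstar nice_X this morphism_id]
  have "morphism X (product_space Cstar X) (\<lambda>p. (t, p))" .
  from morphism_compose[OF this act_morphism] show ?thesis by (simp add: comp_def)
qed

lemma orbit_morphism: assumes p: "p \<in> points X" shows "morphism Cstar X (\<lambda>t. \<alpha> t p)"
proof -
  have "morphism Cstar X (\<lambda>_. p)" by (rule morphism_const[OF nice_Cstar p])
  from morphism_pair[OF nice_Cstar nice_Cstar nice_X morphism_id this]
  have "morphism Cstar (product_space Cstar X) (\<lambda>t. (t, p))" .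
  from morphism_compose[OF this act_morphism] show ?thesis by (simp add: comp_def)
qed

text \<open>
  The action makes every regular function a Laurent polynomial in the parameter whose
  coefficients are again regular; by the group law these coefficients are weight vectors.
\<close>

lemma weights:
  assumes f: "f \<in> coord_ring"
  obtains K G where "finite K" "\<forall>k. k \<in> K --> G k \<in> coord_ring"
    "\<forall>t p. t ~= 0 --> p \<in> points X --> f (\<alpha> t p) = (\<Sum>k\<in>K. G k p * t powi k)"
    "\<forall>k t p. k \<in> K --> t ~= 0 --> p \<in> points X --> G k (\<alpha> t p) = t powi k * G k p"
proof -
  have freg: "f \<in> regfuns X (points X)" using f descend by simp
  let ?F = "\<lambda>t s. f (\<alpha> t (\<rho> s))"
  obtain N M :: nat and P where P: "\<And>k. k \<le> M ==> P k \<in> inv_ring anti"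
    and F: "\<And>t s. t ~= 0 ==> s \<in> quadric ==> ?F t s = (\<Sum>k\<le>M. P k s * t ^ k) / t ^ N"
  proof (rule separately_laurent[where F = ?F and Y = quadric and V = "inv_ring anti"])
    fix n :: nat and c and h :: "nat => pt => complex" assume "\<And>i. i \<le> n ==> h i \<in> inv_ring anti"
    then show "(\<lambda>y. \<Sum>i\<le>n. c i * h i y) \<in> inv_ring anti"
      by (intro inv_ring_sum inv_ring_mult inv_ring_const) auto
  next
    fix S :: "nat => pt set" assume "quadric \<subseteq> (\<Union>n. S n)"
    from qring_determined[OF this] show "\<exists>n. \<forall>f\<in>inv_ring anti. (\<forall>y\<in>S n. y \<in> quadric --> f y = 0) --> (\<forall>y\<in>quadric. f y = 0)"
      by (elim exE, intro exI ballI impI) (use inv_ring_qring in auto)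
  next
    fix t :: complex assume "t ~= 0"
    from morphism_pullback_points[OF act_morphism_fixed[OF this] freg]
    show "(\<lambda>s. f (\<alpha> t (\<rho> s))) \<in> inv_ring anti" using regular_coord by simp
  next
    fix s assume "s \<in> quadric"
    from regular_on_Cstar[OF orbit_morphism[OF rho_points[OF this]] freg]
    show "\<exists>p n. \<forall>t. t ~= 0 --> f (\<alpha> t (\<rho> s)) = poly p t / t ^ n" .
  qed (auto intro: inv_ring_diff)
  define K where "K = (\<lambda>k. int k - int N) ` {..M}"
  define G where "G k = push (P (nat (k + int N)))" for k
  have K: "finite K" by (simp add: K_def)
  have G: "G k \<in> coord_ring" if k: "k \<in> K" for k
  proof -
    have "nat (k + int N) \<le> M" using k by (auto simp: K_def)
    then show ?thesis unfolding G_def by (intro push_coord P)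
  qed
  have fG: "f (\<alpha> t p) = (\<Sum>k\<in>K. G k p * t powi k)" if t: "t ~= 0" and p: "p \<in> points X" for t p
  proof -
    obtain s where s: "s \<in> quadric" "p = \<rho> s" using p rho_onto by blast
    have "f (\<alpha> t p) = (\<Sum>k\<le>M. P k s * t powi (int k - int N))"
      unfolding s(2) F[OF t s(1)] sum_divide_distrib
      by (intro sum.cong refl) (use t in \<open>simp add: power_int_diff\<close>)
    also have "\<dots> = (\<Sum>k\<le>M. G (int k - int N) p * t powi (int k - int N))"
    proof (intro sum.cong refl)
      fix k assume "k \<in> {..M}"
      then show "P k s * t powi (int k - int N) = G (int k - int N) p * t powi (int k - int N)"
        using push_rho[OF P s(1), of k] by (simp add: G_def s(2))
    qed
    also have "\<dots> = (\<Sum>k\<in>K. G k p * t powi k)"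
      unfolding K_def by (subst sum.reindex) (auto simp: inj_on_def)
    finally show ?thesis .
  qed
  have "G k (\<alpha> u p) = u powi k * G k p" if k: "k \<in> K" and u: "u ~= 0" and p: "p \<in> points X" for k u p
  proof (rule laurent_eq[OF K _ k])
    fix t :: complex assume t: "t ~= 0"
    have "(\<Sum>k\<in>K. G k (\<alpha> u p) * t powi k) = f (\<alpha> (t * u) p)"
      using fG[OF t act_points[OF u p]] act_mult[OF t u p] by simp
    also have "\<dots> = (\<Sum>k\<in>K. u powi k * G k p * t powi k)"
      using fG[of "t * u", OF _ p] t u by (simp add: power_int_mult_distrib mult_ac)
    finally show "(\<Sum>k\<in>K. G k (\<alpha> u p) * t powi k) = (\<Sum>k\<in>K. u powi k * G k p * t powi k)" .
  qed
  then have 4: "\<forall>k u p. k \<in> K --> u ~= 0 --> p \<in> points X --> G k (\<alpha> u p) = u powi k * G k p" by (intro allI impI)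
  have 2: "\<forall>k. k \<in> K --> G k \<in> coord_ring" using G by (intro allI impI)
  have 3: "\<forall>t p. t ~= 0 --> p \<in> points X --> f (\<alpha> t p) = (\<Sum>k\<in>K. G k p * t powi k)" using fG by (intro allI impI)
  show ?thesis by (rule that[OF K 2 3 4])
qed

definition infinitesimal :: "(pt => complex) => pt => complex"
  where "infinitesimal P s = deriv (\<lambda>t. push P (\<alpha> t (\<rho> s))) 1"

lemma infinitesimal_weights:
  assumes "finite K" "s \<in> quadric"
    and "\<And>t. t ~= 0 ==> push P (\<alpha> t (\<rho> s)) = (\<Sum>k\<in>K. c k * t powi k)"
  shows "infinitesimal P s = (\<Sum>k\<in>K. of_int k * c k)"
  unfolding infinitesimal_def by (rule DERIV_imp_deriv[OF laurent_deriv[OF assms(1,3)]])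

lemma push_differentiable:
  assumes "P \<in> inv_ring anti" "s \<in> quadric"
  shows "(\<lambda>t. push P (\<alpha> t (\<rho> s))) field_differentiable at 1"
proof -
  obtain K G where K: "finite K"
    "\<forall>k. k \<in> K --> G k \<in> coord_ring"
    "\<forall>t p. t ~= 0 --> p \<in> points X --> push P (\<alpha> t p) = (\<Sum>k\<in>K. G k p * t powi k)"
    "\<forall>k t p. k \<in> K --> t ~= 0 --> p \<in> points X --> G k (\<alpha> t p) = t powi k * G k p"
    by (rule weights[OF push_coord[OF assms(1)]])
  have "((\<lambda>t. push P (\<alpha> t (\<rho> s))) has_field_derivative (\<Sum>k\<in>K. of_int k * G k (\<rho> s))) (at 1)"
    by (rule laurent_deriv[OF K(1)]) (simp add: K(3) rho_points assms(2))
  then show ?thesis by (auto simp: field_differentiable_def)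
qed

text \<open>
  Differentiating \<open>t^k\<close> at \<open>t = 1\<close> gives \<open>k\<close>.
\<close>

lemma weight_vector:
  assumes G: "G \<in> coord_ring" and eq: "\<And>t p. t ~= 0 ==> p \<in> points X ==> G (\<alpha> t p) = t powi k * G p"
    and s: "s \<in> quadric"
  shows "infinitesimal (\<lambda>s. G (\<rho> s)) s = of_int k * G (\<rho> s)"
proof -
  have "infinitesimal (\<lambda>s. G (\<rho> s)) s = (\<Sum>k\<in>{k}. of_int k * G (\<rho> s))"
  proof (rule infinitesimal_weights)
    fix t :: complex assume t: "t ~= 0"
    have "push (\<lambda>s. G (\<rho> s)) (\<alpha> t (\<rho> s)) = G (\<alpha> t (\<rho> s))"
      by (rule push_unique) (simp_all add: act_points t rho_points s)
    then show "push (\<lambda>s. G (\<rho> s)) (\<alpha> t (\<rho> s)) = (\<Sum>k\<in>{k}. G (\<rho> s) * t powi k)"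
      using eq[OF t rho_points[OF s]] by simp
  qed (use s in auto)
  then show ?thesis by simp
qed

lemma weight_decomposition:
  assumes P: "P \<in> inv_ring anti"
  obtains K G where "finite K" "\<forall>k. k \<in> K --> G k \<in> coord_ring"
    "\<forall>t s. t ~= 0 --> s \<in> quadric --> push P (\<alpha> t (\<rho> s)) = (\<Sum>k\<in>K. G k (\<rho> s) * t powi k)"
    "\<forall>k t p. k \<in> K --> t ~= 0 --> p \<in> points X --> G k (\<alpha> t p) = t powi k * G k p"
    "\<forall>s. s \<in> quadric --> P s = (\<Sum>k\<in>K. G k (\<rho> s))"
    "\<forall>s. s \<in> quadric --> infinitesimal P s = (\<Sum>k\<in>K. of_int k * G k (\<rho> s))"
proof -
  obtain K G where KG: "finite K" "\<forall>k. k \<in> K --> G k \<in> coord_ring"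
    "\<forall>t p. t ~= 0 --> p \<in> points X --> push P (\<alpha> t p) = (\<Sum>k\<in>K. G k p * t powi k)"
    "\<forall>k t p. k \<in> K --> t ~= 0 --> p \<in> points X --> G k (\<alpha> t p) = t powi k * G k p"
    by (rule weights[OF push_coord[OF P]])
  note K = KG(1) and f = KG(3)[rule_format]
  have f': "push P (\<alpha> t (\<rho> s)) = (\<Sum>k\<in>K. G k (\<rho> s) * t powi k)" if "t ~= 0" "s \<in> quadric" for t s
    using f[OF that(1) rho_points[OF that(2)]] .
  have 1: "\<forall>t s. t ~= 0 --> s \<in> quadric --> push P (\<alpha> t (\<rho> s)) = (\<Sum>k\<in>K. G k (\<rho> s) * t powi k)"
    by (intro allI impI f')
  have 2: "\<forall>s. s \<in> quadric --> P s = (\<Sum>k\<in>K. G k (\<rho> s))"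
  proof (intro allI impI)
    fix s assume s: "s \<in> quadric"
    show "P s = (\<Sum>k\<in>K. G k (\<rho> s))"
      using f'[of 1, OF _ s] act_one[OF rho_points[OF s]] push_rho[OF P s] by simp
  qed
  have 3: "\<forall>s. s \<in> quadric --> infinitesimal P s = (\<Sum>k\<in>K. of_int k * G k (\<rho> s))"
    by (intro allI impI infinitesimal_weights[OF K _ f'])
  show ?thesis by (rule that[OF KG(1,2) 1 KG(4) 2 3])
qed

text \<open>
  If all weights are zero, every function is invariant; since functions separate points, the action is
  then trivial.
\<close>

lemma infinitesimal_nonzero: "\<exists>P\<in>inv_ring anti. \<exists>s\<in>quadric. infinitesimal P s ~= 0"
proof (rule ccontr)
  assume "\<not> ?thesis"
  then have zero: "infinitesimal P s = 0" if "P \<in> inv_ring anti" "s \<in> quadric" for P s using that by blast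
  have "\<alpha> 2 p = p" if p: "p \<in> points X" for p
  proof (rule coord_separates)
    fix P assume P: "P \<in> inv_ring anti"
  obtain K G where KG: "finite K" "\<forall>k. k \<in> K --> G k \<in> coord_ring"
    "\<forall>t s. t ~= 0 --> s \<in> quadric --> push P (\<alpha> t (\<rho> s)) = (\<Sum>k\<in>K. G k (\<rho> s) * t powi k)"
    "\<forall>k t p. k \<in> K --> t ~= 0 --> p \<in> points X --> G k (\<alpha> t p) = t powi k * G k p"
    "\<forall>s. s \<in> quadric --> P s = (\<Sum>k\<in>K. G k (\<rho> s))"
    "\<forall>s. s \<in> quadric --> infinitesimal P s = (\<Sum>k\<in>K. of_int k * G k (\<rho> s))"
    by (rule weight_decomposition[OF P])
  note K = KG(1) KG(2)[rule_format] and f = KG(3)[rule_format] and w = KG(4)[rule_format]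
    and sum = KG(5)[rule_format] and inf = KG(6)[rule_format]
    obtain s where s: "s \<in> quadric" "p = \<rho> s" using p rho_onto by blast
    have G0: "G k p = 0" if k: "k \<in> K" "k ~= 0" for k
      using weight_vector[OF K(2)[OF k(1)] w[OF k(1)] s(1)] zero[OF _ s(1)] K(2)[OF k(1)] k(2) s(2) by simp
    have "(\<Sum>k\<in>K. G k p * 2 powi k) = (\<Sum>k\<in>K. G k p * 1 powi k)"
    proof (intro sum.cong refl)
      fix k assume "k \<in> K"
      then show "G k p * 2 powi k = G k p * 1 powi k" using G0[of k] by (cases "k = 0") simp_all
    qed
    then show "push P (\<alpha> 2 p) = push P p" using f[of 2, OF _ s(1)] f[of 1, OF _ s(1)] act_one[OF p] s(2) by simp
  qed (use p act_points in auto)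
  then show False using act_nontrivial[of 2] by simp
qed

lemma push_add: "push (\<lambda>s. f s + g s) = (\<lambda>p. push f p + push g p)"
  and push_mult: "push (\<lambda>s. f s * g s) = (\<lambda>p. push f p * push g p)"
  by (auto simp: push_def)

lemma diagonal: "diagonal_derivation anti infinitesimal"
proof
  fix f assume f: "f \<in> inv_ring anti"
  obtain K G where KG: "finite K" "\<forall>k. k \<in> K --> G k \<in> coord_ring"
    "\<forall>t s. t ~= 0 --> s \<in> quadric --> push f (\<alpha> t (\<rho> s)) = (\<Sum>k\<in>K. G k (\<rho> s) * t powi k)"
    "\<forall>k t p. k \<in> K --> t ~= 0 --> p \<in> points X --> G k (\<alpha> t p) = t powi k * G k p"
    "\<forall>s. s \<in> quadric --> f s = (\<Sum>k\<in>K. G k (\<rho> s))"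
    "\<forall>s. s \<in> quadric --> infinitesimal f s = (\<Sum>k\<in>K. of_int k * G k (\<rho> s))"
    by (rule weight_decomposition[OF f])
  note K = KG(1) KG(2)[rule_format] and fw = KG(3)[rule_format] and w = KG(4)[rule_format]
    and sum = KG(5)[rule_format] and inf = KG(6)[rule_format]
  have "(\<lambda>s. \<Sum>k\<in>K. of_int k * G k (\<rho> s)) \<in> inv_ring anti"
    using K(2) by (intro inv_ring_sum inv_ring_mult inv_ring_const) auto
  then show "infinitesimal f \<in> inv_ring anti" by (rule inv_ring_cong) (simp add: inf)
  show "\<exists>K F. finite K \<and> (\<forall>k\<in>K. F k \<in> inv_ring anti \<and> (\<forall>s\<in>quadric. infinitesimal (F k) s = of_int k * F k s)) \<and>
      (\<forall>s\<in>quadric. f s = (\<Sum>k\<in>K. F k s))"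
    using K sum weight_vector[OF K(2) w] by (intro exI[of _ K] exI[of _ "\<lambda>k s. G k (\<rho> s)"]) auto
next
  fix f g :: "pt => complex" and s assume "\<And>s. s \<in> quadric ==> f s = g s"
  then show "infinitesimal f s = infinitesimal g s" unfolding infinitesimal_def by (simp cong: push_cong)
next
  fix f g s assume fg: "f \<in> inv_ring anti" "g \<in> inv_ring anti" and s: "s \<in> quadric"
  note d = push_differentiable[OF fg(1) s] push_differentiable[OF fg(2) s]
  show "infinitesimal (\<lambda>s. f s + g s) s = infinitesimal f s + infinitesimal g s"
    unfolding infinitesimal_def push_add by (rule deriv_add[OF d])
  have "push P (\<alpha> 1 (\<rho> s)) = P s" if "P \<in> inv_ring anti" for P
    using act_one[OF rho_points[OF s]] push_rho[OF that s] by simp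
  then show "infinitesimal (\<lambda>s. f s * g s) s = f s * infinitesimal g s + g s * infinitesimal f s"
    unfolding infinitesimal_def push_mult using deriv_mult[OF d] fg by simp
next
  fix s and c :: complex assume s: "s \<in> quadric"
  show "infinitesimal (\<lambda>_. c) s = 0"
    using weight_vector[of "\<lambda>_. c" 0 s] s by (simp add: inv_ring_const)
qed (rule infinitesimal_nonzero)

text \<open>
  Comparing weight components along an orbit shows that only the component of weight \<open>c\<close> survives, so
  \<open>c\<close> is one of the integer weights.
\<close>

lemma integral_eigenvalue:
  assumes P: "P \<in> inv_ring anti" and ev: "\<And>s. s \<in> quadric ==> infinitesimal P s = c * P s"
    and nz: "\<exists>s\<in>quadric. P s ~= 0"
  shows "\<exists>m. c = of_int m \<and> (\<forall>t p. t ~= 0 --> p \<in> points X --> push P (\<alpha> t p) = t powi m * push P p)"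
proof -
  obtain K G where KG: "finite K" "\<forall>k. k \<in> K --> G k \<in> coord_ring"
    "\<forall>t s. t ~= 0 --> s \<in> quadric --> push P (\<alpha> t (\<rho> s)) = (\<Sum>k\<in>K. G k (\<rho> s) * t powi k)"
    "\<forall>k t p. k \<in> K --> t ~= 0 --> p \<in> points X --> G k (\<alpha> t p) = t powi k * G k p"
    "\<forall>s. s \<in> quadric --> P s = (\<Sum>k\<in>K. G k (\<rho> s))"
    "\<forall>s. s \<in> quadric --> infinitesimal P s = (\<Sum>k\<in>K. of_int k * G k (\<rho> s))"
    by (rule weight_decomposition[OF P])
  note K = KG(1) KG(2)[rule_format] and f = KG(3)[rule_format] and w = KG(4)[rule_format]
    and sum = KG(5)[rule_format] and inf = KG(6)[rule_format]
  have eq: "of_int k * G k (\<rho> s) = c * G k (\<rho> s)" if k: "k \<in> K" and s: "s \<in> quadric" for k s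
  proof (rule laurent_eq[OF K(1) _ k])
    fix t :: complex assume t: "t ~= 0"
    obtain s' where s': "s' \<in> quadric" "\<alpha> t (\<rho> s) = \<rho> s'"
      using act_points[OF t rho_points[OF s]] rho_onto by blast
    have Gs': "G k (\<rho> s') = G k (\<rho> s) * t powi k" if "k \<in> K" for k
      using w[OF that t rho_points[OF s]] s'(2) by simp
    have "(\<Sum>k\<in>K. of_int k * G k (\<rho> s) * t powi k) = infinitesimal P s'"
      unfolding inf[OF s'(1)] by (intro sum.cong refl) (simp add: Gs')
    also have "\<dots> = (\<Sum>k\<in>K. c * G k (\<rho> s) * t powi k)"
      unfolding ev[OF s'(1)] sum[OF s'(1)] sum_distrib_left by (intro sum.cong refl) (simp add: Gs')
    finally show "(\<Sum>k\<in>K. of_int k * G k (\<rho> s) * t powi k) = (\<Sum>k\<in>K. c * G k (\<rho> s) * t powi k)" .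
  qed
  obtain s where s: "s \<in> quadric" "P s ~= 0" using nz by blast
  have "\<exists>m\<in>K. G m (\<rho> s) ~= 0"
  proof (rule ccontr)
    assume "\<not> ?thesis"
    then have "P s = 0" unfolding sum[OF s(1)] by (intro sum.neutral) simp
    then show False using s(2) by simp
  qed
  then obtain m where m: "m \<in> K" "G m (\<rho> s) ~= 0" by blast
  have c: "c = of_int m" using eq[OF m(1) s(1)] m(2) by simp
  have "push P (\<alpha> t p) = t powi m * push P p" if t: "t ~= 0" and p: "p \<in> points X" for t p
  proof -
    obtain s where s: "s \<in> quadric" "p = \<rho> s" using p rho_onto by blast
    have "(\<Sum>k\<in>K. G k (\<rho> s) * t powi k) = (\<Sum>k\<in>K. t powi m * G k (\<rho> s))"
    proof (intro sum.cong refl)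
      fix k assume "k \<in> K"
      then show "G k (\<rho> s) * t powi k = t powi m * G k (\<rho> s)"
        using eq[OF _ s(1), of k] c by (cases "k = m") auto
    qed
    then show ?thesis using f[OF t s(1)] push_rho[OF P s(1)] sum[OF s(1)] s(2) by (simp add: sum_distrib_left)
  qed
  with c show ?thesis by (intro exI[of _ m] conjI allI impI)
qed

end

section \<open>Linearisation and conjugacy of torus actions\<close>

text \<open>
  The bracket with a linear function of \<open>z\<close> generates the hyperbolic flow, so the same integer \<open>w\<close>
  occurs as an eigenvalue and as an exponent.
\<close>

lemma coordinate_weights:
  assumes "u \<in> {cx, cy, cz}"
  obtains w :: int where "br (lmon 0 [:c, b:]) (lexp u) = lmon 0 [:b * of_int w:] * lexp u"
    "\<forall>n t s. u (hyperbolic n t s) = t powi (n * w) * u s"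
proof -
  consider "u = cx" | "u = cy" | "u = cz" using assms by blast
  then show ?thesis
  proof cases
    case 1
    have "br (lmon 0 [:c, b:]) (lexp cx) = lmon 0 [:b * of_int 1:] * lexp cx"
      by (simp add: br_def mult_single pderiv_pCons)
    then show ?thesis using that[of 1] 1 by simp
  next
    case 2
    have "br (lmon 0 [:c, b:]) (lexp cy) = lmon 0 [:b * of_int (-1):] * lexp cy"
      by (simp add: br_def mult_single pderiv_pCons)
    then show ?thesis using that[of "-1"] 2 by simp
  next
    case 3
    have "br (lmon 0 [:c, b:]) (lexp cz) = lmon 0 [:b * of_int 0:] * lexp cz"
      by (simp add: br_def mult_single pderiv_pCons)
    then show ?thesis using that[of 0] 3 by simp
  qed
qed

lemma root_of_unity:
  assumes "m ~= 0" "\<bar>m\<bar> ~= (1::int)"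
  obtains t :: complex where "t ~= 0" "t ~= 1" "t powi m = 1"
proof -
  define N where "N = nat \<bar>m\<bar>"
  have N: "N > 1" using assms by (simp add: N_def)
  have "\<not> {z::complex. z ^ N = 1} \<subseteq> {1}"
  proof
    assume "{z::complex. z ^ N = 1} \<subseteq> {1}"
    then have "card {z::complex. z ^ N = 1} \<le> card {1::complex}" by (rule card_mono[rotated]) simp
    then show False using card_roots_unity_eq[of N] N by simp
  qed
  then obtain t :: complex where t: "t ^ N = 1" "t ~= 1" by auto
  have t0: "t ~= 0" using t(1) N by (auto simp: power_0_left)
  have "t powi m = 1"
  proof (cases "m \<ge> 0")
    case True
    then show ?thesis using t(1) by (simp add: power_int_def N_def)
  next
    case False
    then show ?thesis using t(1) by (simp add: power_int_def N_def power_inverse)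
  qed
  then show ?thesis using that t0 t(2) by blast
qed

lemma qaut_inverse: assumes "qaut anti \<phi> \<psi>" shows "\<phi> (\<psi> s) = s" "\<psi> (\<phi> s) = s"
  using assms unfolding qaut_def by blast+

lemma qaut_uminus: assumes "qaut anti \<phi> \<psi>" anti shows "\<phi> (- s) = - \<phi> s"
  using assms unfolding qaut_def by blast

context surface
begin

lemma rho_qaut:
  assumes "qaut anti \<phi> \<psi>" "s \<in> quadric" "s' \<in> quadric" "\<rho> s = \<rho> s'"
  shows "\<rho> (\<phi> s) = \<rho> (\<phi> s')"
proof -
  have "s' = s \<or> anti \<and> s' = - s" using rho_eq assms(2-4) by blast
  then have "\<phi> s' = \<phi> s \<or> anti \<and> \<phi> s' = - \<phi> s" using qaut_uminus[OF assms(1), of s] by auto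
  then show ?thesis using rho_eq[OF qaut_quadric[OF assms(1,2)] qaut_quadric[OF assms(1,3)]] by blast
qed

end

context surface_action
begin

text \<open>
  The Hamiltonian of the action becomes \<open>b z + c\<close> in new coordinates, whose products are then
  eigenfunctions. Even functions suffice to see that \<open>b\<close> is an integer, because \<open>x z\<close> is even and has
  eigenvalue \<open>b\<close>; and they determine the action up to the antipodal map.
\<close>

lemma linearize:
  obtains \<phi> \<psi> n where "qaut anti \<phi> \<psi>" "n ~= 0"
    "\<forall>t s. t ~= 0 --> s \<in> quadric --> \<alpha> t (\<rho> (\<phi> s)) = \<rho> (\<phi> (hyperbolic n t s))"
proof -
  obtain h where good: "good anti h" and ham: "\<forall>f\<in>inv_ring anti. \<forall>s\<in>quadric. qbr h f s = infinitesimal f s"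
    using diagonal_derivation.good_hamiltonian[OF diagonal] by blast
  obtain \<phi> \<psi> b c where qa: "qaut anti \<phi> \<psi>" and b: "b ~= 0" and lin: "lexp (\<lambda>s. h (\<phi> s)) = lmon 0 [:c, b:]"
    using good_reducible[OF good] unfolding reducible_to_linear_def by (elim exE conjE)
  note qa' = qaut_sym[OF qa]
  have \<phi>\<psi>: "\<phi> (\<psi> s) = s" "\<psi> (\<phi> s) = s" for s by (rule qaut_inverse[OF qa])+
  define L where "L = lmon 0 [:c, b:]"
  have h: "h \<in> qring" using good by (simp add: good_def)
  have h\<phi>: "(\<lambda>s. h (\<phi> s)) \<in> qring" by (rule qaut_qring[OF qa h])
  have ev: "infinitesimal (\<lambda>s. g (\<psi> s)) s = \<gamma> * g (\<psi> s)"
    if g: "g \<in> qring" and gi: "(\<lambda>s. g (\<psi> s)) \<in> inv_ring anti"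
      and br: "br L (lexp g) = lmon 0 [:\<gamma>:] * lexp g" and s: "s \<in> quadric" for g \<gamma> s
  proof -
    have "lexp (qbr (\<lambda>s. h (\<phi> s)) g) = lexp (\<lambda>s. \<gamma> * g s)"
      using qbr(2)[OF h\<phi> g] br lin lexp_cmult[OF g] by (simp add: L_def)
    from lexp_eqD[OF this qbr(1)[OF h\<phi> g] qring_cmult[OF g] qaut_quadric[OF qa' s]]
    have "qbr (\<lambda>s. h (\<phi> s)) g (\<psi> s) = \<gamma> * g (\<psi> s)" .
    moreover have "qbr (\<lambda>s. h (\<phi> (\<psi> s))) (\<lambda>s. g (\<psi> s)) s = qbr (\<lambda>s. h (\<phi> s)) g (\<psi> s)"
      by (rule qaut_qbr_fun[OF qa' h\<phi> g s])
    ultimately show ?thesis using ham gi s by (simp add: \<phi>\<psi>)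
  qed
  \<comment> \<open>A point at which no coordinate vanishes; it shows that the eigenfunctions below are not zero.\<close>
  let ?s0 = "chart 1 2"
  have s0: "\<phi> ?s0 \<in> quadric" by (rule qaut_quadric[OF qa]) simp
  have int: "\<exists>m. \<gamma> = of_int m \<and> (\<forall>t s. t ~= 0 --> s \<in> quadric -->
      push (\<lambda>s. g (\<psi> s)) (\<alpha> t (\<rho> (\<phi> s))) = t powi m * g s)"
    if g: "g \<in> qring" and gi: "(\<lambda>s. g (\<psi> s)) \<in> inv_ring anti"
      and br: "br L (lexp g) = lmon 0 [:\<gamma>:] * lexp g" and nz: "g ?s0 ~= 0" for g \<gamma>
  proof -
    have "\<exists>s\<in>quadric. g (\<psi> s) ~= 0" using nz s0 by (intro bexI[OF _ s0]) (simp add: \<phi>\<psi>)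
    from integral_eigenvalue[OF gi ev[OF g gi br] this] obtain m where m: "\<gamma> = of_int m"
      "\<forall>t p. t ~= 0 --> p \<in> points X --> push (\<lambda>s. g (\<psi> s)) (\<alpha> t p) = t powi m * push (\<lambda>s. g (\<psi> s)) p" by blast
    have "push (\<lambda>s. g (\<psi> s)) (\<alpha> t (\<rho> (\<phi> s))) = t powi m * g s" if t: "t ~= 0" and s: "s \<in> quadric" for t s
    proof -
      have q: "\<phi> s \<in> quadric" by (rule qaut_quadric[OF qa s])
      show ?thesis using m(2)[rule_format, OF t rho_points[OF q]] push_rho[OF gi q] by (simp add: \<phi>\<psi>)
    qed
    with m(1) show ?thesis by (intro exI[of _ m] conjI allI impI)
  qed
  have uq: "u \<in> qring" "u ?s0 ~= 0" if "u \<in> {cx, cy, cz}" for u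
    using that by auto
  have prod_in: "(\<lambda>s. u (\<psi> s) * v (\<psi> s)) \<in> inv_ring anti" if "u \<in> {cx, cy, cz}" "v \<in> {cx, cy, cz}" for u v
    using inv_ring_qaut[OF qa' squares_inv_ring[OF that]] .
  have prod_br: "br L (lexp (\<lambda>s. u s * v s)) = lmon 0 [:b * of_int (w + w'):] * lexp (\<lambda>s. u s * v s)"
    if "u \<in> {cx, cy, cz}" "v \<in> {cx, cy, cz}" "br L (lexp u) = lmon 0 [:b * of_int w:] * lexp u"
      "br L (lexp v) = lmon 0 [:b * of_int w':] * lexp v" for u v w w'
  proof -
    have "lmon 0 [:b * of_int (w + w'):] = lmon 0 [:b * of_int w:] + lmon 0 [:b * of_int w':]"
      by (simp add: single_add[symmetric] algebra_simps)
    then show ?thesis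
      using that uq(1)[OF that(1)] uq(1)[OF that(2)] by (simp add: br_mult_right algebra_simps)
  qed
  have cxz: "cx \<in> {cx, cy, cz}" "cz \<in> {cx, cy, cz}" by auto
  have "br L (lexp (\<lambda>s. cx s * cz s)) = lmon 0 [:b * of_int (1 + 0):] * lexp (\<lambda>s. cx s * cz s)"
    by (rule prod_br[OF cxz]) (simp_all add: L_def br_def mult_single pderiv_pCons)
  from int[OF _ prod_in[OF cxz] this] obtain n where n: "b = of_int n" by auto
  have n0: "n ~= 0" using b n by simp
  have w: "push (\<lambda>s. g (\<psi> s)) (\<alpha> t (\<rho> (\<phi> s))) = t powi (n * w) * g s"
    if g: "g \<in> qring" "(\<lambda>s. g (\<psi> s)) \<in> inv_ring anti" "br L (lexp g) = lmon 0 [:b * of_int w:] * lexp g" "g ?s0 ~= 0"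
      and t: "t ~= 0" and s: "s \<in> quadric" for g w t s
  proof -
    obtain m where m: "b * of_int w = of_int m" "\<forall>t s. t ~= 0 --> s \<in> quadric -->
      push (\<lambda>s. g (\<psi> s)) (\<alpha> t (\<rho> (\<phi> s))) = t powi m * g s" using int[OF g] by blast
    have "of_int (n * w) = (of_int m :: complex)" using m(1) n by simp
    then have "n * w = m" by (simp only: of_int_eq_iff)
    then show ?thesis using m(2)[rule_format, OF t s] by simp
  qed
  have "\<alpha> t (\<rho> (\<phi> s)) = \<rho> (\<phi> (hyperbolic n t s))" if t: "t ~= 0" and s: "s \<in> quadric" for t s
  proof -
    have "\<alpha> t (\<rho> (\<phi> s)) \<in> \<rho> ` quadric"
      unfolding rho_onto by (rule act_points[OF t rho_points[OF qaut_quadric[OF qa s]]])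
    then obtain s' where s': "s' \<in> quadric" "\<alpha> t (\<rho> (\<phi> s)) = \<rho> s'" by blast
    have q: "\<psi> s' \<in> quadric" by (rule qaut_quadric[OF qa' s'(1)])
    have "\<rho> (\<psi> s') = \<rho> (hyperbolic n t s)"
    proof (rule rho_eqI[OF q hyperbolic_quadric[OF t s]])
      fix u v assume u: "u \<in> {cx, cy, cz}" and v: "v \<in> {cx, cy, cz}"
      obtain wu where wu: "br L (lexp u) = lmon 0 [:b * of_int wu:] * lexp u"
        "\<forall>n t s. u (hyperbolic n t s) = t powi (n * wu) * u s" unfolding L_def by (rule coordinate_weights[OF u])
      obtain wv where wv: "br L (lexp v) = lmon 0 [:b * of_int wv:] * lexp v"
        "\<forall>n t s. v (hyperbolic n t s) = t powi (n * wv) * v s" unfolding L_def by (rule coordinate_weights[OF v])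
      have "u (\<psi> s') * v (\<psi> s') = push (\<lambda>s. u (\<psi> s) * v (\<psi> s)) (\<alpha> t (\<rho> (\<phi> s)))"
        unfolding s'(2) by (rule push_rho[OF prod_in[OF u v] s'(1), symmetric])
      also have "\<dots> = t powi (n * (wu + wv)) * (u s * v s)"
        using w[OF qring_mult[OF uq(1)[OF u] uq(1)[OF v]] prod_in[OF u v] prod_br[OF u v wu(1) wv(1)] _ t s]
          uq(2)[OF u] uq(2)[OF v] by simp
      also have "\<dots> = u (hyperbolic n t s) * v (hyperbolic n t s)"
        using wu(2)[rule_format, of n t s] wv(2)[rule_format, of n t s] t by (simp add: distrib_left power_int_add)
      finally show "u (\<psi> s') * v (\<psi> s') = u (hyperbolic n t s) * v (hyperbolic n t s)" .
    next
      fix u assume na: "\<not> anti" and u: "u \<in> {cx, cy, cz}"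
      obtain wu where wu: "br L (lexp u) = lmon 0 [:b * of_int wu:] * lexp u"
        "\<forall>n t s. u (hyperbolic n t s) = t powi (n * wu) * u s" unfolding L_def by (rule coordinate_weights[OF u])
      have ui: "(\<lambda>s. u (\<psi> s)) \<in> inv_ring anti"
        using qaut_qring[OF qa' uq(1)[OF u]] na by (simp add: inv_ring_def)
      have "u (\<psi> s') = push (\<lambda>s. u (\<psi> s)) (\<alpha> t (\<rho> (\<phi> s)))"
        unfolding s'(2) by (rule push_rho[OF ui s'(1), symmetric])
      also have "\<dots> = u (hyperbolic n t s)" using w[OF uq(1)[OF u] ui wu(1) uq(2)[OF u] t s] wu(2)[rule_format, of n t s] by simp
      finally show "u (\<psi> s') = u (hyperbolic n t s)" .
    qed
    from rho_qaut[OF qa q hyperbolic_quadric[OF t s] this] show ?thesis by (simp add: \<phi>\<psi> s'(2))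
  qed
  then have "\<forall>t s. t ~= 0 --> s \<in> quadric --> \<alpha> t (\<rho> (\<phi> s)) = \<rho> (\<phi> (hyperbolic n t s))" by (intro allI impI)
  then show ?thesis by (rule that[OF qa n0])
qed

text \<open>
  For any other weight \<open>n\<close> a nontrivial \<open>n\<close>-th root of unity would act trivially; the swap of \<open>x\<close> and \<open>y\<close>
  exchanges the weights \<open>1\<close> and \<open>-1\<close>.
\<close>

lemma normal_form:
  obtains \<phi> \<psi> where "qaut anti \<phi> \<psi>"
    "\<forall>t s. t ~= 0 --> s \<in> quadric --> \<alpha> t (\<rho> (\<phi> s)) = \<rho> (\<phi> (hyperbolic 1 t s))"
proof -
  obtain \<phi> \<psi> n where qa: "qaut anti \<phi> \<psi>" and n: "n ~= 0"
    and act: "\<forall>t s. t ~= 0 --> s \<in> quadric --> \<alpha> t (\<rho> (\<phi> s)) = \<rho> (\<phi> (hyperbolic n t s))" by (rule linearize)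
  have "\<bar>n\<bar> = 1"
  proof (rule ccontr)
    \<comment> \<open>A nontrivial root of unity \<open>t\<close> with \<open>t^n = 1\<close> would act as the identity.\<close>
    assume "\<bar>n\<bar> ~= 1"
    with n obtain t :: complex where t: "t ~= 0" "t ~= 1" "t powi n = 1" by (rule root_of_unity)
    have h: "hyperbolic n t s = s" for s by (rule pt_eqI) (simp_all add: t(3) power_int_minus)
    have "\<alpha> t p = p" if p: "p \<in> points X" for p
    proof -
      obtain s where s: "s \<in> quadric" "p = \<rho> s" using p rho_onto by blast
      have "\<phi> (\<psi> s) = s" by (rule qaut_inverse[OF qa])
      then show ?thesis
        using act[rule_format, OF t(1) qaut_quadric[OF qaut_sym[OF qa] s(1)]] s(2) by (simp add: h)
    qed
    then show False using act_nontrivial[OF t(1,2)] by blast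
  qed
  then consider "n = 1" | "n = - 1" by linarith
  then show ?thesis
  proof cases
    case 1
    then show ?thesis using that[OF qa] act by simp
  next
    case 2
    have e: "hyperbolic (- 1) t (qswap s) = qswap (hyperbolic 1 t s)" for t :: complex and s
      by (rule pt_eqI) simp_all
    have sq: "qswap s \<in> quadric" if "s \<in> quadric" for s using that by (simp add: quadric_iff mult.commute)
    have *: "\<forall>t s. t ~= 0 --> s \<in> quadric --> \<alpha> t (\<rho> (\<phi> (qswap s))) = \<rho> (\<phi> (qswap (hyperbolic 1 t s)))"
    proof (intro allI impI)
      fix t :: complex and s assume "t ~= 0" "s \<in> quadric"
      then show "\<alpha> t (\<rho> (\<phi> (qswap s))) = \<rho> (\<phi> (qswap (hyperbolic 1 t s)))"
        using act[rule_format, of t "qswap s"] sq 2 by (simp add: e)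
    qed
    show ?thesis by (rule that[OF qaut_comp[OF qa qaut_qswap] *])
  qed
qed

end

context surface
begin

definition induced :: "(pt => pt) => 'a => 'a"
  where "induced \<phi> = restrict (\<lambda>p. \<rho> (\<phi> (lift p))) (points X)"

lemma induced_rho: "qaut anti \<phi> \<psi> ==> s \<in> quadric ==> induced \<phi> (\<rho> s) = \<rho> (\<phi> s)"
  using rho_qaut[of \<phi> \<psi> "lift (\<rho> s)" s] lift[OF rho_points, of s] rho_points[of s]
  by (simp add: induced_def)

lemma induced_points: "qaut anti \<phi> \<psi> ==> p \<in> points X ==> induced \<phi> p \<in> points X"
  using lift[of p] by (simp add: induced_def rho_points qaut_quadric)

lemma induced_inverse:
  assumes qa: "qaut anti \<phi> \<psi>" and p: "p \<in> points X"
  shows "induced \<psi> (induced \<phi> p) = p"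
proof -
  obtain s where s: "s \<in> quadric" "p = \<rho> s" using p rho_onto by blast
  have "\<psi> (\<phi> s) = s" by (rule qaut_inverse[OF qa])
  then show ?thesis
    using induced_rho[OF qa s(1)] induced_rho[OF qaut_sym[OF qa] qaut_quadric[OF qa s(1)]] s(2) by simp
qed

lemma induced_Bij: assumes qa: "qaut anti \<phi> \<psi>" shows "induced \<phi> \<in> Bij (points X)"
proof -
  have "bij_betw (induced \<phi>) (points X) (points X)"
    by (rule bij_betwI[where g = "induced \<psi>"])
       (auto simp: induced_points[OF qa] induced_points[OF qaut_sym[OF qa]] induced_inverse[OF qa]
         induced_inverse[OF qaut_sym[OF qa]])
  then show ?thesis by (simp add: Bij_def induced_def)
qed

lemma induced_morphism:
  assumes qa: "qaut anti \<phi> \<psi>" and f: "\<And>p. p \<in> points X ==> f p = induced \<phi> p"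
  shows "morphism X X f"
proof (rule morphismI_coord)
  show "f p \<in> points X" if "p \<in> points X" for p using that f induced_points[OF qa] by simp
  fix g assume "g \<in> coord_ring"
  then have "(\<lambda>s. g (\<rho> s)) \<in> inv_ring anti" by simp
  from inv_ring_qaut[OF qa this] have "(\<lambda>s. g (\<rho> (\<phi> s))) \<in> inv_ring anti" .
  then show "(\<lambda>s. g (f (\<rho> s))) \<in> inv_ring anti"
    by (rule inv_ring_cong) (simp add: f rho_points induced_rho[OF qa])
qed

lemma induced_automorphism:
  assumes qa: "qaut anti \<phi> \<psi>" shows "induced \<phi> \<in> automorphisms X"
proof -
  have b: "induced \<phi> \<in> Bij (points X)" by (rule induced_Bij[OF qa])
  have "morphism X X (inv_into (points X) (induced \<phi>))"
  proof (rule induced_morphism[OF qaut_sym[OF qa]])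
    fix p assume p: "p \<in> points X"
    show "inv_into (points X) (induced \<phi>) p = induced \<psi> p"
      by (rule inv_into_f_eq) (use b p in \<open>auto simp: Bij_def bij_betw_def induced_points[OF qaut_sym[OF qa]]
         induced_inverse[OF qaut_sym[OF qa]]\<close>)
  qed
  then show ?thesis using b induced_morphism[OF qa] by (simp add: automorphisms_def)
qed

lemma Aut_mult: "f \<in> Bij (points X) ==> g \<in> Bij (points X) ==> f \<otimes>\<^bsub>Aut X\<^esub> g = compose (points X) f g"
  by (simp add: Aut_def BijGroup_def)

lemma Aut_inv_induced:
  assumes qa: "qaut anti \<phi> \<psi>" shows "inv\<^bsub>Aut X\<^esub> (induced \<phi>) = induced \<psi>"
proof (rule group.inv_equality[OF group_Aut_X])
  show "induced \<psi> \<otimes>\<^bsub>Aut X\<^esub> induced \<phi> = \<one>\<^bsub>Aut X\<^esub>"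
    using Aut_mult[OF induced_Bij[OF qaut_sym[OF qa]] induced_Bij[OF qa]] induced_inverse[OF qa]
    by (auto simp: Aut_def BijGroup_def compose_def)
qed (simp_all add: Aut_def induced_automorphism[OF qa] induced_automorphism[OF qaut_sym[OF qa]])

text \<open>
  Both actions are conjugate to the same hyperbolic action; the composite of the two coordinate changes
  descends to the surface and conjugates one into the other.
\<close>

theorem effective_actions_conjugate:
  assumes \<alpha>: "effective_Cstar_action X \<alpha>" and \<beta>: "effective_Cstar_action X \<beta>"
  shows "conjugate_in_Aut X \<alpha> \<beta>"
proof -
  interpret A: surface_action X \<rho> anti \<alpha> by unfold_locales (rule \<alpha>)
  interpret B: surface_action X \<rho> anti \<beta> by unfold_locales (rule \<beta>)
  obtain \<phi> \<psi> where 1: "qaut anti \<phi> \<psi>"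
    and a: "\<forall>t s. t ~= 0 --> s \<in> quadric --> \<alpha> t (\<rho> (\<phi> s)) = \<rho> (\<phi> (hyperbolic 1 t s))" by (rule A.normal_form)
  obtain \<phi>' \<psi>' where 2: "qaut anti \<phi>' \<psi>'"
    and b: "\<forall>t s. t ~= 0 --> s \<in> quadric --> \<beta> t (\<rho> (\<phi>' s)) = \<rho> (\<phi>' (hyperbolic 1 t s))" by (rule B.normal_form)
  have inv1: "\<phi> (\<psi> s) = s" "\<psi> (\<phi> s) = s" and inv2: "\<phi>' (\<psi>' s) = s" for s
    by (rule qaut_inverse[OF 1] qaut_inverse[OF 2])+
  let ?\<Phi> = "induced (\<lambda>s. \<phi>' (\<psi> s))" and ?\<Psi> = "induced (\<lambda>s. \<phi> (\<psi>' s))"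
  have qa: "qaut anti (\<lambda>s. \<phi>' (\<psi> s)) (\<lambda>s. \<phi> (\<psi>' s))" by (rule qaut_comp[OF 2 qaut_sym[OF 1]])
  show ?thesis
    unfolding conjugate_in_Aut_def
  proof (intro bexI[of _ ?\<Phi>] ballI)
    show "?\<Phi> \<in> carrier (Aut X)" using induced_automorphism[OF qa] by (simp add: Aut_def)
    fix t assume "t \<in> carrier Cstar_group"
    then have t: "t ~= 0" by (simp add: Cstar_group_def)
    note bij = induced_Bij[OF qa] A.act_Bij[OF t] induced_Bij[OF qaut_sym[OF qa]]
    have "?\<Phi> \<otimes>\<^bsub>Aut X\<^esub> \<alpha> t \<otimes>\<^bsub>Aut X\<^esub> inv\<^bsub>Aut X\<^esub> ?\<Phi> = compose (points X) (compose (points X) ?\<Phi> (\<alpha> t)) ?\<Psi>"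
      unfolding Aut_inv_induced[OF qa]
      using Aut_mult[OF bij(1,2)] Aut_mult[OF compose_Bij[OF bij(1,2)] bij(3)] by simp
    also have "\<dots> = \<beta> t"
    proof (rule extensionalityI[of _ "points X"])
      show "\<beta> t \<in> extensional (points X)" using B.act_Bij[OF t] by (simp add: Bij_def)
      fix p assume p: "p \<in> points X"
      then obtain s0 where s0: "s0 \<in> quadric" "p = \<rho> s0" using rho_onto by blast
      define s where "s = \<psi>' s0"
      have s: "s \<in> quadric" unfolding s_def by (rule qaut_quadric[OF qaut_sym[OF 2] s0(1)])
      have p': "p = \<rho> (\<phi>' s)" by (simp add: s_def inv2 s0(2))
      have "?\<Psi> p = \<rho> (\<phi> s)"
        using induced_rho[OF qaut_sym[OF qa] s0(1)] by (simp add: s_def s0(2))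
      then have "\<alpha> t (?\<Psi> p) = \<rho> (\<phi> (hyperbolic 1 t s))" using a[rule_format, OF t s] by simp
      then have "?\<Phi> (\<alpha> t (?\<Psi> p)) = \<rho> (\<phi>' (hyperbolic 1 t s))"
        using induced_rho[OF qa qaut_quadric[OF 1 hyperbolic_quadric[OF t s]]] by (simp add: inv1)
      also have "\<dots> = \<beta> t p" unfolding p' using b[rule_format, OF t s] by simp
      finally show "compose (points X) (compose (points X) ?\<Phi> (\<alpha> t)) ?\<Psi> p = \<beta> t p"
        using p induced_points[OF qaut_sym[OF qa] p] by (simp add: compose_def)
    qed simp
    finally show "\<beta> t = ?\<Phi> \<otimes>\<^bsub>Aut X\<^esub> \<alpha> t \<otimes>\<^bsub>Aut X\<^esub> inv\<^bsub>Aut X\<^esub> ?\<Phi>" ..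
  qed
qed

end

section \<open>The complement of the diagonal\<close>

definition rep :: "(complex ^ 'n) set => complex ^ 'n" where "rep q = (SOME x. x \<in> q)"

lemma rep:
  assumes "q \<in> proj_points" shows "rep q ~= 0" "scaling_rel `` {rep q} = q" "rep q \<in> q"
proof -
  obtain x where x: "x ~= 0" "q = scaling_rel `` {x}" "x \<in> q" by (rule proj_pointsE[OF assms])
  show r: "rep q \<in> q" unfolding rep_def using x(3) by (rule someI)
  then have "rep q \<in> scaling_rel `` {x}" by (simp only: x(2)[symmetric])
  then have *: "rep q ~= 0" "\<exists>c. rep q = c *s x" using class_iff[OF x(1), of "rep q"] by blast+
  then show "rep q ~= 0" "scaling_rel `` {rep q} = q" using class_eq_iff[OF x(1) *(1)] x(2) by auto
qed

lemma rep_class: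
  assumes "x ~= 0" obtains c where "c ~= 0" "rep (scaling_rel `` {x}) = c *s x"
proof -
  note r = rep[OF proj_points_class[OF assms]]
  obtain c where c: "rep (scaling_rel `` {x}) = c *s x"
    using class_eq_iff[OF assms r(1)] r(2) by metis
  moreover have "c ~= 0" using r(1) c by auto
  ultimately show ?thesis using that by blast
qed

lemma class_member: "q \<in> proj_points ==> x \<in> q ==> \<exists>c. c ~= 0 \<and> x = c *s rep q"
  using class_iff[OF rep(1), of q x] rep(2)[of q] by force

lemma class_scale: "x ~= 0 ==> c ~= 0 ==> scaling_rel `` {c *s x} = scaling_rel `` {x}"
  using class_eq_iff[of x "c *s x"] by (auto simp: vector_mul_eq_0)

lemma form_ratio_regular:
  assumes "homogeneous_form d g" "homogeneous_form d h" "openin proj_zariski N"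
    and "\<And>q. q \<in> N ==> q \<in> proj_points \<and> h (rep q) ~= 0 \<and> f q = g (rep q) / h (rep q)"
  shows "f \<in> regfuns proj_space N"
proof -
  have "h x ~= 0 \<and> f q = g x / h x" if q: "q \<in> N" and x: "x \<in> q" for q x
  proof -
    obtain c where c: "c ~= 0" "x = c *s rep q" using class_member[OF _ x] assms(4)[OF q] by blast
    show ?thesis
      using assms(4)[OF q] c homogeneous_form_scale[OF assms(1)] homogeneous_form_scale[OF assms(2)] by simp
  qed
  then have "\<exists>N' d g' h'. openin proj_zariski N' \<and> p \<in> N' \<and> N' \<subseteq> N \<and> homogeneous_form d g' \<and> homogeneous_form d h' \<and>
      (\<forall>q\<in>N'. \<forall>x\<in>q. h' x ~= 0 \<and> f q = g' x / h' x)" if "p \<in> N" for p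
    using assms(1-3) that by (intro exI[of _ N] exI[of _ d] exI[of _ g] exI[of _ h] conjI ballI) auto
  then show ?thesis unfolding proj_space_def fun_space.simps by (intro CollectI ballI)
qed

definition coord_open :: "'n => (complex ^ 'n) set set"
  where "coord_open i = {q \<in> proj_points. rep q $ i ~= 0}"

lemma form_open:
  assumes "homogeneous_form d f" shows "openin proj_zariski {q \<in> proj_points. f (rep q) ~= 0}"
proof -
  have "f (rep q) ~= 0 \<longleftrightarrow> (\<forall>x\<in>q. f x ~= 0)" if q: "q \<in> proj_points" for q
  proof
    assume nz: "f (rep q) ~= 0"
    show "\<forall>x\<in>q. f x ~= 0"
    proof
      fix x assume "x \<in> q"
      then obtain c where "c ~= 0" "x = c *s rep q" using class_member[OF q] by blast
      then show "f x ~= 0" using nz homogeneous_form_scale[OF assms] by simp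
    qed
  qed (use rep(3)[OF q] in blast)
  then have "{q \<in> proj_points. f (rep q) ~= 0} = {q \<in> proj_points. \<forall>x\<in>q. f x ~= 0}" by blast
  then show ?thesis using proj_open_nonzero[OF assms] by simp
qed

lemma open_coord: "openin (zariski proj_space) (coord_open i)"
  using form_open[OF homogeneous_form_coord] by (simp add: coord_open_def proj_space_def)

lemma ratio_regular: "(\<lambda>q. rep q $ i / rep q $ j) \<in> regfuns proj_space (coord_open j)"
  by (rule form_ratio_regular[OF homogeneous_form_coord homogeneous_form_coord])
     (use open_coord in \<open>auto simp: coord_open_def proj_space_def\<close>)

lemma coord_open_cover: "q \<in> proj_points ==> \<exists>i. q \<in> coord_open i"
  using rep(1)[of q] by (auto simp: coord_open_def vec_eq_iff)

lemma tensor_regular: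
  assumes X: "nice X" "openin (zariski X) U" and Y: "nice Y" "openin (zariski Y) U'" and t: "t \<in> tensor_funs X Y U U'"
  shows "t \<in> regfuns (product_space X Y) (U \<times> U')"
proof -
  have one: "(\<lambda>_. 1) \<in> tensor_funs X Y U U'"
    using tensor_pure[OF nice_const[OF X, of 1] nice_const[OF Y, of 1]] by simp
  have o: "openin (product_zariski X Y) (U \<times> U')"
    using product_basic_open[OF X(2) Y(2) one] by simp
  have "\<exists>N V V' g h. openin (product_zariski X Y) N \<and> p \<in> N \<and> N \<subseteq> U \<times> U' \<and>
        openin (zariski X) V \<and> openin (zariski Y) V' \<and> N \<subseteq> V \<times> V' \<and>
        g \<in> tensor_funs X Y V V' \<and> h \<in> tensor_funs X Y V V' \<and> (\<forall>q\<in>N. h q ~= 0 \<and> t q = g q / h q)"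
    if "p \<in> U \<times> U'" for p
    using o one t X(2) Y(2) that
    by (intro exI[of _ "U \<times> U'"] exI[of _ U] exI[of _ U'] exI[of _ t] exI[of _ "\<lambda>_. 1"] conjI) simp_all
  then show ?thesis unfolding product_space_def fun_space.simps by (intro CollectI ballI)
qed

abbreviation P1P1 :: "((complex ^ 2) set \<times> (complex ^ 2) set) fun_space"
  where "P1P1 \<equiv> product_space proj_space proj_space"

lemma nice_P1P1: "nice P1P1"
  by (rule nice_product_space[OF nice_proj_space nice_proj_space])

definition offdiag :: "((complex ^ 2) set \<times> (complex ^ 2) set) set"
  where "offdiag = {q \<in> proj_points \<times> proj_points. fst q ~= snd q}"

definition vdet :: "complex ^ 2 => complex ^ 2 => complex" where "vdet v w = v $ 1 * w $ 2 - v $ 2 * w $ 1"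

lemma vdet_0_iff:
  assumes "v ~= 0" "w ~= 0"
  shows "vdet v w = 0 \<longleftrightarrow> (\<exists>c. w = c *s v)"
proof
  assume d: "vdet v w = 0"
  show "\<exists>c. w = c *s v"
  proof (cases "v $ 1 = 0")
    case True
    then have "v $ 2 ~= 0" using assms(1) by (auto simp: vec_eq_iff forall_2)
    then show ?thesis
      using d True by (intro exI[of _ "w $ 2 / v $ 2"]) (auto simp: vdet_def vec_eq_iff forall_2)
  next
    case False
    then show ?thesis
      using d by (intro exI[of _ "w $ 1 / v $ 1"]) (auto simp: vdet_def vec_eq_iff forall_2 field_simps)
  qed
qed (auto simp: vdet_def)

lemma offdiag_vdet: "p \<in> proj_points ==> p' \<in> proj_points ==> p ~= p' \<longleftrightarrow> vdet (rep p) (rep p') ~= 0"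
  using vdet_0_iff[OF rep(1) rep(1), of p p'] class_eq_iff[OF rep(1) rep(1), of p p'] rep(2)[of p] rep(2)[of p'] by simp

text \<open>
  These invariants are homogeneous of degree 0 in both vectors. They satisfy the equation of the quadric
  because \<open>(a d + b c)^2 - (a d - b c)^2 = 4 a b c d\<close>.
\<close>

definition pair_point :: "complex ^ 2 => complex ^ 2 => pt"
  where "pair_point v w = (2 * (v $ 2 * w $ 2) / vdet v w, 2 * (v $ 1 * w $ 1) / vdet v w,
    (v $ 1 * w $ 2 + v $ 2 * w $ 1) / vdet v w)"

lemma pair_point_scale: "c ~= 0 ==> d ~= 0 ==> pair_point (c *s v) (d *s w) = pair_point v w"
proof -
  assume cd: "c ~= 0" "d ~= 0"
  have "vdet (c *s v) (d *s w) = (c * d) * vdet v w" by (simp add: vdet_def algebra_simps)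
  moreover have "2 * ((c *s v) $ 2 * (d *s w) $ 2) = (c * d) * (2 * (v $ 2 * w $ 2))"
    "2 * ((c *s v) $ 1 * (d *s w) $ 1) = (c * d) * (2 * (v $ 1 * w $ 1))"
    "(c *s v) $ 1 * (d *s w) $ 2 + (c *s v) $ 2 * (d *s w) $ 1 = (c * d) * (v $ 1 * w $ 2 + v $ 2 * w $ 1)"
    by (simp_all add: algebra_simps)
  ultimately show ?thesis
    unfolding pair_point_def using cd by (simp only: mult_divide_mult_cancel_left mult_eq_0_iff simp_thms not_False_eq_True)
qed

lemma pair_point_quadric: "vdet v w ~= 0 ==> pair_point v w \<in> quadric"
  by (simp add: quadric_iff pair_point_def field_simps power2_eq_square) (simp add: vdet_def algebra_simps)

definition affine_point :: "(complex ^ 2) set \<times> (complex ^ 2) set => pt"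
  where "affine_point q = pair_point (rep (fst q)) (rep (snd q))"

definition first_vector :: "pt => complex ^ 2"
  where "first_vector s = (if cz s + 1 ~= 0 \<or> cx s ~= 0 then vector [cz s + 1, cx s] else vector [cy s, cz s - 1])"

definition second_vector :: "pt => complex ^ 2"
  where "second_vector s = (if cz s - 1 ~= 0 \<or> cx s ~= 0 then vector [cz s - 1, cx s] else vector [cy s, cz s + 1])"

definition line_pair :: "pt => (complex ^ 2) set \<times> (complex ^ 2) set"
  where "line_pair s = (scaling_rel `` {first_vector s}, scaling_rel `` {second_vector s})"

lemma vector2_nonzero: "vector [a, b] ~= (0 :: complex ^ 2) \<longleftrightarrow> a ~= 0 \<or> b ~= 0"
  by (simp add: vec_eq_iff forall_2)

lemma line_vectors_nonzero: "first_vector s ~= 0" "second_vector s ~= 0"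
proof -
  have two: "a + 1 = 0 ==> a - 1 ~= 0" for a :: complex by algebra
  have two': "a - 1 = 0 ==> a + 1 ~= 0" for a :: complex by algebra
  show "first_vector s ~= 0" unfolding first_vector_def
    using two[of "cz s"] by (cases "cz s + 1 ~= 0 \<or> cx s ~= 0") (simp_all only: if_True if_False vector2_nonzero, auto)
  show "second_vector s ~= 0" unfolding second_vector_def
    using two'[of "cz s"] by (cases "cz s - 1 ~= 0 \<or> cx s ~= 0") (simp_all only: if_True if_False vector2_nonzero, auto)
qed

lemma pair_point_vectors:
  assumes s: "s \<in> quadric"
  shows "vdet (first_vector s) (second_vector s) ~= 0" "pair_point (first_vector s) (second_vector s) = s"
proof -
  have q: "cx s * cy s = cz s * cz s - 1" using s by (simp add: quadric_iff power2_eq_square)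
  have "vdet (first_vector s) (second_vector s) ~= 0 \<and> pair_point (first_vector s) (second_vector s) = s"
  proof (cases "cx s = 0")
    case False
    then have v: "first_vector s = vector [cz s + 1, cx s]" "second_vector s = vector [cz s - 1, cx s]"
      by (simp_all add: first_vector_def second_vector_def)
    have d: "vdet (first_vector s) (second_vector s) = 2 * cx s" by (simp add: v vdet_def algebra_simps)
    have "pair_point (first_vector s) (second_vector s) = s"
      by (rule pt_eqI) (simp_all add: pair_point_def d, simp_all add: v field_simps False q)
    then show ?thesis using d False by simp
  next
    case True
    then have "(cz s - 1) * (cz s + 1) = 0" using q by (simp add: algebra_simps)
    then consider "cz s = 1" | "cz s = -1" by (auto simp: eq_neg_iff_add_eq_0)
    then show ?thesis
    proof cases
      case 1
      then have v: "first_vector s = vector [2, 0]" "second_vector s = vector [cy s, 2]"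
        using True by (simp_all add: first_vector_def second_vector_def)
      show ?thesis by (auto simp: v vdet_def pair_point_def True 1 intro!: pt_eqI)
    next
      case 2
      then have v: "first_vector s = vector [cy s, -2]" "second_vector s = vector [-2, 0]"
        using True by (simp_all add: first_vector_def second_vector_def)
      show ?thesis by (auto simp: v vdet_def pair_point_def True 2 intro!: pt_eqI)
    qed
  qed
  then show "vdet (first_vector s) (second_vector s) ~= 0" "pair_point (first_vector s) (second_vector s) = s" by blast+
qed

lemma affine_point_line_pair: "s \<in> quadric ==> affine_point (line_pair s) = s"
proof -
  assume s: "s \<in> quadric"
  obtain c where c: "c ~= 0" "rep (scaling_rel `` {first_vector s}) = c *s first_vector s"
    by (rule rep_class[OF line_vectors_nonzero(1)])
  obtain d where d: "d ~= 0" "rep (scaling_rel `` {second_vector s}) = d *s second_vector s"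
    by (rule rep_class[OF line_vectors_nonzero(2)])
  show ?thesis
    unfolding affine_point_def line_pair_def fst_conv snd_conv c(2) d(2)
    using pair_point_scale[OF c(1) d(1)] pair_point_vectors(2)[OF s] by simp
qed

lemma line_pair_offdiag: "s \<in> quadric ==> line_pair s \<in> offdiag"
  using pair_point_vectors(1)[of s] vdet_0_iff[OF line_vectors_nonzero] class_eq_iff[OF line_vectors_nonzero]
  by (auto simp: offdiag_def line_pair_def proj_points_class[OF line_vectors_nonzero(1)] proj_points_class[OF line_vectors_nonzero(2)])

lemma affine_point_quadric: "q \<in> offdiag ==> affine_point q \<in> quadric"
  unfolding affine_point_def using offdiag_vdet[of "fst q" "snd q"] by (intro pair_point_quadric) (auto simp: offdiag_def)

lemma class_vector2:
  assumes "q \<in> proj_points" "a = k * rep q $ 1" "b = k * rep q $ 2" "a ~= 0 \<or> b ~= 0"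
  shows "q = scaling_rel `` {vector [a, b] :: complex ^ 2}"
proof -
  have "vector [a, b] = k *s rep q" using assms(2,3) by (simp add: vec_eq_iff forall_2)
  moreover have "k ~= 0" using assms by auto
  ultimately show ?thesis using class_scale[OF rep(1)[OF assms(1)]] rep(2)[OF assms(1)] by simp
qed

text \<open>
  Up to the factor \<open>2 / vdet v w\<close>, the vectors \<open>(z + 1, x)\<close> and \<open>(y, z - 1)\<close> are the multiples of \<open>v\<close>
  by the coordinates of \<open>w\<close>, and \<open>(z - 1, x)\<close> and \<open>(y, z + 1)\<close> are the multiples of \<open>w\<close> by those of \<open>v\<close>.
\<close>

lemma offdiag_classes:
  assumes q: "q \<in> offdiag"
  shows "cz (affine_point q) + 1 ~= 0 \<or> cx (affine_point q) ~= 0 ==>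
      fst q = scaling_rel `` {vector [cz (affine_point q) + 1, cx (affine_point q)]}"
    and "cy (affine_point q) ~= 0 \<or> cz (affine_point q) - 1 ~= 0 ==>
      fst q = scaling_rel `` {vector [cy (affine_point q), cz (affine_point q) - 1]}"
    and "cz (affine_point q) - 1 ~= 0 \<or> cx (affine_point q) ~= 0 ==>
      snd q = scaling_rel `` {vector [cz (affine_point q) - 1, cx (affine_point q)]}"
    and "cy (affine_point q) ~= 0 \<or> cz (affine_point q) + 1 ~= 0 ==>
      snd q = scaling_rel `` {vector [cy (affine_point q), cz (affine_point q) + 1]}"
proof -
  let ?v = "rep (fst q)" and ?w = "rep (snd q)"
  have p: "fst q \<in> proj_points" "snd q \<in> proj_points" and d: "vdet ?v ?w ~= 0"
    using q offdiag_vdet[of "fst q" "snd q"] by (auto simp: offdiag_def)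
  have c: "cx (affine_point q) = 2 * (?v $ 2 * ?w $ 2) / vdet ?v ?w" "cy (affine_point q) = 2 * (?v $ 1 * ?w $ 1) / vdet ?v ?w"
    by (simp_all add: affine_point_def pair_point_def)
  have z: "cz (affine_point q) = (?v $ 1 * ?w $ 2 + ?v $ 2 * ?w $ 1) / vdet ?v ?w"
    by (simp add: affine_point_def pair_point_def)
  have z1: "cz (affine_point q) + 1 = 2 * (?v $ 1 * ?w $ 2) / vdet ?v ?w"
    "cz (affine_point q) - 1 = 2 * (?v $ 2 * ?w $ 1) / vdet ?v ?w"
    unfolding z using d by (simp_all add: field_simps) (simp_all add: vdet_def)
  show "cz (affine_point q) + 1 ~= 0 \<or> cx (affine_point q) ~= 0 ==>
      fst q = scaling_rel `` {vector [cz (affine_point q) + 1, cx (affine_point q)]}"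
    by (rule class_vector2[OF p(1), where k = "2 * ?w $ 2 / vdet ?v ?w"]) (simp_all add: c z1)
  show "cy (affine_point q) ~= 0 \<or> cz (affine_point q) - 1 ~= 0 ==>
      fst q = scaling_rel `` {vector [cy (affine_point q), cz (affine_point q) - 1]}"
    by (rule class_vector2[OF p(1), where k = "2 * ?w $ 1 / vdet ?v ?w"]) (simp_all add: c z1)
  show "cz (affine_point q) - 1 ~= 0 \<or> cx (affine_point q) ~= 0 ==>
      snd q = scaling_rel `` {vector [cz (affine_point q) - 1, cx (affine_point q)]}"
    by (rule class_vector2[OF p(2), where k = "2 * ?v $ 2 / vdet ?v ?w"]) (simp_all add: c z1)
  show "cy (affine_point q) ~= 0 \<or> cz (affine_point q) + 1 ~= 0 ==>
      snd q = scaling_rel `` {vector [cy (affine_point q), cz (affine_point q) + 1]}"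
    by (rule class_vector2[OF p(2), where k = "2 * ?v $ 1 / vdet ?v ?w"]) (simp_all add: c z1)
qed

lemma line_pair_affine_point: "q \<in> offdiag ==> line_pair (affine_point q) = q"
proof (rule prod_eqI)
  assume q: "q \<in> offdiag"
  have two: "a + 1 = 0 ==> a - 1 ~= 0" "a - 1 = 0 ==> a + 1 ~= 0" for a :: complex by algebra+
  show "fst (line_pair (affine_point q)) = fst q"
    unfolding line_pair_def fst_conv first_vector_def
    using offdiag_classes(1,2)[OF q] two[of "cz (affine_point q)"]
    by (cases "cz (affine_point q) + 1 ~= 0 \<or> cx (affine_point q) ~= 0") (simp_all only: if_True if_False, blast)
  show "snd (line_pair (affine_point q)) = snd q"
    unfolding line_pair_def snd_conv second_vector_def
    using offdiag_classes(3,4)[OF q] two[of "cz (affine_point q)"]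
    by (cases "cz (affine_point q) - 1 ~= 0 \<or> cx (affine_point q) ~= 0") (simp_all only: if_True if_False, blast)
qed

text \<open>
  Where the coordinates \<open>i\<close> and \<open>j\<close> of the two points do not vanish, the numerators and the determinant
  become products of regular functions of the two points after division by these coordinates.
\<close>

lemma affine_point_chart:
  fixes i j :: 2
  defines "W \<equiv> coord_open i \<times> coord_open j"
    and "r \<equiv> (\<lambda>k l q. (rep (fst q) $ k / rep (fst q) $ i) * (rep (snd q) $ l / rep (snd q) $ j))"
  defines "t \<equiv> (\<lambda>q. r 1 2 q + - 1 * r 2 1 q)"
  shows "openin (zariski P1P1) {q \<in> W. t q ~= 0}" "{q \<in> W. t q ~= 0} = W \<inter> offdiag"
    and "(\<lambda>q. cx (affine_point q)) \<in> regfuns P1P1 (W \<inter> offdiag)"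
    and "(\<lambda>q. cy (affine_point q)) \<in> regfuns P1P1 (W \<inter> offdiag)"
    and "(\<lambda>q. cz (affine_point q)) \<in> regfuns P1P1 (W \<inter> offdiag)"
proof -
  note o = open_coord[of i] open_coord[of j]
  have rT: "r k l \<in> tensor_funs proj_space proj_space (coord_open i) (coord_open j)" for k l
    unfolding r_def by (rule tensor_pure[OF ratio_regular ratio_regular])
  have W: "openin (zariski P1P1) W"
    using product_basic_open[OF o, of "\<lambda>_. 1"] tensor_pure[OF nice_const[OF nice_proj_space o(1), of 1] nice_const[OF nice_proj_space o(2), of 1]]
    by (simp add: W_def product_space_def)
  have r: "r k l \<in> regfuns P1P1 W" for k l
    unfolding W_def by (rule tensor_regular[OF nice_proj_space o(1) nice_proj_space o(2) rT])
  have tr: "t \<in> regfuns P1P1 W"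
    unfolding t_def by (intro nice_add[OF nice_P1P1 W] nice_mult[OF nice_P1P1 W] nice_const[OF nice_P1P1 W] r)
  show op: "openin (zariski P1P1) {q \<in> W. t q ~= 0}" by (rule nice_open_nonzero[OF nice_P1P1 W tr])
  have tv: "vdet (rep (fst q)) (rep (snd q)) = (rep (fst q) $ i * rep (snd q) $ j) * t q" if "q \<in> W" for q
    using that by (auto simp: W_def t_def r_def vdet_def coord_open_def field_simps)
  show eq: "{q \<in> W. t q ~= 0} = W \<inter> offdiag"
  proof -
    have "t q ~= 0 \<longleftrightarrow> q \<in> offdiag" if q: "q \<in> W" for q
      using tv[OF q] q offdiag_vdet[of "fst q" "snd q"] by (auto simp: offdiag_def W_def coord_open_def)
    then show ?thesis by blast
  qed
  have rs: "r k l \<in> regfuns P1P1 {q \<in> W. t q ~= 0}" for k l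
    by (rule nice_restrict[OF nice_P1P1 W op _ r]) blast
  have ts: "t \<in> regfuns P1P1 {q \<in> W. t q ~= 0}"
    by (rule nice_restrict[OF nice_P1P1 W op _ tr]) blast
  have frac: "f \<in> regfuns P1P1 (W \<inter> offdiag)"
    if f: "\<And>q. q \<in> W \<inter> offdiag ==> f q = (a * r k l q + b * r k' l' q) / t q" for f k l k' l' a b
  proof -
    have "(\<lambda>q. (a * r k l q + b * r k' l' q) / t q) \<in> regfuns P1P1 {q \<in> W. t q ~= 0}"
      by (intro nice_divide[OF nice_P1P1 op] nice_add[OF nice_P1P1 op] nice_mult[OF nice_P1P1 op] nice_const[OF nice_P1P1 op] rs ts) blast
    then show ?thesis unfolding eq by (rule nice_cong[OF nice_P1P1 op[unfolded eq]]) (simp only: f)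
  qed
  have nz: "rep (fst q) $ i ~= 0" "rep (snd q) $ j ~= 0" "t q ~= 0" "q \<in> W" if "q \<in> W \<inter> offdiag" for q
  proof -
    have "q \<in> {q \<in> W. t q ~= 0}" using that by (simp only: eq)
    then show *: "t q ~= 0" "q \<in> W" by blast+
    then show "rep (fst q) $ i ~= 0" "rep (snd q) $ j ~= 0" unfolding W_def coord_open_def by auto
  qed
  show "(\<lambda>q. cx (affine_point q)) \<in> regfuns P1P1 (W \<inter> offdiag)"
  proof (rule frac[of _ 2 2 2 0 1 1])
    fix q assume "q \<in> W \<inter> offdiag"
    note n = nz[OF this]
    show "cx (affine_point q) = (2 * r 2 2 q + 0 * r 1 1 q) / t q"
      unfolding affine_point_def pair_point_def coords tv[OF n(4)] r_def using n(1-3) by (simp add: field_simps)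
  qed
  show "(\<lambda>q. cy (affine_point q)) \<in> regfuns P1P1 (W \<inter> offdiag)"
  proof (rule frac[of _ 2 1 1 0 1 1])
    fix q assume "q \<in> W \<inter> offdiag"
    note n = nz[OF this]
    show "cy (affine_point q) = (2 * r 1 1 q + 0 * r 1 1 q) / t q"
      unfolding affine_point_def pair_point_def coords tv[OF n(4)] r_def using n(1-3) by (simp add: field_simps)
  qed
  show "(\<lambda>q. cz (affine_point q)) \<in> regfuns P1P1 (W \<inter> offdiag)"
  proof (rule frac[of _ 1 1 2 1 2 1])
    fix q assume "q \<in> W \<inter> offdiag"
    note n = nz[OF this]
    show "cz (affine_point q) = (1 * r 1 2 q + 1 * r 2 1 q) / t q"
      unfolding affine_point_def pair_point_def coords tv[OF n(4)] r_def using n(1-3) by (simp add: field_simps)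
  qed
qed

lemma offdiag_coord_open: assumes "q \<in> offdiag" shows "\<exists>i j. q \<in> coord_open i \<times> coord_open j"
proof -
  have "fst q \<in> proj_points" "snd q \<in> proj_points" using assms by (simp_all add: offdiag_def mem_Times_iff)
  then obtain i j where "fst q \<in> coord_open i" "snd q \<in> coord_open j" using coord_open_cover by metis
  then show ?thesis by (intro exI[of _ i] exI[of _ j]) (simp add: mem_Times_iff)
qed

lemma offdiag_open: "openin (zariski P1P1) offdiag"
proof -
  have "openin (zariski P1P1) ((coord_open i \<times> coord_open j) \<inter> offdiag)" for i j
    using affine_point_chart(1,2)[of i j] by simp
  then have "openin (zariski P1P1) (\<Union> {(coord_open i \<times> coord_open j) \<inter> offdiag | i j. True})"
    by (intro openin_Union) blast
  moreover have "\<Union> {(coord_open i \<times> coord_open j) \<inter> offdiag | i j. True} = offdiag" (is "?L = _")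
  proof
    show "offdiag \<subseteq> ?L"
    proof
      fix q assume q: "q \<in> offdiag"
      from offdiag_coord_open[OF this] obtain i j where "q \<in> coord_open i \<times> coord_open j" by blast
      with q show "q \<in> ?L" by blast
    qed
  qed blast
  ultimately show ?thesis by (simp only:)
qed

lemma affine_point_regular:
  "(\<lambda>q. cx (affine_point q)) \<in> regfuns P1P1 offdiag" "(\<lambda>q. cy (affine_point q)) \<in> regfuns P1P1 offdiag"
  "(\<lambda>q. cz (affine_point q)) \<in> regfuns P1P1 offdiag"
proof -
  have loc: "f \<in> regfuns P1P1 offdiag"
    if f: "\<And>i j. f \<in> regfuns P1P1 ((coord_open i \<times> coord_open j) \<inter> offdiag)" for f
  proof (rule nice_glue[OF nice_P1P1 offdiag_open])
    fix q assume q: "q \<in> offdiag"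
    from offdiag_coord_open[OF q] obtain i j where "q \<in> coord_open i \<times> coord_open j" by blast
    then have "q \<in> (coord_open i \<times> coord_open j) \<inter> offdiag" using q by blast
    moreover have "openin (zariski P1P1) ((coord_open i \<times> coord_open j) \<inter> offdiag)"
      using affine_point_chart(1,2)[of i j] by simp
    ultimately show "\<exists>N. openin (zariski P1P1) N \<and> q \<in> N \<and> N \<subseteq> offdiag \<and> f \<in> regfuns P1P1 N" using f by blast
  qed
  show "(\<lambda>q. cx (affine_point q)) \<in> regfuns P1P1 offdiag" by (rule loc[OF affine_point_chart(3)])
  show "(\<lambda>q. cy (affine_point q)) \<in> regfuns P1P1 offdiag" by (rule loc[OF affine_point_chart(4)])
  show "(\<lambda>q. cz (affine_point q)) \<in> regfuns P1P1 offdiag" by (rule loc[OF affine_point_chart(5)])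
qed

lemma P1P1_minus_diagonal_eq: "P1P1_minus_diagonal = open_subspace P1P1 offdiag"
proof -
  have *: "offdiag = topspace (zariski P1P1) \<inter> {(p, p'). p ~= p'}"
    using points_product_nice[OF nice_proj_space nice_proj_space] by (auto simp: offdiag_def points_proj_space)
  show ?thesis
    unfolding P1P1_minus_diagonal_def open_subspace_def * subtopology_restrict ..
qed

lemma local_vector2:
  fixes Z :: "'a fun_space" and f g h :: "'a => complex" and \<phi> :: "'a => (complex ^ 2) set"
  assumes Z: "nice Z" and f: "f \<in> regfuns Z (points Z)" and h: "h \<in> regfuns Z (points Z)" and g: "g = f \<or> g = h"
    and z: "z \<in> points Z" "g z ~= 0"
    and \<phi>: "\<And>z. z \<in> points Z ==> f z ~= 0 \<or> h z ~= 0 ==> \<phi> z = scaling_rel `` {vector [f z, h z]}"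
  shows "\<exists>N v. openin (zariski Z) N \<and> z \<in> N \<and> (\<forall>i. (\<lambda>w. v w $ i) \<in> regfuns Z N) \<and>
      (\<forall>w\<in>N. v w ~= 0 \<and> \<phi> w = scaling_rel `` {v w})"
proof (intro exI conjI allI ballI)
  have top: "openin (zariski Z) (points Z)" by (rule openin_topspace)
  let ?N = "{z \<in> points Z. g z ~= 0}"
  have gr: "g \<in> regfuns Z (points Z)" using g f h by blast
  show o: "openin (zariski Z) ?N" by (rule nice_open_nonzero[OF Z top gr])
  show "z \<in> ?N" using z by simp
  have fh: "f \<in> regfuns Z ?N" "h \<in> regfuns Z ?N"
    by (rule nice_restrict[OF Z top o _ f], blast) (rule nice_restrict[OF Z top o _ h], blast)
  show "(\<lambda>w. (vector [f w, h w] :: complex ^ 2) $ i) \<in> regfuns Z ?N" for i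
    using exhaust_2[of i] fh by auto
  fix w assume w: "w \<in> ?N"
  then have nz: "f w ~= 0 \<or> h w ~= 0" using g by blast
  then show "vector [f w, h w] ~= (0 :: complex ^ 2)" by (simp only: vector2_nonzero)
  show "\<phi> w = scaling_rel `` {vector [f w, h w]}" using \<phi> w nz by blast
qed

lemma morphism_two_vectors:
  fixes Z :: "'a fun_space" and a b c d :: "'a => complex" and \<phi> :: "'a => (complex ^ 2) set"
  assumes Z: "nice Z" and r: "a \<in> regfuns Z (points Z)" "b \<in> regfuns Z (points Z)"
      "c \<in> regfuns Z (points Z)" "d \<in> regfuns Z (points Z)"
    and 1: "\<And>z. z \<in> points Z ==> a z ~= 0 \<or> b z ~= 0 ==> \<phi> z = scaling_rel `` {vector [a z, b z]}"
    and 2: "\<And>z. z \<in> points Z ==> c z ~= 0 \<or> d z ~= 0 ==> \<phi> z = scaling_rel `` {vector [c z, d z]}"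
    and nz: "\<And>z. z \<in> points Z ==> a z ~= 0 \<or> b z ~= 0 \<or> c z ~= 0 \<or> d z ~= 0"
  shows "morphism Z proj_space \<phi>"
proof (rule morphism_proj_space[OF Z])
  fix z assume z: "z \<in> points Z"
  from nz[OF z] consider "a z ~= 0" | "b z ~= 0" | "c z ~= 0" | "d z ~= 0" by blast
  then show "\<exists>N v. openin (zariski Z) N \<and> z \<in> N \<and> (\<forall>i. (\<lambda>w. v w $ i) \<in> regfuns Z N) \<and>
      (\<forall>w\<in>N. v w ~= 0 \<and> \<phi> w = scaling_rel `` {v w})"
  proof cases
    case 1 show ?thesis by (rule local_vector2[where f = a and h = b and g = a, OF Z r(1,2) _ z 1 assms(6)]) simp_all
  next
    case 2 show ?thesis by (rule local_vector2[where f = a and h = b and g = b, OF Z r(1,2) _ z 2 assms(6)]) simp_all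
  next
    case 3 show ?thesis by (rule local_vector2[where f = c and h = d and g = c, OF Z r(3,4) _ z 3 assms(7)]) simp_all
  next
    case 4 show ?thesis by (rule local_vector2[where f = c and h = d and g = d, OF Z r(3,4) _ z 4 assms(7)]) simp_all
  qed
qed

lemma surface_P1P1: "surface P1P1_minus_diagonal line_pair False"
proof (rule surface.intro)
  have pts: "points P1P1_minus_diagonal = offdiag"
    unfolding P1P1_minus_diagonal_eq by (rule points_open_subspace[OF offdiag_open])
  show nice: "nice P1P1_minus_diagonal"
    unfolding P1P1_minus_diagonal_eq by (rule nice_open_subspace[OF nice_P1P1 offdiag_open])
  show "group (Aut P1P1_minus_diagonal)" by (rule group_Aut_P1P1_minus_diagonal)
  show "line_pair ` quadric = points P1P1_minus_diagonal"
    unfolding pts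
  proof
    show "line_pair ` quadric \<subseteq> offdiag" using line_pair_offdiag by blast
    show "offdiag \<subseteq> line_pair ` quadric"
    proof
      fix q assume q: "q \<in> offdiag"
      from imageI[OF affine_point_quadric[OF q], of line_pair] show "q \<in> line_pair ` quadric"
        by (simp only: line_pair_affine_point[OF q])
    qed
  qed
  show "line_pair s = line_pair s' \<longleftrightarrow> s' = s \<or> False \<and> s' = - s" if "s \<in> quadric" "s' \<in> quadric" for s s'
  proof
    assume "line_pair s = line_pair s'"
    then have "affine_point (line_pair s) = affine_point (line_pair s')" by (rule arg_cong)
    then have "s' = s" by (simp only: affine_point_line_pair[OF that(1)] affine_point_line_pair[OF that(2)])
    then show "s' = s \<or> False \<and> s' = - s" ..
  qed (simp only: simp_thms)
  have reg: "regfuns P1P1_minus_diagonal = regfuns P1P1" by (simp add: P1P1_minus_diagonal_eq regfuns_open_subspace)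
  show "f \<in> regfuns P1P1_minus_diagonal (points P1P1_minus_diagonal)"
    if f: "(\<lambda>s. f (line_pair s)) \<in> inv_ring False" for f
  proof -
    have "(\<lambda>q. f (line_pair (affine_point q))) \<in> regfuns P1P1 offdiag"
      by (rule qring_pullback[OF nice_P1P1 offdiag_open affine_point_regular affine_point_quadric inv_ring_qring[OF f]])
    then show ?thesis
      unfolding reg pts by (rule nice_cong[OF nice_P1P1 offdiag_open]) (simp add: line_pair_affine_point)
  qed
  let ?R = "{f. (\<lambda>s. f (line_pair s)) \<in> inv_ring False}"
  let ?A = "aff (points P1P1_minus_diagonal) ?R"
  have R: "function_ring ?R" by (simp add: function_ring_def inv_ring_ops)
  have A: "nice ?A" by (rule nice_aff[OF R])
  have pA: "points ?A = offdiag" using points_aff[OF R, of "points P1P1_minus_diagonal"] pts by simp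
  have rA: "f \<in> regfuns ?A (points ?A)" if "f \<in> ?R" for f by (rule regular_aff[OF R that openin_topspace])
  have cR: "(\<lambda>q. u (affine_point q) + c) \<in> ?R" if u: "u \<in> {cx, cy, cz}" for u c
  proof -
    have "(\<lambda>s. u s + c) \<in> qring" using u by auto
    then have "(\<lambda>s. u s + c) \<in> inv_ring False" by (simp add: inv_ring_def)
    then have "(\<lambda>s. u (affine_point (line_pair s)) + c) \<in> inv_ring False"
      by (rule inv_ring_cong) (simp add: affine_point_line_pair)
    then show ?thesis by simp
  qed
  have regs: "(\<lambda>q. cx (affine_point q)) \<in> regfuns ?A (points ?A)" "(\<lambda>q. cy (affine_point q)) \<in> regfuns ?A (points ?A)"
    "(\<lambda>q. cz (affine_point q) + 1) \<in> regfuns ?A (points ?A)" "(\<lambda>q. cz (affine_point q) - 1) \<in> regfuns ?A (points ?A)"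
    using rA[OF cR[of cx 0]] rA[OF cR[of cy 0]] rA[OF cR[of cz 1]] rA[OF cR[of cz "- 1"]] by simp_all
  have two: "a + 1 ~= 0 \<or> b \<or> c \<or> a - 1 ~= 0" "a - 1 ~= 0 \<or> b \<or> c \<or> a + 1 ~= 0" for a :: complex and b c
    by (auto simp: add_eq_0_iff)
  note cls = offdiag_classes[folded pA]
  have 1: "morphism ?A proj_space fst"
    by (rule morphism_two_vectors[OF A regs(3,1,2,4) cls(1,2)]) (simp_all only: two)
  have 2: "morphism ?A proj_space snd"
    by (rule morphism_two_vectors[OF A regs(4,1,2,3) cls(3,4)]) (simp_all only: two)
  have "morphism ?A P1P1 (\<lambda>q. q)"
    using morphism_pair[OF A nice_proj_space nice_proj_space 1 2] by simp
  then show "morphism ?A P1P1_minus_diagonal (\<lambda>q. q)"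
    unfolding P1P1_minus_diagonal_eq by (rule morphism_open_subspace[OF _ offdiag_open]) (simp add: pA[unfolded P1P1_minus_diagonal_eq])
qed

section \<open>Normal form of nonsingular ternary quadratic forms\<close>

definition qform :: "(nat => complex) => complex ^ 3 => complex"
  where "qform a x = a 1 * (x $ 1)^2 + a 2 * (x $ 2)^2 + a 3 * (x $ 3)^2
    + a 4 * (x $ 1 * x $ 2) + a 5 * (x $ 1 * x $ 3) + a 6 * (x $ 2 * x $ 3)"

definition polar :: "(nat => complex) => complex ^ 3 => complex ^ 3 => complex"
  where "polar a x y = 2 * a 1 * (x $ 1 * y $ 1) + 2 * a 2 * (x $ 2 * y $ 2) + 2 * a 3 * (x $ 3 * y $ 3)
    + a 4 * (x $ 1 * y $ 2 + x $ 2 * y $ 1) + a 5 * (x $ 1 * y $ 3 + x $ 3 * y $ 1) + a 6 * (x $ 2 * y $ 3 + x $ 3 * y $ 2)"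

lemma qform_add: "qform a (x + y) = qform a x + qform a y + polar a x y"
  and qform_scale: "qform a (c *s x) = c^2 * qform a x"
  and polar_add: "polar a (x + y) z = polar a x z + polar a y z"
  and polar_scale: "polar a (c *s x) z = c * polar a x z"
  and polar_sym: "polar a x z = polar a z x"
  and polar_self: "polar a x x = 2 * qform a x"
  by (simp_all add: qform_def polar_def power2_eq_square algebra_simps)

lemma polar_add_right: "polar a z (x + y) = polar a z x + polar a z y"
  and polar_scale_right: "polar a z (c *s x) = c * polar a z x"
  by (simp_all add: polar_sym[of a z] polar_add polar_scale)

lemmas polar_simps = polar_add polar_scale polar_add_right polar_scale_right

lemma monomial_2_qform:
  fixes m :: "3 => nat" and b :: complex
  assumes m: "(\<Sum>i\<in>UNIV. m i) = 2"
  shows "\<exists>a. \<forall>x. b * (\<Prod>i\<in>UNIV. (x $ i) ^ m i) = qform a x"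
proof -
  have p: "(\<Prod>i\<in>UNIV. (x $ i) ^ m i) = x $ 1 ^ m 1 * (x $ 2 ^ m 2 * x $ 3 ^ m 3)" for x :: "complex ^ 3"
    unfolding UNIV_3 by simp
  have total: "m 1 + m 2 + m 3 = 2" using m unfolding sum_3 .
  have le: "m 1 + m 2 \<le> 2" and m3: "m 3 = 2 - m 1 - m 2" using total by linarith+
  have m1: "m 1 = 0 \<or> m 1 = 1 \<or> m 1 = 2" and m2: "m 2 = 0 \<or> m 2 = 1 \<or> m 2 = 2" using le by linarith+
  have "m 1 = 2 \<and> m 2 = 0 \<and> m 3 = 0 \<or> m 1 = 0 \<and> m 2 = 2 \<and> m 3 = 0 \<or> m 1 = 0 \<and> m 2 = 0 \<and> m 3 = 2
    \<or> m 1 = 1 \<and> m 2 = 1 \<and> m 3 = 0 \<or> m 1 = 1 \<and> m 2 = 0 \<and> m 3 = 1 \<or> m 1 = 0 \<and> m 2 = 1 \<and> m 3 = 1"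
    using m1 m2 le unfolding m3 by (elim disjE) simp_all
  then show ?thesis
  proof (elim disjE)
    assume "m 1 = 2 \<and> m 2 = 0 \<and> m 3 = 0"
    then show ?thesis unfolding p by (intro exI[of _ "\<lambda>i. if i = 1 then b else 0"] allI) (simp add: qform_def)
  next
    assume "m 1 = 0 \<and> m 2 = 2 \<and> m 3 = 0"
    then show ?thesis unfolding p by (intro exI[of _ "\<lambda>i. if i = 2 then b else 0"] allI) (simp add: qform_def)
  next
    assume "m 1 = 0 \<and> m 2 = 0 \<and> m 3 = 2"
    then show ?thesis unfolding p by (intro exI[of _ "\<lambda>i. if i = 3 then b else 0"] allI) (simp add: qform_def)
  next
    assume "m 1 = 1 \<and> m 2 = 1 \<and> m 3 = 0"
    then show ?thesis unfolding p by (intro exI[of _ "\<lambda>i. if i = 4 then b else 0"] allI) (simp add: qform_def)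
  next
    assume "m 1 = 1 \<and> m 2 = 0 \<and> m 3 = 1"
    then show ?thesis unfolding p by (intro exI[of _ "\<lambda>i. if i = 5 then b else 0"] allI) (simp add: qform_def)
  next
    assume "m 1 = 0 \<and> m 2 = 1 \<and> m 3 = 1"
    then show ?thesis unfolding p by (intro exI[of _ "\<lambda>i. if i = 6 then b else 0"] allI) (simp add: qform_def)
  qed
qed

lemma homogeneous_form_2_qform:
  fixes q :: "complex ^ 3 => complex"
  assumes "homogeneous_form 2 q" shows "\<exists>a. q = qform a"
proof -
  have "\<exists>c. q = (\<lambda>x. \<Sum>m | (\<Sum>i\<in>UNIV. m i) = 2. c m * (\<Prod>i\<in>UNIV. (x $ i) ^ m i))"
    using assms unfolding homogeneous_form_def .
  then show ?thesis
  proof (elim exE)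
    fix c assume q: "q = (\<lambda>x. \<Sum>m | (\<Sum>i\<in>UNIV. m i) = 2. c m * (\<Prod>i\<in>UNIV. (x $ i) ^ m i))"
    define A where "A m = (SOME a. \<forall>x. c m * (\<Prod>i\<in>UNIV. (x $ i) ^ m i) = qform a x)" for m
    have A: "c m * (\<Prod>i\<in>UNIV. (x $ i) ^ m i) = qform (A m) x" if "(\<Sum>i\<in>UNIV. m i) = 2" for m x
      using someI_ex[OF monomial_2_qform[OF that, of "c m"], folded A_def] by (rule spec)
    have "q x = qform (\<lambda>i. \<Sum>m | (\<Sum>i\<in>UNIV. m i) = 2. A m i) x" for x
    proof -
      have "q x = (\<Sum>m | (\<Sum>i\<in>UNIV. m i) = 2. qform (A m) x)"
        unfolding q by (rule sum.cong[OF refl], rule A, erule CollectD)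
      then show ?thesis by (simp only: qform_def sum.distrib sum_distrib_right)
    qed
    then show ?thesis by (intro exI ext)
  qed
qed

lemma qform_nonsingular:
  assumes ns: "nonsingular_quadratic_form (qform a)" and x: "x ~= 0" "qform a x = 0"
  obtains y where "polar a x y ~= 0"
proof -
  obtain i where i: "partial_deriv i (qform a) x ~= 0"
    using ns x by (auto simp: nonsingular_quadratic_form_def)
  let ?e = "axis i 1 :: complex ^ 3"
  have "((\<lambda>z. qform a (x + z *s ?e)) has_field_derivative polar a x ?e) (at 0)"
    unfolding qform_add qform_scale polar_scale_right by (auto intro!: derivative_eq_intros)
  then have "partial_deriv i (qform a) x = polar a x ?e" unfolding partial_deriv_def by (rule DERIV_imp_deriv)
  then show ?thesis using that[of ?e] i by simp
qed

lemma isotropic_vector: obtains e where "e ~= 0" "qform a e = 0"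
proof (cases "a 1 = 0")
  case True
  have "qform a (vector [1, 0, 0]) = 0" using True by (simp add: qform_def)
  moreover have "vector [1, 0, 0] ~= (0 :: complex ^ 3)" by (simp add: vec_eq_iff forall_3)
  ultimately show ?thesis using that by blast
next
  case False
  define r where "r = csqrt (a 4 ^ 2 - 4 * a 1 * a 2)"
  have r: "r * r = a 4 * a 4 - 4 * a 1 * a 2" using power2_csqrt[of "a 4 ^ 2 - 4 * a 1 * a 2"] by (simp add: r_def power2_eq_square)
  define u where "u = (r - a 4) / (2 * a 1)"
  have u: "2 * a 1 * u = r - a 4" using False by (simp add: u_def)
  have "4 * a 1 * (a 1 * u^2 + a 2 + a 4 * u) = (2 * a 1 * u) * (2 * a 1 * u) + 2 * a 4 * (2 * a 1 * u) + 4 * a 1 * a 2"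
    by (simp add: algebra_simps power2_eq_square)
  also have "\<dots> = 0" unfolding u using r by (simp add: algebra_simps)
  finally have "a 1 * u^2 + a 2 + a 4 * u = 0" using False by simp
  then have "qform a (vector [u, 1, 0]) = 0" by (simp add: qform_def)
  moreover have "vector [u, 1, 0] ~= (0 :: complex ^ 3)" by (simp add: vec_eq_iff forall_3)
  ultimately show ?thesis using that by blast
qed

lemma linear_combination3:
  "Vector_Spaces.linear (*s) (*s) (\<lambda>y :: complex ^ 3. y $ 1 *s e + y $ 2 *s f + y $ 3 *s (g :: complex ^ 3))"
  by unfold_locales (simp_all add: vec_eq_iff algebra_simps)

text \<open>
  Two vectors spanning the space would make a linear map surjective that is not injective.
\<close>

lemma spanned_not_by_two:
  fixes e f :: "complex ^ 3"
  shows "\<exists>x. \<forall>c d. x ~= c *s e + d *s f"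
proof (rule ccontr)
  assume "\<not> ?thesis"
  then have all: "\<exists>c d. x = c *s e + d *s f" for x by blast
  let ?h = "\<lambda>y :: complex ^ 3. y $ 1 *s e + y $ 2 *s f + y $ 3 *s 0"
  have "surj ?h"
    unfolding surj_def
  proof
    fix x
    obtain c d where "x = c *s e + d *s f" using all by blast
    then have "x = ?h (vector [c, d, 0])" by simp
    then show "\<exists>y. x = ?h y" by blast
  qed
  from vec.linear_surj_imp_inj[OF linear_combination3 this] have "inj ?h" .
  moreover have "?h (vector [0, 0, 1]) = ?h 0" by simp
  ultimately have "vector [0, 0, 1] = (0 :: complex ^ 3)" by (rule injD)
  then show False by (simp add: vec_eq_iff forall_3)
qed

text \<open>A nonsingular form is \<open>z^2 - x y\<close> in suitable coordinates: take a hyperbolic pair \<open>e, f\<close> and a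
  unit vector orthogonal to both.\<close>

lemma hyperbolic_basis:
  assumes ns: "nonsingular_quadratic_form (qform a)"
  obtains e f g where "qform a e = 0" "qform a f = 0" "polar a e f = - 1"
    "qform a g = 1" "polar a e g = 0" "polar a f g = 0"
proof -
  obtain e where e: "e ~= 0" "qform a e = 0" by (rule isotropic_vector)
  obtain y where y: "polar a e y ~= 0" by (rule qform_nonsingular[OF ns e])
  define f1 where "f1 = (- 1 / polar a e y) *s y"
  \<comment> \<open>Moving along \<open>e\<close> keeps the pairing with \<open>e\<close> and cancels the value of the form.\<close>
  define f where "f = f1 + qform a f1 *s e"
  have ef1: "polar a e f1 = - 1" unfolding f1_def polar_scale_right using y by simp
  have ef: "polar a e f = - 1" using ef1 e(2) by (simp add: f_def polar_simps polar_self)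
  have f: "qform a f = 0"
    using ef1 e(2) polar_sym[of a f1 e] by (simp add: f_def qform_add qform_scale polar_simps)
  \<comment> \<open>The orthogonal projection along the plane of \<open>e\<close> and \<open>f\<close>, which have pairing \<open>-1\<close>.\<close>
  define pr where "pr u = u + polar a u f *s e + polar a u e *s f" for u
  have pr: "polar a e (pr u) = 0" "polar a f (pr u) = 0" for u
    using ef e(2) f polar_sym[of a f e] polar_sym[of a u e] polar_sym[of a u f]
    by (simp_all add: pr_def polar_simps polar_self)
  have "\<exists>u. qform a (pr u) ~= 0"
  proof (rule ccontr)
    assume "\<not> ?thesis"
    then have z: "qform a (pr u) = 0" for u by blast
    have "pr u = 0" for u
    proof (rule ccontr)
      assume "pr u ~= 0"
      then obtain x where x: "polar a (pr u) x ~= 0" using qform_nonsingular[OF ns _ z] by blast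
      have "pr (u + x) = pr u + pr x" by (simp add: pr_def polar_simps vec_eq_iff algebra_simps)
      then have "polar a (pr u) (pr x) = 0" using z[of "u + x"] z[of u] z[of x] by (simp add: qform_add)
      moreover have "polar a (pr u) (pr x) = polar a (pr u) x"
        using pr[of u] polar_sym[of a "pr u" e] polar_sym[of a "pr u" f]
        unfolding pr_def[of x] polar_add_right polar_scale_right by simp
      ultimately show False using x by simp
    qed
    then have p0: "u + polar a u f *s e + polar a u e *s f = 0" for u by (simp only: pr_def)
    have "u = (- polar a u f) *s e + (- polar a u e) *s f" for u
      unfolding vec_eq_iff
    proof
      fix i
      have "u $ i + polar a u f * e $ i + polar a u e * f $ i = 0"
        using arg_cong[OF p0[of u], of "\<lambda>v. v $ i"] by simp
      then have "u $ i = (- polar a u f) * e $ i + (- polar a u e) * f $ i" by algebra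
      then show "u $ i = ((- polar a u f) *s e + (- polar a u e) *s f) $ i" by simp
    qed
    then show False using spanned_not_by_two[of e f] by blast
  qed
  then obtain u where u: "qform a (pr u) ~= 0" by blast
  define g where "g = (1 / csqrt (qform a (pr u))) *s pr u"
  have "qform a g = 1" using u by (simp add: g_def qform_scale power_divide)
  moreover have "polar a e g = 0" "polar a f g = 0" by (simp_all add: g_def polar_simps pr)
  ultimately show ?thesis using that e(2) f ef by blast
qed

lemma homogeneous_polar: "homogeneous_form 1 (\<lambda>x. polar a x y)"
proof -
  have "(\<lambda>x. polar a x y) = (\<lambda>x. \<Sum>i\<in>UNIV. polar a (axis i 1) y * x $ i)"
    by (rule ext) (simp add: sum_3 polar_def axis_def algebra_simps)
  then show ?thesis by (simp only:) (intro homogeneous_form_sum homogeneous_form_cmult homogeneous_form_coord)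
qed

section \<open>The complement of a conic\<close>

lemma invariant_even:
  assumes "f \<in> inv_ring True" shows "\<exists>h\<in>evenfun. \<forall>s\<in>quadric. f s = h s"
proof (rule inv_ring_evenfun[OF assms])
  fix h assume "h \<in> evenfun" "\<And>s. s \<in> quadric ==> f s = h s"
  then show ?thesis by (intro bexI[of _ h] ballI)
qed

locale conic_coordinates =
  fixes a :: "nat => complex" and e f g :: "complex ^ 3"
  assumes basis: "qform a e = 0" "qform a f = 0" "polar a e f = - 1"
    "qform a g = 1" "polar a e g = 0" "polar a f g = 0"
begin

definition vec_of :: "pt => complex ^ 3"
  where "vec_of s = cx s *s e + cy s *s f + cz s *s g"

definition pt_of :: "complex ^ 3 => pt"
  where "pt_of x = (- polar a x f, - polar a x e, (1/2) * polar a x g)"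

lemma polar_basis: "polar a e e = 0" "polar a f f = 0" "polar a g g = 2" "polar a f e = - 1" "polar a g e = 0" "polar a g f = 0"
  using basis polar_sym[of a f e] polar_sym[of a g e] polar_sym[of a g f] by (simp_all add: polar_self)

lemma pt_of_vec_of: "pt_of (vec_of s) = s"
  by (rule pt_eqI) (simp_all add: pt_of_def vec_of_def polar_simps polar_basis basis)

lemma vec_of_pt_of: "vec_of (pt_of x) = x"
proof -
  let ?h = "\<lambda>y :: complex ^ 3. y $ 1 *s e + y $ 2 *s f + y $ 3 *s g"
  have h: "?h y = vec_of (y $ 1, y $ 2, y $ 3)" for y by (simp add: vec_of_def)
  have "inj ?h"
  proof (rule injI)
    fix y y' assume "?h y = ?h y'"
    then have "pt_of (vec_of (y $ 1, y $ 2, y $ 3)) = pt_of (vec_of (y' $ 1, y' $ 2, y' $ 3))" by (simp only: h)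
    then show "y = y'" by (simp add: pt_of_vec_of vec_eq_iff forall_3)
  qed
  from vec.linear_inj_imp_surj[OF linear_combination3 this] obtain y where "x = ?h y" by (rule surjE)
  then show ?thesis using h[of y] by (simp add: pt_of_vec_of)
qed

lemma qform_vec_of: "qform a (vec_of s) = cz s ^ 2 - cx s * cy s"
  by (simp add: vec_of_def qform_add qform_scale polar_simps polar_basis basis)

lemma vec_of_quadric: "s \<in> quadric ==> qform a (vec_of s) = 1"
  by (simp add: qform_vec_of quadric_iff)

lemma vec_of_scale: "vec_of (c * cx s, c * cy s, c * cz s) = c *s vec_of s"
  by (simp add: vec_of_def vec_eq_iff algebra_simps)

lemma vec_of_uminus: "vec_of (- s) = (- 1) *s vec_of s"
  by (simp add: vec_of_def vec_eq_iff)

lemma pt_of_scale: "u \<in> {cx, cy, cz} ==> u (pt_of (c *s x)) = c * u (pt_of x)"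
  by (auto simp: pt_of_def polar_simps)

lemma homogeneous_pt_of: "u \<in> {cx, cy, cz} ==> homogeneous_form 1 (\<lambda>x. u (pt_of x))"
  using homogeneous_form_cmult[OF homogeneous_polar, of "- 1" a f] homogeneous_form_cmult[OF homogeneous_polar, of "- 1" a e]
    homogeneous_form_cmult[OF homogeneous_polar, of "1/2" a g]
  by (elim insertE emptyE) (simp_all add: pt_of_def)

definition conic_class :: "pt => (complex ^ 3) set" where "conic_class s = scaling_rel `` {vec_of s}"

definition unit_point :: "(complex ^ 3) set => pt"
  where "unit_point p = pt_of ((1 / csqrt (qform a (rep p))) *s rep p)"

definition complement :: "(complex ^ 3) set set" where "complement = {p \<in> proj_points. qform a (rep p) ~= 0}"

lemma vec_of_nonzero: "s \<in> quadric ==> vec_of s ~= 0"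
  using vec_of_quadric[of s] by (auto simp: qform_def)

lemma conic_class_complement: assumes s: "s \<in> quadric" shows "conic_class s \<in> complement"
proof -
  obtain c where "c ~= 0" "rep (scaling_rel `` {vec_of s}) = c *s vec_of s" by (rule rep_class[OF vec_of_nonzero[OF s]])
  then show ?thesis
    by (simp add: complement_def conic_class_def proj_points_class[OF vec_of_nonzero[OF s]] qform_scale vec_of_quadric[OF s])
qed

lemma unit_point:
  assumes p: "p \<in> complement"
  shows "unit_point p \<in> quadric" "conic_class (unit_point p) = p"
proof -
  have pp: "p \<in> proj_points" and q: "qform a (rep p) ~= 0" using p by (simp_all add: complement_def)
  let ?k = "1 / csqrt (qform a (rep p))"
  have v: "vec_of (unit_point p) = ?k *s rep p" by (simp add: unit_point_def vec_of_pt_of)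
  have "qform a (vec_of (unit_point p)) = 1" unfolding v qform_scale using q by (simp add: power_divide)
  then show "unit_point p \<in> quadric" by (simp add: qform_vec_of quadric_iff algebra_simps)
  show "conic_class (unit_point p) = p"
    unfolding conic_class_def v using class_scale[OF rep(1)[OF pp], of ?k] q rep(2)[OF pp] by simp
qed

lemma conic_class_eq_iff:
  assumes s: "s \<in> quadric" "s' \<in> quadric"
  shows "conic_class s = conic_class s' \<longleftrightarrow> s' = s \<or> s' = - s"
proof
  assume "conic_class s = conic_class s'"
  then obtain c where c: "vec_of s' = c *s vec_of s"
    unfolding conic_class_def class_eq_iff[OF vec_of_nonzero[OF s(1)] vec_of_nonzero[OF s(2)]] by blast
  have "c^2 = 1" using arg_cong[OF c, of "qform a"] by (simp add: qform_scale vec_of_quadric s)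
  then have "c = 1 \<or> c = - 1" by (simp add: power2_eq_1_iff)
  then have "vec_of s' = vec_of s \<or> vec_of s' = vec_of (- s)" using c vec_of_uminus[of s] by auto
  then have "pt_of (vec_of s') = pt_of (vec_of s) \<or> pt_of (vec_of s') = pt_of (vec_of (- s))" by (elim disjE) simp_all
  then show "s' = s \<or> s' = - s" by (simp only: pt_of_vec_of)
next
  assume "s' = s \<or> s' = - s"
  then show "conic_class s = conic_class s'"
  proof
    assume "s' = - s"
    moreover have "scaling_rel `` {(- 1) *s vec_of s} = scaling_rel `` {vec_of s}"
      by (rule class_scale[OF vec_of_nonzero[OF s(1)]]) simp
    ultimately show ?thesis by (simp only: conic_class_def vec_of_uminus)
  qed (simp only:)
qed

lemma unit_point_class: "s \<in> quadric ==> unit_point (conic_class s) = s \<or> unit_point (conic_class s) = - s"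
proof -
  assume s: "s \<in> quadric"
  note u = unit_point[OF conic_class_complement[OF s]]
  show "unit_point (conic_class s) = s \<or> unit_point (conic_class s) = - s"
    using conic_class_eq_iff[OF s u(1)] u(2) by blast
qed

lemma homogeneous_qform: "homogeneous_form 2 (qform a)"
proof -
  have m: "homogeneous_form 2 (\<lambda>x :: complex ^ 3. c * (x $ i * x $ j))" for c i j
    using homogeneous_form_cmult[OF homogeneous_form_mult[OF homogeneous_form_coord homogeneous_form_coord], of c i j]
    by (simp add: numeral_2_eq_2)
  show ?thesis unfolding qform_def[abs_def] power2_eq_square by (intro homogeneous_form_add m)
qed

lemma complement_open: "openin (zariski proj_space) complement"
  using form_open[OF homogeneous_qform] by (simp add: complement_def proj_space_def)

text \<open>
  The square root in \<open>unit_point\<close> disappears from products of two coordinates, which become quotients of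
  quadratic forms.
\<close>

lemma unit_point_even:
  assumes "h \<in> evenfun" shows "(\<lambda>p. h (unit_point p)) \<in> regfuns proj_space complement"
  using assms
proof induction
  case (const c) show ?case by (rule nice_const[OF nice_proj_space complement_open])
next
  case (prod u v)
  have hf: "homogeneous_form 2 (\<lambda>x. u (pt_of x) * v (pt_of x))"
    using homogeneous_form_mult[OF homogeneous_pt_of[OF prod(1)] homogeneous_pt_of[OF prod(2)]] by (simp add: numeral_2_eq_2)
  show ?case
  proof (rule form_ratio_regular[OF hf homogeneous_qform])
    show "openin proj_zariski complement" using complement_open by (simp add: proj_space_def)
    fix p assume "p \<in> complement"
    then have p: "p \<in> proj_points" "qform a (rep p) ~= 0" by (simp_all add: complement_def)
    have "csqrt (qform a (rep p)) * csqrt (qform a (rep p)) = qform a (rep p)"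
      using power2_csqrt[of "qform a (rep p)"] by (simp add: power2_eq_square)
    then show "p \<in> proj_points \<and> qform a (rep p) ~= 0 \<and>
        u (unit_point p) * v (unit_point p) = u (pt_of (rep p)) * v (pt_of (rep p)) / qform a (rep p)"
      using p unfolding unit_point_def pt_of_scale[OF prod(1)] pt_of_scale[OF prod(2)] by simp
  qed
next
  case (add h h') then show ?case by (intro nice_add[OF nice_proj_space complement_open])
next
  case (mult h h') then show ?case by (intro nice_mult[OF nice_proj_space complement_open])
qed

text \<open>
  Even functions are polynomials in products of two coordinates, hence regular on the complement.
  Conversely, multiplying a unit vector by one of its nonzero coordinates gives homogeneous coordinates
  that are even functions.
\<close>

lemma surface_conic:
  assumes X: "X = open_subspace proj_space complement" and grp: "group (Aut X)"
  shows "surface X conic_class True"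
proof (rule surface.intro)
  have pts: "points X = complement" unfolding X by (rule points_open_subspace[OF complement_open])
  have reg: "regfuns X = regfuns proj_space" by (simp add: X regfuns_open_subspace)
  show "nice X" unfolding X by (rule nice_open_subspace[OF nice_proj_space complement_open])
  show "group (Aut X)" by (rule grp)
  show "conic_class ` quadric = points X"
    unfolding pts
  proof
    show "conic_class ` quadric \<subseteq> complement" using conic_class_complement by blast
    show "complement \<subseteq> conic_class ` quadric"
    proof
      fix p assume "p \<in> complement"
      note u = unit_point[OF this]
      from imageI[OF u(1), of conic_class] show "p \<in> conic_class ` quadric" by (simp only: u(2))
    qed
  qed
  show "conic_class s = conic_class s' \<longleftrightarrow> s' = s \<or> True \<and> s' = - s" if "s \<in> quadric" "s' \<in> quadric" for s s'
    using conic_class_eq_iff[OF that] by blast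
  show "h \<in> regfuns X (points X)" if h: "(\<lambda>s. h (conic_class s)) \<in> inv_ring True" for h
  proof -
    obtain k where k: "k \<in> evenfun" "\<forall>s\<in>quadric. h (conic_class s) = k s" using invariant_even[OF h] by blast
    show ?thesis
      unfolding reg pts
    proof (rule nice_cong[OF nice_proj_space complement_open unit_point_even[OF k(1)]])
      fix p assume p: "p \<in> complement"
      show "k (unit_point p) = h p" using bspec[OF k(2) unit_point(1)[OF p]] unit_point(2)[OF p] by simp
    qed
  qed
  let ?R = "{h. (\<lambda>s. h (conic_class s)) \<in> inv_ring True}"
  let ?A = "aff (points X) ?R"
  have R: "function_ring ?R" by (simp add: function_ring_def inv_ring_ops)
  have A: "nice ?A" by (rule nice_aff[OF R])
  have pA: "points ?A = complement" using points_aff[OF R, of "points X"] pts by simp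
  have top: "openin (zariski ?A) (points ?A)" by (rule openin_topspace)
  have uvR: "(\<lambda>p. u (unit_point p) * v (unit_point p)) \<in> regfuns ?A (points ?A)"
    if uv: "u \<in> {cx, cy, cz}" "v \<in> {cx, cy, cz}" for u v
  proof (rule regular_aff[OF R _ top])
    have m: "u (- s) = - u s" "v (- s) = - v s" for s using uv by auto
    have "(\<lambda>s. u (unit_point (conic_class s)) * v (unit_point (conic_class s))) \<in> inv_ring True"
    proof (rule inv_ring_cong[OF squares_inv_ring[OF uv]])
      fix s assume "s \<in> quadric"
      from unit_point_class[OF this]
      show "u s * v s = u (unit_point (conic_class s)) * v (unit_point (conic_class s))" by (elim disjE) (simp_all add: m)
    qed
    then show "(\<lambda>p. u (unit_point p) * v (unit_point p)) \<in> ?R" by simp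
  qed
  have "morphism ?A proj_space (\<lambda>p. p)"
  proof (rule morphism_proj_space[OF A])
    fix p assume "p \<in> points ?A"
    then have p: "p \<in> complement" by (simp only: pA)
    obtain u where u: "u \<in> {cx, cy, cz}" "u (unit_point p) ~= 0"
    proof (cases "cz (unit_point p) = 0")
      case True
      then have "cx (unit_point p) ~= 0" using unit_point(1)[OF p] by (auto simp: quadric_iff)
      then show ?thesis using that[of cx] by simp
    qed (use that[of cz] in simp)
    let ?N = "{p \<in> points ?A. u (unit_point p) * u (unit_point p) ~= 0}"
    let ?v = "\<lambda>p. vec_of (u (unit_point p) * cx (unit_point p), u (unit_point p) * cy (unit_point p), u (unit_point p) * cz (unit_point p))"
    have o: "openin (zariski ?A) ?N" by (rule nice_open_nonzero[OF A top uvR[OF u(1) u(1)]])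
    have r: "(\<lambda>p. u (unit_point p) * v (unit_point p)) \<in> regfuns ?A ?N" if "v \<in> {cx, cy, cz}" for v
      by (rule nice_restrict[OF A top o _ uvR[OF u(1) that]]) blast
    have c: "(\<lambda>p. ?v p $ i) \<in> regfuns ?A ?N" for i
    proof -
      have "(\<lambda>p. u (unit_point p) * cx (unit_point p) * e $ i + u (unit_point p) * cy (unit_point p) * f $ i
          + u (unit_point p) * cz (unit_point p) * g $ i) \<in> regfuns ?A ?N"
        by (intro nice_add[OF A o] nice_mult[OF A o _ nice_const[OF A o]] r) simp_all
      then show ?thesis by (simp add: vec_of_def)
    qed
    have cls: "?v p ~= 0 \<and> p = scaling_rel `` {?v p}" if "p \<in> ?N" for p
    proof -
      have p: "p \<in> complement" and nz: "u (unit_point p) ~= 0" using that pA by auto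
      have "vec_of (unit_point p) ~= 0" by (rule vec_of_nonzero[OF unit_point(1)[OF p]])
      then show ?thesis
        unfolding vec_of_scale using nz class_scale[of "vec_of (unit_point p)" "u (unit_point p)"] unit_point(2)[OF p]
        by (simp add: conic_class_def vector_mul_eq_0)
    qed
    have "p \<in> ?N" using p u(2) by (simp add: pA)
    then show "\<exists>N v. openin (zariski ?A) N \<and> p \<in> N \<and> (\<forall>i. (\<lambda>w. v w $ i) \<in> regfuns ?A N) \<and>
      (\<forall>w\<in>N. v w ~= 0 \<and> w = scaling_rel `` {v w})"
      using o c cls by (intro exI[of _ ?N] exI[of _ ?v] conjI allI ballI) simp_all
  qed
  then show "morphism ?A X (\<lambda>p. p)"
    unfolding X by (rule morphism_open_subspace[OF _ complement_open]) (simp add: pA[unfolded X])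
qed

end

lemma P2_minus_conjugate:
  assumes Q: "nonsingular_quadric Q"
    and \<alpha>: "effective_Cstar_action (P2_minus Q) \<alpha>" and \<beta>: "effective_Cstar_action (P2_minus Q) \<beta>"
  shows "conjugate_in_Aut (P2_minus Q) \<alpha> \<beta>"
proof -
  obtain q where q: "nonsingular_quadratic_form q" "Q = {p \<in> proj_points. \<forall>x\<in>p. q x = 0}"
    using Q by (auto simp: nonsingular_quadric_def)
  obtain a where a: "q = qform a"
    using homogeneous_form_2_qform[of q] q(1) unfolding nonsingular_quadratic_form_def by blast
  obtain e f g where "qform a e = 0" "qform a f = 0" "polar a e f = - 1"
    "qform a g = 1" "polar a e g = 0" "polar a f g = 0" by (rule hyperbolic_basis[OF q(1)[unfolded a]])
  then interpret conic_coordinates a e f g by unfold_locales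
  have mem: "p \<in> Q \<longleftrightarrow> qform a (rep p) = 0" if p: "p \<in> proj_points" for p
  proof
    assume "qform a (rep p) = 0"
    then have "q x = 0" if "x \<in> p" for x
      using class_member[OF p that] by (auto simp: a qform_scale)
    then show "p \<in> Q" using p q(2) by blast
  qed (use rep(3)[OF p] q(2) a in blast)
  have "complement = topspace (zariski proj_space) \<inter> - Q"
    using mem by (auto simp: complement_def points_proj_space)
  then have "P2_minus Q = open_subspace proj_space complement"
    unfolding P2_minus_def open_subspace_def by (simp only: subtopology_restrict)
  from surface_conic[OF this group_Aut_P2_minus] have "surface (P2_minus Q) conic_class True" .
  from surface.effective_actions_conjugate[OF this \<alpha> \<beta>] show ?thesis .
qed

section \<open>Conjugacy on the two surfaces\<close>

theorem theorem5p1: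
  shows "(\<forall>\<alpha> \<beta>. effective_Cstar_action P1P1_minus_diagonal \<alpha> \<and>
                effective_Cstar_action P1P1_minus_diagonal \<beta> \<longrightarrow>
                conjugate_in_Aut P1P1_minus_diagonal \<alpha> \<beta>) \<and>
         (\<forall>Q. nonsingular_quadric Q \<longrightarrow>
           (\<forall>\<alpha> \<beta>. effective_Cstar_action (P2_minus Q) \<alpha> \<and>
                  effective_Cstar_action (P2_minus Q) \<beta> \<longrightarrow>
                  conjugate_in_Aut (P2_minus Q) \<alpha> \<beta>))"
  using surface.effective_actions_conjugate[OF surface_P1P1] P2_minus_conjugate by blast

end
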